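(* Let $\Omega$ be a smooth planar domain, $\Sigma$ a closed subinterval (closed arc) of its boundary, and $L=X+iY$ a smooth locally integrable complex vector field defined near each point of $\Sigma$ and transversal to $\Sigma$, with $X$ transversal to $\Sigma$ and pointing toward $\Omega$. Let $f\in C^0(\Omega)$ be such that for some defining function $\rho$ of $\Omega$ there exists an integer $N$ with $$\int_{\rho=t}|f|\,d\sigma_t=O(t^{-N})\quad\text{as } t\to0^+ .$$ Assume that (1) $Lf=0$ on $W\cap\Omega$ for some open $W\supset\Sigma$; (2) the trace satisfies $bf\in L^1(\Sigma)$; (3) $p\in\Sigma_2$ is a $\sigma$-density point of the set $E=\{q\in\Sigma: bf(q)=0\}$. Then there is an open disc $\Delta=\Delta(p,r)$ centered at $p$ such that $f$ vanishes identically on $\Delta\cap\Omega$.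
   Context: $X,Y$ are real vector fields. A nowhere vanishing smooth planar vector field $L$ is locally integrable if near each point there is a smooth complex function $Z$ with $LZ=0$ and $dZ\neq0$. The defining function $\rho$ is smooth, positive in $\Omega$, zero on $\partial\Omega$, with $d\rho\neq0$ on $\partial\Omega$; $\sigma_t$ is arc length on $\{\rho=t\}$, and $\sigma$ is arc length on $\partial\Omega$. Trace: near any point of $\Sigma$ choose coordinates $(x,t)$ with $t=\rho$, $\Sigma\subset\{t=0\}$, $\Omega=\{t>0\}$, in which $L$ is a nonvanishing multiple of $\partial_t+a(x,t)\partial_x$. Under the growth assumption $f(\cdot,t)$ converges in the sense of distributions as $t\to0^+$; the limit is the trace $bf$, defined in a neighborhood of $\Sigma$ in $\partial\Omega$. For $q\in\Sigma$ let $\gamma_q$ be the integral curve of $X$ through $q$ and $\gamma_q^+$ its positive half, which enters $\Omega$. A point $q\in\Sigma$ is of type (II) if there is a sequence of points $q_k\in\gamma_q^+$ converging to $q$ such that $L$ is elliptic at each $q_k$ (i.e. $X$ and $Y$ are linearly independent at $q_k$). $\Sigma_2\subset\Sigma$ is the set of points of type (II). A point $p\in E\subset\Sigma$ is called a $\sigma$-density point of $E$ if $\sigma(V\cap E)>0$ for every neighborhood $V$ of $p$. *)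

theory Defs
  imports "HOL-Analysis.Analysis"
begin

type_synonym plane = "real \<times> real"

fun Ck_on :: "nat \<Rightarrow> 'a::real_normed_vector set \<Rightarrow> ('a \<Rightarrow> 'b::real_normed_vector) \<Rightarrow> bool" where
  "Ck_on 0 S u \<longleftrightarrow> continuous_on S u"
| "Ck_on (Suc k) S u \<longleftrightarrow>
     (\<forall>z\<in>S. u differentiable (at z)) \<and> (\<forall>v. Ck_on k S (\<lambda>z. frechet_derivative u (at z) v))"

text \<open>Only used for open \<open>S\<close>, since the derivatives are full (not one-sided) derivatives.\<close>
definition smooth_on :: "'a::real_normed_vector set \<Rightarrow> ('a \<Rightarrow> 'b::real_normed_vector) \<Rightarrow> bool" where
  "smooth_on S u \<longleftrightarrow> (\<forall>k. Ck_on k S u)"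

definition test_function :: "'a::real_normed_vector set \<Rightarrow> ('a \<Rightarrow> complex) \<Rightarrow> bool" where
  "test_function S \<phi> \<longleftrightarrow>
     smooth_on UNIV \<phi> \<and> compact (closure {z. \<phi> z \<noteq> 0}) \<and> closure {z. \<phi> z \<noteq> 0} \<subseteq> S"

definition smooth_domain :: "plane set \<Rightarrow> bool" where
  "smooth_domain \<Omega> \<longleftrightarrow> open \<Omega> \<and> connected \<Omega> \<and> \<Omega> \<noteq> {} \<and>
     (\<forall>q\<in>frontier \<Omega>. \<exists>B r. open B \<and> q \<in> B \<and> smooth_on B (r :: plane \<Rightarrow> real) \<and>
        frechet_derivative r (at q) \<noteq> (\<lambda>_. 0) \<and> \<Omega> \<inter> B = {z\<in>B. r z > 0})"

definition defining_function :: "plane set \<Rightarrow> (plane \<Rightarrow> real) \<Rightarrow> bool" where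
  "defining_function \<Omega> \<rho> \<longleftrightarrow>
     (\<exists>V. open V \<and> closure \<Omega> \<subseteq> V \<and> smooth_on V \<rho>) \<and>
     (\<forall>z\<in>\<Omega>. \<rho> z > 0) \<and>
     (\<forall>z\<in>frontier \<Omega>. \<rho> z = 0 \<and> frechet_derivative \<rho> (at z) \<noteq> (\<lambda>_. 0))"

definition regular_arc :: "(real \<Rightarrow> plane) \<Rightarrow> bool" where
  "regular_arc \<gamma> \<longleftrightarrow> arc \<gamma> \<and> (\<exists>S. open S \<and> {0..1} \<subseteq> S \<and> smooth_on S \<gamma>) \<and>
     (\<forall>s\<in>{0..1}. vector_derivative \<gamma> (at s) \<noteq> 0)"

text \<open>The image under \<open>\<gamma>\<close> of \<open>\<bar>\<gamma>'(s)\<bar> ds\<close> on \<open>[0,1]\<close>, as a Borel measure on the plane.\<close>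
definition arc_length :: "(real \<Rightarrow> plane) \<Rightarrow> plane measure" where
  "arc_length \<gamma> =
     distr (density (restrict_space lborel {0..1})
              (\<lambda>s. ennreal (norm (vector_derivative \<gamma> (at s))))) borel \<gamma>"

text \<open>The integral of a nonnegative \<open>h\<close> with respect to arc length over a curve \<open>C\<close> that may have
  several (even infinitely many) components, some of them closed curves: the supremum over the finite
  systems of disjoint regular arcs in \<open>C\<close>. If \<open>C\<close> is an embedded smooth curve, such systems exhaust
  \<open>C\<close> up to sets of arbitrarily small length, so the supremum is the full integral.\<close>
definition curve_integral :: "plane set \<Rightarrow> (plane \<Rightarrow> ennreal) \<Rightarrow> ennreal" where
  "curve_integral C h =
     (SUP \<Gamma> \<in> {\<Gamma>. finite \<Gamma> \<and> (\<forall>\<gamma>\<in>\<Gamma>. regular_arc \<gamma> \<and> path_image \<gamma> \<subseteq> C) \<and>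
                  disjoint_family_on path_image \<Gamma>}.
        \<Sum>\<gamma>\<in>\<Gamma>. \<integral>\<^sup>+z\<in>path_image \<gamma>. h z \<partial>arc_length \<gamma>)"

text \<open>\<open>\<integral>\<^bsub>\<rho>=t\<^esub> \<bar>f\<bar> d\<sigma>\<^sub>t = O(t\<^bsup>-N\<^esup>)\<close> as \<open>t \<rightarrow> 0+\<close>; in particular the integrals are finite for small \<open>t\<close>.\<close>
definition tempered_growth :: "plane set \<Rightarrow> (plane \<Rightarrow> real) \<Rightarrow> (plane \<Rightarrow> complex) \<Rightarrow> int \<Rightarrow> bool" where
  "tempered_growth \<Omega> \<rho> f N \<longleftrightarrow>
     (\<exists>K::real. \<forall>\<^sub>F t in at_right 0.
        curve_integral {z\<in>\<Omega>. \<rho> z = t} (\<lambda>z. ennreal (cmod (f z))) \<le> ennreal (K * t powi (- N)))"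

definition density_point :: "plane measure \<Rightarrow> plane set \<Rightarrow> plane \<Rightarrow> bool" where
  "density_point \<mu> E p \<longleftrightarrow> p \<in> E \<and> (\<forall>V. open V \<longrightarrow> p \<in> V \<longrightarrow> emeasure \<mu> (V \<inter> E) > 0)"

definition vf_apply ::
  "(plane \<Rightarrow> plane) \<Rightarrow> (plane \<Rightarrow> plane) \<Rightarrow> (plane \<Rightarrow> complex) \<Rightarrow> plane \<Rightarrow> complex" where
  "vf_apply X Y u z = frechet_derivative u (at z) (X z) + \<i> * frechet_derivative u (at z) (Y z)"

definition divergence :: "(plane \<Rightarrow> plane) \<Rightarrow> plane \<Rightarrow> real" where
  "divergence V z = (\<Sum>b\<in>Basis. frechet_derivative V (at z) b \<bullet> b)"

definition locally_integrable :: "plane set \<Rightarrow> (plane \<Rightarrow> plane) \<Rightarrow> (plane \<Rightarrow> plane) \<Rightarrow> bool" where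
  "locally_integrable U X Y \<longleftrightarrow>
     (\<forall>z\<in>U. X z \<noteq> 0 \<or> Y z \<noteq> 0) \<and>
     (\<forall>z\<in>U. \<exists>B Z. open B \<and> z \<in> B \<and> B \<subseteq> U \<and> smooth_on B Z \<and>
        (\<forall>w\<in>B. vf_apply X Y Z w = 0 \<and> frechet_derivative Z (at w) \<noteq> (\<lambda>_. 0)))"

definition elliptic_at :: "(plane \<Rightarrow> plane) \<Rightarrow> (plane \<Rightarrow> plane) \<Rightarrow> plane \<Rightarrow> bool" where
  "elliptic_at X Y z \<longleftrightarrow> (\<forall>a b. a *\<^sub>R X z + b *\<^sub>R Y z = 0 \<longrightarrow> a = 0 \<and> b = 0)"

text \<open>\<open>Lf = 0\<close> in the sense of distributions on the open set \<open>D\<close>, for continuous \<open>f\<close>. The formal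
  transpose of \<open>L\<close> is \<open>\<phi> \<mapsto> - (L\<phi> + (div X + i div Y) \<phi>)\<close>.\<close>
definition weak_solution ::
  "plane set \<Rightarrow> (plane \<Rightarrow> plane) \<Rightarrow> (plane \<Rightarrow> plane) \<Rightarrow> (plane \<Rightarrow> complex) \<Rightarrow> bool" where
  "weak_solution D X Y f \<longleftrightarrow>
     (\<forall>\<phi>. test_function D \<phi> \<longrightarrow>
        (LINT z|lborel. f z *
           (- (vf_apply X Y \<phi> z + Complex (divergence X z) (divergence Y z) * \<phi> z))) = 0)"

text \<open>The integral curve \<open>c\<close> is taken with its positive half inside \<open>\<Omega>\<close>, so that a global return of
  the orbit to \<open>q\<close> from outside plays no role.\<close>
definition type_II ::
  "plane set \<Rightarrow> plane set \<Rightarrow> (plane \<Rightarrow> plane) \<Rightarrow> (plane \<Rightarrow> plane) \<Rightarrow> plane \<Rightarrow> bool" where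
  "type_II \<Omega> U X Y q \<longleftrightarrow>
     (\<exists>\<epsilon>>0. \<exists>c. c 0 = q \<and>
        (\<forall>s\<in>{-\<epsilon><..<\<epsilon>}. c s \<in> U \<and> (c has_vector_derivative X (c s)) (at s)) \<and>
        c ` {0<..<\<epsilon>} \<subseteq> \<Omega> \<and>
        (\<exists>Q. (\<forall>k::nat. Q k \<in> c ` {0<..<\<epsilon>} \<and> elliptic_at X Y (Q k)) \<and> Q \<longlonglongrightarrow> q))"

text \<open>\<open>\<Psi>\<close> is the inverse of a coordinate map \<open>(x,t)\<close> with values in \<open>]a,b[ \<times> ]-\<tau>,\<tau>[\<close>, where \<open>t = \<rho>\<close>,
  \<open>\<Omega>\<close> is \<open>{t > 0}\<close>, and \<open>L\<close> is a nonvanishing multiple \<open>m (\<partial>\<^sub>t + \<alpha> \<partial>\<^sub>x)\<close>. That \<open>{t = 0}\<close> parametrizes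
  a piece of the boundary follows.\<close>
definition adapted_chart ::
  "plane set \<Rightarrow> (plane \<Rightarrow> real) \<Rightarrow> plane set \<Rightarrow> (plane \<Rightarrow> plane) \<Rightarrow> (plane \<Rightarrow> plane) \<Rightarrow>
   real \<Rightarrow> real \<Rightarrow> real \<Rightarrow> (real \<times> real \<Rightarrow> plane) \<Rightarrow> bool" where
  "adapted_chart \<Omega> \<rho> U X Y a b \<tau> \<Psi> \<longleftrightarrow>
     a < b \<and> \<tau> > 0 \<and>
     smooth_on ({a<..<b} \<times> {-\<tau><..<\<tau>}) \<Psi> \<and> inj_on \<Psi> ({a<..<b} \<times> {-\<tau><..<\<tau>}) \<and>
     (\<forall>x\<in>{a<..<b}. \<forall>t\<in>{-\<tau><..<\<tau>}.
        bij (frechet_derivative \<Psi> (at (x, t))) \<and>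
        \<Psi> (x, t) \<in> U \<and> \<rho> (\<Psi> (x, t)) = t \<and> (\<Psi> (x, t) \<in> \<Omega> \<longleftrightarrow> t > 0) \<and>
        (\<exists>m \<alpha>. m \<noteq> 0 \<and>
           (\<forall>e\<in>Basis. Complex (X (\<Psi> (x, t)) \<bullet> e) (Y (\<Psi> (x, t)) \<bullet> e) =
              m * (of_real (frechet_derivative \<Psi> (at (x, t)) (0, 1) \<bullet> e) +
                   \<alpha> * of_real (frechet_derivative \<Psi> (at (x, t)) (1, 0) \<bullet> e)))))"

definition trace_in_chart ::
  "(plane \<Rightarrow> complex) \<Rightarrow> (real \<times> real \<Rightarrow> plane) \<Rightarrow> (real \<Rightarrow> complex) \<Rightarrow> complex" where
  "trace_in_chart f \<Psi> \<psi> = Lim (at_right 0) (\<lambda>t. LINT x|lborel. f (\<Psi> (x, t)) * \<psi> x)"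

text \<open>The distribution \<open>bf\<close> coincides with the function \<open>g\<close> on the open piece \<open>J\<close> of the boundary.\<close>
definition trace_eq_on ::
  "plane set \<Rightarrow> (plane \<Rightarrow> real) \<Rightarrow> plane set \<Rightarrow> (plane \<Rightarrow> plane) \<Rightarrow> (plane \<Rightarrow> plane) \<Rightarrow>
   (plane \<Rightarrow> complex) \<Rightarrow> plane set \<Rightarrow> (plane \<Rightarrow> complex) \<Rightarrow> bool" where
  "trace_eq_on \<Omega> \<rho> U X Y f J g \<longleftrightarrow>
     (\<forall>a b \<tau> \<Psi> \<psi>. adapted_chart \<Omega> \<rho> U X Y a b \<tau> \<Psi> \<longrightarrow>
        test_function {x\<in>{a<..<b}. \<Psi> (x, 0) \<in> J} \<psi> \<longrightarrow>
        trace_in_chart f \<Psi> \<psi> = (LINT x|lborel. g (\<Psi> (x, 0)) * \<psi> x))"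

end

(* In a chart straightening the real part of a first integral Z with t = rho, a weak solution f satisfies
   d(f dZ) = 0, so f has iterated primitives G along Z (dG = g dZ); after finitely many steps G is continuous up to t = 0.
   Gaussian convolution along t = 0 (Baouendi-Treves) approximates G uniformly by entire functions of Z. At a type II
   point the curve Im Z(0,t) moves to one side, possibly after replacing Z by -Z, so the approximations converge to a
   holomorphic F on one side of the graph Im Z(x,0), and bf is the boundary value of F^(k) in the sense of distributions.
   An integrable boundary value vanishing on a set of positive measure forces F^(k) = 0: instead of subharmonicity of
   log |F^(k)| one multiplies by the exponential of a Cauchy potential that is large on that set. Hence F is a polynomial,
   and applying the approximation again to G - F(Z), which vanishes for t = 0, gives G = F(Z) near p, so that f = 0 there. *)
theory Submission
  imports Defs "HOL-Complex_Analysis.Complex_Analysis"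
begin

text \<open>The obstacle is that \<open>bf\<close> is merely integrable and vanishes on a set that
  may be nowhere dense, so neither reflection nor continuity at the boundary is available. What
  survives is an L^1 statement. Let H = F^(k). The difference of the Cauchy kernels at a point and
  at its reflection in the arc acts like a Poisson kernel, so H has bounded L^1 norms on the
  parallels to the arc, and small ones near a compact part A of the zero set. Multiplying H by
  exp(-i m p), with p a Cauchy integral of a cut-off of A, multiplies |H| by exp(m Im p). On a box
  contour Im p stays below some c away from A and below a constant near A, while at some points
  inside it exceeds c + kappa. Near A the smallness of H beats the weight once the bottom of the
  contour is lowered, after m is fixed. Cauchy's estimate then bounds |H| exp(m kappa) independently
  of m. Type (II) enters once: if Im Z(0,t) vanished for all small t, the orbit of X would be the
  axis, and X, Y would be parallel along it. Each primitive gains about one power of t, so any order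
  N of growth is admissible.\<close>

lemmas con_subset = continuous_on_subset
lemmas con_comp = continuous_on_compose2
lemmas int_con = integrable_continuous_interval
lemmas hrd_hvd = has_real_derivative_iff_has_vector_derivative
lemmas FTC = fundamental_theorem_of_calculus
lemmas con_mult = continuous_on_mult
lemmas con_const = continuous_on_const
lemmas hol_con = holomorphic_on_imp_continuous_on
lemmas con_norm = continuous_on_norm
lemmas bm_restrict = borel_measurable_continuous_on_restrict
lemmas hvd_const = has_vector_derivative_const
lemmas con_diff = continuous_on_diff
lemmas int_norm_bd = integral_norm_bound_integral
lemmas open_preimage = continuous_open_preimage
lemmas con_at_on = continuous_at_imp_continuous_on
lemmas hd_transform = has_derivative_transform_within_open
lemmas bm_indicator = borel_measurable_continuous_on_indicator
lemmas hvd_def = has_vector_derivative_def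
lemmas int_param = integral_continuous_on_param
lemmas mult_lm = mult_left_mono
lemmas mult_rm = mult_right_mono
lemmas hd_comp = has_derivative_compose
lemmas hd_within = has_derivative_at_withinI
abbreviation "cts == continuous_on"
abbreviation "fder == frechet_derivative"
abbreviation "HK == integral"
abbreviation "Csm == smooth_on"
abbreviation "ind == indicator"
abbreviation "enn == ennreal"
abbreviation "NI == nn_integral lborel"
abbreviation hvd0 (infix "hvd" 50) where "f hvd D == (f has_vector_derivative D)"
abbreviation hfd0 (infix "hfd" 50) where "f hfd D == (f has_field_derivative D)"
abbreviation hrd0 (infix "hrd" 50) where "f hrd D == (f has_real_derivative D)"
abbreviation hasd0 (infix "hasd" 50) where "f hasd D == (f has_derivative D)"
abbreviation hol0 (infix "hol" 50) where "f hol D == (f holomorphic_on D)"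

section \<open>The calculus of \<open>Ck_on\<close> and \<open>smooth_on\<close>\<close>

text \<open>No differentiability is assumed: \<open>frechet_derivative\<close> is a choice among the
  derivatives, and both functions have the same ones at \<open>z\<close>.\<close>

lemma frechet_derivative_cong_open:
 assumes "open S" "z : S" "!!z. z : S ==> u z = v z"
 shows "fder u (at z) = fder v (at z)"
proof -
 have "(u hasd D) (at z) \<longleftrightarrow> (v hasd D) (at z)" for D
 using hd_transform[of u D z UNIV S v]
 hd_transform[of v D z UNIV S u] assms by auto
 thus ?thesis unfolding frechet_derivative_def by presburger
qed

lemma differentiable_cong_open:
 assumes "open S" "z : S" "!!z. z : S ==> u z = v z"
 shows "u differentiable (at z) \<longleftrightarrow> v differentiable (at z)"
 unfolding differentiable_def
 using hd_transform[of u _ z UNIV S v]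
 hd_transform[of v _ z UNIV S u] assms by (metis)

lemma Ck_on_cong:
 assumes "open S" "!!z. z : S ==> u z = v z"
 shows "Ck_on k S u \<longleftrightarrow> Ck_on k S v"
 using assms(2)
proof (induction k arbitrary: u v)
 case 0
 thus ?case by (simp cong: continuous_on_cong)
next
 case (Suc k)
 have "Ck_on k S (%z. fder u (at z) w) \<longleftrightarrow> Ck_on k S (%z. fder v (at z) w)" for w
 by (rule Suc.IH) (use frechet_derivative_cong_open[OF assms(1) _ Suc.prems] in auto)
 thus ?case using differentiable_cong_open[OF assms(1) _ Suc.prems] by auto
qed

lemma Ck_on_Suc_imp: "Ck_on (Suc k) S u ==> Ck_on k S u"
proof (induction k arbitrary: u)
 case 0
 thus ?case
 by (auto intro!: differentiable_imp_continuous_on simp: differentiable_on_def intro: differentiable_at_imp_differentiable_on)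
next
 case (Suc k)
 thus ?case by (auto simp del: Ck_on.simps(1))
qed

lemma Ck_on_subset: "Ck_on k S u ==> T <= S ==> Ck_on k T u"
 by (induction k arbitrary: u) (auto intro: con_subset)

lemma Ck_on_const: "Ck_on k S (%z. c)"
 by (induction k arbitrary: c) (auto simp: frechet_derivative_const)

lemma Ck_on_SucI:
 assumes "open S" "!!z. z : S ==> (u hasd D z) (at z)" "!!v. Ck_on k S (%z. D z v)"
 shows "Ck_on (Suc k) S u"
proof -
 have "fder u (at z) = D z" if "z : S" for z
 using frechet_derivative_at[OF assms(2)[OF that]] by simp
 hence "Ck_on k S (%z. fder u (at z) v)" for v
 using Ck_on_cong[OF assms(1), of "%z. fder u (at z) v" "%z. D z v"] assms(3) by auto
 thus ?thesis using assms(2) by (auto simp: differentiable_def)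
qed

lemma Ck_on_SucD:
 assumes "Ck_on (Suc k) S u"
 shows "!!z. z : S ==> (u hasd fder u (at z)) (at z)"
 and "!!v. Ck_on k S (%z. fder u (at z) v)"
 using assms by (auto simp: frechet_derivative_works)

lemma Ck_on_bounded_linear:
 assumes "open S" "bounded_linear l"
 shows "Ck_on k S l"
proof (cases k)
 case 0
 thus ?thesis using assms by (simp add: linear_continuous_on)
next
 case (Suc m)
 show ?thesis unfolding Suc
 by (rule Ck_on_SucI[where D = "%_. l"])
 (use assms in \<open>auto intro: bounded_linear_imp_has_derivative Ck_on_const\<close>)
qed

lemma Ck_on_linear_compose:
 assumes "open S" "bounded_linear l" "Ck_on k S u"
 shows "Ck_on k S (%z. l (u z))"
 using assms(3)
proof (induction k arbitrary: u)
 case 0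
 thus ?case using assms(2) by (auto intro: bounded_linear.continuous_on)
next
 case (Suc k)
 show ?case
 by (rule Ck_on_SucI[where D = "%z v. l (fder u (at z) v)"])
 (use assms Suc.IH Ck_on_SucD[OF Suc.prems] in \<open>auto intro!: bounded_linear.has_derivative[of l]\<close>)
qed

lemma Ck_on_add:
 assumes "open S" "Ck_on k S u" "Ck_on k S v"
 shows "Ck_on k S (%z. u z + v z)"
 using assms(2,3)
proof (induction k arbitrary: u v)
 case 0
 thus ?case by (auto intro: continuous_intros)
next
 case (Suc k)
 show ?case
 by (rule Ck_on_SucI[where D = "%z w. fder u (at z) w + fder v (at z) w"])
 (use assms(1) Suc.IH Ck_on_SucD[OF Suc.prems(1)] Ck_on_SucD[OF Suc.prems(2)] in \<open>auto intro!: has_derivative_add\<close>)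
qed

lemma Ck_on_sum:
 assumes "open S" "!!i. i : I ==> Ck_on k S (u i)"
 shows "Ck_on k S (%z. \<Sum>i\<in>I. u i z)"
 using assms(2)
 by (induction I rule: infinite_finite_induct) (auto intro: Ck_on_add[OF assms(1)] Ck_on_const)

lemma Ck_on_bilinear:
 assumes "open S" "bounded_bilinear b" "Ck_on k S u" "Ck_on k S v"
 shows "Ck_on k S (%z. b (u z) (v z))"
 using assms(3,4)
proof (induction k arbitrary: u v)
 case 0
 thus ?case using assms(2) by (auto intro: bounded_bilinear.continuous_on)
next
 case (Suc k)
 show ?case
 by (rule Ck_on_SucI[where D = "%z w. b (u z) (fder v (at z) w) + b (fder u (at z) w) (v z)"])
 (use assms(1,2) Suc.IH Ck_on_SucD[OF Suc.prems(1)] Ck_on_SucD[OF Suc.prems(2)] Ck_on_Suc_imp[OF Suc.prems(1)]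
 Ck_on_Suc_imp[OF Suc.prems(2)]
 in \<open>auto intro!: bounded_bilinear.FDERIV[OF assms(2)] Ck_on_add\<close>)
qed

text \<open>\<open>Ck_on\<close> differentiates in constant directions only, whereas the chain rule
  produces the moving direction \<open>fder w (at z) v\<close>. Expanding it in the basis turns the
  derivative into a finite sum of products to which the induction hypothesis applies; hence the
  Euclidean middle space.\<close>

lemma Ck_on_compose:
 fixes w :: "'a::real_normed_vector => 'b::euclidean_space"
 assumes "open S" "open T" "w ` S <= T" "Ck_on k T u" "Ck_on k S w"
 shows "Ck_on k S (%z. u (w z))"
 using assms(4,5)
proof (induction k arbitrary: u)
 case 0
 thus ?case using assms(3) by (auto intro: con_comp)
next
 case (Suc k)
 let ?D = "%z v. \<Sum>b\<in>Basis. (fder w (at z) v \<bullet> b) *\<^sub>R fder u (at (w z)) b"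
 note u = Ck_on_SucD[OF Suc.prems(1)] and w = Ck_on_SucD[OF Suc.prems(2)]
 show ?case
 proof (rule Ck_on_SucI[where D = ?D, OF assms(1)])
 fix z assume z: "z : S"
 have "w z : T" using z assms(3) by auto
 have "((%z. u (w z)) hasd (%v. fder u (at (w z)) (fder w (at z) v))) (at z)"
 using hd_comp[OF w(1)[OF z] u(1)[OF \<open>w z : T\<close>]] .
 moreover have "fder u (at (w z)) (fder w (at z) v) = ?D z v" for v
 proof -
 interpret l: linear "fder u (at (w z))"
 using u(1)[OF \<open>w z : T\<close>] by (simp add: has_derivative_bounded_linear bounded_linear.linear)
 show ?thesis
 by (subst euclidean_representation[symmetric, of "fder w (at z) v"]) (simp only: l.sum l.scale)
 qed
 ultimately show "((%z. u (w z)) hasd ?D z) (at z)" by simp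
 next
 fix v
 show "Ck_on k S (%z. ?D z v)"
 by (intro Ck_on_sum Ck_on_bilinear[OF _ bounded_bilinear_scaleR] assms(1)
 Ck_on_linear_compose[OF _ bounded_linear_inner_left] w(2) Suc.IH u(2) Ck_on_Suc_imp[OF Suc.prems(2)])
 qed
qed

lemma Ck_on_inverse:
 fixes u :: "'a::real_normed_vector => 'b::real_normed_field"
 assumes "open S" "Ck_on k S u" "!!z. z : S ==> u z ~= 0"
 shows "Ck_on k S (%z. inverse (u z))"
 using assms(2)
proof (induction k)
 case 0
 thus ?case using assms(3) by (auto intro: continuous_intros)
next
 case (Suc k)
 note u = Ck_on_SucD[OF Suc.prems(1)]
 have m: "bounded_bilinear ((*) :: 'b => 'b => 'b)" by (rule bounded_bilinear_mult)
 show ?case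
 by (rule Ck_on_SucI[where D = "%z v. - (inverse (u z) * fder u (at z) v * inverse (u z))"])
 (use assms u Ck_on_Suc_imp[OF Suc.prems] Suc.IH in
 \<open>auto intro!: Deriv.has_derivative_inverse Ck_on_linear_compose[OF _ bounded_linear_minus[OF bounded_linear_ident]]
 Ck_on_bilinear[OF _ m]\<close>)
qed

lemma smooth_cong: "open S ==> (!!z. z : S ==> u z = v z) ==> Csm S u \<longleftrightarrow> Csm S v"
 unfolding smooth_on_def using Ck_on_cong by blast

lemma smooth_subset: "Csm S u ==> T <= S ==> Csm T u"
 unfolding smooth_on_def using Ck_on_subset by blast

lemma smooth_const [intro]: "Csm S (%z. c)"
 unfolding smooth_on_def using Ck_on_const by blast

lemma smooth_bounded_linear: "open S ==> bounded_linear l ==> Csm S l"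
 unfolding smooth_on_def using Ck_on_bounded_linear by blast

lemma smooth_linear_compose: "open S ==> bounded_linear l ==> Csm S u ==> Csm S (%z. l (u z))"
 unfolding smooth_on_def using Ck_on_linear_compose by blast

lemma smooth_add: "open S ==> Csm S u ==> Csm S v ==> Csm S (%z. u z + v z)"
 unfolding smooth_on_def using Ck_on_add by blast

lemma smooth_minus: "open S ==> Csm S u ==> Csm S (%z. - u z)"
 by (rule smooth_linear_compose[OF _ bounded_linear_minus[OF bounded_linear_ident]])

lemma smooth_diff: "open S ==> Csm S u ==> Csm S v ==> Csm S (%z. u z - v z)"
 using smooth_add[of S u "%z. - v z"] smooth_minus by fastforce

lemma smooth_bilinear:
 "open S ==> bounded_bilinear b ==> Csm S u ==> Csm S v ==> Csm S (%z. b (u z) (v z))"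
 unfolding smooth_on_def using Ck_on_bilinear by blast

lemma smooth_mult:
 fixes u v :: "'a::real_normed_vector => 'b::real_normed_algebra"
 shows "open S ==> Csm S u ==> Csm S v ==> Csm S (%z. u z * v z)"
 by (rule smooth_bilinear[OF _ bounded_bilinear_mult])

lemma smooth_inverse:
 fixes u :: "'a::real_normed_vector => 'b::real_normed_field"
 shows "open S ==> Csm S u ==> (!!z. z : S ==> u z ~= 0) ==> Csm S (%z. inverse (u z))"
 unfolding smooth_on_def using Ck_on_inverse by blast

lemma smooth_divide:
 fixes u :: "'a::real_normed_vector => 'b::real_normed_field"
 shows "open S ==> Csm S u ==> Csm S v ==> (!!z. z : S ==> v z ~= 0) ==> Csm S (%z. u z / v z)"
 unfolding divide_inverse by (intro smooth_mult smooth_inverse)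

lemma smooth_compose:
 fixes w :: "'a::real_normed_vector => 'b::euclidean_space"
 shows "open S ==> open T ==> w ` S <= T ==> Csm T u ==> Csm S w ==> Csm S (%z. u (w z))"
 unfolding smooth_on_def using Ck_on_compose by blast

lemma smooth_con: "Csm S u ==> cts S u"
 unfolding smooth_on_def by (metis Ck_on.simps(1))

lemma smooth_has_derivative:
 "Csm S u ==> z : S ==> (u hasd fder u (at z)) (at z)"
 unfolding smooth_on_def using Ck_on_SucD(1) by blast

lemma smooth_frechet_derivative:
 "Csm S u ==> Csm S (%z. fder u (at z) v)"
 unfolding smooth_on_def using Ck_on_SucD(2) by blast

lemma smooth_Pair:
 fixes u :: "'a::real_normed_vector => 'b::real_normed_vector" and v :: "'a => 'c::real_normed_vector"
 assumes "open S" "Csm S u" "Csm S v"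
 shows "Csm S (%z. (u z, v z))"
proof -
 have 1: "bounded_linear (%x::'b. (x, 0::'c))" and 2: "bounded_linear (%y::'c. (0::'b, y))"
 by (intro bounded_linear_Pair bounded_linear_ident bounded_linear_zero)+
 show ?thesis
 using smooth_add[OF assms(1) smooth_linear_compose[OF assms(1) 1 assms(2)]
 smooth_linear_compose[OF assms(1) 2 assms(3)]] by simp
qed

lemma smooth_Un:
 assumes "open S" "open T" "Csm S u" "Csm T u"
 shows "Csm (S \<union> T) u"
proof -
 have "Ck_on k (S \<union> T) u" if "Ck_on k S u" "Ck_on k T u" for k
 using that
 proof (induction k arbitrary: u)
 case 0
 thus ?case using assms(1,2) by (simp add: continuous_on_open_Un)
 next
 case (Suc k)
 thus ?case by auto
 qed
 thus ?thesis using assms(3,4) by (simp add: smooth_on_def)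
qed

lemma smooth_UNIV_extend:
 assumes "open S" "closed K" "K <= S" "Csm S u" "!!z. z ~: K ==> u z = 0"
 shows "Csm UNIV u"
proof -
 have "Csm (- K) u"
 using smooth_cong[of "- K" u "%_. 0"] assms by auto
 hence "Csm (S \<union> - K) u"
 using assms by (intro smooth_Un) auto
 moreover have "S \<union> - K = UNIV" using assms by auto
 ultimately show ?thesis by simp
qed

section \<open>Smooth bumps built from exp(-1/x)\<close>

text \<open>The powers of 1/x are carried along because differentiation maps \<open>flat n\<close>
  to a combination of \<open>flat (n + 2)\<close> and \<open>flat (n + 1)\<close>; smoothness of all
  of them is then one induction.\<close>

definition flat :: "nat => real => real" where
 "flat n x = (if x > 0 then (1 / x) ^ n * exp (- (1 / x)) else 0)"

lemma power_div_fact_le_exp: "0 <= y ==> y ^ n / fact n <= exp (y::real)"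
proof -
 assume y: "0 <= y"
 have s: "(%n. y ^ n / fact n) sums exp y"
 using exp_converges[of y] by (simp add: divide_inverse scaleR_conv_of_real mult.commute)
 have "(\<Sum>i\<in>{n}. y ^ i / fact i) <= (\<Sum>i. y ^ i / fact i)"
 by (rule sum_le_suminf) (use s y in \<open>auto intro: sums_summable\<close>)
 thus ?thesis using s by (simp add: sums_iff)
qed

text \<open>The term of index n + 2 of the exponential series at 1/x leaves the factor x^2, which is
  what makes the difference quotient at 0 tend to 0.\<close>

lemma flat_le: "\<bar>flat n x\<bar> <= fact (n + 2) * x\<^sup>2"
proof (cases "x > 0")
 case True
 define K :: real where "K = fact (n + 2)"
 have "(1 / x) ^ (n + 2) / K <= exp (1 / x)" "K > 0"
 using power_div_fact_le_exp[of "1 / x" "n + 2"] True unfolding K_def by auto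
 hence "(1 / x) ^ (n + 2) <= K * exp (1 / x)"
 by (simp only: pos_divide_le_eq mult.commute)
 hence "(1 / x) ^ (n + 2) * exp (- (1 / x)) <= K * exp (1 / x) * exp (- (1 / x))"
 by (intro mult_rm) auto
 also have "... = K" by (simp add: mult.assoc flip: exp_add)
 finally have "x\<^sup>2 * ((1 / x) ^ (n + 2) * exp (- (1 / x))) <= x\<^sup>2 * K"
 by (intro mult_lm) auto
 moreover have "x\<^sup>2 * (1 / x) ^ (n + 2) = (1 / x) ^ n"
 using True by (simp add: power_add power2_eq_square)
 ultimately have "(1 / x) ^ n * exp (- (1 / x)) <= K * x\<^sup>2"
 by (metis mult.assoc mult.commute)
 thus ?thesis using True by (simp add: flat_def K_def)
qed (simp add: flat_def)

lemma flat_nonneg: "0 <= flat n x" and flat_eq_0: "x <= 0 ==> flat n x = 0" and flat_pos: "0 < x ==> 0 < flat n x"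
 by (auto simp: flat_def)

lemma flat_has_real_derivative:
 "(flat n hrd (flat (n + 2) x - real n * flat (n + 1) x)) (at x)"
proof -
 consider "x > 0" | "x < 0" | "x = 0" by linarith
 thus ?thesis
 proof cases
 case 1
 have "((%x. (1 / x) ^ n * exp (- (1 / x))) hrd
 (real n * (1 / x) ^ (n - 1) * (- 1 / x\<^sup>2)) * exp (- (1 / x)) + (1 / x) ^ n * (exp (- (1 / x)) * (1 / x\<^sup>2))) (at x)"
 using 1 by (auto intro!: derivative_eq_intros simp: power2_eq_square)
 moreover have "real n * (1 / x) ^ (n - 1) * (- 1 / x\<^sup>2) = - (real n * (1 / x) ^ (n + 1))"
 by (cases n) (auto simp: power2_eq_square)
 moreover have "(1 / x) ^ n * (exp (- (1 / x)) * (1 / x\<^sup>2)) = (1 / x) ^ (n + 2) * exp (- (1 / x))"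
 by (simp add: power_add power2_eq_square)
 ultimately have "((%x. (1 / x) ^ n * exp (- (1 / x))) hrd
 (- (real n * (1 / x) ^ (n + 1)) * exp (- (1 / x)) + (1 / x) ^ (n + 2) * exp (- (1 / x)))) (at x)"
 by metis
 moreover have "- (real n * (1 / x) ^ (n + 1)) * exp (- (1 / x)) + (1 / x) ^ (n + 2) * exp (- (1 / x)) =
 flat (n + 2) x - real n * flat (n + 1) x"
 using 1 by (simp add: flat_def)
 ultimately have "((%x. (1 / x) ^ n * exp (- (1 / x))) hrd (flat (n + 2) x - real n * flat (n + 1) x)) (at x)"
 by metis
 thus ?thesis
 by (rule has_field_derivative_transform_within_open[where S = "{0<..}"]) (use 1 in \<open>auto simp: flat_def\<close>)
 next
 case 2
 have "((%_. 0) hrd 0) (at x)" by simp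
 hence "(flat n hrd 0) (at x)"
 by (rule has_field_derivative_transform_within_open[where S = "{..<0}"]) (use 2 in \<open>auto simp: flat_def\<close>)
 thus ?thesis using 2 by (simp add: flat_def)
 next
 case 3
 have "((%h. (flat n (x + h) - flat n x) / h) \<longlongrightarrow> 0) (at 0)"
 proof (rule Lim_null_comparison)
 show "\<forall>\<^sub>F h in at 0. norm ((flat n (x + h) - flat n x) / h) <= fact (n + 2) * \<bar>h\<bar>"
 unfolding eventually_at_filter
 proof (intro always_eventually allI impI)
 fix h :: real
 assume "h ~= 0"
 have "\<bar>flat n h\<bar> / \<bar>h\<bar> <= fact (n + 2) * h\<^sup>2 / \<bar>h\<bar>"
 by (intro divide_right_mono flat_le) simp
 also have "... = fact (n + 2) * \<bar>h\<bar>"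
 using \<open>h ~= 0\<close> by (simp add: power2_eq_square abs_if del: fact_Suc)
 finally show "norm ((flat n (x + h) - flat n x) / h) <= fact (n + 2) * \<bar>h\<bar>"
 using \<open>h ~= 0\<close> 3 by (simp add: flat_eq_0 del: fact_Suc)
 qed
 show "((%h. fact (n + 2) * \<bar>h\<bar>) \<longlongrightarrow> 0) (at (0::real))"
 by (auto intro!: tendsto_eq_intros)
 qed
 thus ?thesis using 3 by (simp add: DERIV_def flat_eq_0)
 qed
qed

lemma smooth_flat: "Csm UNIV (flat n)"
proof -
 have "Ck_on k UNIV (flat n)" for k
 proof (induction k arbitrary: n)
 case 0
 show ?case
 using flat_has_real_derivative by (auto intro!: con_at_on DERIV_isCont)
 next
 case (Suc k)
 show ?case
 proof (rule Ck_on_SucI)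
 show "(flat n hasd (*) (flat (n + 2) z - real n * flat (n + 1) z)) (at z)" for z
 using flat_has_real_derivative by (simp add: has_field_derivative_def)
 have "Ck_on k UNIV (%z. v *\<^sub>R flat (n + 2) z + (- v * real n) *\<^sub>R flat (n + 1) z)" for v
 by (intro Ck_on_add Ck_on_linear_compose[OF _ bounded_linear_scaleR_right] Suc.IH) auto
 thus "Ck_on k UNIV (%z. (flat (n + 2) z - real n * flat (n + 1) z) * v)" for v
 by (simp add: algebra_simps)
 qed auto
 qed
 thus ?thesis by (simp add: smooth_on_def)
qed

text \<open>The derivative \<open>et\<close> is delivered with the step because it is nonnegative
  with integral 1 and serves as the mollifier in \<open>weakly_constant\<close>.\<close>

lemma smooth_step_exists:
 fixes l r :: real
 assumes "l < r"
 obtains B et where "Csm UNIV B" "!!x. (B hrd et x) (at x)"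
 "!!x. 0 <= et x" "!!x. 0 <= B x" "!!x. B x <= 1" "!!x. x <= l ==> B x = 0" "!!x. x <= l ==> et x = 0"
 "!!x. r <= x ==> B x = 1" "!!x. r <= x ==> et x = 0" "cts UNIV et"
proof
 let ?a = "%x. flat 0 (x - l)" and ?b = "%x. flat 0 (r - x)"
 let ?a' = "%x. flat 2 (x - l)" and ?b' = "%x. flat 2 (r - x)"
 let ?B = "%x. ?a x / (?a x + ?b x)"
 let ?et = "%x. (?a' x * ?b x + ?a x * ?b' x) / (?a x + ?b x)\<^sup>2"
 have pos: "?a x + ?b x > 0" for x
 proof (cases "x > l")
 case True
 thus ?thesis using flat_pos[of "x - l" 0] flat_nonneg[of 0 "r - x"] by linarith
 next
 case False
 thus ?thesis using assms flat_pos[of "r - x" 0] flat_nonneg[of 0 "x - l"] by linarith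
 qed
 have nz: "?a x + ?b x ~= 0" for x using pos[of x] by linarith
 have sm: "Csm UNIV (%x. flat n (x - l))" "Csm UNIV (%x. flat n (r - x))" for n
 using smooth_compose[where S = UNIV and T = UNIV and u = "flat n" and w = "%x. x - l", OF _ _ _ smooth_flat]
 smooth_compose[where S = UNIV and T = UNIV and u = "flat n" and w = "%x. r - x", OF _ _ _ smooth_flat]
 smooth_diff[of UNIV "%x. x" "%_. l"] smooth_diff[of UNIV "%_. r" "%x. x"]
 smooth_bounded_linear[of UNIV "%x::real. x"] by auto
 show "Csm UNIV ?B"
 by (intro smooth_divide smooth_add sm open_UNIV nz)
 show "cts UNIV ?et"
 by (intro continuous_intros smooth_con[OF sm(1)] smooth_con[OF sm(2)]) (use nz in simp)
 have a: "(?a hrd ?a' x) (at x)" and b: "(?b hrd - ?b' x) (at x)" for x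
 using DERIV_chain2[where g = "%x. x - l" and f = "flat 0" and x = x and s = UNIV, OF flat_has_real_derivative, of 1]
 DERIV_chain2[where g = "%x. r - x" and f = "flat 0" and x = x and s = UNIV, OF flat_has_real_derivative, of "-1"]
 DERIV_diff[OF DERIV_ident DERIV_const, of l x UNIV] DERIV_diff[OF DERIV_const DERIV_ident, of r x UNIV]
 by (simp_all add: numeral_2_eq_2)
 show "(?B hrd ?et x) (at x)" for x
 using nz[of x] by (auto intro!: derivative_eq_intros a b simp: power2_eq_square field_simps)
 show "0 <= ?et x" for x by (intro divide_nonneg_nonneg add_nonneg_nonneg mult_nonneg_nonneg flat_nonneg) simp
 show "0 <= ?B x" for x using pos[of x] flat_nonneg[of 0 "x - l"] by simp
 show "?B x <= 1" for x using pos[of x] flat_nonneg[of 0 "r - x"] by simp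
 show "?B x = 0" if "x <= l" for x using that by (simp add: flat_eq_0)
 show "?et x = 0" if "x <= l" for x using that by (simp add: flat_eq_0)
 show "?et x = 0" if "r <= x" for x using that by (simp add: flat_eq_0)
 show "?B x = 1" if "r <= x" for x using that assms flat_pos[of "x - l" 0] by (simp add: flat_eq_0)
qed

section \<open>Weak derivatives of continuous functions of one variable\<close>

text \<open>Real factors suffice, since the weak equation is tested only on products of a function
  of x and a function of y.\<close>

definition test_pair :: "real => real => (real => real) => (real => real) => bool" where
 "test_pair l r A A' \<longleftrightarrow> Csm UNIV A & cts UNIV A' & (ALL x. (A hrd A' x) (at x)) &
 (ALL x. x ~: {l..r} --> A x = 0) & A l = 0 & A r = 0"

lemma mollify_bound:
 fixes w :: "real => complex"
 assumes et: "cts UNIV et" "!!x. 0 <= et x" "!!x. x <= x0 - ep ==> et x = 0" "!!x. x0 + ep <= x ==> et x = 0"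
 and one: "(et has_integral 1) {l..r}"
 and w: "cts {l..r} w" and le: "!!x. x : {x0 - ep..x0 + ep} ==> norm (w x - c) <= e"
 shows "norm (HK {l..r} (%x. et x *\<^sub>R w x) - c) <= e"
proof -
 have 1: "((%x. et x *\<^sub>R c) has_integral c) {l..r}"
 using has_integral_scaleR_left[OF one, of c] by simp
 have cet: "cts {l..r} et" using et(1) con_subset by blast
 have 2: "(%x. et x *\<^sub>R w x) integrable_on {l..r}"
 by (intro int_con continuous_intros cet w)
 have "HK {l..r} (%x. et x *\<^sub>R w x) - c = HK {l..r} (%x. et x *\<^sub>R (w x - c))"
 using 1 2 by (simp add: integral_unique integral_diff scaleR_diff_right has_integral_integrable)
 also have "norm ... <= HK {l..r} (%x. et x * e)"
 proof (rule int_norm_bd)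
 show "(%x. et x *\<^sub>R (w x - c)) integrable_on {l..r}"
 by (intro int_con continuous_intros cet w)
 show "(%x. et x * e) integrable_on {l..r}"
 by (intro int_con continuous_intros cet)
 show "norm (et x *\<^sub>R (w x - c)) <= et x * e" if "x : {l..r}" for x
 proof (cases "x : {x0 - ep..x0 + ep}")
 case True
 thus ?thesis using le[of x] et(2)[of x] by (simp add: mult_lm)
 next
 case False
 hence "et x = 0" using et(3,4)[of x] by auto
 thus ?thesis by simp
 qed
 qed
 also have "... = e" using integral_unique[OF has_integral_mult_left[OF one, of e]] by simp
 finally show ?thesis .
qed

text \<open>The lemma of du Bois-Reymond. The test function is the difference of a step at
  \<open>x0\<close> and a step at \<open>x1\<close>, so that its derivative compares averages of
  \<open>w\<close> near the two points.\<close>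

lemma weakly_constant:
 fixes w :: "real => complex"
 assumes w: "cts {c<..<d} w"
 and weak: "!!l r A A'. test_pair l r A A' ==> c < l ==> l <= r ==> r < d ==> HK {l..r} (%x. A' x *\<^sub>R w x) = 0"
 and "x0 : {c<..<d}" "x1 : {c<..<d}"
 shows "w x0 = w x1"
proof -
 have *: "w x0 = w x1" if "c < x0" "x0 < x1" "x1 < d" for x0 x1
 proof -
 have "norm (w x0 - w x1) <= e" if "e > 0" for e
 proof -
 have "continuous (at x0) w" "continuous (at x1) w"
 using w \<open>c < x0\<close> \<open>x0 < x1\<close> \<open>x1 < d\<close> by (auto simp: continuous_on_eq_continuous_at)
 then obtain d0 d1 where d0: "d0 > 0" "!!x. \<bar>x - x0\<bar> < d0 ==> norm (w x - w x0) < e / 2"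
 and d1: "d1 > 0" "!!x. \<bar>x - x1\<bar> < d1 ==> norm (w x - w x1) < e / 2"
 unfolding continuous_at_eps_delta using \<open>e > 0\<close>
 by (metis dist_norm half_gt_zero_iff real_norm_def)
 define ep where "ep = min (min (d0 / 2) (d1 / 2)) (min ((x1 - x0) / 2) (min ((x0 - c) / 2) ((d - x1) / 2)))"
 have ep: "ep > 0" "ep < d0" "ep < d1" "2 * ep <= x1 - x0" "ep < x0 - c" "ep < d - x1"
 using d0(1) d1(1) that \<open>c < x0\<close> \<open>x0 < x1\<close> \<open>x1 < d\<close> unfolding ep_def by (auto simp: min_def field_simps)
 obtain B0 et0 where B0: "Csm UNIV B0" "!!x. (B0 hrd et0 x) (at x)"
 "!!x. 0 <= et0 x" "!!x. 0 <= B0 x" "!!x. B0 x <= 1" "!!x. x <= x0 - ep ==> B0 x = 0" "!!x. x <= x0 - ep ==> et0 x = 0"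
 "!!x. x0 + ep <= x ==> B0 x = 1" "!!x. x0 + ep <= x ==> et0 x = 0" "cts UNIV et0"
 using smooth_step_exists[of "x0 - ep" "x0 + ep"] ep(1) by auto
 obtain B1 et1 where B1: "Csm UNIV B1" "!!x. (B1 hrd et1 x) (at x)"
 "!!x. 0 <= et1 x" "!!x. 0 <= B1 x" "!!x. B1 x <= 1" "!!x. x <= x1 - ep ==> B1 x = 0" "!!x. x <= x1 - ep ==> et1 x = 0"
 "!!x. x1 + ep <= x ==> B1 x = 1" "!!x. x1 + ep <= x ==> et1 x = 0" "cts UNIV et1"
 using smooth_step_exists[of "x1 - ep" "x1 + ep"] ep(1) by auto
 define l r where "l = x0 - ep" and "r = x1 + ep"
 have lr: "l <= r" "c < l" "r < d" using ep that unfolding l_def r_def by auto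
 have "test_pair l r (%x. B0 x - B1 x) (%x. et0 x - et1 x)"
 unfolding test_pair_def l_def r_def using ep \<open>x0 < x1\<close>
 by (auto intro!: smooth_diff continuous_intros derivative_intros B0(2) B1(2) simp: B0 B1)
 from weak[OF this lr(2,1,3)]
 have z: "HK {l..r} (%x. (et0 x - et1 x) *\<^sub>R w x) = 0" .
 have cw: "cts {l..r} w" using w lr by (auto intro: con_subset)
 have ii: "(%x. et0 x *\<^sub>R w x) integrable_on {l..r}" "(%x. et1 x *\<^sub>R w x) integrable_on {l..r}"
 by (intro int_con continuous_intros cw con_subset[OF B0(10)]
 con_subset[OF B1(10)]; simp)+
 have "(et0 has_integral (B0 r - B0 l)) {l..r}"
 by (rule FTC[OF lr(1)])
 (metis B0(2) hrd_hvd has_vector_derivative_at_within)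
 moreover have "(et1 has_integral (B1 r - B1 l)) {l..r}"
 by (rule FTC[OF lr(1)])
 (metis B1(2) hrd_hvd has_vector_derivative_at_within)
 ultimately have o: "(et0 has_integral 1) {l..r}" "(et1 has_integral 1) {l..r}"
 using ep \<open>x0 < x1\<close> by (simp_all add: l_def r_def B0 B1)
 have "norm (HK {l..r} (%x. et0 x *\<^sub>R w x) - w x0) <= e / 2"
 by (rule mollify_bound[where ?x0.0 = x0 and ep = ep]) (use B0 o cw d0(2) ep in \<open>auto intro!: less_imp_le\<close>)
 moreover have "norm (HK {l..r} (%x. et1 x *\<^sub>R w x) - w x1) <= e / 2"
 by (rule mollify_bound[where ?x0.0 = x1 and ep = ep]) (use B1 o cw d1(2) ep in \<open>auto intro!: less_imp_le\<close>)
 moreover have "HK {l..r} (%x. et0 x *\<^sub>R w x) = HK {l..r} (%x. et1 x *\<^sub>R w x)"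
 using z ii by (simp add: scaleR_diff_left integral_diff)
 ultimately have "norm (w x0 - w x1) <= e / 2 + e / 2"
 using norm_triangle_ineq4[of "HK {l..r} (%x. et1 x *\<^sub>R w x) - w x1" "HK {l..r} (%x. et0 x *\<^sub>R w x) - w x0"]
 by (simp add: algebra_simps)
 thus ?thesis by simp
 qed
 hence "~ 0 < norm (w x0 - w x1)"
 using dense[of 0 "norm (w x0 - w x1)"] by (meson less_le_not_le)
 thus ?thesis by simp
 qed
 show ?thesis using * assms(3,4) by (metis greaterThanLessThan_iff linorder_less_linear)
qed

lemma test_pair_by_parts:
 fixes V :: "real => complex"
 assumes t: "test_pair l r A A'" and "l <= r"
 and V: "!!x. x : {l..r} ==> (V hvd v x) (at x within {l..r})" "cts {l..r} v"
 shows "HK {l..r} (%x. A x *\<^sub>R v x) = - HK {l..r} (%x. A' x *\<^sub>R V x)"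
proof -
 have A: "(A hvd A' x) (at x within {l..r})" for x
 using t unfolding test_pair_def hrd_hvd
 by (blast intro: has_vector_derivative_at_within)
 have cV: "cts {l..r} V"
 using V(1) by (rule continuous_on_vector_derivative)
 have cA: "cts {l..r} A" "cts {l..r} A'"
 using t unfolding test_pair_def by (meson con_subset subset_UNIV smooth_con)+
 have "((%x. A x *\<^sub>R v x + A' x *\<^sub>R V x) has_integral (A r *\<^sub>R V r - A l *\<^sub>R V l)) {l..r}"
 by (rule FTC[OF \<open>l <= r\<close>]) (rule has_vector_derivative_scaleR[OF _ V(1)],
 use A in \<open>auto simp: hrd_hvd\<close>)
 hence "HK {l..r} (%x. A x *\<^sub>R v x + A' x *\<^sub>R V x) = 0"
 using t by (simp add: test_pair_def integral_unique)
 moreover have "(%x. A x *\<^sub>R v x) integrable_on {l..r}" "(%x. A' x *\<^sub>R V x) integrable_on {l..r}"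
 by (intro int_con continuous_intros cA cV V(2))+
 ultimately show ?thesis by (simp add: integral_add eq_neg_iff_add_eq_0)
qed

text \<open>Subtracting a primitive of \<open>v\<close> from \<open>u\<close> leaves a function with
  vanishing weak derivative, to which \<open>weakly_constant\<close> applies.\<close>

lemma weak_derivative_is_derivative:
 fixes u v :: "real => complex"
 assumes u: "cts {c<..<d} u" and v: "cts {c<..<d} v"
 and weak: "!!l r A A'. test_pair l r A A' ==> c < l ==> l <= r ==> r < d ==>
 HK {l..r} (%x. A x *\<^sub>R v x + A' x *\<^sub>R u x) = 0"
 and y: "c < y0" "y0 <= y1" "y1 < d"
 shows "HK {y0..y1} v = u y1 - u y0"
proof -
 obtain c1 d1 where cd: "c < c1" "c1 < y0" "y1 < d1" "d1 < d"
 using y dense by meson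
 define V where "V = (%y. HK {c1..y} v)"
 have cv: "cts {c1..d1} v" using v cd by (auto intro: con_subset)
 have V: "(V hvd v x) (at x within {c1..d1})" if "x : {c1..d1}" for x
 unfolding V_def using integral_has_vector_derivative[OF cv that] .
 have cV: "cts {c1..d1} V"
 using V by (rule continuous_on_vector_derivative)
 have "u y0 - V y0 = u y1 - V y1"
 proof (rule weakly_constant[where c = c1 and d = d1])
 show "cts {c1<..<d1} (%y. u y - V y)"
 by (intro continuous_intros con_subset[OF u] con_subset[OF cV]) (use cd in auto)
 fix l r A A' assume t: "test_pair l r A A'" and lr: "c1 < l" "l <= r" "r < d1"
 have sub: "{l..r} <= {c1..d1}" "{l..r} <= {c<..<d}" using lr cd by auto
 have tA: "cts {l..r} A" "cts {l..r} A'"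
 using t unfolding test_pair_def by (meson con_subset subset_UNIV smooth_con)+
 note cs = con_subset[OF u sub(2)] con_subset[OF v sub(2)] con_subset[OF cV sub(1)]
 have "HK {l..r} (%x. A x *\<^sub>R v x) = - HK {l..r} (%x. A' x *\<^sub>R V x)"
 by (rule test_pair_by_parts[OF t lr(2)]) (use V sub cs in \<open>auto intro!: has_vector_derivative_within_subset[OF V]\<close>)
 moreover have "HK {l..r} (%x. A x *\<^sub>R v x + A' x *\<^sub>R u x) = 0"
 using weak[OF t _ lr(2)] lr cd by auto
 moreover have "(%x. A x *\<^sub>R v x) integrable_on {l..r}" "(%x. A' x *\<^sub>R V x) integrable_on {l..r}" "(%x. A' x *\<^sub>R u x) integrable_on {l..r}"
 by (intro int_con continuous_intros tA cs)+
 ultimately show "HK {l..r} (%x. A' x *\<^sub>R (u x - V x)) = 0"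
 by (simp add: scaleR_diff_right integral_add integral_diff)
 qed (use cd y in auto)
 moreover have "HK {c1..y0} v + HK {y0..y1} v = HK {c1..y1} v"
 by (rule Henstock_Kurzweil_Integration.integral_combine) (use cd y cv in \<open>auto intro!: int_con intro: con_subset\<close>)
 ultimately show ?thesis unfolding V_def by algebra
qed

section \<open>Continuous one-forms on plane sets and their primitives\<close>

definition px :: "(plane => 'a::real_normed_vector) => plane => 'a" where
 "px u z = fder u (at z) (1, 0)"

definition py :: "(plane => 'a::real_normed_vector) => plane => 'a" where
 "py u z = fder u (at z) (0, 1)"

lemma smooth_px: "Csm S u ==> Csm S (px u)"
 and smooth_py: "Csm S u ==> Csm S (py u)"
 using smooth_frechet_derivative[of S u "(1, 0)"] smooth_frechet_derivative[of S u "(0, 1)"]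
 by (simp_all add: px_def[abs_def] py_def[abs_def])

lemma linear_plane:
 fixes D :: "plane => 'a::real_normed_vector"
 assumes "linear D"
 shows "D v = fst v *\<^sub>R D (1, 0) + snd v *\<^sub>R D (0, 1)"
proof -
 interpret linear D by fact
 have "D v = D (fst v *\<^sub>R (1, 0) + snd v *\<^sub>R (0, 1))" by (simp add: prod_eq_iff)
 also have "... = fst v *\<^sub>R D (1, 0) + snd v *\<^sub>R D (0, 1)" by (simp only: add scale)
 finally show ?thesis .
qed

lemma has_derivative_plane_partials:
 fixes u :: "plane => 'a::real_normed_vector"
 assumes "(u hasd D) (at (x, y))"
 shows "((%x. u (x, y)) hvd D (1, 0)) (at x within A)"
 and "((%y. u (x, y)) hvd D (0, 1)) (at y within A)"
proof -
 have l: "linear D" using assms by (simp add: has_derivative_bounded_linear bounded_linear.linear)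
 have "((%x. (x, y)) hasd (%h. (h, 0))) (at x within A)"
 by (auto intro!: derivative_eq_intros)
 from hd_comp[OF this assms]
 show "((%x. u (x, y)) hvd D (1, 0)) (at x within A)"
 unfolding hvd_def by (rule has_derivative_eq_rhs) (rule ext, subst linear_plane[OF l], simp)
 have "((%y. (x, y)) hasd (%h. (0, h))) (at y within A)"
 by (auto intro!: derivative_eq_intros)
 from hd_comp[OF this assms]
 show "((%y. u (x, y)) hvd D (0, 1)) (at y within A)"
 unfolding hvd_def by (rule has_derivative_eq_rhs) (rule ext, subst linear_plane[OF l], simp)
qed

lemma smooth_partials:
 assumes "Csm S u" "(x, y) : S"
 shows "((%x. u (x, y)) hvd px u (x, y)) (at x within A)"
 and "((%y. u (x, y)) hvd py u (x, y)) (at y within A)"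
 using has_derivative_plane_partials[OF smooth_has_derivative[OF assms]] by (simp_all add: px_def py_def)

lemma frechet_derivative_plane:
 assumes "u differentiable at z"
 shows "fder u (at z) v = fst v *\<^sub>R px u z + snd v *\<^sub>R py u z"
 unfolding px_def py_def by (rule linear_plane[OF linear_frechet_derivative[OF assms]])

lemma con_slice:
 assumes "cts S u"
 shows "(!!x. x : A ==> (x, y) : S) ==> cts A (%x. u (x, y))"
 and "(!!y. y : A ==> (x, y) : S) ==> cts A (%y. u (x, y))"
 by (rule con_comp[OF assms]; auto intro!: continuous_intros)+

text \<open>The integral of P dx + Q dy along the boundary of the rectangle,
  counterclockwise.\<close>

definition rect_integral :: "(plane => complex) => (plane => complex) => real => real => real => real => complex" where
 "rect_integral P Q x0 x1 y0 y1 =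
 HK {x0..x1} (%x. P (x, y0)) + HK {y0..y1} (%y. Q (x1, y))
 - HK {x0..x1} (%x. P (x, y1)) - HK {y0..y1} (%y. Q (x0, y))"

lemma rect_integral_combine_x:
 assumes "cts ({x0..x2} \<times> {y0..y1}) P" "x0 <= x1" "x1 <= x2" "y0 <= y1"
 shows "rect_integral P Q x0 x1 y0 y1 + rect_integral P Q x1 x2 y0 y1 = rect_integral P Q x0 x2 y0 y1"
proof -
 have "HK {x0..x1} (%x. P (x, y)) + HK {x1..x2} (%x. P (x, y)) = HK {x0..x2} (%x. P (x, y))"
 if "y : {y0..y1}" for y
 by (rule Henstock_Kurzweil_Integration.integral_combine[OF assms(2,3)],
 rule int_con, rule con_slice(1)[OF assms(1)]) (use that in auto)
 from this[of y0, symmetric] this[of y1, symmetric] show ?thesis using assms(4) unfolding rect_integral_def by simp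
qed

lemma rect_integral_combine_y:
 assumes "cts ({x0..x1} \<times> {y0..y2}) Q" "y0 <= y1" "y1 <= y2" "x0 <= x1"
 shows "rect_integral P Q x0 x1 y0 y1 + rect_integral P Q x0 x1 y1 y2 = rect_integral P Q x0 x1 y0 y2"
proof -
 have "HK {y0..y1} (%y. Q (x, y)) + HK {y1..y2} (%y. Q (x, y)) = HK {y0..y2} (%y. Q (x, y))"
 if "x : {x0..x1}" for x
 by (rule Henstock_Kurzweil_Integration.integral_combine[OF assms(2,3)],
 rule int_con, rule con_slice(2)[OF assms(1)]) (use that in auto)
 from this[of x0, symmetric] this[of x1, symmetric] show ?thesis using assms(4) unfolding rect_integral_def by simp
qed

definition exact_on :: "plane set => (plane => complex) => (plane => complex) => (plane => complex) => bool" where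
 "exact_on S P Q U \<longleftrightarrow> cts S P & cts S Q &
 (ALL z:S. (U hasd (%v. fst v *\<^sub>R P z + snd v *\<^sub>R Q z)) (at z))"

text \<open>Closedness in the sense of Morera, since the coefficients of f dZ are only continuous
  and cannot be differentiated.\<close>

definition closed_on :: "plane set => (plane => complex) => (plane => complex) => bool" where
 "closed_on S P Q \<longleftrightarrow> cts S P & cts S Q &
 (ALL x0 x1 y0 y1. x0 <= x1 --> y0 <= y1 --> {x0..x1} \<times> {y0..y1} <= S --> rect_integral P Q x0 x1 y0 y1 = 0)"

lemma exact_imp_closed_on:
 assumes "exact_on S P Q U"
 shows "closed_on S P Q"
 unfolding closed_on_def
proof (intro conjI allI impI)
 fix x0 x1 y0 y1 :: real
 assume le: "x0 <= x1" "y0 <= y1" and sub: "{x0..x1} \<times> {y0..y1} <= S"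
 have D: "(U hasd (%v. fst v *\<^sub>R P z + snd v *\<^sub>R Q z)) (at z)" if "z : S" for z
 using assms that by (auto simp: exact_on_def)
 have h: "HK {x0..x1} (%x. P (x, y)) = U (x1, y) - U (x0, y)" if "y : {y0..y1}" for y
 proof (rule integral_unique, rule FTC[OF le(1)])
 fix x assume "x : {x0..x1}"
 hence "(x, y) : S" using sub that by auto
 from has_derivative_plane_partials(1)[OF D[OF this]]
 show "((%x. U (x, y)) hvd P (x, y)) (at x within {x0..x1})" by simp
 qed
 have v: "HK {y0..y1} (%y. Q (x, y)) = U (x, y1) - U (x, y0)" if "x : {x0..x1}" for x
 proof (rule integral_unique, rule FTC[OF le(2)])
 fix y assume "y : {y0..y1}"
 hence "(x, y) : S" using sub that by auto
 from has_derivative_plane_partials(2)[OF D[OF this]]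
 show "((%y. U (x, y)) hvd Q (x, y)) (at y within {y0..y1})" by simp
 qed
 show "rect_integral P Q x0 x1 y0 y1 = 0"
 using h[of y0] h[of y1] v[of x0] v[of x1] le by (simp add: rect_integral_def)
qed (use assms in \<open>auto simp: exact_on_def\<close>)

text \<open>Compactness in each variable by the rule \<open>Bolzano\<close>: first rectangles of
  full width and small height around every level, then a stack of them.\<close>

lemma closed_on_local:
 assumes cont: "cts S P" "cts S Q"
 and loc: "!!z. z : S ==> EX T. open T & z : T & closed_on T P Q"
 shows "closed_on S P Q"
 unfolding closed_on_def
proof (intro conjI allI impI cont)
 fix x0 x1 y0 y1 :: real
 assume le: "x0 <= x1" "y0 <= y1" and sub: "{x0..x1} \<times> {y0..y1} <= S"
 have sP: "cts ({a..b} \<times> {c..d}) P" and sQ: "cts ({a..b} \<times> {c..d}) Q"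
 if "x0 <= a" "b <= x1" "y0 <= c" "d <= y1" for a b c d
 proof -
 have "{a..b} \<times> {c..d} <= {x0..x1} \<times> {y0..y1}" using that by auto
 hence "{a..b} \<times> {c..d} <= S" using sub by (rule subset_trans)
 thus "cts ({a..b} \<times> {c..d}) P" "cts ({a..b} \<times> {c..d}) Q"
 using cont con_subset by blast+
 qed
 have strip: "\<exists>d>0. ALL c e. c <= y & y <= e & e - c < d --> y0 <= c --> e <= y1 --> rect_integral P Q x0 x1 c e = 0"
 if y: "y0 <= y" "y <= y1" for y
 proof -
 define R where "R = (%a b. x0 <= a --> b <= x1 --> (\<exists>d>0. ALL c e. c <= y & y <= e & e - c < d --> y0 <= c --> e <= y1 --> rect_integral P Q a b c e = 0))"
 have "R x0 x1" using le(1)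
 proof (induction rule: Bolzano)
 case (trans a b c)
 show ?case unfolding R_def
 proof (intro impI)
 assume ac: "x0 <= a" "c <= x1"
 obtain d where d: "d > 0" "!!l u. l <= y & y <= u & u - l < d ==> y0 <= l ==> u <= y1 ==> rect_integral P Q a b l u = 0"
 using trans ac unfolding R_def by (meson order_trans)
 obtain d' where d': "d' > 0" "!!l u. l <= y & y <= u & u - l < d' ==> y0 <= l ==> u <= y1 ==> rect_integral P Q b c l u = 0"
 using trans ac unfolding R_def by (meson order_trans)
 have "rect_integral P Q a c l u = 0" if "l <= y & y <= u & u - l < min d d'" "y0 <= l" "u <= y1" for l u
 proof -
 have "rect_integral P Q a b l u + rect_integral P Q b c l u = rect_integral P Q a c l u"
 using that ac trans by (intro rect_integral_combine_x sP) auto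
 thus ?thesis using d(2)[of l u] d'(2)[of l u] that by auto
 qed
 thus "\<exists>d>0. ALL l u. l <= y & y <= u & u - l < d --> y0 <= l --> u <= y1 --> rect_integral P Q a c l u = 0"
 using d(1) d'(1) by (intro exI[of _ "min d d'"]) auto
 qed
 next
 case (local x)
 have "(x, y) : S" using local y sub by auto
 then obtain T where T: "open T" "(x, y) : T" "closed_on T P Q" using loc by blast
 then obtain A B where AB: "open A" "open B" "x : A" "y : B" "A \<times> B <= T" by (metis open_prod_elim mem_Times_iff fst_conv snd_conv)
 obtain d1 where d1: "d1 > 0" "!!x'. \<bar>x' - x\<bar> < d1 ==> x' : A" using AB(1,3) by (metis open_real)
 obtain d2 where d2: "d2 > 0" "!!x'. \<bar>x' - y\<bar> < d2 ==> x' : B" using AB(2,4) by (metis open_real)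
 have "rect_integral P Q a b l u = 0"
 if "a <= x & x <= b & b - a < d1" "l <= y & y <= u & u - l < d2" for a b l u
 proof -
 have "{a..b} <= A" using that d1(2) by force
 moreover have "{l..u} <= B" using that d2(2) by force
 ultimately have "{a..b} \<times> {l..u} <= T" using AB(5) by blast
 thus ?thesis using T(3) that unfolding closed_on_def by auto
 qed
 thus ?case unfolding R_def using d1(1) d2(1) by blast
 qed
 thus ?thesis unfolding R_def by simp
 qed
 have "y0 <= y0 --> y1 <= y1 --> rect_integral P Q x0 x1 y0 y1 = 0" using le(2)
 proof (induction rule: Bolzano[where P = "%c e. y0 <= c --> e <= y1 --> rect_integral P Q x0 x1 c e = 0"])
 case (trans a b c)
 show ?case
 proof (intro impI)
 assume ac: "y0 <= a" "c <= y1"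
 hence "rect_integral P Q x0 x1 a b = 0" "rect_integral P Q x0 x1 b c = 0" using trans by auto
 moreover have "rect_integral P Q x0 x1 a b + rect_integral P Q x0 x1 b c = rect_integral P Q x0 x1 a c"
 using ac trans le by (intro rect_integral_combine_y sQ) auto
 ultimately show "rect_integral P Q x0 x1 a c = 0" by simp
 qed
 next
 case (local y)
 thus ?case using strip[of y] by blast
 qed
 thus "rect_integral P Q x0 x1 y0 y1 = 0" by simp
qed

text \<open>Green's theorem with \<open>R\<close> as the common value of P_y and Q_x: by
  differentiation under the integral sign, the integral of \<open>P\<close> over a horizontal side
  has the y-derivative \<open>Q (x1, y) - Q (x0, y)\<close>.\<close>

lemma closed_on_cross_partials:
 assumes "cts S P" "cts S Q" "cts S R"
 and P: "!!x y. (x, y) : S ==> ((%y. P (x, y)) hvd R (x, y)) (at y)"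
 and Q: "!!x y. (x, y) : S ==> ((%x. Q (x, y)) hvd R (x, y)) (at x)"
 shows "closed_on S P Q"
 unfolding closed_on_def
proof (intro conjI allI impI assms(1,2))
 fix x0 x1 y0 y1 :: real
 assume le: "x0 <= x1" "y0 <= y1" and sub: "{x0..x1} \<times> {y0..y1} <= S"
 have "((%y. HK {x0..x1} (%x. P (x, y))) hvd HK {x0..x1} (%x. R (x, y))) (at y within {y0..y1})"
 if "y : {y0..y1}" for y
 proof -
 have "((%y. HK (cbox x0 x1) (%x. P (x, y))) hvd HK (cbox x0 x1) (%x. R (x, y))) (at y within {y0..y1})"
 proof (rule leibniz_rule_vector_derivative)
 show "((%y. P (x, y)) hvd R (x, y)) (at y within {y0..y1})" if "y : {y0..y1}" "x : cbox x0 x1" for x y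
 by (rule has_vector_derivative_at_within[OF P]) (use that sub in auto)
 show "(%x. P (x, y)) integrable_on cbox x0 x1" if "y : {y0..y1}" for y
 unfolding box_real
 by (rule int_con, rule con_slice(1)[OF assms(1)]) (use that sub in auto)
 show "cts ({y0..y1} \<times> cbox x0 x1) (%(y, x). R (x, y))"
 unfolding split_beta by (rule con_comp[OF assms(3)]) (use sub in \<open>auto intro!: continuous_intros\<close>)
 qed (use that in auto)
 thus ?thesis by simp
 qed
 moreover have "HK {x0..x1} (%x. R (x, y)) = Q (x1, y) - Q (x0, y)" if "y : {y0..y1}" for y
 proof (rule integral_unique, rule FTC[OF le(1)])
 fix x assume "x : {x0..x1}"
 hence "(x, y) : S" using sub that by auto
 from Q[OF this]
 show "((%x. Q (x, y)) hvd R (x, y)) (at x within {x0..x1})" by (rule has_vector_derivative_at_within)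
 qed
 ultimately have I: "((%y. Q (x1, y) - Q (x0, y)) has_integral
 (HK {x0..x1} (%x. P (x, y1)) - HK {x0..x1} (%x. P (x, y0)))) {y0..y1}"
 by (intro FTC[OF le(2)]) simp
 have "(%y. Q (x, y)) integrable_on {y0..y1}" if "x : {x0..x1}" for x
 by (rule int_con, rule con_slice(2)[OF assms(2)]) (use that sub in auto)
 thus "rect_integral P Q x0 x1 y0 y1 = 0"
 using le integral_unique[OF I] unfolding rect_integral_def by (simp add: integral_diff algebra_simps)
qed

text \<open>Schwarz's theorem: the horizontal integral of \<open>px Z\<close> is a difference of
  values of \<open>Z\<close>. Differentiating it in y under the integral sign, and the result in x,
  exchanges the partial derivatives.\<close>

lemma smooth_mixed_partials:
 fixes Z :: "plane => complex"
 assumes "open S" "Csm S Z" "z : S"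
 shows "py (px Z) z = px (py Z) z"
proof -
 obtain x y where z: "z = (x, y)" by (cases z)
 obtain A B where AB: "open A" "open B" "x : A" "y : B" "A \<times> B <= S"
 using assms(1,3) z by (metis open_prod_elim mem_Times_iff fst_conv snd_conv)
 obtain d1 where d1: "d1 > 0" "!!x'. \<bar>x' - x\<bar> < d1 ==> x' : A" using AB(1,3) by (metis open_real)
 obtain d2 where d2: "d2 > 0" "!!x'. \<bar>x' - y\<bar> < d2 ==> x' : B" using AB(2,4) by (metis open_real)
 define x0 x1 y0 y1 where "x0 = x - d1 / 2" and "x1 = x + d1 / 2" and "y0 = y - d2 / 2" and "y1 = y + d2 / 2"
 have sub: "{x0..x1} \<times> {y0..y1} <= S"
 using AB(5) d1 d2 unfolding x0_def x1_def y0_def y1_def by (force simp: abs_less_iff)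
 have xy: "x0 < x" "x < x1" "y0 < y" "y < y1" using d1 d2 by (auto simp: x0_def x1_def y0_def y1_def)
 note sm = smooth_px[OF assms(2)] smooth_py[OF assms(2)]
 have eq: "HK {x0..x'} (%s. py (px Z) (s, y)) = py Z (x', y) - py Z (x0, y)" if "x' : {x0..x1}" for x'
 proof -
 have "((%y. HK (cbox x0 x') (%s. px Z (s, y))) hvd HK (cbox x0 x') (%s. py (px Z) (s, y))) (at y within {y0..y1})"
 proof (rule leibniz_rule_vector_derivative)
 show "((%y. px Z (s, y)) hvd py (px Z) (s, y)) (at y within {y0..y1})"
 if "y : {y0..y1}" "s : cbox x0 x'" for s y
 using that sub \<open>x' : {x0..x1}\<close> by (intro smooth_partials[OF sm(1)]) auto
 show "(%x. px Z (x, y)) integrable_on cbox x0 x'" if "y : {y0..y1}" for y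
 using that sub \<open>x' : {x0..x1}\<close>
 by (auto intro!: int_con con_slice(1)[OF smooth_con[OF sm(1)]])
 show "cts ({y0..y1} \<times> cbox x0 x') (%(y, x). py (px Z) (x, y))"
 unfolding split_beta by (rule con_comp[OF smooth_con[OF smooth_py[OF sm(1)]]])
 (use sub that in \<open>auto intro!: continuous_intros\<close>)
 qed (use xy in auto)
 moreover have "HK {x0..x'} (%s. px Z (s, y)) = Z (x', y) - Z (x0, y)" if "y : {y0..y1}" for y
 by (rule integral_unique, rule FTC)
 (use sub that \<open>x' : {x0..x1}\<close> in \<open>auto intro!: smooth_partials[OF assms(2)]\<close>)
 ultimately have "((%y. Z (x', y) - Z (x0, y)) hvd HK {x0..x'} (%s. py (px Z) (s, y))) (at y within {y0..y1})"
 using xy by (auto intro: has_vector_derivative_transform_within[where d = 1])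
 hence "((%y. Z (x', y) - Z (x0, y)) hvd HK {x0..x'} (%s. py (px Z) (s, y))) (at y)"
 using at_within_Icc_at[OF xy(3,4)] by simp
 moreover have "((%y. Z (x', y) - Z (x0, y)) hvd py Z (x', y) - py Z (x0, y)) (at y)"
 using sub that xy by (intro has_vector_derivative_diff smooth_partials(2)[OF assms(2)]) auto
 ultimately show ?thesis using vector_derivative_unique_at by blast
 qed
 have "cts {x0..x1} (%s. py (px Z) (s, y))"
 by (rule con_slice(1)[OF smooth_con[OF smooth_py[OF sm(1)]]]) (use sub xy in auto)
 from integral_has_vector_derivative[OF this, of x]
 have "((%x'. HK {x0..x'} (%s. py (px Z) (s, y))) hvd py (px Z) (x, y)) (at x within {x0..x1})"
 using xy by auto
 hence "((%x'. py Z (x', y) - py Z (x0, y)) hvd py (px Z) (x, y)) (at x within {x0..x1})"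
 using eq xy by (auto intro: has_vector_derivative_transform_within[where d = 1])
 hence "((%x'. py Z (x', y) - py Z (x0, y)) hvd py (px Z) (x, y)) (at x)"
 using at_within_Icc_at[OF xy(1,2)] by simp
 moreover have "((%x'. py Z (x', y) - py Z (x0, y)) hvd px (py Z) (x, y) - 0) (at x)"
 using assms(3) z by (intro has_vector_derivative_diff smooth_partials(1)[OF sm(2)] hvd_const) auto
 ultimately show ?thesis using vector_derivative_unique_at z by auto
qed

definition signed_integral :: "(real => complex) => real => real => complex" where
 "signed_integral g a x = (if a <= x then HK {a..x} g else - HK {x..a} g)"

lemma signed_integral_has_vector_derivative:
 assumes "cts {c<..<d} g" "a : {c<..<d}" "x : {c<..<d}"
 shows "(signed_integral g a hvd g x) (at x)"
proof -
 obtain l where l: "c < l" "l < a" "l < x" using assms(2,3) dense[of c "min a x"] by auto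
 obtain r where r: "a < r" "x < r" "r < d" using assms(2,3) dense[of "max a x" d] by auto
 have cg: "cts {l..r} g" using l r by (intro con_subset[OF assms(1)]) auto
 have ig: "g integrable_on {u..v}" if "l <= u" "v <= r" for u v
 using that by (intro int_con con_subset[OF cg]) auto
 have eq: "signed_integral g a y = HK {l..y} g - HK {l..a} g" if "y : {l..r}" for y
 proof (cases "a <= y")
 case True
 hence "HK {l..a} g + HK {a..y} g = HK {l..y} g"
 using that l r by (intro Henstock_Kurzweil_Integration.integral_combine ig) auto
 thus ?thesis using True by (simp add: signed_integral_def eq_diff_eq add.commute)
 next
 case False
 hence "HK {l..y} g + HK {y..a} g = HK {l..a} g"
 using that l r by (intro Henstock_Kurzweil_Integration.integral_combine ig) auto
 thus ?thesis using False unfolding signed_integral_def by (simp add: algebra_simps)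
 qed
 have "x : {l..r}" using l r by auto
 from has_vector_derivative_diff[OF integral_has_vector_derivative[OF cg this] hvd_const]
 have "((%y. HK {l..y} g - HK {l..a} g) hvd g x) (at x within {l..r})" by simp
 hence "(signed_integral g a hvd g x) (at x within {l..r})"
 by (rule has_vector_derivative_transform_within[where d = 1]) (use eq \<open>x : {l..r}\<close> in auto)
 thus ?thesis using at_within_Icc_at[of l x r] l r by simp
qed

lemma closed_on_box_imp_exact:
 assumes c: "closed_on ({a<..<b} \<times> {c<..<d}) P Q"
 shows "EX U. exact_on ({a<..<b} \<times> {c<..<d}) P Q U"
proof (cases "{a<..<b} \<times> {c<..<d} = {}")
 case True
 thus ?thesis by (auto simp: exact_on_def)
next
 case False
 let ?S = "{a<..<b} \<times> {c<..<d}"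
 obtain x0 y0 where z0: "x0 : {a<..<b}" "y0 : {c<..<d}" using False by blast
 have cP: "cts ?S P" and cQ: "cts ?S Q" using c by (auto simp: closed_on_def)
 have cPx: "cts {a<..<b} (%x. P (x, y))" if "y : {c<..<d}" for y
 using that by (intro con_slice(1)[OF cP]) auto
 have cQy: "cts {c<..<d} (%y. Q (x, y))" if "x : {a<..<b}" for x
 using that by (intro con_slice(2)[OF cQ]) auto
 define U where "U = (%z. signed_integral (%x. P (x, y0)) x0 (fst z) + signed_integral (%y. Q (fst z, y)) y0 (snd z))"
 have r0: "rect_integral P Q x x' y y' = 0" if "x : {a<..<b}" "x' : {a<..<b}" "y : {c<..<d}" "y' : {c<..<d}" "x <= x'" "y <= y'" for x x' y y'
 proof -
 have "{x..x'} \<times> {y..y'} <= ?S" using that by auto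
 thus ?thesis using c that unfolding closed_on_def by blast
 qed
 \<comment> \<open>The vanishing rectangle integral lets the potential be computed along either of
   the two L-shaped paths; one of them shows the x-derivative, the other the y-derivative.\<close>
 have U2: "U (x, y) = signed_integral (%x. P (x, y)) x0 x + signed_integral (%y. Q (x0, y)) y0 y" if "(x, y) : ?S" for x y
 using r0[of x0 x y0 y] r0[of x x0 y0 y] r0[of x0 x y y0] r0[of x x0 y y0] that z0
 unfolding rect_integral_def U_def signed_integral_def by (auto simp: algebra_simps split: if_splits)
 have Ux: "((%x. U (x, y)) hvd P (x, y)) (at x)" if "(x, y) : ?S" for x y
 proof -
 have xy: "x : {a<..<b}" "y : {c<..<d}" using that by auto
 from has_vector_derivative_add[OF signed_integral_has_vector_derivative[OF cPx[OF xy(2)] z0(1) xy(1)] hvd_const]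
 have "((%x. signed_integral (%x. P (x, y)) x0 x + signed_integral (%y. Q (x0, y)) y0 y) hvd P (x, y)) (at x)"
 by simp
 thus ?thesis
 by (rule has_vector_derivative_transform_within_open[where S = "{a<..<b}"]) (use U2 xy in auto)
 qed
 have Uy: "((%y. U (x, y)) hvd Q (x, y)) (at y)" if "(x, y) : ?S" for x y
 proof -
 have xy: "x : {a<..<b}" "y : {c<..<d}" using that by auto
 from has_vector_derivative_add[OF hvd_const signed_integral_has_vector_derivative[OF cQy[OF xy(1)] z0(2) xy(2)]]
 show ?thesis unfolding U_def by simp
 qed
 have "(U hasd (%v. fst v *\<^sub>R P z + snd v *\<^sub>R Q z)) (at z)" if "z : ?S" for z
 proof -
 obtain x y where zxy: "z = (x, y)" by (cases z)
 hence z: "z = (x, y)" "x : {a<..<b}" "y : {c<..<d}" using that by auto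
 have "((%(x, y). U (x, y)) hasd (%(tx, ty). tx *\<^sub>R P (x, y) + blinfun_scaleR_left (Q (x, y)) ty)) (at (x, y) within {a<..<b} \<times> {c<..<d})"
 proof (rule has_derivative_partialsI[where fy = "%x y. blinfun_scaleR_left (Q (x, y))" and f = "%x y. U (x, y)"])
 show "((%x. U (x, y)) hasd (%h. h *\<^sub>R P (x, y))) (at x within {a<..<b})"
 using Ux[of x y] z by (auto simp: hvd_def intro: hd_within)
 show "((%y. U (x, y)) hasd blinfun_apply (blinfun_scaleR_left (Q (x, y)))) (at y within {c<..<d})" if "x : {a<..<b}" "y : {c<..<d}" for x y
 using Uy[of x y] that by (auto simp: hvd_def intro: hd_within)
 have "cts ?S (%z. blinfun_scaleR_left (Q z))"
 by (intro bounded_linear.continuous_on[OF bounded_linear_blinfun_scaleR_left] cQ)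
 thus "continuous (at (x, y) within ?S) (%(x, y). blinfun_scaleR_left (Q (x, y)))"
 using z by (simp add: continuous_on_eq_continuous_within case_prod_eta split_beta')
 qed (use z in auto)
 thus ?thesis using z at_within_open[of z ?S] that by (simp add: open_Times split_beta')
 qed
 thus ?thesis using cP cQ by (auto simp: exact_on_def)
qed

text \<open>\<open>dG = g dZ\<close>.\<close>
definition prim :: "plane set => (plane => complex) => (plane => complex) => (plane => complex) => bool" where
 "prim S Z g G \<longleftrightarrow> cts S g & (ALL z:S. (G hasd (%v. g z * fder Z (at z) v)) (at z))"

lemma prim_imp_continuous_on: "prim S Z g G ==> cts S G"
 unfolding prim_def by (meson con_at_on has_derivative_continuous)

lemma prim_eq_exact_on:
 assumes "Csm S Z" "cts S g"
 shows "prim S Z g G \<longleftrightarrow> exact_on S (%z. g z * px Z z) (%z. g z * py Z z) G"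
proof -
 have "(%v. g z * fder Z (at z) v) = (%v. fst v *\<^sub>R (g z * px Z z) + snd v *\<^sub>R (g z * py Z z))" if "z : S" for z
 proof
 fix v
 have "Z differentiable at z" using smooth_has_derivative[OF assms(1) that] by (auto simp: differentiable_def)
 from frechet_derivative_plane[OF this, of v]
 show "g z * fder Z (at z) v = fst v *\<^sub>R (g z * px Z z) + snd v *\<^sub>R (g z * py Z z)"
 by (simp add: algebra_simps)
 qed
 moreover have "cts S (%z. g z * px Z z)" "cts S (%z. g z * py Z z)"
 by (intro continuous_intros assms smooth_con[OF smooth_px] smooth_con[OF smooth_py])+
 ultimately show ?thesis using assms unfolding prim_def exact_on_def by simp
qed

text \<open>d(G dZ) = dG wedge dZ = g dZ wedge dZ = 0. Hence a primitive along \<open>Z\<close> can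
  be integrated along \<open>Z\<close> again.\<close>

lemma prim_imp_closed_on:
 assumes "open S" "Csm S Z" "prim S Z g G"
 shows "closed_on S (%z. G z * px Z z) (%z. G z * py Z z)"
proof (rule closed_on_cross_partials)
 let ?R = "%z. G z * py (px Z) z + g z * py Z z * px Z z"
 have cG: "cts S G" and cg: "cts S g"
 using assms(3) prim_imp_continuous_on by (auto simp: prim_def)
 note sx = smooth_px[OF assms(2)] and sy = smooth_py[OF assms(2)]
 note cs = smooth_con[OF sx] smooth_con[OF sy] smooth_con[OF smooth_py[OF sx]]
 show "cts S (%z. G z * px Z z)" "cts S (%z. G z * py Z z)" "cts S ?R"
 by (intro continuous_intros cG cg cs)+
 fix x y assume z: "(x, y) : S"
 have G: "(G hasd (%v. g (x, y) * fder Z (at (x, y)) v)) (at (x, y))"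
 using assms(3) z by (auto simp: prim_def)
 note Gp = has_derivative_plane_partials[OF G, folded px_def py_def]
 show "((%y. G (x, y) * px Z (x, y)) hvd ?R (x, y)) (at y)"
 using has_vector_derivative_mult[OF Gp(2) smooth_partials(2)[OF sx z]] by (simp add: algebra_simps)
 show "((%x. G (x, y) * py Z (x, y)) hvd ?R (x, y)) (at x)"
 using has_vector_derivative_mult[OF Gp(1) smooth_partials(1)[OF sy z]] smooth_mixed_partials[OF assms(1,2) z]
 by (simp add: algebra_simps)
qed

lemma prim_exists:
 assumes "Csm ({a<..<b} \<times> {c<..<d}) Z" "cts ({a<..<b} \<times> {c<..<d}) g"
 and "closed_on ({a<..<b} \<times> {c<..<d}) (%z. g z * px Z z) (%z. g z * py Z z)"
 shows "EX G. prim ({a<..<b} \<times> {c<..<d}) Z g G"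
 using closed_on_box_imp_exact[OF assms(3)] prim_eq_exact_on[OF assms(1,2)] by auto

section \<open>For a weak solution f the form f dZ is closed\<close>

lemma px_eqI: "(u hasd D) (at z) ==> px u z = D (1, 0)"
 and py_eqI: "(u hasd D) (at z) ==> py u z = D (0, 1)"
 using frechet_derivative_at[of u D z] by (auto simp: px_def py_def)

lemma px_cong_open: "open S ==> z : S ==> (!!z. z : S ==> u z = v z) ==> px u z = px v z"
 and py_cong_open: "open S ==> z : S ==> (!!z. z : S ==> u z = v z) ==> py u z = py v z"
 unfolding px_def py_def using frechet_derivative_cong_open[of S z u v] by auto

lemma px_mult:
 fixes u v :: "plane => complex"
 assumes "u differentiable (at z)" "v differentiable (at z)"
 shows "px (%z. u z * v z) z = px u z * v z + u z * px v z"
 and "py (%z. u z * v z) z = py u z * v z + u z * py v z"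
proof -
 have "((%z. u z * v z) hasd (%h. u z * fder v (at z) h + fder u (at z) h * v z)) (at z)"
 using assms by (intro has_derivative_mult) (simp_all add: frechet_derivative_works)
 from px_eqI[OF this] py_eqI[OF this]
 show "px (%z. u z * v z) z = px u z * v z + u z * px v z" "py (%z. u z * v z) z = py u z * v z + u z * py v z"
 by (simp_all add: px_def py_def)
qed

definition vf_x :: "(plane => plane) => (plane => plane) => plane => complex" where
 "vf_x X Y z = Complex (fst (X z)) (fst (Y z))"

definition vf_y :: "(plane => plane) => (plane => plane) => plane => complex" where
 "vf_y X Y z = Complex (snd (X z)) (snd (Y z))"

lemma vf_apply_eq:
 assumes "u differentiable (at z)"
 shows "vf_apply X Y u z = vf_x X Y z * px u z + vf_y X Y z * py u z"
 unfolding vf_apply_def frechet_derivative_plane[OF assms, of "X z"] frechet_derivative_plane[OF assms, of "Y z"]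
 by (simp add: vf_x_def vf_y_def Complex_eq scaleR_conv_of_real algebra_simps)

lemma Complex_has_derivative:
 assumes "(u hasd D) F" "(v hasd E) F"
 shows "((%z. Complex (u z) (v z)) hasd (%h. Complex (D h) (E h))) F"
 unfolding Complex_eq
 by (intro has_derivative_add has_derivative_of_real has_derivative_mult_right assms)

lemma divergence_eq:
 assumes "X differentiable (at z)" "Y differentiable (at z)"
 shows "Complex (divergence X z) (divergence Y z) = px (vf_x X Y) z + py (vf_y X Y) z"
proof -
 let ?X = "fder X (at z)" and ?Y = "fder Y (at z)"
 have X: "(X hasd ?X) (at z)" and Y: "(Y hasd ?Y) (at z)"
 using assms by (simp_all add: frechet_derivative_works)
 have 1: "(vf_x X Y hasd (%h. Complex (fst (?X h)) (fst (?Y h)))) (at z)"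
 unfolding vf_x_def[abs_def] by (intro Complex_has_derivative has_derivative_fst X Y)
 have 2: "(vf_y X Y hasd (%h. Complex (snd (?X h)) (snd (?Y h)))) (at z)"
 unfolding vf_y_def[abs_def] by (intro Complex_has_derivative has_derivative_snd X Y)
 have d: "divergence V z = fst (fder V (at z) (1, 0)) + snd (fder V (at z) (0, 1))" for V
 by (simp add: divergence_def Basis_prod_def sum.union_disjoint inner_prod_def)
 show ?thesis
 unfolding px_eqI[OF 1] py_eqI[OF 2] d by (simp add: complex_eq_iff)
qed

lemma smooth_Complex:
 "open S ==> Csm S u ==> Csm S v ==> Csm S (%z. Complex (u z) (v z))"
 unfolding Complex_eq
 by (intro smooth_add smooth_mult smooth_const smooth_linear_compose[OF _ bounded_linear_of_real])

lemma smooth_vf: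
 assumes "open S" "Csm S X" "Csm S Y"
 shows "Csm S (vf_x X Y)" "Csm S (vf_y X Y)"
 unfolding vf_x_def[abs_def] vf_y_def[abs_def]
 by (intro smooth_Complex assms smooth_linear_compose[OF _ bounded_linear_fst] smooth_linear_compose[OF _ bounded_linear_snd])+

lemma smooth_differentiable: "Csm S u ==> z : S ==> u differentiable (at z)"
 using smooth_has_derivative[of S u z] by (auto simp: differentiable_def)

text \<open>\<open>L\<close> is \<open>h\<close> times the Hamiltonian field of the first integral \<open>Z\<close>, so its transpose is \<open>dZ \<and> d(h \<cdot>)\<close>.\<close>
lemma hamiltonian_form:
 assumes S: "open S" "Csm S X" "Csm S Y" "Csm S Z" "Csm S rh"
 and Z: "!!z. z : S ==> vf_apply X Y Z z = 0" "!!z. z : S ==> px Z z ~= 0 \<or> py Z z ~= 0"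
 and rh: "!!z. z : S ==> vf_apply X Y rh z ~= 0"
 shows "EX h. Csm S h & (ALL z:S. h z ~= 0 & vf_x X Y z = h z * py Z z & vf_y X Y z = - (h z * px Z z)) &
 (ALL z:S. ALL ph. ph differentiable (at z) -->
 vf_apply X Y ph z + Complex (divergence X z) (divergence Y z) * ph z =
 py Z z * px (%z. h z * ph z) z - px Z z * py (%z. h z * ph z) z)"
proof -
 define den where "den z = py Z z * px rh z - px Z z * py rh z" for z
 \<comment> \<open>\<open>L\<close> annihilates \<open>Z\<close>, so its coefficients are mu (Z_y,
   -Z_x) for some factor mu. Applying \<open>L\<close> to \<open>rh\<close> exhibits mu as this
   quotient, which is visibly smooth.\<close>
 define h where "h z = (vf_x X Y z * px rh z + vf_y X Y z * py rh z) / den z" for z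
 have key: "den z ~= 0 & h z ~= 0 & vf_x X Y z = h z * py Z z & vf_y X Y z = - (h z * px Z z)" if z: "z : S" for z
 proof -
 let ?a = "vf_x X Y z" and ?b = "vf_y X Y z" and ?p = "px Z z" and ?q = "py Z z"
 have 0: "?a * ?p + ?b * ?q = 0" using Z(1)[OF z] vf_apply_eq[OF smooth_differentiable[OF S(4) z]] by simp
 have 1: "?a * px rh z + ?b * py rh z ~= 0" using rh[OF z] vf_apply_eq[OF smooth_differentiable[OF S(5) z]] by simp
 have "EX mu. ?a = mu * ?q & ?b = - (mu * ?p)"
 proof (cases "?q = 0")
 case True
 hence "?p ~= 0" "?a = 0" using 0 Z(2)[OF z] by auto
 thus ?thesis using True by (intro exI[of _ "- ?b / ?p"]) auto
 next
 case False
 hence "?b = - (?a / ?q * ?p)" using 0 by (simp add: field_simps eq_neg_iff_add_eq_0)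
 thus ?thesis using False by (intro exI[of _ "?a / ?q"]) auto
 qed
 then obtain mu where mu: "?a = mu * ?q" "?b = - (mu * ?p)" by blast
 have "?a * px rh z + ?b * py rh z = mu * den z" unfolding mu den_def by (simp add: algebra_simps)
 hence "h z = mu" "den z ~= 0" "mu ~= 0" using 1 by (auto simp: h_def)
 thus ?thesis using mu by auto
 qed
 have sh: "Csm S h"
 unfolding h_def[abs_def] using key
 by (intro smooth_divide smooth_add smooth_mult smooth_vf smooth_px S
 smooth_py smooth_diff[of S "%z. py Z z * px rh z" "%z. px Z z * py rh z", folded den_def]) (auto simp: den_def)
 show ?thesis
 proof (intro exI[of _ h] conjI ballI allI impI sh)
 fix z and ph :: "plane => complex" assume z: "z : S" and ph: "ph differentiable (at z)"
 have dh: "h differentiable (at z)" using smooth_differentiable[OF sh z] .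
 have "px (vf_x X Y) z = px (%z. h z * py Z z) z" by (rule px_cong_open[OF S(1) z]) (use key in auto)
 also have "... = px h z * py Z z + h z * px (py Z) z"
 by (rule px_mult(1)[OF dh smooth_differentiable[OF smooth_py[OF S(4)] z]])
 finally have A: "px (vf_x X Y) z = px h z * py Z z + h z * px (py Z) z" .
 have "Csm S (%z. - h z)" by (rule smooth_minus[OF S(1) sh])
 hence dh': "(%z. - h z) differentiable (at z)" using smooth_differentiable z by blast
 have "py (vf_y X Y) z = py (%z. - h z * px Z z) z" by (rule py_cong_open[OF S(1) z]) (use key in auto)
 also have "... = py (%z. - h z) z * px Z z + (- h z) * py (px Z) z"
 by (rule px_mult(2)[OF dh' smooth_differentiable[OF smooth_px[OF S(4)] z]])
 also have "py (%z. - h z) z = - py h z"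
 using py_eqI[OF has_derivative_minus[OF smooth_has_derivative[OF sh z]]] by (simp add: py_def)
 finally have B: "py (vf_y X Y) z = - (py h z * px Z z) - h z * px (py Z) z"
 unfolding smooth_mixed_partials[OF S(1,4) z] by simp
 have k: "vf_x X Y z = h z * py Z z" "vf_y X Y z = - (h z * px Z z)" using key[OF z] by auto
 show "vf_apply X Y ph z + Complex (divergence X z) (divergence Y z) * ph z =
 py Z z * px (%z. h z * ph z) z - px Z z * py (%z. h z * ph z) z"
 unfolding vf_apply_eq[OF ph] divergence_eq[OF smooth_differentiable[OF S(2) z] smooth_differentiable[OF S(3) z]]
 A B px_mult[OF dh ph] k by (simp add: algebra_simps)
 qed (use key in auto)
qed

text \<open>By \<open>hamiltonian_form\<close> the transpose of \<open>L\<close> acts on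
  \<open>ph\<close> through \<open>h * ph\<close> alone, so the test function A(x) B(y) / h brings
  out the derivatives of the product A(x) B(y).\<close>

lemma weak_solution_product_test:
 assumes S: "open S" "Csm S X" "Csm S Y" "Csm S Z" "Csm S rh"
 and Z: "!!z. z : S ==> vf_apply X Y Z z = 0" "!!z. z : S ==> px Z z ~= 0 \<or> py Z z ~= 0"
 and rh: "!!z. z : S ==> vf_apply X Y rh z ~= 0"
 and f: "cts S f" "weak_solution D X Y f" "S <= D"
 and AB: "test_pair l r A A'" "test_pair l' r' B B'" "{l..r} \<times> {l'..r'} <= S"
 shows "HK {l..r} (%x. HK {l'..r'} (%y.
 f (x, y) * (py Z (x, y) * of_real (A' x * B y) - px Z (x, y) * of_real (A x * B' y)))) = 0"
proof -
 obtain h where h: "Csm S h" "!!z. z : S ==> h z ~= 0"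
 "!!z ph. z : S ==> ph differentiable (at z) ==>
 vf_apply X Y ph z + Complex (divergence X z) (divergence Y z) * ph z =
 py Z z * px (%z. h z * ph z) z - px Z z * py (%z. h z * ph z) z"
 using hamiltonian_form[OF S Z rh] by auto
 define K where "K = {l..r} \<times> {l'..r'}"
 have K: "compact K" "closed K" "K <= S" using AB(3) by (auto simp: K_def compact_Times closed_Times)
 define th :: "plane => complex" where "th z = of_real (A (fst z) * B (snd z))" for z
 define ph where "ph z = th z / h z" for z
 have A: "!!x. x ~: {l..r} ==> A x = 0" and B: "!!x. x ~: {l'..r'} ==> B x = 0" and smA: "Csm UNIV A" "Csm UNIV B"
 using AB(1,2) by (auto simp: test_pair_def)
 have "Csm UNIV (%z::plane. A (fst z))" "Csm UNIV (%z::plane. B (snd z))"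
 using smooth_compose[where S = "UNIV::plane set" and T = UNIV and w = fst, OF _ _ _ smA(1)] smooth_bounded_linear[OF open_UNIV bounded_linear_fst]
 smooth_compose[where S = "UNIV::plane set" and T = UNIV and w = snd, OF _ _ _ smA(2)] smooth_bounded_linear[OF open_UNIV bounded_linear_snd]
 by auto
 hence sth: "Csm UNIV th"
 unfolding th_def[abs_def] by (intro smooth_linear_compose[OF _ bounded_linear_of_real] smooth_mult) auto
 have th0: "th z = 0" if "z ~: K" for z
 using that A[of "fst z"] B[of "snd z"] by (cases z) (auto simp: th_def K_def)
 have sph: "Csm S ph"
 unfolding ph_def[abs_def] using h(2) by (intro smooth_divide S(1) h(1) smooth_subset[OF sth]) auto
 have ph0: "ph z = 0" if "z ~: K" for z using th0[OF that] by (simp add: ph_def)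
 have "Csm UNIV ph" by (rule smooth_UNIV_extend[OF S(1) K(2,3) sph ph0])
 moreover have cl: "closure {z. ph z ~= 0} <= K" by (rule closure_minimal) (use ph0 K in auto)
 moreover have "compact (closure {z. ph z ~= 0})" using cl K(1) by (meson closed_closure compact_eq_bounded_closed bounded_subset)
 ultimately have "test_function D ph" using K(3) f(3) by (auto simp: test_function_def)
 hence 0: "(LINT z|lborel. f z * (- (vf_apply X Y ph z + Complex (divergence X z) (divergence Y z) * ph z))) = 0"
 using f(2) by (auto simp: weak_solution_def)
 define g where "g = (%z. f z * (py Z z * of_real (A' (fst z) * B (snd z)) - px Z z * of_real (A (fst z) * B' (snd z))))"
 have "((%z. A (fst z) * B (snd z)) hasd (%v. A (fst z) * (B' (snd z) * snd v) + (A' (fst z) * fst v) * B (snd z))) (at z)" for z :: plane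
 proof -
 have "(A hasd (%h. A' (fst z) * h)) (at (fst z))" "(B hasd (%h. B' (snd z) * h)) (at (snd z))"
 using AB(1,2) by (auto simp: test_pair_def has_field_derivative_def)
 from hd_comp[OF has_derivative_fst[OF has_derivative_ident] this(1)]
 hd_comp[OF has_derivative_snd[OF has_derivative_ident] this(2)]
 show ?thesis by (intro has_derivative_mult) (auto simp: o_def)
 qed
 from has_derivative_of_real[OF this]
 have Dth: "(th hasd (%v. of_real (A (fst z) * (B' (snd z) * snd v) + (A' (fst z) * fst v) * B (snd z)))) (at z)" for z
 unfolding th_def[abs_def] .
 have dth: "px th z = of_real (A' (fst z) * B (snd z))" "py th z = of_real (A (fst z) * B' (snd z))" for z
 using px_eqI[OF Dth] py_eqI[OF Dth] by simp_all
 have eq: "f z * (- (vf_apply X Y ph z + Complex (divergence X z) (divergence Y z) * ph z)) = ind K z *\<^sub>R (- g z)" for z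
 proof (cases "z : K")
 case True
 hence z: "z : S" using K by auto
 have "px (%z. h z * ph z) z = px th z" "py (%z. h z * ph z) z = py th z"
 by (rule px_cong_open[OF S(1) z], use h(2) in \<open>simp add: ph_def\<close>, rule py_cong_open[OF S(1) z], use h(2) in \<open>simp add: ph_def\<close>)
 thus ?thesis
 using True h(3)[OF z smooth_differentiable[OF sph z]] by (simp add: g_def dth del: minus_diff_eq)
 next
 case False
 hence "fder ph (at z) = fder (%_. 0) (at z)"
 by (intro frechet_derivative_cong_open[of "- K"]) (use K ph0 in auto)
 thus ?thesis using False ph0[OF False] by (simp add: vf_apply_def)
 qed
 have cg: "cts K g"
 proof -
 have cA: "cts UNIV A" "cts UNIV B" "cts UNIV A'" "cts UNIV B'"
 using smA AB by (auto intro: smooth_con simp: test_pair_def)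
 have "cts K (%z. A (fst z))" "cts K (%z. B (snd z))" "cts K (%z. A' (fst z))" "cts K (%z. B' (snd z))"
 by (rule con_comp[OF cA(1)] con_comp[OF cA(2)] con_comp[OF cA(3)] con_comp[OF cA(4)];
 auto intro: continuous_intros)+
 thus ?thesis unfolding g_def
 by (intro continuous_intros con_subset[OF f(1) K(3)] con_subset[OF smooth_con[OF smooth_py[OF S(4)]] K(3)]
 con_subset[OF smooth_con[OF smooth_px[OF S(4)]] K(3)])
 qed
 have "set_integrable lborel K (%z. - g z)"
 unfolding set_integrable_def by (intro borel_integrable_compact K continuous_intros cg)
 from set_borel_integral_eq_integral(2)[OF this]
 have "HK K (%z. - g z) = 0"
 using 0 unfolding eq set_lebesgue_integral_def by simp
 hence "HK (cbox (l, l') (r, r')) g = 0"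
 by (simp add: K_def cbox_Pair_eq)
 moreover have "HK (cbox (l, l') (r, r')) g = HK (cbox l r) (%x. HK (cbox l' r') (%y. g (x, y)))"
 by (rule integral_prod_continuous) (use cg in \<open>simp add: K_def cbox_Pair_eq\<close>)
 ultimately show ?thesis by (simp add: g_def)
qed

text \<open>Two one-dimensional weak equations in succession. With B fixed, the product tests say
  that the integral of B Q over y has the x-derivative minus the integral of B' P. Integrated over
  \<open>{x0..x1}\<close>, this says that \<open>u\<close>, the integral of P over a horizontal
  side, has the weak y-derivative \<open>v\<close>, and integrating once more gives the vanishing of
  the rectangle integral.\<close>

lemma weak_solution_closed_on:
 assumes S: "open S" "Csm S X" "Csm S Y" "Csm S Z" "Csm S rh"
 and Z: "!!z. z : S ==> vf_apply X Y Z z = 0" "!!z. z : S ==> px Z z ~= 0 \<or> py Z z ~= 0"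
 and rh: "!!z. z : S ==> vf_apply X Y rh z ~= 0"
 and f: "cts S f" "weak_solution D X Y f" "S <= D"
 shows "closed_on S (%z. f z * px Z z) (%z. f z * py Z z)"
proof (rule closed_on_local)
 let ?p = "%z. f z * px Z z" and ?q = "%z. f z * py Z z"
 show cp: "cts S ?p" and cq: "cts S ?q"
 by (intro continuous_intros f(1) smooth_con[OF smooth_px[OF S(4)]] smooth_con[OF smooth_py[OF S(4)]])+
 fix z assume "z : S"
 obtain zx zy where z: "z = (zx, zy)" by (cases z)
 obtain M N where MN: "open M" "open N" "zx : M" "zy : N" "M \<times> N <= S"
 using S(1) \<open>z : S\<close> z by (metis open_prod_elim mem_Times_iff fst_conv snd_conv)
 obtain d1 where d1: "d1 > 0" "!!x'. \<bar>x' - zx\<bar> < d1 ==> x' : M" using MN(1,3) by (metis open_real)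
 obtain d2 where d2: "d2 > 0" "!!x'. \<bar>x' - zy\<bar> < d2 ==> x' : N" using MN(2,4) by (metis open_real)
 define c d c' d' where "c = zx - d1" and "d = zx + d1" and "c' = zy - d2" and "d' = zy + d2"
 define T where "T = {c<..<d} \<times> {c'<..<d'}"
 have TS: "T <= S"
 proof -
 have "{c<..<d} <= M" "{c'<..<d'} <= N" using d1(2) d2(2) by (auto simp: c_def d_def c'_def d'_def abs_less_iff)
 thus ?thesis using MN(5) unfolding T_def by blast
 qed
 have cpT: "cts T ?p" and cqT: "cts T ?q" using cp cq TS con_subset by blast+
 have sub: "{u..v} \<times> {u'..v'} <= T" if "c < u" "v < d" "c' < u'" "v' < d'" for u v u' v'
 using that by (auto simp: T_def)
 have cs: "cts ({u..v} \<times> {u'..v'}) ?p" "cts ({u..v} \<times> {u'..v'}) ?q"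
 if "c < u" "v < d" "c' < u'" "v' < d'" for u v u' v'
 using con_subset[OF cpT sub[OF that]] con_subset[OF cqT sub[OF that]] by auto
 have "closed_on T ?p ?q"
 unfolding closed_on_def
 proof (intro conjI allI impI cpT cqT)
 fix x0 x1 y0 y1 :: real
 assume le: "x0 <= x1" "y0 <= y1" and xy: "{x0..x1} \<times> {y0..y1} <= T"
 have "(x0, y0) : T" "(x1, y1) : T" using xy le by auto
 hence in': "c < x0" "x1 < d" "c' < y0" "y1 < d'" by (auto simp: T_def)
 define v where "v y = ?q (x1, y) - ?q (x0, y)" for y
 define u where "u y = HK {x0..x1} (%x. ?p (x, y))" for y
 have cv: "cts {c'<..<d'} v"
 unfolding v_def using in' le
 by (intro con_diff con_slice(2)[OF cqT]) (auto simp: T_def)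
 have cu: "cts {c'<..<d'} u"
 proof -
 have "cts {c'<..<d'} (%y. HK (cbox x0 x1) (%x. ?p (x, y)))"
 by (rule int_param, unfold split_beta, rule con_comp[OF cpT])
 (use in' in \<open>auto intro!: continuous_intros simp: T_def\<close>)
 thus ?thesis by (simp add: u_def)
 qed
 have "HK {y0..y1} v = u y1 - u y0"
 proof (rule weak_derivative_is_derivative[OF cu cv _ in'(3) le(2) in'(4)])
 fix l' r' B B' assume B: "test_pair l' r' B B'" and lr': "c' < l'" "l' <= r'" "r' < d'"
 have cB: "cts UNIV B" "cts UNIV B'"
 using B by (auto simp: test_pair_def intro: smooth_con)
 define a where "a x = HK {l'..r'} (%y. B y *\<^sub>R ?q (x, y))" for x
 define b where "b x = HK {l'..r'} (%y. B' y *\<^sub>R ?p (x, y))" for x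
 have cB2: "cts Q (%z. B (snd z))" "cts Q (%z. B' (snd z))" for Q :: "plane set"
 by (rule con_comp[OF cB(1)] con_comp[OF cB(2)]; auto intro: continuous_intros)+
 have cpar: "cts ({c<..<d} \<times> {l'..r'}) ?p" "cts ({c<..<d} \<times> {l'..r'}) ?q"
 using lr' by (auto intro!: con_subset[OF cpT] con_subset[OF cqT] simp: T_def)
 have ca: "cts {c<..<d} a"
 unfolding a_def box_real(2)[symmetric]
 by (rule int_param, unfold split_beta) (use cpar in \<open>auto intro!: continuous_intros cB2\<close>)
 have cb: "cts {c<..<d} b"
 unfolding b_def box_real(2)[symmetric]
 by (rule int_param, unfold split_beta) (use cpar in \<open>auto intro!: continuous_intros cB2\<close>)
 have "HK {x0..x1} (%x. - b x) = a x1 - a x0"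
 proof (rule weak_derivative_is_derivative[OF ca _ _ in'(1) le(1) in'(2)])
 show "cts {c<..<d} (%x. - b x)" by (intro continuous_intros cb)
 fix l r A A' assume A: "test_pair l r A A'" and lr: "c < l" "l <= r" "r < d"
 have "{l..r} \<times> {l'..r'} <= S" using lr lr' TS by (auto simp: T_def)
 from weak_solution_product_test[OF S Z rh f A B this]
 have z: "HK {l..r} (%x. HK {l'..r'} (%y. f (x, y) * (py Z (x, y) * of_real (A' x * B y) - px Z (x, y) * of_real (A x * B' y)))) = 0"
 by simp
 have "HK {l'..r'} (%y. f (x, y) * (py Z (x, y) * of_real (A' x * B y) - px Z (x, y) * of_real (A x * B' y)))
 = A x *\<^sub>R - b x + A' x *\<^sub>R a x" if "x : {l..r}" for x
 proof -
 have "cts {l'..r'} (%y. B y *\<^sub>R ?q (x, y))" "cts {l'..r'} (%y. B' y *\<^sub>R ?p (x, y))"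
 using that lr lr'
 by (auto intro!: continuous_on_scaleR con_subset[OF cB(1)] con_subset[OF cB(2)]
 con_slice(2)[OF cpT] con_slice(2)[OF cqT] simp: T_def)
 note ii = this[THEN int_con]
 have "HK {l'..r'} (%y. f (x, y) * (py Z (x, y) * of_real (A' x * B y) - px Z (x, y) * of_real (A x * B' y)))
 = HK {l'..r'} (%y. A' x *\<^sub>R (B y *\<^sub>R ?q (x, y)) - A x *\<^sub>R (B' y *\<^sub>R ?p (x, y)))"
 by (rule arg_cong[where f = "HK {l'..r'}"]) (auto simp: scaleR_conv_of_real algebra_simps)
 also have "... = A' x *\<^sub>R a x - A x *\<^sub>R b x"
 unfolding a_def b_def integral_diff[OF integrable_cmul[OF ii(1)] integrable_cmul[OF ii(2)]] integral_cmul ..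
 finally show ?thesis by simp
 qed
 thus "HK {l..r} (%x. A x *\<^sub>R - b x + A' x *\<^sub>R a x) = 0"
 using z by (metis (no_types, lifting) integral_cong)
 qed
 hence "- HK {x0..x1} b = a x1 - a x0" by (simp only: integral_neg)
 hence ab: "a x1 - a x0 + HK {x0..x1} b = 0" by (metis add.commute neg_eq_iff_add_eq_0)
 have "cts (cbox (x0, l') (x1, r')) (%(x, y). B' y *\<^sub>R ?p (x, y))"
 unfolding split_beta cbox_Pair_eq box_real prod.collapse
 by (rule continuous_on_scaleR[OF cB2(2) cs(1)]) (use in' lr' in auto)
 from integral_swap_continuous[OF this]
 have "HK {x0..x1} b = HK {l'..r'} (%y. HK {x0..x1} (%x. B' y *\<^sub>R ?p (x, y)))"
 by (simp add: b_def[abs_def])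
 also have "... = HK {l'..r'} (%y. B' y *\<^sub>R u y)"
 by (simp add: u_def)
 finally have e1: "HK {x0..x1} b = HK {l'..r'} (%y. B' y *\<^sub>R u y)" .
 have sl: "cts {l'..r'} (%y. B y *\<^sub>R ?q (x, y))" if "x : {c<..<d}" for x
 using that lr' by (auto intro!: continuous_on_scaleR con_subset[OF cB(1)] con_slice(2)[OF cqT] simp: T_def)
 have ii: "(%y. B y *\<^sub>R ?q (x, y)) integrable_on {l'..r'}" if "x : {c<..<d}" for x
 using sl[OF that] by (rule int_con)
 have "a x1 - a x0 = HK {l'..r'} (%y. B y *\<^sub>R ?q (x1, y) - B y *\<^sub>R ?q (x0, y))"
 unfolding a_def using ii[of x0] ii[of x1] in' le by (simp add: integral_diff)
 also have "... = HK {l'..r'} (%y. B y *\<^sub>R v y)"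
 by (simp add: v_def scaleR_diff_right)
 finally have e2: "a x1 - a x0 = HK {l'..r'} (%y. B y *\<^sub>R v y)" .
 have "(%y. B y *\<^sub>R v y) integrable_on {l'..r'}" "(%y. B' y *\<^sub>R u y) integrable_on {l'..r'}"
 using lr' by (auto intro!: int_con continuous_on_scaleR con_subset[OF cB(1)]
 con_subset[OF cB(2)] con_subset[OF cv] con_subset[OF cu])
 thus "HK {l'..r'} (%y. B y *\<^sub>R v y + B' y *\<^sub>R u y) = 0"
 using ab e1 e2 by (simp add: integral_add)
 qed
 moreover have "HK {y0..y1} v = HK {y0..y1} (%y. ?q (x1, y)) - HK {y0..y1} (%y. ?q (x0, y))"
 proof -
 have "(%y. ?q (x, y)) integrable_on {y0..y1}" if "x : {x0..x1}" for x
 by (rule int_con, rule con_slice(2)[OF cqT]) (use that in' in \<open>auto simp: T_def\<close>)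
 thus ?thesis unfolding v_def using le by (simp add: integral_diff)
 qed
 moreover have "d + a - c - b = 0" if "I = c - d" "I = a - b" for a b c d I :: complex
 using that by algebra
 ultimately show "rect_integral ?p ?q x0 x1 y0 y1 = 0"
 unfolding rect_integral_def u_def by blast
 qed
 moreover have "open T" "z : T" using d1(1) d2(1) by (auto simp: T_def z c_def d_def c'_def d'_def intro: open_Times)
 ultimately show "EX T. open T & z : T & closed_on T ?p ?q" by blast
qed

section \<open>Gaussian approximation along the curves of constant t\<close>

lemma exp_le_inverse: "0 <= v ==> exp (- v) <= 1 / (1 + (v::real))"
 using exp_ge_add_one_self[of v] by (simp add: exp_minus field_simps)

lemma mult_exp_le_inverse: "0 <= v ==> v * exp (- v) <= 2 / (1 + (v::real))"
proof -
 assume v: "0 <= v"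
 have "1 + v + v\<^sup>2 / 2 <= exp v" using exp_lower_Taylor_quadratic[OF v] .
 hence "v * (1 + v) <= 2 * exp v" using v by (simp add: power2_eq_square algebra_simps)
 thus ?thesis using v by (simp add: exp_minus field_simps)
qed

text \<open>A primitive of \<open>exp (-u\<^sup>2)\<close> on the plane has a common limit along the sector \<open>\<bar>Im u\<bar> \<le> Re u / 2\<close>.\<close>
lemma gauss_primitive:
 "\<exists>(Erf :: complex => complex) ka. (ALL u. (Erf hfd exp (- u\<^sup>2)) (at u)) & (ALL u. Erf (- u) = - Erf u) & ka ~= 0 &
 (\<forall>e>0. EX R. ALL u. R <= Re u --> \<bar>Im u\<bar> <= Re u / 2 --> cmod (Erf u - ka) < e)"
proof -
 have "(%u::complex. exp (- u\<^sup>2)) hol UNIV" by (intro holomorphic_intros)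
 then obtain F :: "complex => complex" where F: "!!u. (F hfd exp (- u\<^sup>2)) (at u)"
 using holomorphic_convex_primitive'[OF convex_UNIV open_UNIV, of "%u. exp (- u\<^sup>2)"] by (metis UNIV_I)
 define Erf where "Erf u = F u - F 0" for u
 have E: "(Erf hfd exp (- u\<^sup>2)) (at u)" for u
 unfolding Erf_def by (auto intro!: derivative_eq_intros F)
 have odd: "Erf (- u) = - Erf u" for u
 proof -
 have "((%u. Erf (- u) + Erf u) hfd 0) (at u)" for u
 proof -
 have "(uminus hfd - 1) (at u)" by (auto intro!: derivative_eq_intros)
 from DERIV_chain2[where g = uminus and f = Erf, OF E this]
 have "((%u. Erf (- u)) hfd - exp (- u\<^sup>2)) (at u)" by simp
 from DERIV_add[OF this E[of u]] show ?thesis by simp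
 qed
 then obtain c where c: "!!u. Erf (- u) + Erf u = c"
 using has_field_derivative_zero_constant[of UNIV "%u. Erf (- u) + Erf u"] by auto
 have "c = 0" using c[of 0] by (simp add: Erf_def)
 thus ?thesis using c[of u] by (simp add: eq_neg_iff_add_eq_0)
 qed
 have real_int: "((%s. exp (- (of_real s)\<^sup>2)) has_integral (Erf (of_real r') - Erf (of_real r))) {r..r'}" if "r <= r'" for r r' :: real
 using that by (intro FTC has_vector_derivative_real_field E)
 have tail: "cmod (Erf (of_real r') - Erf (of_real r)) <= exp (- r)" if "1 <= r" "r <= r'" for r r' :: real
 proof -
 have e: "((%s. exp (- s)) has_integral (- exp (- r') - - exp (- r))) {r..r'}"
 using that by (intro FTC)
 (auto simp: hrd_hvd[symmetric] intro!: derivative_eq_intros)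
 have "norm (HK {r..r'} (%s. exp (- (complex_of_real s)\<^sup>2))) <= HK {r..r'} (%s. exp (- s))"
 proof (rule int_norm_bd)
 show "norm (exp (- (complex_of_real s)\<^sup>2)) <= exp (- s)" if "s : {r..r'}" for s
 using that \<open>1 <= r\<close> by (simp add: norm_exp_eq_Re power2_eq_square)
 qed (use real_int[OF that(2)] e in auto)
 thus ?thesis using integral_unique[OF real_int[OF that(2)]] integral_unique[OF e] by (smt (verit) exp_gt_zero)
 qed
 have "Cauchy (%n. Erf (of_real (real (Suc n))))"
 unfolding Cauchy_altdef2
 proof (intro allI impI)
 fix e :: real assume "e > 0"
 obtain N where N: "exp (- real (Suc N)) < e"
 using \<open>e > 0\<close> reals_Archimedean2[of "- ln e"] by (metis exp_ln exp_less_cancel_iff less_SucI minus_less_iff of_nat_less_iff order_less_trans lessI)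
 have "dist (Erf (of_real (real (Suc n)))) (Erf (of_real (real (Suc N)))) < e" if "n \<ge> N" for n
 using tail[of "real (Suc N)" "real (Suc n)"] that N by (simp add: dist_norm)
 thus "EX N. \<forall>n\<ge>N. dist (Erf (of_real (real (Suc n)))) (Erf (of_real (real (Suc N)))) < e" by blast
 qed
 then obtain ka where ka: "(%n. Erf (of_real (real (Suc n)))) \<longlonglongrightarrow> ka"
 using Cauchy_convergent convergent_def by blast
 have tailka: "cmod (ka - Erf (of_real r)) <= exp (- r)" if "1 <= r" for r :: real
 proof (rule Lim_bounded)
 show "(%n. cmod (Erf (of_real (real (Suc n))) - Erf (of_real r))) \<longlonglongrightarrow> cmod (ka - Erf (of_real r))"
 by (intro tendsto_intros ka)
 show "\<forall>n\<ge>nat \<lceil>r\<rceil>. cmod (Erf (of_real (real (Suc n))) - Erf (of_real r)) <= exp (- r)"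
 proof (intro allI impI)
 fix n assume "nat \<lceil>r\<rceil> <= n"
 hence "r <= real (Suc n)" by linarith
 thus "cmod (Erf (of_real (real (Suc n))) - Erf (of_real r)) <= exp (- r)" by (rule tail[OF that])
 qed
 qed
 \<comment> \<open>Otherwise the tail bound at 1 gives
   \<open>cmod (Erf 1) <= exp (- 1) <= 1 / 2\<close>, whereas exp(-s^2) >= 1 - s^2 gives
   \<open>Re (Erf 1) >= 2 / 3\<close>.\<close>
 have "ka ~= 0"
 proof
 assume "ka = 0"
 hence "cmod (Erf 1) <= exp (- 1)" using tailka[of 1] by simp
 have "exp (- 1 :: real) <= 1 / 2" using exp_le_inverse[of 1] by simp
 have i1: "((%s. exp (- s\<^sup>2)) has_integral Re (Erf 1)) {0..1}"
 using has_integral_Re[OF real_int[of 0 1]]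
 by (simp add: Erf_def Re_exp flip: of_real_power of_real_minus)
 have i2: "((%s. 1 - s\<^sup>2) has_integral (1 - 1 ^ 3 / 3 - (0 - 0 ^ 3 / 3))) {0..1::real}"
 by (rule FTC[where f = "%s. s - s ^ 3 / 3"])
 (auto simp: hrd_hvd[symmetric] power2_eq_square intro!: derivative_eq_intros)
 have "1 - 1 ^ 3 / 3 - (0 - 0 ^ 3 / 3) <= Re (Erf 1)"
 proof (rule has_integral_le[OF i2 i1])
 show "1 - s\<^sup>2 <= exp (- s\<^sup>2)" for s :: real using exp_ge_add_one_self[of "- s\<^sup>2"] by simp
 qed
 hence "1 - 1 / 3 <= Re (Erf 1)" by simp
 thus False using \<open>cmod (Erf 1) <= exp (- 1)\<close> \<open>exp (- 1 :: real) <= 1 / 2\<close> complex_Re_le_cmod[of "Erf 1"] by linarith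
 qed
 moreover have "EX R. ALL u. R <= Re u --> \<bar>Im u\<bar> <= Re u / 2 --> cmod (Erf u - ka) < e" if "0 < e" for e
 proof -
 have est: "cmod (Erf u - ka) <= 2 / Re u" if u: "1 <= Re u" "\<bar>Im u\<bar> <= Re u / 2" for u
 proof -
 let ?r = "Re u"
 have "cmod (Erf u - Erf (of_real ?r)) <= (4 / (3 * ?r\<^sup>2)) * cmod (u - of_real ?r)"
 proof (rule field_differentiable_bound[where S = "closed_segment (of_real ?r) u" and f' = "%u. exp (- u\<^sup>2)"])
 fix s assume "s : closed_segment (of_real ?r) u"
 then obtain t where t: "0 <= t" "t <= 1" "s = (1 - t) *\<^sub>R of_real ?r + t *\<^sub>R u"
 by (auto simp: closed_segment_def)
 hence s: "Re s = ?r" "Im s = t * Im u" unfolding t(3) by (simp_all add: left_diff_distrib)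
 have "\<bar>Im s\<bar> <= \<bar>Im u\<bar>" using t(1,2) unfolding s(2) by (simp add: abs_mult mult_left_le_one_le)
 hence "\<bar>Im s\<bar> <= \<bar>?r / 2\<bar>" using u by linarith
 hence "(Im s)\<^sup>2 <= (?r / 2)\<^sup>2" by (rule abs_le_square_iff[THEN iffD1])
 \<comment> \<open>The sector has slope 1/2, so Re (s^2) loses at most a quarter of (Re
   s)^2.\<close>
 hence "Re (- s\<^sup>2) <= - (3 / 4 * ?r\<^sup>2)"
 using s(1) by (simp add: power2_eq_square field_simps)
 hence "cmod (exp (- s\<^sup>2)) <= exp (- (3 / 4 * ?r\<^sup>2))" by (simp only: norm_exp_eq_Re exp_le_cancel_iff)
 also have "... <= 1 / (1 + 3 / 4 * ?r\<^sup>2)" by (rule exp_le_inverse) simp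
 also have "... <= 1 / (3 / 4 * ?r\<^sup>2)" using u by (intro divide_left_mono mult_pos_pos) (auto simp: add_pos_nonneg)
 finally show "cmod (exp (- s\<^sup>2)) <= 4 / (3 * ?r\<^sup>2)" by (simp add: field_simps)
 show "(Erf hfd exp (- s\<^sup>2)) (at s within closed_segment (of_real ?r) u)"
 using E by (rule has_field_derivative_at_within)
 qed auto
 also have "cmod (u - of_real ?r) = \<bar>Im u\<bar>" by (simp add: cmod_eq_Im)
 also have "(4 / (3 * ?r\<^sup>2)) * \<bar>Im u\<bar> <= (4 / (3 * ?r\<^sup>2)) * (?r / 2)" using u by (intro mult_lm) auto
 also have "... <= 1 / ?r" using u by (simp add: power2_eq_square field_simps)
 finally have 1: "cmod (Erf u - Erf (of_real ?r)) <= 1 / ?r" .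
 have "exp (- ?r) <= 1 / (1 + ?r)" using u by (intro exp_le_inverse) auto
 also have "... <= 1 / ?r" using u by (intro divide_left_mono) auto
 finally have 2: "cmod (ka - Erf (of_real ?r)) <= 1 / ?r" using tailka[OF u(1)] by simp
 have "cmod (Erf u - ka) <= cmod (Erf u - Erf (of_real ?r)) + cmod (ka - Erf (of_real ?r))"
 using norm_triangle_ineq4[of "Erf u - Erf (of_real ?r)" "ka - Erf (of_real ?r)"] by simp
 thus ?thesis using 1 2 by simp
 qed
 show ?thesis
 proof (intro exI[of _ "max 1 (2 / e + 1)"] allI impI)
 fix u assume u: "max 1 (2 / e + 1) <= Re u" "\<bar>Im u\<bar> <= Re u / 2"
 hence "2 / e < Re u" "1 <= Re u" by auto
 hence "2 / Re u < e" using \<open>0 < e\<close> by (simp add: field_simps)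
 thus "cmod (Erf u - ka) < e" using est[of u] u(2) \<open>1 <= Re u\<close> by linarith
 qed
 qed
 ultimately show ?thesis using E odd by blast
qed

text \<open>The form is closed above height 0 and merely continuous at height 0; the formula for
  rectangles standing on the boundary is a limit of those for higher rectangles.\<close>

lemma rect_integral_closure:
 assumes c: "closed_on ({a'<..<b'} \<times> {0<..<T'}) P Q"
 and P: "cts ({x0..x1} \<times> {0..t}) P" and Q: "cts ({x0..x1} \<times> {0..t}) Q"
 and in': "a' < x0" "x0 <= x1" "x1 < b'" "0 < t" "t < T'"
 shows "rect_integral P Q x0 x1 0 t = 0"
proof -
 have "cts {0..t} (%s. HK (cbox x0 x1) (%x. P (x, s)))"
 by (rule int_param, unfold split_beta, rule con_comp[OF P]) (auto intro!: continuous_intros)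
 moreover have "cts {0..t} (%s. HK {s..t} (%y. Q (x, y)))" if "x : {x0..x1}" for x
 by (rule indefinite_integral_continuous_1', rule int_con, rule con_slice(2)[OF Q]) (use that in auto)
 ultimately have "cts {0..t} (%s. rect_integral P Q x0 x1 s t)"
 unfolding rect_integral_def using in' by (intro continuous_intros) auto
 moreover have cl: "closure {0<..<t} = {0..t}" using in' by simp
 moreover have "rect_integral P Q x0 x1 s t = 0" if "s : {0<..<t}" for s
 proof -
 have "{x0..x1} \<times> {s..t} <= {a'<..<b'} \<times> {0<..<T'}" using that in' by auto
 thus ?thesis using c that in' unfolding closed_on_def by auto
 qed
 ultimately show ?thesis
 using continuous_constant_on_closure[of "{0<..<t}" "%s. rect_integral P Q x0 x1 s t" 0 0] in' by auto
qed

text \<open>The kernel majorizes sqrt n exp(-3/4 n (x - y)^2) and has an arctangent as primitive;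
  the total mass 2 pi / sqrt 3 lies below 4 for every n.\<close>

lemma gauss_kernel_integral:
 assumes n: "0 < n"
 shows "(%y. sqrt n / (1 + 3/4 * n * (x - y)\<^sup>2)) integrable_on {a..b}"
 and "a <= b ==> HK {a..b} (%y. sqrt n / (1 + 3/4 * n * (x - y)\<^sup>2)) <= 4"
proof -
 have nz: "1 + 3/4 * n * (x - y)\<^sup>2 > 0" for y using n by (simp add: add_pos_nonneg)
 show "(%y. sqrt n / (1 + 3/4 * n * (x - y)\<^sup>2)) integrable_on {a..b}"
 by (rule int_con) (use nz in \<open>auto intro!: continuous_intros simp: less_le\<close>)
 assume ab: "a <= b"
 define c where "c = sqrt (3/4 * n)"
 have c: "c > 0" "c\<^sup>2 = 3/4 * n" using n by (simp_all add: c_def)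
 have "((%y. sqrt n / c * arctan (c * (y - x))) hrd sqrt n / (1 + 3/4 * n * (x - y)\<^sup>2)) (at y within {a..b})" for y
 proof -
 have e: "1 + (c * (y - x))\<^sup>2 = 1 + 3/4 * n * (x - y)\<^sup>2" unfolding power_mult_distrib c(2) by (simp add: power2_commute)
 have "((%y. sqrt n / c * arctan (c * (y - x))) hrd sqrt n / c * (inverse (1 + (c * (y - x))\<^sup>2) * c)) (at y within {a..b})"
 by (auto intro!: derivative_eq_intros)
 thus ?thesis unfolding e using c(1) by (simp add: field_simps)
 qed
 hence "((%y. sqrt n / (1 + 3/4 * n * (x - y)\<^sup>2)) has_integral (sqrt n / c * arctan (c * (b - x)) - sqrt n / c * arctan (c * (a - x)))) {a..b}"
 by (intro FTC[OF ab]) (simp add: hrd_hvd)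
 hence "HK {a..b} (%y. sqrt n / (1 + 3/4 * n * (x - y)\<^sup>2)) = sqrt n / c * (arctan (c * (b - x)) - arctan (c * (a - x)))"
 by (simp add: integral_unique right_diff_distrib)
 also have "... <= sqrt n / c * pi"
 using arctan_bounded[of "c * (b - x)"] arctan_bounded[of "c * (a - x)"] c(1) n by (intro mult_lm) auto
 also have "sqrt n / c = 2 / sqrt 3" using n by (simp add: c_def real_sqrt_mult real_sqrt_divide)
 also have "2 / sqrt 3 * pi <= 4"
 proof -
 have "2 * pi <= 4 * sqrt 3"
 proof -
 have "1.7 <= sqrt (3::real)" by (rule real_le_rsqrt) (simp add: power2_eq_square)
 moreover have "pi < 3.2" using pi_less_4 pi_approx by simp
 ultimately show ?thesis by simp
 qed
 thus ?thesis by (simp add: field_simps)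
 qed
 finally show "HK {a..b} (%y. sqrt n / (1 + 3/4 * n * (x - y)\<^sup>2)) <= 4" .
qed

lemma compact_bd:
 fixes u :: "'a::topological_space => 'b::real_normed_vector"
 assumes "cts K u" "compact K"
 obtains B where "B > 0" "!!z. z : K ==> norm (u z) <= B"
 using compact_imp_bounded[OF compact_continuous_image[OF assms]] unfolding bounded_pos by auto

text \<open>The constants make exp(-n (Z - Z')^2) a decaying kernel: slope 1/2 in x gives Re (Z -
  Z')^2 >= 3/4 (x - y)^2 at equal heights, and the vertical variation a/16 preserves the decay
  between the middle of the box and its lateral sides. The box of double size is an open
  neighbourhood of the closed one.\<close>

locale tube =
 fixes a T :: real and Z :: "plane => complex"
 assumes a: "0 < a" and T: "0 < T"
 and smooth: "Csm ({-2*a<..<2*a} \<times> {-2*T<..<2*T}) Z"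
 and Re_Z: "!!x t. x : {-2*a<..<2*a} ==> t : {-2*T<..<2*T} ==> Re (Z (x, t)) = x"
 and lipx: "!!x y t. x : {-a..a} ==> y : {-a..a} ==> t : {0..T} ==> \<bar>Im (Z (x, t)) - Im (Z (y, t))\<bar> <= \<bar>x - y\<bar> / 2"
 and lipt: "!!x t. x : {-a..a} ==> t : {0..T} ==> \<bar>Im (Z (x, t)) - Im (Z (x, 0))\<bar> <= a / 16"
begin

abbreviation "tbox \<equiv> {-2*a<..<2*a} \<times> {-2*T<..<2*T}"
abbreviation "tupper \<equiv> {-2*a<..<2*a} \<times> {0<..<2*T}"
abbreviation "tclosed \<equiv> {-a..a} \<times> {0..T}"

lemma tclosed_sub: "tclosed <= tbox" and tupper_sub: "tupper <= tbox" and open_tbox: "open tbox" and open_tupper: "open tupper"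
 using a T by (auto intro!: open_Times)

lemma cont_Z: "cts tclosed Z" "cts tclosed (px Z)" "cts tclosed (py Z)"
 using smooth smooth_px[OF smooth] smooth_py[OF smooth] tclosed_sub
 by (meson con_subset smooth_con)+

lemma Re_Z': "(x, t) : tclosed ==> Re (Z (x, t)) = x"
 using a T by (intro Re_Z) auto

lemma kernel_same_height:
 assumes "x : {-a..a}" "y : {-a..a}" "t : {0..T}" "0 <= n"
 shows "cmod (exp (- (of_real n * (Z (x, t) - Z (y, t))\<^sup>2))) <= exp (- (3/4 * n * (x - y)\<^sup>2))"
proof -
 have "(Im (Z (x, t)) - Im (Z (y, t)))\<^sup>2 <= ((x - y) / 2)\<^sup>2"
 by (rule abs_le_square_iff[THEN iffD1]) (use lipx[OF assms(1-3)] in simp)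
 hence "3/4 * (x - y)\<^sup>2 <= (x - y)\<^sup>2 - (Im (Z (x, t)) - Im (Z (y, t)))\<^sup>2" by (simp add: power_divide)
 hence "n * (3/4 * (x - y)\<^sup>2) <= n * ((x - y)\<^sup>2 - (Im (Z (x, t)) - Im (Z (y, t)))\<^sup>2)" using assms(4) by (rule mult_lm)
 moreover have "Re (- (of_real n * (Z (x, t) - Z (y, t))\<^sup>2)) = - (n * ((x - y)\<^sup>2 - (Im (Z (x, t)) - Im (Z (y, t)))\<^sup>2))"
 using assms by (simp add: power2_eq_square Re_Z')
 ultimately show ?thesis by (simp add: norm_exp_eq_Re mult.assoc mult.left_commute del: uminus_complex.sel)
qed

lemma kernel_side:
 assumes "x : {-a/4..a/4}" "y = a \<or> y = - a" "t : {0..T}" "s : {0..T}" "0 <= n"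
 shows "cmod (exp (- (of_real n * (Z (x, t) - Z (y, s))\<^sup>2))) <= exp (- (n * a\<^sup>2 / 4))"
proof -
 have x: "x : {-a..a}" and y: "y : {-a..a}" using assms(1,2) a by auto
 have d: "3/4 * a <= \<bar>x - y\<bar>" using assms(1,2) by auto
 \<comment> \<open>Changing the height at \<open>y\<close> through 0 costs a/16 twice. As |x - y| >=
   3a/4, the total a/8 is at most |x - y|/6, so the factor 1/2 becomes 2/3, and (1 - 4/9) (3a/4)^2
   still exceeds a^2/4.\<close>
 have "\<bar>Im (Z (x, t)) - Im (Z (y, s))\<bar> <= \<bar>x - y\<bar> / 2 + a / 16 + a / 16"
 using lipx[OF x y assms(3)] lipt[OF y assms(3)] lipt[OF y assms(4)] by linarith
 also have "... <= \<bar>2/3\<bar> * \<bar>x - y\<bar>" using d by simp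
 finally have "(Im (Z (x, t)) - Im (Z (y, s)))\<^sup>2 <= (2/3 * (x - y))\<^sup>2"
 unfolding abs_mult[symmetric] by (rule abs_le_square_iff[THEN iffD1])
 hence "5/9 * (x - y)\<^sup>2 <= (x - y)\<^sup>2 - (Im (Z (x, t)) - Im (Z (y, s)))\<^sup>2" unfolding power_mult_distrib power_divide by simp
 moreover have "(3/4 * a)\<^sup>2 <= (x - y)\<^sup>2" using d a by (intro abs_le_square_iff[THEN iffD1]) simp
 moreover have "(3/4 * a)\<^sup>2 = 9/16 * a\<^sup>2" unfolding power_mult_distrib power_divide by simp
 ultimately have "a\<^sup>2 / 4 <= (x - y)\<^sup>2 - (Im (Z (x, t)) - Im (Z (y, s)))\<^sup>2" using zero_le_power2[of a] by linarith
 hence "n * (a\<^sup>2 / 4) <= n * ((x - y)\<^sup>2 - (Im (Z (x, t)) - Im (Z (y, s)))\<^sup>2)" using assms(5) by (rule mult_lm)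
 moreover have "Re (- (of_real n * (Z (x, t) - Z (y, s))\<^sup>2)) = - (n * ((x - y)\<^sup>2 - (Im (Z (x, t)) - Im (Z (y, s)))\<^sup>2))"
 using assms x y by (simp add: power2_eq_square Re_Z')
 ultimately show ?thesis by (simp add: norm_exp_eq_Re del: uminus_complex.sel)
qed

text \<open>An entire function of \<open>Z\<close> times a primitive along \<open>Z\<close> is again
  such a primitive, so the weighted form is closed and the path of integration may be moved.\<close>

lemma gauss_weight_prim:
 assumes g: "prim tupper Z g G"
 shows "EX g'. prim tupper Z g' (%z. exp (- (of_real n * (w - Z z)\<^sup>2)) * G z)"
proof -
 let ?e = "%z. exp (- (of_real n * (w - Z z)\<^sup>2))"
 let ?g = "%z. 2 * of_real n * (w - Z z) * ?e z * G z + ?e z * g z"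
 have cZ: "cts tupper Z" using smooth tupper_sub by (meson con_subset smooth_con)
 have "cts tupper ?g"
 using g prim_imp_continuous_on[OF g] cZ by (auto intro!: continuous_intros simp: prim_def)
 moreover have "((%z. ?e z * G z) hasd (%v. ?g z * fder Z (at z) v)) (at z)" if "z : tupper" for z
 proof -
 have Z: "(Z hasd fder Z (at z)) (at z)"
 using smooth_has_derivative[OF smooth] that tupper_sub by blast
 have "((%u. exp (- (of_real n * (w - u)\<^sup>2))) hfd (2 * of_real n * (w - Z z) * ?e z)) (at (Z z))"
 by (auto intro!: derivative_eq_intros simp: algebra_simps)
 hence "((%u. exp (- (of_real n * (w - u)\<^sup>2))) hasd (%h. (2 * of_real n * (w - Z z) * ?e z) * h)) (at (Z z))"
 by (simp add: has_field_derivative_def)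
 from hd_comp[OF Z this]
 have "(?e hasd (%v. (2 * of_real n * (w - Z z) * ?e z) * fder Z (at z) v)) (at z)" .
 moreover have "(G hasd (%v. g z * fder Z (at z) v)) (at z)" using g that by (auto simp: prim_def)
 ultimately have "((%z. ?e z * G z) hasd (%v. ?e z * (g z * fder Z (at z) v) +
 (2 * of_real n * (w - Z z) * ?e z) * fder Z (at z) v * G z)) (at z)"
 by (rule has_derivative_mult)
 thus ?thesis by (rule has_derivative_eq_rhs) (auto simp: algebra_simps)
 qed
 ultimately show ?thesis unfolding prim_def by blast
qed

text \<open>The Baouendi-Treves approximation: Gaussian averages of the values at \<open>t = 0\<close> along the curve
 \<open>Z (\<cdot>, 0)\<close>. By Stokes the curve can be moved up to height \<open>t\<close>; the vertical sides contribute
 exponentially little because \<open>x\<close> stays away from them.\<close>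
theorem gauss_approximation:
 assumes G: "cts tclosed G" and prim: "prim tupper Z g G"
 obtains h :: "nat => complex => complex" where
 "!!n. h n hol UNIV"
 "uniform_limit ({-a/4..a/4} \<times> {0..T}) (%n z. h n (Z z)) G sequentially"
 "(!!x. x : {-a..a} ==> G (x, 0) = 0) ==> (!!n w. h n w = 0)"
proof -
 obtain Erf :: "complex => complex" and ka :: complex where
 Erf: "!!u. (Erf hfd exp (- u\<^sup>2)) (at u)" "!!u. Erf (- u) = - Erf u" "ka ~= 0"
 "!!e. 0 < e ==> EX R. ALL u. R <= Re u --> \<bar>Im u\<bar> <= Re u / 2 --> cmod (Erf u - ka) < e"
 using gauss_primitive by blast
 define ker where "ker = (%n w z. exp (- (of_real n * (w - Z z)\<^sup>2)) :: complex)"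
 define I where "I = (%(n::real) w t. HK {-a..a} (%y. ker n w (y, t) * G (y, t) * px Z (y, t)))"
 \<comment> \<open>\<open>2 * ka\<close> is the mass of the Gaussian over the whole line.\<close>
 define h where "h = (%(n::nat) w. of_real (sqrt n) * I n w 0 / (2 * ka))"
 have cker: "cts tclosed (ker n w)" for n w
 unfolding ker_def by (intro continuous_intros cont_Z)
 have cP1: "cts tclosed (%z. ker n w z * G z * px Z z)" for n w
 using con_mult[OF con_mult[OF cker[of n w] G] cont_Z(2)] .
 have cP2: "cts tclosed (%z. ker n w z * G z * py Z z)" for n w
 using con_mult[OF con_mult[OF cker[of n w] G] cont_Z(3)] .
 note cP = cP1 cP2
 have comp: "compact tclosed" by (rule compact_Times[OF compact_Icc compact_Icc])
 obtain C where C: "C > 0" "!!z. z : tclosed ==> cmod (G z) <= C"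
 using compact_bd[OF G comp] by blast
 obtain B1 where B1: "B1 > 0" "!!z. z : tclosed ==> cmod (px Z z) <= B1"
 using compact_bd[OF cont_Z(2) comp] by blast
 obtain B2 where B2: "B2 > 0" "!!z. z : tclosed ==> cmod (py Z z) <= B2"
 using compact_bd[OF cont_Z(3) comp] by blast
 have in': "{-a..a} \<times> {0..t} <= tclosed" if "t <= T" for t using that by auto
 have stokes: "cmod (I n (Z (x, t)) 0 - I n (Z (x, t)) t) <= 2 * T * C * B2 * exp (- (n * a\<^sup>2 / 4))"
 if n: "0 <= n" and x: "x : {-a/4..a/4}" and t: "0 < t" "t <= T" for n x t
 proof -
 let ?w = "Z (x, t)"
 let ?P = "%z. ker n ?w z * G z * px Z z" and ?Q = "%z. ker n ?w z * G z * py Z z"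
 have "closed_on tupper ?P ?Q"
 using gauss_weight_prim[OF prim, of n ?w] prim_imp_closed_on[OF open_tupper smooth_subset[OF smooth tupper_sub]]
 unfolding ker_def by blast
 hence "rect_integral ?P ?Q (-a) a 0 t = 0"
 by (rule rect_integral_closure) (use a T t con_subset[OF cP(1) in'] con_subset[OF cP(2) in'] in auto)
 hence eq: "I n ?w 0 - I n ?w t = HK {0..t} (%y. ?Q (-a, y)) - HK {0..t} (%y. ?Q (a, y))"
 unfolding rect_integral_def I_def by (simp add: algebra_simps)
 have side: "cmod (HK {0..t} (%s. ?Q (y, s))) <= T * C * B2 * exp (- (n * a\<^sup>2 / 4))" if y: "y = a \<or> y = - a" for y
 proof -
 let ?e = "exp (- (n * a\<^sup>2 / 4))"
 have "cmod (HK {0..t} (%s. ?Q (y, s))) <= HK {0..t} (%s. ?e * C * B2)"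
 proof (rule int_norm_bd)
 show "(%s. ?Q (y, s)) integrable_on {0..t}"
 by (rule int_con, rule con_slice(2)[OF cP(2)]) (use y t a in auto)
 show "cmod (?Q (y, s)) <= ?e * C * B2" if "s : {0..t}" for s
 proof -
 have s: "s : {0..T}" "t : {0..T}" and z: "(y, s) : tclosed" using that t y a by auto
 show ?thesis unfolding norm_mult
 using kernel_side[OF x y s(2,1) n] C(2)[OF z] B2(2)[OF z] C(1) by (intro mult_mono) (auto simp: ker_def)
 qed
 qed auto
 also have "... = t * (?e * C * B2)" using t by simp
 also have "... <= T * (?e * C * B2)" using t C B2 by (intro mult_rm) auto
 finally show ?thesis by (simp add: mult_ac)
 qed
 have "cmod (I n ?w 0 - I n ?w t) <= cmod (HK {0..t} (%y. ?Q (-a, y))) + cmod (HK {0..t} (%y. ?Q (a, y)))"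
 unfolding eq by (rule norm_triangle_ineq4)
 also have "... <= 2 * T * C * B2 * exp (- (n * a\<^sup>2 / 4))"
 using side[of a] side[of "-a"] by simp
 finally show ?thesis .
 qed
 have stokes': "cmod (I n (Z (x, t)) 0 - I n (Z (x, t)) t) <= 2 * T * C * B2 * exp (- (n * a\<^sup>2 / 4))"
 if "0 <= n" "x : {-a/4..a/4}" "t : {0..T}" for n x t
 using stokes[OF that(1,2), of t] that C B2 T by (cases "t = 0") auto
 \<comment> \<open>The same average for the constant function 1, computed exactly through
   \<open>Erf\<close>. It tends to \<open>2 * ka\<close> uniformly because x keeps the distance 3a/4
   from both end points.\<close>
 define N where "N = (%(n::real) x t. Erf (of_real (sqrt n) * (Z (a, t) - Z (x, t))) - Erf (of_real (sqrt n) * (Z (-a, t) - Z (x, t))))"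
 have N: "((%y. of_real (sqrt n) * ker n (Z (x, t)) (y, t) * px Z (y, t)) has_integral N n x t) {-a..a}"
 if n: "0 <= n" and t: "t : {0..T}" for n x t
 unfolding N_def
 proof (rule FTC)
 fix y assume y: "y : {-a..a}"
 have z: "(y, t) : tbox" using y t a T by auto
 have "((%y. of_real (sqrt n) * (Z (y, t) - Z (x, t))) hvd of_real (sqrt n) * (px Z (y, t) - 0)) (at y within {-a..a})"
 by (intro has_vector_derivative_mult_right has_vector_derivative_diff smooth_partials(1)[OF smooth z] hvd_const)
 from field_vector_diff_chain_within[OF this has_field_derivative_at_within[OF Erf(1)]]
 have "((%y. Erf (of_real (sqrt n) * (Z (y, t) - Z (x, t)))) hvd
 of_real (sqrt n) * px Z (y, t) * exp (- (of_real (sqrt n) * (Z (y, t) - Z (x, t)))\<^sup>2)) (at y within {-a..a})"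
 by (simp add: o_def)
 moreover have "(complex_of_real (sqrt n) * (Z (y, t) - Z (x, t)))\<^sup>2 = of_real n * (Z (x, t) - Z (y, t))\<^sup>2"
 using n by (simp add: power_mult_distrib power2_commute[of "Z (y, t)"] flip: of_real_power)
 ultimately show "((%y. Erf (of_real (sqrt n) * (Z (y, t) - Z (x, t)))) hvd
 of_real (sqrt n) * ker n (Z (x, t)) (y, t) * px Z (y, t)) (at y within {-a..a})"
 by (simp add: ker_def mult_ac)
 qed (use a in simp)
 have N_lim: "EX n0. \<forall>n\<ge>n0. ALL x:{-a/4..a/4}. ALL t:{0..T}. cmod (N n x t - 2 * ka) < e" if "e > 0" for e
 proof -
 obtain R where R: "!!u. R <= Re u ==> \<bar>Im u\<bar> <= Re u / 2 ==> cmod (Erf u - ka) < e / 2"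
 using Erf(4)[of "e / 2"] \<open>e > 0\<close> by auto
 \<comment> \<open>The threshold for n amounts to \<open>R <= sqrt n * (3/4 * a)\<close>, which puts
   both arguments of \<open>Erf\<close> into the range of the limit.\<close>
 have "cmod (N n x t - 2 * ka) < e" if n: "n \<ge> (4 * max R 0 / (3 * a))\<^sup>2" and x: "x : {-a/4..a/4}" and t: "t : {0..T}" for n x t
 proof -
 have n0: "0 <= n" using n by (meson order_trans zero_le_power2)
 have "4 * max R 0 / (3 * a) <= sqrt n" using n a by (intro real_le_rsqrt)
 hence sR: "R <= sqrt n * (3/4 * a)" using a by (simp add: field_simps)
 have xa: "x : {-a..a}" "a : {-a..a}" "-a : {-a..a}" using x a by auto
 have tri: "cmod (N n x t - 2 * ka) <= cmod (Erf (of_real (sqrt n) * (Z (a, t) - Z (x, t))) - ka) + cmod (Erf (of_real (sqrt n) * (Z (x, t) - Z (-a, t))) - ka)"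
 proof -
 have "of_real (sqrt n) * (Z (-a, t) - Z (x, t)) = - (of_real (sqrt n) * (Z (x, t) - Z (-a, t)))" by (simp add: algebra_simps)
 hence "N n x t - 2 * ka = (Erf (of_real (sqrt n) * (Z (a, t) - Z (x, t))) - ka) + (Erf (of_real (sqrt n) * (Z (x, t) - Z (-a, t))) - ka)"
 unfolding N_def by (simp only: Erf(2)) simp
 thus ?thesis by (simp only: norm_triangle_ineq)
 qed
 have "cmod (Erf (of_real (sqrt n) * (Z (u, t) - Z (v, t))) - ka) < e / 2"
 if uv: "u : {-a..a}" "v : {-a..a}" "3/4 * a <= u - v" for u v
 proof (rule R)
 have re: "Re (of_real (sqrt n) * (Z (u, t) - Z (v, t))) = sqrt n * (u - v)" using uv t by (simp add: Re_Z')
 have "sqrt n * (3/4 * a) <= sqrt n * (u - v)" using uv(3) n0 by (intro mult_lm) auto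
 thus "R <= Re (of_real (sqrt n) * (Z (u, t) - Z (v, t)))" using sR re by linarith
 have "\<bar>Im (of_real (sqrt n) * (Z (u, t) - Z (v, t)))\<bar> = sqrt n * \<bar>Im (Z (u, t)) - Im (Z (v, t))\<bar>"
 using n0 by (simp add: abs_mult)
 also have "... <= sqrt n * (\<bar>u - v\<bar> / 2)" using lipx[OF uv(1,2) t] n0 by (intro mult_lm) auto
 also have "... = Re (of_real (sqrt n) * (Z (u, t) - Z (v, t))) / 2" unfolding re using uv(3) a by simp
 finally show "\<bar>Im (of_real (sqrt n) * (Z (u, t) - Z (v, t)))\<bar> <= Re (of_real (sqrt n) * (Z (u, t) - Z (v, t))) / 2" .
 qed
 from this[OF xa(2,1)] this[OF xa(1,3)] show ?thesis using tri x by auto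
 qed
 thus ?thesis by blast
 qed
 have average: "EX n0. \<forall>n\<ge>n0. ALL x:{-a/4..a/4}. ALL t:{0..T}. cmod (of_real (sqrt n) * I n (Z (x, t)) t - G (x, t) * N n x t) < e" if "e > 0" for e
 proof -
 \<comment> \<open>The 8 absorbs the bound 4 for the mass of the kernel and the 2 in
   \<open>ep + 8 * D / (3 * n) < 2 * ep\<close>.\<close>
 define ep where "ep = e / (8 * B1)"
 have "ep > 0" using \<open>e > 0\<close> B1(1) by (simp add: ep_def)
 have "uniformly_continuous_on tclosed G" by (rule compact_uniformly_continuous[OF G comp])
 then obtain dl where dl: "dl > 0" "!!z z'. z : tclosed ==> z' : tclosed ==> dist z' z < dl ==> dist (G z') (G z) < ep"
 unfolding uniformly_continuous_on_def using \<open>ep > 0\<close> by metis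
 define D where "D = 2 * C / dl\<^sup>2"
 have "D > 0" using C dl by (simp add: D_def)
 \<comment> \<open>A quadratic bound treats near and distant points in one estimate: at distance
   \<open>dl\<close> the term D dl^2 is already twice the bound of \<open>G\<close>.\<close>
 have osc: "cmod (G (y, t) - G (x, t)) <= ep + D * (x - y)\<^sup>2" if "x : {-a..a}" "y : {-a..a}" "t : {0..T}" for x y t
 proof (cases "\<bar>x - y\<bar> < dl")
 case True
 hence "dist (G (y, t)) (G (x, t)) < ep"
 using that by (intro dl(2)) (auto simp: dist_Pair_Pair dist_real_def abs_minus_commute)
 moreover have "0 <= D * (x - y)\<^sup>2" using \<open>D > 0\<close> by simp
 ultimately show ?thesis by (simp add: dist_norm)
 next
 case False
 have "dl\<^sup>2 <= (x - y)\<^sup>2" using False dl(1) by (intro abs_le_square_iff[THEN iffD1]) simp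
 hence "D * dl\<^sup>2 <= D * (x - y)\<^sup>2" using \<open>D > 0\<close> by simp
 moreover have "D * dl\<^sup>2 = 2 * C" using dl(1) by (simp add: D_def)
 moreover have "cmod (G (y, t) - G (x, t)) <= 2 * C"
 using norm_triangle_ineq4[of "G (y, t)" "G (x, t)"] C(2)[of "(y, t)"] C(2)[of "(x, t)"] that by auto
 ultimately show ?thesis using \<open>ep > 0\<close> by linarith
 qed
 have bound: "cmod (of_real (sqrt n) * I n (Z (x, t)) t - G (x, t) * N n x t) <= 4 * B1 * (ep + 8 * D / (3 * n))"
 if n: "0 < n" and x: "x : {-a/4..a/4}" and t: "t : {0..T}" for n x t
 proof -
 let ?k = "%y. of_real (sqrt n) * ker n (Z (x, t)) (y, t) * px Z (y, t)"
 have xa: "x : {-a..a}" using x a by auto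
 have "cts {-a..a} (%y. ker n (Z (x, t)) (y, t) * G (y, t) * px Z (y, t))"
 by (rule con_slice(1)[OF cP(1)]) (use t in auto)
 note i1 = int_con[OF this]
 have i2: "((%y. of_real (sqrt n) * (ker n (Z (x, t)) (y, t) * G (y, t) * px Z (y, t))) has_integral (of_real (sqrt n) * I n (Z (x, t)) t)) {-a..a}"
 unfolding I_def by (intro has_integral_mult_right integrable_integral i1)
 have i3: "((%y. G (x, t) * ?k y) has_integral (G (x, t) * N n x t)) {-a..a}"
 by (intro has_integral_mult_right N) (use n t in auto)
 have i4: "((%y. ?k y * (G (y, t) - G (x, t))) has_integral (of_real (sqrt n) * I n (Z (x, t)) t - G (x, t) * N n x t)) {-a..a}"
 using has_integral_diff[OF i2 i3] by (simp add: algebra_simps)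
 let ?m = "%y. sqrt n / (1 + 3/4 * n * (x - y)\<^sup>2)"
 have "cmod (HK {-a..a} (%y. ?k y * (G (y, t) - G (x, t)))) <= HK {-a..a} (%y. (B1 * (ep + 8 * D / (3 * n))) * ?m y)"
 proof (rule int_norm_bd)
 show "(%y. (B1 * (ep + 8 * D / (3 * n))) * ?m y) integrable_on {-a..a}"
 by (intro integrable_on_mult_right gauss_kernel_integral(1)[OF n])
 fix y assume y: "y : {-a..a}"
 let ?v = "3/4 * n * (x - y)\<^sup>2"
 have v: "0 <= ?v" using n by simp
 have "cmod (?k y * (G (y, t) - G (x, t))) = sqrt n * cmod (ker n (Z (x, t)) (y, t)) * cmod (px Z (y, t)) * cmod (G (y, t) - G (x, t))"
 using n by (simp add: norm_mult)
 also have "... <= sqrt n * exp (- ?v) * B1 * (ep + D * (x - y)\<^sup>2)"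
 using kernel_same_height[OF xa y t, of n] n B1(2)[of "(y, t)"] osc[OF xa y t] y t B1(1)
 by (intro mult_mono mult_nonneg_nonneg) (auto simp: ker_def)
 also have "... = sqrt n * B1 * (ep * exp (- ?v) + 4 * D / (3 * n) * (?v * exp (- ?v)))"
 using n by (simp add: algebra_simps)
 also have "... <= sqrt n * B1 * (ep * (1 / (1 + ?v)) + 4 * D / (3 * n) * (2 / (1 + ?v)))"
 using exp_le_inverse[OF v] mult_exp_le_inverse[OF v] \<open>ep > 0\<close> \<open>D > 0\<close> n B1(1)
 by (intro mult_lm add_mono) auto
 also have "... = (B1 * (ep + 8 * D / (3 * n))) * ?m y" by (simp add: algebra_simps add_divide_distrib)
 finally show "cmod (?k y * (G (y, t) - G (x, t))) <= (B1 * (ep + 8 * D / (3 * n))) * ?m y" .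
 qed (use i4 in auto)
 also have "... = (B1 * (ep + 8 * D / (3 * n))) * HK {-a..a} ?m" by (rule integral_mult_right)
 also have "... <= (B1 * (ep + 8 * D / (3 * n))) * 4"
 using gauss_kernel_integral(2)[OF n, of "-a" a x] a B1(1) \<open>ep > 0\<close> \<open>D > 0\<close> n by (intro mult_lm mult_nonneg_nonneg add_nonneg_nonneg) auto
 finally show ?thesis using integral_unique[OF i4] by (simp add: mult_ac)
 qed
 have "cmod (of_real (sqrt n) * I n (Z (x, t)) t - G (x, t) * N n x t) < e"
 if n: "n \<ge> 16 * D / (3 * ep)" and x: "x : {-a/4..a/4}" and t: "t : {0..T}" for n x t
 proof -
 have "16 * D / (3 * ep) > 0" using \<open>D > 0\<close> \<open>ep > 0\<close> by simp
 hence n0: "n > 0" using n by linarith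
 have "8 * D / (3 * n) <= ep / 2" using n n0 \<open>ep > 0\<close> by (simp add: field_simps)
 hence "ep + 8 * D / (3 * n) < 2 * ep" using \<open>ep > 0\<close> by linarith
 hence "4 * B1 * (ep + 8 * D / (3 * n)) < 4 * B1 * (2 * ep)" using B1(1) by simp
 also have "... = e" using B1(1) by (simp add: ep_def)
 finally show ?thesis using bound[OF n0 x t] by linarith
 qed
 thus ?thesis by blast
 qed
 have side_lim: "EX n0. \<forall>n\<ge>n0. sqrt n * (2 * T * C * B2 * exp (- (n * a\<^sup>2 / 4))) < e" if "e > 0" for e
 proof -
 define K where "K = 2 * T * C * B2"
 define c where "c = a\<^sup>2 / 4"
 have K: "K > 0" "c > 0" using T C B2 a by (auto simp: K_def c_def)
 have "sqrt n * (K * exp (- (n * c))) < e" if n: "n \<ge> (K / (c * e) + 1)\<^sup>2" for n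
 proof -
 have p: "K / (c * e) + 1 > 0" using K \<open>e > 0\<close> by (simp add: add_pos_pos)
 hence n0: "n > 0" using n zero_less_power[OF p, of 2] by linarith
 have "K / (c * e) + 1 <= sqrt n" using n by (rule real_le_rsqrt)
 hence s: "K / (c * e) < sqrt n" by simp
 have "exp (- (n * c)) <= 1 / (1 + n * c)" using n0 K by (intro exp_le_inverse) auto
 also have "... <= 1 / (n * c)" using n0 K by (intro divide_left_mono) (auto simp: add_pos_pos)
 finally have "sqrt n * (K * exp (- (n * c))) <= sqrt n * (K * (1 / (n * c)))" using n0 K by (intro mult_lm) auto
 also have "... = K / (c * sqrt n)" using n0 K by (simp add: field_simps)
 also have "... < e" using s K \<open>e > 0\<close> n0 by (simp add: field_simps)
 finally show ?thesis .
 qed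
 thus ?thesis unfolding K_def c_def by (metis times_divide_eq_right)
 qed
 show thesis
 proof (rule that)
 show "h n hol UNIV" for n
 proof -
 have "(%w. HK (cbox (-a) a) (%y. ker (real n) w (y, 0) * G (y, 0) * px Z (y, 0))) hol UNIV"
 proof (rule leibniz_rule_holomorphic[where fx = "%w y. - (2 * of_real n * (w - Z (y, 0))) * ker (real n) w (y, 0) * G (y, 0) * px Z (y, 0)"])
 show "((%w. ker (real n) w (y, 0) * G (y, 0) * px Z (y, 0)) hfd
 - (2 * of_real n * (w - Z (y, 0))) * ker (real n) w (y, 0) * G (y, 0) * px Z (y, 0)) (at w within UNIV)" for w y
 unfolding ker_def by (auto intro!: derivative_eq_intros)
 show "(%y. ker (real n) w (y, 0) * G (y, 0) * px Z (y, 0)) integrable_on cbox (-a) a" for w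
 unfolding box_real
 by (rule int_con, rule con_slice(1)[OF cP(1)]) (use T in auto)
 have c: "cts (UNIV \<times> cbox (-a) a) (%p. u (snd p, 0))" if "cts tclosed u" for u :: "plane => complex"
 by (rule con_comp[OF that]) (use T in \<open>auto intro!: continuous_intros\<close>)
 show "cts (UNIV \<times> cbox (-a) a) (%(w, y). - (2 * of_real n * (w - Z (y, 0))) * ker (real n) w (y, 0) * G (y, 0) * px Z (y, 0))"
 unfolding split_beta ker_def by (intro continuous_intros c cont_Z G)
 qed auto
 thus ?thesis unfolding h_def I_def box_real by (intro holomorphic_intros) (use Erf(3) in auto)
 qed
 show "h n w = 0" if "!!x. x : {-a..a} ==> G (x, 0) = 0" for n w
 proof -
 have "I n w 0 = HK {-a..a} (%_. 0)" unfolding I_def using that by (intro integral_cong) auto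
 thus ?thesis by (simp add: h_def)
 qed
 show "uniform_limit ({-a/4..a/4} \<times> {0..T}) (%n z. h n (Z z)) G sequentially"
 unfolding uniform_limit_sequentially_iff
 proof (intro allI impI)
 fix e :: real assume "e > 0"
 define e' where "e' = e * cmod ka / 2"
 define e'' where "e'' = e * cmod ka / (2 * C)"
 have e': "e' > 0" "e'' > 0" using \<open>e > 0\<close> Erf(3) C(1) by (auto simp: e'_def e''_def)
 obtain n1 where n1: "!!n x t. n \<ge> n1 ==> x : {-a/4..a/4} ==> t : {0..T} ==> cmod (of_real (sqrt n) * I n (Z (x, t)) t - G (x, t) * N n x t) < e'"
 using average[OF e'(1)] by blast
 obtain n2 where n2: "!!n x t. n \<ge> n2 ==> x : {-a/4..a/4} ==> t : {0..T} ==> cmod (N n x t - 2 * ka) < e''"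
 using N_lim[OF e'(2)] by blast
 obtain n3 where n3: "!!n. n \<ge> n3 ==> sqrt n * (2 * T * C * B2 * exp (- (n * a\<^sup>2 / 4))) < e'"
 using side_lim[OF e'(1)] by blast
 have "dist (h n (Z z)) (G z) < e" if n: "n \<ge> nat \<lceil>max n1 (max n2 (max n3 0))\<rceil>" and z: "z : {-a/4..a/4} \<times> {0..T}" for n z
 proof -
 obtain x t where xt: "z = (x, t)" "x : {-a/4..a/4}" "t : {0..T}" using z by auto
 have nn: "real n \<ge> n1" "real n \<ge> n2" "real n \<ge> n3" "0 <= real n" using n by linarith+
 have zc: "z : tclosed" using xt a by auto
 let ?s = "complex_of_real (sqrt (real n))"
 have A: "cmod (?s * I n (Z z) 0 - ?s * I n (Z z) t) < e'"
 proof -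
 have "cmod (?s * I n (Z z) 0 - ?s * I n (Z z) t) = sqrt n * cmod (I n (Z z) 0 - I n (Z z) t)"
 by (simp add: norm_mult flip: right_diff_distrib)
 also have "... <= sqrt n * (2 * T * C * B2 * exp (- (n * a\<^sup>2 / 4)))"
 using stokes'[OF nn(4) xt(2,3)] xt(1) by (intro mult_lm) auto
 finally show ?thesis using n3[OF nn(3)] by linarith
 qed
 have Bd: "cmod (?s * I n (Z z) t - G z * N n x t) < e'" using n1[OF nn(1) xt(2,3)] xt(1) by simp
 have "cmod (G z * N n x t - G z * (2 * ka)) = cmod (G z) * cmod (N n x t - 2 * ka)" by (simp add: norm_mult flip: right_diff_distrib)
 also have "... <= C * e''" using n2[OF nn(2) xt(2,3)] C(2)[OF zc] C(1) by (intro mult_mono) auto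
 also have "... = e'" using C(1) by (simp add: e'_def e''_def)
 finally have Cd: "cmod (G z * N n x t - G z * (2 * ka)) <= e'" .
 have "cmod (?s * I n (Z z) 0 - G z * (2 * ka)) < 3 * e'"
 using A Bd Cd norm_triangle_ineq[of "?s * I n (Z z) 0 - ?s * I n (Z z) t" "?s * I n (Z z) t - G z * N n x t"]
 norm_triangle_ineq[of "?s * I n (Z z) 0 - G z * N n x t" "G z * N n x t - G z * (2 * ka)"] by simp
 moreover have "h n (Z z) - G z = (?s * I n (Z z) 0 - G z * (2 * ka)) / (2 * ka)"
 using Erf(3) by (simp add: h_def diff_divide_distrib)
 ultimately have "cmod (h n (Z z) - G z) < 3 * e' / (2 * cmod ka)"
 using Erf(3) by (simp add: norm_divide norm_mult divide_strict_right_mono)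
 also have "... = 3 / 4 * e" using Erf(3) by (simp add: e'_def)
 also have "... < e" using \<open>e > 0\<close> by simp
 finally show ?thesis by (simp add: dist_norm)
 qed
 thus "EX N. \<forall>n\<ge>N. ALL x:{-a/4..a/4} \<times> {0..T}. dist (h n (Z x)) (G x) < e" by blast
 qed
 qed
qed

end

section \<open>Cauchy's formula on boxes standing on a graph\<close>

lemma entire_primitive:
 assumes "h hol UNIV"
 shows "EX Q. ALL z. (Q hfd h z) (at z)"
proof -
 obtain Q :: "complex => complex" where "!!z. z : UNIV ==> (Q hfd h z) (at z within UNIV)"
 using holomorphic_convex_primitive'[OF convex_UNIV open_UNIV assms] by blast
 thus ?thesis by (intro exI[of _ Q]) simp
qed

lemma smooth_has_vector_derivative:
 assumes "Csm S u" "x : S"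
 shows "(u hvd fder u (at x) 1) (at x within A)"
proof -
 have d: "(u hasd fder u (at x)) (at x within A)"
 by (rule hd_within[OF smooth_has_derivative[OF assms]])
 have "fder u (at x) = (%h. h *\<^sub>R fder u (at x) 1)"
 proof (rule ext)
 fix h
 show "fder u (at x) h = h *\<^sub>R fder u (at x) 1"
 using linear_scale[OF bounded_linear.linear[OF has_derivative_bounded_linear[OF d]], of h 1]
 by (simp only: real_scaleR_def mult_1_right)
 qed
 from has_derivative_eq_rhs[OF d this] show ?thesis unfolding hvd_def .
qed

text \<open>The arc is x + i ph(x), and \<open>pt x s\<close> will be the point at height s above
  it. The slope bound 1/2 makes distances in the plane comparable with those in the parameters (x,
  s).\<close>

locale graph_arc =
 fixes ph :: "real => real" and b B :: real
 assumes bB: "0 < b" "b < B"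
 and smooth: "Csm {-B<..<B} ph"
 and lip: "!!x y. x : {-b..b} ==> y : {-b..b} ==> \<bar>ph x - ph y\<bar> <= \<bar>x - y\<bar> / 2"
begin

definition pt :: "real => real => complex" where "pt x s = Complex x (ph x + s)"
definition zt' :: "real => complex" where "zt' x = Complex 1 (fder ph (at x) 1)"

lemma sub_B: "{-b..b} <= {-B<..<B}" using bB by auto

lemma pt_deriv_x:
 assumes "x : {-b..b}"
 shows "((%x. pt x s) hvd zt' x) (at x within A)"
proof -
 have "x : {-B<..<B}" using assms sub_B by auto
 note d = smooth_has_vector_derivative[OF smooth this, where A = A]
 have "((%x. of_real x + \<i> * (of_real (ph x) + of_real s)) hvd of_real 1 + \<i> * (of_real (fder ph (at x) 1) + 0)) (at x within A)"
 by (intro has_vector_derivative_add has_vector_derivative_mult_right has_vector_derivative_of_real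
 d[folded hrd_hvd] DERIV_ident hvd_const)
 thus ?thesis unfolding pt_def zt'_def Complex_eq by simp
qed

lemma pt_deriv_s: "((%s. pt x s) hvd \<i>) (at s within A)"
proof -
 have "((%s. of_real x + \<i> * (of_real (ph x) + of_real s)) hvd 0 + \<i> * (0 + of_real 1)) (at s within A)"
 by (intro has_vector_derivative_add has_vector_derivative_mult_right has_vector_derivative_of_real DERIV_ident hvd_const)
 thus ?thesis unfolding pt_def Complex_eq by simp
qed

lemma smooth_zt': "Csm {-B<..<B} zt'"
 unfolding zt'_def[abs_def] by (intro smooth_Complex smooth_const smooth_frechet_derivative[OF smooth]) simp

lemma smooth_pt: "Csm {-B<..<B} (%x. pt x s)"
proof -
 have "Csm {-B<..<B} (%x::real. x)" by (rule smooth_bounded_linear) (auto intro: bounded_linear_ident)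
 thus ?thesis
 unfolding pt_def[abs_def] by (intro smooth_Complex smooth_add smooth_const smooth) auto
qed

lemma cont_zt': "cts {-b..b} zt'"
 using smooth_con[OF smooth_zt'] sub_B con_subset by blast

lemma cont_ph: "cts {-b..b} ph"
 using smooth_con[OF smooth] sub_B con_subset by blast

lemma cont_pt: "cts ({-b..b} \<times> UNIV) (%(x, s). pt x s)"
 unfolding pt_def Complex_eq split_beta
 by (intro continuous_intros con_comp[OF cont_ph]) auto

lemma cont_pt1: "cts {-b..b} (%x. pt x s)" and cont_pt2: "cts A (%s. pt x s)"
 unfolding pt_def Complex_eq by (intro continuous_intros cont_ph)+

lemma Re_pt [simp]: "Re (pt x s) = x" and Im_pt [simp]: "Im (pt x s) = ph x + s"
 by (simp_all add: pt_def)

lemma side_h: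
 assumes "-b <= y0" "y0 <= y1" "y1 <= b"
 and Q: "!!y. y : {y0..y1} ==> (Q hfd q (pt y s)) (at (pt y s))"
 shows "((%y. q (pt y s) * zt' y) has_integral (Q (pt y1 s) - Q (pt y0 s))) {y0..y1}"
proof (rule FTC[OF assms(2)])
 fix y assume y: "y : {y0..y1}"
 have "((%x. pt x s) hvd zt' y) (at y within {y0..y1})" using y assms by (intro pt_deriv_x) auto
 from field_vector_diff_chain_within[OF this has_field_derivative_at_within[OF Q[OF y]]]
 show "((%y. Q (pt y s)) hvd q (pt y s) * zt' y) (at y within {y0..y1})"
 by (simp add: o_def mult.commute)
qed

lemma side_v:
 assumes "s0 <= s1" and Q: "!!s. s : {s0..s1} ==> (Q hfd q (pt y s)) (at (pt y s))"
 shows "((%s. \<i> * q (pt y s)) has_integral (Q (pt y s1) - Q (pt y s0))) {s0..s1}"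
proof (rule FTC[OF assms(1)])
 fix s assume s: "s : {s0..s1}"
 from field_vector_diff_chain_within[OF pt_deriv_s has_field_derivative_at_within[OF Q[OF s]]]
 show "((%s. Q (pt y s)) hvd \<i> * q (pt y s)) (at s within {s0..s1})"
 by (simp add: o_def)
qed

definition box_frame :: "real => real => real => complex set" where
 "box_frame y0 y1 s1 = (%y. pt y 0) ` {y0..y1} \<union> (%y. pt y s1) ` {y0..y1} \<union> pt y0 ` {0..s1} \<union> pt y1 ` {0..s1}"

text \<open>The integral of \<open>q dz\<close> around \<open>pt ` ([y0, y1] \<times> [0, s1])\<close>.\<close>
definition box_integral :: "real => real => real => (complex => complex) => complex" where
 "box_integral y0 y1 s1 q =
 HK {y0..y1} (%y. q (pt y 0) * zt' y) + HK {0..s1} (%s. \<i> * q (pt y1 s))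
 - HK {y0..y1} (%y. q (pt y s1) * zt' y) - HK {0..s1} (%s. \<i> * q (pt y0 s))"

text \<open>Subtracting the vanishing integral for the reflected point \<open>pt x (-v)\<close> makes the kernel of order \<open>v\<close> away from \<open>pt x 0\<close>.\<close>
definition kern :: "nat => real => real => complex => complex" where
 "kern m x v z = 1 / (z - pt x v) ^ Suc m - 1 / (z - pt x (- v)) ^ Suc m"

context
 fixes y0 y1 s1 :: real
 assumes y: "-b <= y0" "y0 < y1" "y1 <= b" and s1: "0 < s1"
begin

lemma box_integrable:
 assumes "cts (box_frame y0 y1 s1) q"
 shows "s : {0, s1} ==> (%y. q (pt y s) * zt' y) integrable_on {y0..y1}"
 and "x : {y0, y1} ==> (%s. \<i> * q (pt x s)) integrable_on {0..s1}"
proof -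
 assume s: "s : {0, s1}"
 have "cts {y0..y1} (%y. q (pt y s))"
 by (rule con_comp[OF assms con_subset[OF cont_pt1]]) (use s y in \<open>auto simp: box_frame_def\<close>)
 thus "(%y. q (pt y s) * zt' y) integrable_on {y0..y1}"
 using y by (intro int_con con_mult con_subset[OF cont_zt']) auto
next
 assume x: "x : {y0, y1}"
 have "cts {0..s1} (%s. q (pt x s))"
 by (rule con_comp[OF assms cont_pt2]) (use x in \<open>auto simp: box_frame_def\<close>)
 thus "(%s. \<i> * q (pt x s)) integrable_on {0..s1}"
 by (intro int_con con_mult con_const)
qed

lemma box_integral_add:
 assumes "cts (box_frame y0 y1 s1) q" "cts (box_frame y0 y1 s1) q'"
 shows "box_integral y0 y1 s1 (%z. q z + q' z) = box_integral y0 y1 s1 q + box_integral y0 y1 s1 q'"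
 using box_integrable[OF assms(1)] box_integrable[OF assms(2)]
 by (simp add: box_integral_def distrib_left distrib_right integral_add)

lemma box_integral_cmult:
 "box_integral y0 y1 s1 (%z. c * q z) = c * box_integral y0 y1 s1 q"
proof -
 have "(%s. \<i> * (c * q (pt x s))) = (%s. c * (\<i> * q (pt x s)))" for x by (simp add: fun_eq_iff)
 thus ?thesis by (simp add: box_integral_def mult.assoc right_diff_distrib distrib_left)
qed

lemma box_integral_cong:
 assumes "!!z. z : box_frame y0 y1 s1 ==> q z = q' z"
 shows "box_integral y0 y1 s1 q = box_integral y0 y1 s1 q'"
proof -
 have h: "HK {y0..y1} (%y. q (pt y s) * zt' y) = HK {y0..y1} (%y. q' (pt y s) * zt' y)" if "s : {0, s1}" for s
 by (rule integral_cong, subst assms) (use that in \<open>auto simp: box_frame_def\<close>)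
 have v: "HK {0..s1} (%s. \<i> * q (pt x s)) = HK {0..s1} (%s. \<i> * q' (pt x s))" if "x : {y0, y1}" for x
 by (rule integral_cong, subst assms) (use that in \<open>auto simp: box_frame_def\<close>)
 show ?thesis
 unfolding box_integral_def by (intro arg_cong2[where f = "(-)"] arg_cong2[where f = "(+)"] h v) auto
qed

lemma box_integral_primitive:
 assumes "!!z. z : box_frame y0 y1 s1 ==> (Q hfd q z) (at z)"
 shows "box_integral y0 y1 s1 q = 0"
proof -
 have h: "((%y. q (pt y s) * zt' y) has_integral (Q (pt y1 s) - Q (pt y0 s))) {y0..y1}" if "s : {0, s1}" for s
 using y by (intro side_h assms) (use that in \<open>auto simp: box_frame_def\<close>)
 have v: "((%s. \<i> * q (pt x s)) has_integral (Q (pt x s1) - Q (pt x 0))) {0..s1}" if "x : {y0, y1}" for x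
 using s1 by (intro side_v assms) (use that in \<open>auto simp: box_frame_def\<close>)
 have "HK {y0..y1} (%y. q (pt y 0) * zt' y) = Q (pt y1 0) - Q (pt y0 0)"
 "HK {y0..y1} (%y. q (pt y s1) * zt' y) = Q (pt y1 s1) - Q (pt y0 s1)"
 "HK {0..s1} (%s. \<i> * q (pt y0 s)) = Q (pt y0 s1) - Q (pt y0 0)"
 "HK {0..s1} (%s. \<i> * q (pt y1 s)) = Q (pt y1 s1) - Q (pt y1 0)"
 by (rule integral_unique, rule h v, simp)+
 thus ?thesis unfolding box_integral_def by (simp only:) simp
qed

lemma box_integral_entire: "h hol UNIV ==> box_integral y0 y1 s1 h = 0"
 using entire_primitive[of h] box_integral_primitive by blast

lemma pt_inside_notin_frame: "y0 < x ==> x < y1 ==> 0 < v ==> v < s1 ==> pt x v ~: box_frame y0 y1 s1"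
 by (auto simp: box_frame_def pt_def)

lemma pt_below_notin_frame: "0 < v ==> pt x (- v) ~: box_frame y0 y1 s1"
 using s1 by (auto simp: box_frame_def pt_def)

lemma Ln_primitive: "c * z + d ~: \<real>\<^sub>\<le>\<^sub>0 ==> c ~= 0 ==> ((%z. Ln (c * z + d)) hfd 1 / (z + d / c)) (at z)"
 by (auto intro!: derivative_eq_intros simp: field_simps)

text \<open>The logarithm Ln(-i (z - w)) is cut straight downwards from the reflected point w, and
  every point of the frame on the vertical line through w lies above w.\<close>

lemma box_winding_outside:
 assumes v: "0 < v" and x: "y0 < x" "x < y1"
 shows "box_integral y0 y1 s1 (%z. 1 / (z - pt x (- v))) = 0"
proof (rule box_integral_primitive)
 fix z assume z: "z : box_frame y0 y1 s1"
 then obtain u s where us: "z = pt u s" "u : {y0..y1}" "s \<ge> 0" using s1 y by (auto simp: box_frame_def)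
 have "- \<i> * z + \<i> * pt x (- v) ~: \<real>\<^sub>\<le>\<^sub>0"
 using us(3) v by (auto simp: us(1) complex_nonpos_Reals_iff)
 from Ln_primitive[OF this]
 show "((%z. Ln (- \<i> * z + \<i> * pt x (- v))) hfd 1 / (z - pt x (- v))) (at z)" by simp
qed

text \<open>The frame is divided by the vertical line through w = \<open>pt x v\<close>: Ln(z - w)
  is a primitive on the right, Ln(w - z) on the left. They differ by pi i with opposite signs at the
  two crossings, and the box integral takes the difference of the two.\<close>

lemma box_winding_inside:
 assumes v: "0 < v" "v < s1" and x: "y0 < x" "x < y1"
 shows "box_integral y0 y1 s1 (%z. 1 / (z - pt x v)) = 2 * of_real pi * \<i>"
proof -
 let ?w = "pt x v"
 let ?q = "%z. 1 / (z - ?w)"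
 have R: "((%z. Ln (z - ?w)) hfd ?q z) (at z)" if "x < Re z \<or> Re z = x & Im z ~= ph x + v" for z
 using Ln_primitive[of 1 z "- ?w"] that by (auto simp: complex_nonpos_Reals_iff)
 have L: "((%z. Ln (?w - z)) hfd ?q z) (at z)" if "Re z < x \<or> Re z = x & Im z ~= ph x + v" for z
 using Ln_primitive[of "-1" z "?w"] that by (auto simp: complex_nonpos_Reals_iff)
 have xs: "-b <= x" "x <= b" using x y by auto
 have h1: "((%u. ?q (pt u s) * zt' u) has_integral (Ln (pt y1 s - ?w) - Ln (pt x s - ?w))) {x..y1}" if "s ~= v" for s
 using x y xs that by (intro side_h R) auto
 have h2: "((%u. ?q (pt u s) * zt' u) has_integral (Ln (?w - pt x s) - Ln (?w - pt y0 s))) {y0..x}" if "s ~= v" for s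
 using x y xs that by (intro side_h L) auto
 have h: "((%u. ?q (pt u s) * zt' u) has_integral (Ln (?w - pt x s) - Ln (?w - pt y0 s) + (Ln (pt y1 s - ?w) - Ln (pt x s - ?w)))) {y0..y1}"
 if "s ~= v" for s
 using x by (intro has_integral_combine[OF _ _ h2[OF that] h1[OF that]]) auto
 have v1: "((%s. \<i> * ?q (pt y1 s)) has_integral (Ln (pt y1 s1 - ?w) - Ln (pt y1 0 - ?w))) {0..s1}"
 using x s1 by (intro side_v R) auto
 have v2: "((%s. \<i> * ?q (pt y0 s)) has_integral (Ln (?w - pt y0 s1) - Ln (?w - pt y0 0))) {0..s1}"
 using x s1 by (intro side_v L) auto
 have e: "pt x s - ?w = \<i> * of_real (s - v)" "?w - pt x s = \<i> * of_real (v - s)" for s by (simp_all add: complex_eq_iff)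
 have l1: "Ln (\<i> * of_real r) = of_real (ln r) + \<i> * of_real pi / 2" if "r > 0" for r
 using Ln_times_of_real[of r \<i>] that by (simp add: mult.commute Ln_of_real)
 have l2: "Ln (\<i> * of_real (- r)) = of_real (ln r) - \<i> * of_real pi / 2" if "r > 0" for r
 using Ln_times_of_real[of r "- \<i>"] that by (simp add: mult.commute Ln_of_real)
 have "box_integral y0 y1 s1 ?q = (Ln (?w - pt x 0) - Ln (pt x 0 - ?w)) - (Ln (?w - pt x s1) - Ln (pt x s1 - ?w))"
 unfolding box_integral_def using integral_unique[OF h[of 0]] integral_unique[OF h[of s1]] integral_unique[OF v1] integral_unique[OF v2] v
 by simp
 also have "... = 2 * of_real pi * \<i>"
 using l1[of v] l2[of v] l1[of "s1 - v"] l2[of "s1 - v"] v unfolding e by simp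
 finally show ?thesis .
qed

lemma cont_frame_power:
 assumes "w ~: box_frame y0 y1 s1" "h hol UNIV"
 shows "cts (box_frame y0 y1 s1) (%z. h z / (z - w) ^ m)"
 using assms by (intro continuous_intros con_subset[OF hol_con[OF assms(2)]]) auto

text \<open>The difference quotient of \<open>h\<close> at \<open>w\<close> is entire after filling
  in the derivative, hence integrates to 0.\<close>

lemma box_Cauchy_0:
 assumes h: "h hol UNIV" and w: "w ~: box_frame y0 y1 s1"
 shows "box_integral y0 y1 s1 (%z. h z / (z - w)) = h w * box_integral y0 y1 s1 (%z. 1 / (z - w))"
proof -
 let ?q = "%z. if z = w then deriv h w else (h z - h w) / (z - w)"
 have q: "?q hol UNIV" using pole_lemma_open[OF h open_UNIV] .
 have "box_integral y0 y1 s1 (%z. h z / (z - w)) = box_integral y0 y1 s1 (%z. ?q z + h w * (1 / (z - w)))"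
 proof (rule box_integral_cong)
 fix z assume "z : box_frame y0 y1 s1"
 hence "z ~= w" using w by auto
 thus "h z / (z - w) = ?q z + h w * (1 / (z - w))" by (simp flip: add_divide_distrib)
 qed
 also have "... = box_integral y0 y1 s1 ?q + box_integral y0 y1 s1 (%z. h w * (1 / (z - w)))"
 by (rule box_integral_add) (use w in \<open>auto intro!: con_subset[OF hol_con[OF q]] continuous_intros\<close>)
 finally show ?thesis unfolding box_integral_entire[OF q] box_integral_cmult by simp
qed

text \<open>Integration by parts: h / (z - w)^(k+1) is a primitive of the integrand for (h', k)
  minus (k + 1) times that for (h, k + 1), so one order of the pole is traded for one derivative of
  \<open>h\<close>.\<close>

lemma box_Cauchy:
 assumes h: "h hol UNIV" and w: "w ~: box_frame y0 y1 s1"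
 shows "fact k * box_integral y0 y1 s1 (%z. h z / (z - w) ^ Suc k) = (deriv ^^ k) h w * box_integral y0 y1 s1 (%z. 1 / (z - w))"
 using h
proof (induction k arbitrary: h)
 case 0
 thus ?case using box_Cauchy_0[OF 0 w] by simp
next
 case (Suc k)
 have h': "deriv h hol UNIV" using Suc.prems by (simp add: holomorphic_deriv)
 let ?A = "%z. deriv h z / (z - w) ^ Suc k" and ?B = "%z. h z / (z - w) ^ Suc (Suc k)"
 have "box_integral y0 y1 s1 (%z. ?A z + (- of_nat (Suc k)) * ?B z) = 0"
 proof (rule box_integral_primitive[where Q = "%z. h z / (z - w) ^ Suc k"])
 fix z assume "z : box_frame y0 y1 s1"
 hence nz: "z - w ~= 0" using w by auto
 have "(h hfd deriv h z) (at z)" using Suc.prems by (simp add: holomorphic_derivI)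
 hence "((%z. h z / (z - w) ^ Suc k) hfd
 (deriv h z * (z - w) ^ Suc k - h z * (of_nat (Suc k) * (z - w) ^ k)) / ((z - w) ^ Suc k * (z - w) ^ Suc k)) (at z)"
 using nz by (auto intro!: derivative_eq_intros simp del: power_Suc)
 moreover have "(deriv h z * (z - w) ^ Suc k - h z * (of_nat (Suc k) * (z - w) ^ k)) / ((z - w) ^ Suc k * (z - w) ^ Suc k) = ?A z + (- of_nat (Suc k)) * ?B z"
 proof -
 have "(A * d ^ Suc k - H * (c * d ^ k)) / (d ^ Suc k * d ^ Suc k) = A / d ^ Suc k + (- c) * (H / d ^ Suc (Suc k))"
 if "d ~= 0" for A H c d :: complex
 using that by (simp add: divide_simps) (simp add: algebra_simps)
 from this[OF nz] show ?thesis .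
 qed
 ultimately show "((%z. h z / (z - w) ^ Suc k) hfd ?A z + (- of_nat (Suc k)) * ?B z) (at z)" by simp
 qed
 moreover have "box_integral y0 y1 s1 (%z. ?A z + (- of_nat (Suc k)) * ?B z) = box_integral y0 y1 s1 ?A + box_integral y0 y1 s1 (%z. (- of_nat (Suc k)) * ?B z)"
 by (intro box_integral_add con_mult con_const cont_frame_power w h' Suc.prems)
 ultimately have "box_integral y0 y1 s1 ?A + (- of_nat (Suc k)) * box_integral y0 y1 s1 ?B = 0"
 unfolding box_integral_cmult by (simp only:)
 moreover have "a = c * b" if "a + (- c) * b = 0" for a b c :: complex using that by algebra
 ultimately have "box_integral y0 y1 s1 ?A = of_nat (Suc k) * box_integral y0 y1 s1 ?B" by blast
 hence "fact (Suc k) * box_integral y0 y1 s1 ?B = fact k * box_integral y0 y1 s1 ?A"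
 by (simp add: mult_ac)
 also have "... = (deriv ^^ k) (deriv h) w * box_integral y0 y1 s1 (%z. 1 / (z - w))" by (rule Suc.IH[OF h'])
 finally show ?case by (simp add: funpow_swap1 del: fact_Suc)
qed

lemma box_Cauchy_kern:
 assumes h: "h hol UNIV" and v: "0 < v" "v < s1" and x: "y0 < x" "x < y1"
 shows "fact k * box_integral y0 y1 s1 (%z. h z * kern k x v z) = 2 * of_real pi * \<i> * (deriv ^^ k) h (pt x v)"
proof -
 note n1 = pt_inside_notin_frame[OF x v] and n2 = pt_below_notin_frame[OF v(1), of x]
 have "box_integral y0 y1 s1 (%z. h z * kern k x v z) =
 box_integral y0 y1 s1 (%z. h z / (z - pt x v) ^ Suc k + (-1) * (h z / (z - pt x (- v)) ^ Suc k))"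
 by (rule box_integral_cong) (simp add: kern_def right_diff_distrib)
 also have "... = box_integral y0 y1 s1 (%z. h z / (z - pt x v) ^ Suc k) + box_integral y0 y1 s1 (%z. (-1) * (h z / (z - pt x (- v)) ^ Suc k))"
 by (intro box_integral_add con_mult con_const cont_frame_power n1 n2 h)
 finally have "fact k * box_integral y0 y1 s1 (%z. h z * kern k x v z) =
 fact k * box_integral y0 y1 s1 (%z. h z / (z - pt x v) ^ Suc k) - fact k * box_integral y0 y1 s1 (%z. h z / (z - pt x (- v)) ^ Suc k)"
 unfolding box_integral_cmult by (simp add: right_diff_distrib)
 thus ?thesis
 unfolding box_Cauchy[OF h n1] box_Cauchy[OF h n2] box_winding_outside[OF v(1) x] box_winding_inside[OF v x] by simp
qed

end

end

section \<open>The derivative along the arc and the cut-off kernel\<close>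

lemma inverse_power_diff_bound:
 fixes a b :: complex
 assumes rh: "0 < rh" "rh <= cmod a" "rh <= cmod b"
 shows "cmod (1 / a ^ n - 1 / b ^ n) <= real n * cmod (b - a) / rh ^ Suc n"
proof (induction n)
 case (Suc n)
 have nz: "a ~= 0" "b ~= 0" using rh by auto
 have "1 / a ^ Suc n - 1 / b ^ Suc n = 1 / a * (1 / a ^ n - 1 / b ^ n) + (b - a) / (a * b * b ^ n)"
 using nz by (simp add: divide_simps) (simp add: algebra_simps)
 hence "cmod (1 / a ^ Suc n - 1 / b ^ Suc n) <= cmod (1 / a * (1 / a ^ n - 1 / b ^ n)) + cmod ((b - a) / (a * b * b ^ n))"
 using norm_triangle_ineq by metis
 also have "cmod (1 / a * (1 / a ^ n - 1 / b ^ n)) <= 1 / rh * (real n * cmod (b - a) / rh ^ Suc n)"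
 unfolding norm_mult using rh nz by (intro mult_mono Suc.IH) (auto simp: norm_divide intro!: divide_left_mono)
 also have "cmod ((b - a) / (a * b * b ^ n)) <= cmod (b - a) / (rh * rh * rh ^ n)"
 unfolding norm_divide norm_mult norm_power
 using rh nz by (intro divide_left_mono mult_mono power_mono mult_pos_pos) auto
 finally show ?case using rh(1) by (simp add: field_simps)
qed simp

context graph_arc
begin

text \<open>The operator d/dz along the arc, expressed in the parameter x. It is skew with respect
  to dz = zt' dx, which is how it enters distributions on the arc.\<close>

definition Dz :: "(real => complex) => real => complex" where
 "Dz u = (%x. fder u (at x) 1 / zt' x)"

abbreviation "IB \<equiv> {-B<..<B}"

lemma zt'_nz: "zt' x ~= 0" by (simp add: zt'_def complex_eq_iff)

lemma smooth_Dz: "Csm S u ==> S <= IB ==> open S ==> Csm S (Dz u)"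
 unfolding Dz_def by (intro smooth_divide smooth_frechet_derivative smooth_subset[OF smooth_zt'] zt'_nz) auto

lemma smooth_Dz_pow: "Csm S u ==> S <= IB ==> open S ==> Csm S ((Dz ^^ n) u)"
 by (induction n) (auto intro: smooth_Dz)

lemma Dz_cong: "open S ==> x : S ==> (!!x. x : S ==> u x = v x) ==> Dz u x = Dz v x"
 unfolding Dz_def using frechet_derivative_cong_open[of S x u v] by simp

lemma Dz_eqI: "(u hvd u') (at x) ==> Dz u x = u' / zt' x"
 unfolding Dz_def hvd_def using frechet_derivative_at by (metis scaleR_one)

lemma Dz_hvd: "Csm S u ==> x : S ==> (u hvd Dz u x * zt' x) (at x within A)"
 using smooth_has_vector_derivative[of S u x A] zt'_nz[of x] by (simp add: Dz_def)

lemma kern_base_ne: "0 < v ==> pt y 0 - pt x v ~= 0" "0 < v ==> pt y 0 - pt x (- v) ~= 0"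
 by (auto simp: complex_eq_iff)

lemma smooth_kern:
 assumes "0 < v"
 shows "Csm IB (%y. kern m x v (pt y 0))"
proof -
 have p: "Csm IB (%y. (pt y 0 - c) ^ n)" for c n
 by (induction n) (auto intro!: smooth_mult smooth_diff smooth_pt)
 show ?thesis unfolding kern_def
 by (intro smooth_diff smooth_divide p smooth_const) (use kern_base_ne[OF assms] in auto)
qed

lemma pt_deriv_IB: "y : IB ==> ((%x. pt x 0) hvd zt' y) (at y within A)"
proof -
 assume "y : IB"
 note d = smooth_has_vector_derivative[OF smooth this, where A = A]
 have "((%x. of_real x + \<i> * (of_real (ph x) + of_real 0)) hvd of_real 1 + \<i> * (of_real (fder ph (at y) 1) + 0)) (at y within A)"
 by (intro has_vector_derivative_add has_vector_derivative_mult_right has_vector_derivative_of_real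
 d[folded hrd_hvd] DERIV_ident hvd_const)
 thus ?thesis unfolding pt_def zt'_def Complex_eq by simp
qed

lemma Dz_kern:
 assumes "0 < v" "y : IB"
 shows "Dz (%y. kern m x v (pt y 0)) y = - of_nat (Suc m) * kern (Suc m) x v (pt y 0)"
proof -
 let ?z = "pt y 0"
 have nz: "?z - pt x v ~= 0" "?z - pt x (- v) ~= 0" using kern_base_ne[OF assms(1)] by auto
 have p: "((%z. 1 / (z - c) ^ Suc m) hfd (- of_nat (Suc m) * (1 / (?z - c) ^ Suc (Suc m)))) (at ?z)"
 if "?z - c ~= 0" for c
 proof -
 have "((%z. 1 / (z - c) ^ Suc m) hfd (- (of_nat (Suc m) * (?z - c) ^ m) / ((?z - c) ^ Suc m * (?z - c) ^ Suc m))) (at ?z)"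
 using that by (auto intro!: derivative_eq_intros simp del: power_Suc)
 moreover have "- (n * e ^ m) / (e ^ Suc m * e ^ Suc m) = - n * (1 / e ^ Suc (Suc m))" if "e ~= 0" for n e :: complex
 using that by (simp add: divide_simps)
 ultimately show ?thesis using that by metis
 qed
 have "(kern m x v hfd (- of_nat (Suc m) * (1 / (?z - pt x v) ^ Suc (Suc m)) - - of_nat (Suc m) * (1 / (?z - pt x (- v)) ^ Suc (Suc m)))) (at ?z)"
 unfolding kern_def[abs_def] by (intro DERIV_diff p nz)
 hence "(kern m x v hfd (- of_nat (Suc m) * kern (Suc m) x v ?z)) (at ?z)"
 by (simp add: kern_def right_diff_distrib del: power_Suc)
 from field_vector_diff_chain_within[OF pt_deriv_IB[OF assms(2), of UNIV] has_field_derivative_at_within[OF this]]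
 have "((%y. kern m x v (pt y 0)) hvd (zt' y * (- of_nat (Suc m) * kern (Suc m) x v ?z))) (at y)"
 by (simp add: o_def)
 from Dz_eqI[OF this] show ?thesis using zt'_nz[of y] by simp
qed

lemma Dz_mult: "Csm S u ==> Csm S v ==> x : S ==> Dz (%x. u x * v x) x = Dz u x * v x + u x * Dz v x"
proof -
 assume "Csm S u" "Csm S v" "x : S"
 from has_vector_derivative_mult[OF Dz_hvd[OF this(1,3)] Dz_hvd[OF this(2,3)], of UNIV]
 have "((%x. u x * v x) hvd (Dz u x * v x + u x * Dz v x) * zt' x) (at x)" by (simp add: algebra_simps)
 from Dz_eqI[OF this] show ?thesis using zt'_nz[of x] by simp
qed

lemma Dz_sum: "finite M ==> (!!m. m : M ==> Csm S (u m)) ==> x : S ==> Dz (%x. \<Sum>m\<in>M. u m x) x = (\<Sum>m\<in>M. Dz (u m) x)"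
proof -
 assume "finite M" and u: "!!m. m : M ==> Csm S (u m)" and x: "x : S"
 have "((%x. \<Sum>m\<in>M. u m x) hvd (\<Sum>m\<in>M. Dz (u m) x * zt' x)) (at x)"
 by (intro has_vector_derivative_sum Dz_hvd[OF u] x)
 from Dz_eqI[OF this] show ?thesis using zt'_nz[of x] by (simp flip: sum_distrib_right)
qed

lemma Dz_add: "Csm S u ==> Csm S v ==> x : S ==> Dz (%x. u x + v x) x = Dz u x + Dz v x"
proof -
 assume "Csm S u" "Csm S v" "x : S"
 from has_vector_derivative_add[OF Dz_hvd[OF this(1,3)] Dz_hvd[OF this(2,3)], of UNIV]
 have "((%x. u x + v x) hvd (Dz u x + Dz v x) * zt' x) (at x)" by (simp add: algebra_simps)
 from Dz_eqI[OF this] show ?thesis using zt'_nz[of x] by simp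
qed

text \<open>Leibniz' rule for the cut-off kernel: up to terms supported where the cut-off \<open>th\<close> is not constant,
 the powers of \<open>Dz\<close> fall on the kernel.\<close>
lemma Dz_pow_cutoff_kern:
 assumes th: "Csm IB th" and V: "open V" "V <= IB" "!!y. y : V ==> th y = 1"
 shows "EX c. (ALL m. Csm IB (c m)) & (ALL m. ALL y:V. c m y = 0) &
 (ALL x v. 0 < v --> (ALL y:IB. (Dz ^^ n) (%y. th y * kern 0 x v (pt y 0)) y =
 (-1) ^ n * fact n * th y * kern n x v (pt y 0) + (\<Sum>m<n. c m y * kern m x v (pt y 0))))"
proof (induction n)
 case 0
 show ?case by (rule exI[of _ "%_ _. 0"]) auto
next
 case (Suc n)
 then obtain c where c: "!!m. Csm IB (c m)" "!!m y. y : V ==> c m y = 0"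
 and eq: "!!x v y. 0 < v ==> y : IB ==> (Dz ^^ n) (%y. th y * kern 0 x v (pt y 0)) y =
 (-1) ^ n * fact n * th y * kern n x v (pt y 0) + (\<Sum>m<n. c m y * kern m x v (pt y 0))"
 by blast
 \<comment> \<open>Two sources: \<open>Dz\<close> applied to the old coefficients, and
   \<open>Dz\<close> applied to \<open>kern (m - 1)\<close>, which raises the index and brings the
   factor -m. The coefficients do not involve x and v, so that bounds for them are uniform.\<close>
 define c' where "c' m y = (if m = n then (-1) ^ n * fact n * Dz th y else Dz (c m) y) - (if m = 0 then 0 else of_nat m * c (m - 1) y)" for m y
 have sD: "Csm IB (Dz th)" "Csm IB (Dz (c m))" for m using smooth_Dz[OF th] smooth_Dz[OF c(1)] by auto
 have sc': "Csm IB (c' m)" for m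
 unfolding c'_def[abs_def]
 by (cases "m = n"; cases "m = 0") (auto intro!: smooth_diff smooth_mult sD smooth_const c(1))
 have zc': "c' m y = 0" if "y : V" for m y
 proof -
 have z: "Dz u y = 0" if u: "!!y. y : V ==> u y = a" for u a
 using Dz_cong[OF V(1) \<open>y : V\<close>, of u "%_. a"] u Dz_eqI[OF hvd_const, of "a" y] by simp
 show ?thesis unfolding c'_def using z[of th 1] z[of "c m" 0] V(3) c(2) that by auto
 qed
 have "(Dz ^^ Suc n) (%y. th y * kern 0 x v (pt y 0)) y =
 (-1) ^ Suc n * fact (Suc n) * th y * kern (Suc n) x v (pt y 0) + (\<Sum>m<Suc n. c' m y * kern m x v (pt y 0))"
 if v: "0 < v" and y: "y : IB" for x v y
 proof -
 let ?K = "%m y. kern m x v (pt y 0)"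
 note sK = smooth_kern[OF v]
 have s1: "Csm IB (%y. (-1) ^ n * fact n * th y * ?K n y)" by (intro smooth_mult smooth_const th sK) auto
 have s2: "Csm IB (%y. c m y * ?K m y)" for m by (intro smooth_mult c sK) auto
 have s3: "Csm IB (%y. \<Sum>m\<in>M. c m y * ?K m y)" if "finite M" for M
 using that by induction (auto intro!: smooth_add s2)
 have s4: "Csm IB (%y. (-1) ^ n * fact n * th y)" by (intro smooth_mult smooth_const th) auto
 have "(Dz ^^ Suc n) (%y. th y * ?K 0 y) y = Dz (%y. (-1) ^ n * fact n * th y * ?K n y + (\<Sum>m<n. c m y * ?K m y)) y"
 by (simp, rule Dz_cong[of IB]) (use y eq[OF v] in auto)
 also have "... = Dz (%y. (-1) ^ n * fact n * th y * ?K n y) y + Dz (%y. \<Sum>m<n. c m y * ?K m y) y"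
 by (rule Dz_add[OF s1 s3 y]) simp
 also have "Dz (%y. (-1) ^ n * fact n * th y * ?K n y) y = Dz (%y. (-1) ^ n * fact n * th y) y * ?K n y + (-1) ^ n * fact n * th y * Dz (?K n) y"
 by (rule Dz_mult[OF s4 sK y])
 also have "Dz (%y. (-1) ^ n * fact n * th y) y = (-1) ^ n * fact n * Dz th y"
 using Dz_mult[of IB "%_. (-1) ^ n * fact n" th y] th y Dz_eqI[OF hvd_const, of "(-1) ^ n * fact n" y]
 by (simp add: smooth_const)
 also have "Dz (%y. \<Sum>m<n. c m y * ?K m y) y = (\<Sum>m<n. Dz (c m) y * ?K m y + c m y * Dz (?K m) y)"
 by (subst Dz_sum[where S = IB]) (use s2 y Dz_mult[OF c(1) sK y] in auto)
 also have "... = (\<Sum>m<n. Dz (c m) y * ?K m y) + (\<Sum>m<n. - (of_nat (Suc m) * c m y * ?K (Suc m) y))"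
 unfolding Dz_kern[OF v y] by (simp add: sum.distrib[symmetric] algebra_simps)
 finally have A: "(Dz ^^ Suc n) (%y. th y * ?K 0 y) y =
 (-1) ^ n * fact n * Dz th y * ?K n y + (-1) ^ n * fact n * th y * (- of_nat (Suc n) * ?K (Suc n) y)
 + ((\<Sum>m<n. Dz (c m) y * ?K m y) + (\<Sum>m<n. - (of_nat (Suc m) * c m y * ?K (Suc m) y)))"
 unfolding Dz_kern[OF v y] .
 have "(\<Sum>m<Suc n. c' m y * ?K m y) = (\<Sum>m<Suc n. (if m = n then (-1) ^ n * fact n * Dz th y else Dz (c m) y) * ?K m y)
 + (\<Sum>m<Suc n. - ((if m = 0 then 0 else of_nat m * c (m - 1) y) * ?K m y))"
 unfolding c'_def by (simp add: sum.distrib[symmetric] algebra_simps)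
 also have "(\<Sum>m<Suc n. (if m = n then (-1) ^ n * fact n * Dz th y else Dz (c m) y) * ?K m y) = (\<Sum>m<n. Dz (c m) y * ?K m y) + (-1) ^ n * fact n * Dz th y * ?K n y"
 by simp
 also have "(\<Sum>m<Suc n. - ((if m = 0 then 0 else of_nat m * c (m - 1) y) * ?K m y)) = (\<Sum>m<n. - (of_nat (Suc m) * c m y * ?K (Suc m) y))"
 by (subst sum.lessThan_Suc_shift) simp
 finally show ?thesis unfolding A by (simp add: algebra_simps)
 qed
 thus ?case using sc' zc' by blast
qed

end

lemma smooth_cutoff_exists:
 fixes p q r s :: real
 assumes "p < q" "q <= r" "r < s"
 shows "\<exists>th::real => real. Csm UNIV th & (ALL x. 0 <= th x & th x <= 1) & (ALL x. x ~: {p..s} --> th x = 0) & (ALL x:{q..r}. th x = 1)"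
proof -
 obtain B0 et0 where B0: "Csm UNIV B0" "!!x. (B0 hrd et0 x) (at x)"
 "!!x. 0 <= et0 x" "!!x. 0 <= B0 x" "!!x. B0 x <= 1" "!!x. x <= p ==> B0 x = 0" "!!x. x <= p ==> et0 x = 0"
 "!!x. q <= x ==> B0 x = 1" "!!x. q <= x ==> et0 x = 0" "cts UNIV et0"
 using smooth_step_exists[OF assms(1)] by auto
 obtain B1 et1 where B1: "Csm UNIV B1" "!!x. (B1 hrd et1 x) (at x)"
 "!!x. 0 <= et1 x" "!!x. 0 <= B1 x" "!!x. B1 x <= 1" "!!x. x <= r ==> B1 x = 0" "!!x. x <= r ==> et1 x = 0"
 "!!x. s <= x ==> B1 x = 1" "!!x. s <= x ==> et1 x = 0" "cts UNIV et1"
 using smooth_step_exists[OF assms(3)] by auto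
 have "0 <= B0 x - B1 x & B0 x - B1 x <= 1" for x
 using B0(4,5)[of x] B1(4,5)[of x] B0(8)[of x] B1(6)[of x] assms(2) by (cases "q <= x") auto
 moreover have "B0 x - B1 x = 0" if "x ~: {p..s}" for x
 using that B0(6,8)[of x] B1(6,8)[of x] assms by (cases "x < p") auto
 moreover have "B0 x - B1 x = 1" if "x : {q..r}" for x
 using that B0(8)[of x] B1(6)[of x] by auto
 ultimately show ?thesis
 by (intro exI[of _ "%x. B0 x - B1 x"]) (auto intro!: smooth_diff B0(1) B1(1))
qed

lemma set_integrable_mult_continuous:
 fixes g c :: "real => complex"
 assumes g: "set_integrable lborel {l..r} g" and c: "cts {l..r} c"
 shows "set_integrable lborel {l..r} (%x. g x * c x)"
proof -
 obtain M where M: "M > 0" "!!x. x : {l..r} ==> cmod (c x) <= M" using compact_bd[OF c compact_Icc] by blast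
 have mg: "(%x. ind {l..r} x *\<^sub>R g x) : borel_measurable lborel"
 using g by (simp add: set_integrable_def borel_measurable_integrable)
 have mc: "(%x. ind {l..r} x *\<^sub>R c x) : borel_measurable lborel"
 using bm_indicator[OF _ c] by simp
 have e: "(%x. (ind {l..r} x *\<^sub>R g x) * (ind {l..r} x *\<^sub>R c x)) = (%x. ind {l..r} x *\<^sub>R (g x * c x))"
 by (auto simp: fun_eq_iff indicator_def)
 show ?thesis
 unfolding set_integrable_def
 proof (rule Bochner_Integration.integrable_bound)
 show "integrable lborel (%x. (ind {l..r} x *\<^sub>R g x) * of_real M)"
 using g unfolding set_integrable_def by (intro integrable_mult_left)
 show "(%x. ind {l..r} x *\<^sub>R (g x * c x)) : borel_measurable lborel"
 unfolding e[symmetric] by (intro borel_measurable_times mg mc)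
 show "AE x in lborel. norm (ind {l..r} x *\<^sub>R (g x * c x)) <= norm ((ind {l..r} x *\<^sub>R g x) * complex_of_real M)"
 using M by (intro AE_I2) (auto simp: indicator_def norm_mult intro!: mult_lm)
 qed
qed

context graph_arc
begin

lemma kern_bound:
 assumes "0 < rh" "rh <= cmod (z - pt x v)" "rh <= cmod (z - pt x (- v))" "0 <= v"
 shows "cmod (kern m x v z) <= (real (Suc m) * 2 / rh ^ Suc (Suc m)) * v"
proof -
 have "cmod (kern m x v z) <= real (Suc m) * cmod ((z - pt x (- v)) - (z - pt x v)) / rh ^ Suc (Suc m)"
 unfolding kern_def by (rule inverse_power_diff_bound[OF assms(1-3)])
 also have "(z - pt x (- v)) - (z - pt x v) = of_real (2 * v) * \<i>" by (simp add: complex_eq_iff)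
 also have "cmod ... = 2 * v" using assms(4) by (simp add: norm_mult)
 finally show ?thesis by (simp only: times_divide_eq_left mult.assoc)
qed

text \<open>With u = \<open>pt y 0 - pt x 0\<close> the kernel is 2 i v / (u^2 + v^2), and Re (u^2)
  >= 3/4 (x - y)^2; so it is a Poisson kernel up to the factor 2 / (3/4).\<close>

lemma kern_0_bound:
 assumes "x : {-b..b}" "y : {-b..b}" "0 < v"
 shows "cmod (kern 0 x v (pt y 0)) <= 8 / 3 * (v / ((x - y)\<^sup>2 + v\<^sup>2))"
proof -
 define u where "u = pt y 0 - pt x 0"
 have e: "pt y 0 - pt x v = u - \<i> * of_real v" "pt y 0 - pt x (- v) = u + \<i> * of_real v"
 by (simp_all add: u_def complex_eq_iff)
 have nz: "u - \<i> * of_real v ~= 0" "u + \<i> * of_real v ~= 0"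
 using kern_base_ne[OF assms(3), of y x] unfolding e by auto
 have "kern 0 x v (pt y 0) = 2 * \<i> * of_real v / (u\<^sup>2 + (of_real v)\<^sup>2)"
 proof -
 have p: "(u - \<i> * of_real v) * (u + \<i> * of_real v) = u\<^sup>2 + (of_real v)\<^sup>2" by (simp add: algebra_simps power2_eq_square)
 have "1 / (u - \<i> * of_real v) - 1 / (u + \<i> * of_real v) = 2 * \<i> * of_real v / ((u - \<i> * of_real v) * (u + \<i> * of_real v))"
 using nz by (simp add: divide_simps)
 thus ?thesis unfolding kern_def e p by simp
 qed
 hence k: "cmod (kern 0 x v (pt y 0)) = 2 * v / cmod (u\<^sup>2 + (of_real v)\<^sup>2)"
 using assms(3) by (simp add: norm_divide norm_mult)
 have "(ph y - ph x)\<^sup>2 <= ((y - x) / 2)\<^sup>2"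
 by (rule abs_le_square_iff[THEN iffD1]) (use lip[OF assms(2,1)] in simp)
 hence "(ph y - ph x)\<^sup>2 <= 1/4 * (x - y)\<^sup>2"
 by (simp add: power_divide power2_commute[of x y])
 hence "3/4 * (x - y)\<^sup>2 + 3/4 * v\<^sup>2 <= (y - x)\<^sup>2 - (ph y - ph x)\<^sup>2 + v\<^sup>2"
 using zero_le_power2[of v] unfolding power2_commute[of y x] by linarith
 also have "... = Re (u\<^sup>2 + (of_real v)\<^sup>2)" by (simp add: u_def power2_eq_square)
 also have "... <= cmod (u\<^sup>2 + (of_real v)\<^sup>2)" by (rule complex_Re_le_cmod)
 finally have l: "3/4 * ((x - y)\<^sup>2 + v\<^sup>2) <= cmod (u\<^sup>2 + (of_real v)\<^sup>2)" by simp
 have pos: "0 < (x - y)\<^sup>2 + v\<^sup>2" using assms(3) by (simp add: add_nonneg_pos)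
 have "2 * v / cmod (u\<^sup>2 + (of_real v)\<^sup>2) <= 2 * v / (3/4 * ((x - y)\<^sup>2 + v\<^sup>2))"
 using l pos assms(3) by (intro divide_left_mono mult_pos_pos) auto
 also have "... = 8 / 3 * (v / ((x - y)\<^sup>2 + v\<^sup>2))" by simp
 finally show ?thesis unfolding k .
qed

end

section \<open>A holomorphic function on one side of the arc and its boundary values\<close>

text \<open>\<open>trace\<close> says that \<open>g\<close> is the k-th derivative of the boundary
  values of \<open>F\<close> in the sense of distributions; the sign comes from moving
  \<open>Dz\<close> onto the test function. \<open>F\<close> comes with entire approximants because
  Cauchy's formula will be applied to boxes whose bottom lies on the arc, where \<open>F\<close> is
  only continuous.\<close>

locale boundary_data = graph_arc +
 fixes F :: "complex => complex" and h :: "nat => complex => complex" and et :: real and k :: nat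
 and g :: "real => complex" and j0 j1 :: real
 assumes et: "0 < et"
 and entire: "!!n. h n hol UNIV"
 and ulim: "uniform_limit {pt x s |x s. x : {-b..b} & s : {0..et}} h F sequentially"
 and J: "-b < j0" "j0 < j1" "j1 < b"
 and g: "set_integrable lborel {j0<..<j1} g"
 and trace: "!!u l r. Csm UNIV u ==> (!!x. x ~: {l..r} ==> u x = 0) ==> j0 < l ==> l < r ==> r < j1 ==>
 (LINT x:{l..r}|lborel. g x * (zt' x * u x)) = (-1) ^ k * HK {l..r} (%x. F (pt x 0) * (zt' x * (Dz ^^ k) u x))"
begin

definition Dc :: "complex set" where "Dc = {pt x s |x s. x : {-b..b} & s : {0..et}}"
definition Do :: "complex set" where "Do = {w. \<bar>Re w\<bar> < b & 0 < Im w - ph (Re w) & Im w - ph (Re w) < et}"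
definition H :: "complex => complex" where "H = (deriv ^^ k) F"

lemma ulim': "uniform_limit Dc h F sequentially" using ulim by (simp add: Dc_def)

lemma pt_in_Dc: "x : {-b..b} ==> s : {0..et} ==> pt x s : Dc" by (auto simp: Dc_def)

lemma pt_in_Do: "\<bar>x\<bar> < b ==> 0 < s ==> s < et ==> pt x s : Do" by (simp add: Do_def)

lemma Do_pt: "w : Do ==> w = pt (Re w) (Im w - ph (Re w))" by (simp add: complex_eq_iff)

lemma Do_sub_Dc: "Do <= Dc"
proof
 fix w assume w: "w : Do"
 hence "pt (Re w) (Im w - ph (Re w)) : Dc" by (intro pt_in_Dc) (auto simp: Do_def)
 thus "w : Dc" using Do_pt[OF w] by simp
qed

lemma open_Do: "open Do"
proof -
 have o: "open {w. Re w : {-b<..<b}}"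
 using continuous_open_vimage[of "{-b<..<b}" Re] by (simp add: vimage_def continuous_on_Re continuous_on_id con_at_on)
 have c: "cts {w. Re w : {-b<..<b}} (%w. Im w - ph (Re w))"
 by (intro continuous_intros con_comp[OF cont_ph]) auto
 have "Do = {w. Re w : {-b<..<b}} \<inter> (%w. Im w - ph (Re w)) -` {0<..<et}" by (auto simp: Do_def)
 thus ?thesis using open_preimage[OF c o, of "{0<..<et}"] by simp
qed

lemma holomorphic_h: "h n hol S" using entire holomorphic_on_subset by blast

lemma holomorphic_F: "F hol Do"
proof (rule holomorphic_uniform_sequence[OF open_Do holomorphic_h])
 fix x assume "x : Do"
 then obtain d where d: "d > 0" "cball x d <= Do" using open_Do open_contains_cball by blast
 hence "uniform_limit (cball x d) h F sequentially"
 using uniform_limit_on_subset[OF ulim'] Do_sub_Dc by blast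
 thus "\<exists>d>0. cball x d <= Do & uniform_limit (cball x d) h F sequentially" using d by blast
qed

lemma holomorphic_H: "H hol Do"
 unfolding H_def by (rule holomorphic_higher_deriv[OF holomorphic_F open_Do])

lemma h_lim_H: "w : Do ==> (%n. (deriv ^^ k) (h n) w) \<longlonglongrightarrow> H w"
 unfolding H_def
 by (rule higher_deriv_complex_uniform_limit[OF uniform_limit_on_subset[OF ulim' Do_sub_Dc] _ _ open_Do]) (auto simp: holomorphic_h)

lemma cont_F: "cts Dc F"
 by (rule uniform_limit_theorem[OF _ ulim']) (auto intro!: hol_con holomorphic_h always_eventually)

lemma compact_Dc: "compact Dc"
proof -
 have "Dc = (%(x, s). pt x s) ` ({-b..b} \<times> {0..et})" by (auto simp: Dc_def) blast
 moreover have "cts ({-b..b} \<times> {0..et}) (%(x, s). pt x s)" by (rule con_subset[OF cont_pt]) auto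
 ultimately show ?thesis by (metis compact_continuous_image compact_Times compact_Icc)
qed

lemma bounds:
 obtains S where "S > 0" "!!w. w : Dc ==> cmod (F w) <= S" "\<forall>\<^sub>F n in sequentially. ALL w:Dc. cmod (h n w) <= S"
proof -
 obtain C where C: "C > 0" "!!w. w : Dc ==> cmod (F w) <= C" using compact_bd[OF cont_F compact_Dc] by blast
 have "\<forall>\<^sub>F n in sequentially. ALL w:Dc. dist (h n w) (F w) < 1" using uniform_limitD[OF ulim', of 1] by simp
 hence "\<forall>\<^sub>F n in sequentially. ALL w:Dc. cmod (h n w) <= C + 1"
 proof eventually_elim
 case (elim n)
 show ?case
 proof
 fix w assume "w : Dc"
 hence "cmod (h n w - F w) < 1" "cmod (F w) <= C" using elim C by (auto simp: dist_norm)
 thus "cmod (h n w) <= C + 1" using norm_triangle_ineq[of "h n w - F w" "F w"] by simp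
 qed
 qed
 thus ?thesis using that[of "C + 1"] C by force
qed

text \<open>\<open>H\<close> is, up to \<open>O(v)\<close>, the integral of \<open>g\<close> against the difference of the Cauchy kernels at the two
 points reflected in the arc.\<close>
lemma H_representation:
 assumes d: "0 < d" "j0 < x1 - 3 * d" "x1 + 3 * d < j1"
 shows "EX C v0. 0 < v0 & v0 < et & 0 < C & (ALL x:{x1 - d..x1 + d}. ALL v. 0 < v --> v < v0 -->
 cmod (H (pt x v)) <= C * (LINT y:{x1 - 3 * d..x1 + 3 * d}|lborel. cmod (g y) * (v / ((x - y)\<^sup>2 + v\<^sup>2))) + C * v)"
proof -
 define l r where "l = x1 - 3 * d" and "r = x1 + 3 * d"
 have lr: "l < r" "j0 < l" "r < j1" "-b <= l" "r <= b" "l < x1 - d" "x1 + d < r" using d J by (auto simp: l_def r_def)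
 have lrb: "{l..r} <= {-b..b}" "{l..r} <= IB" using lr sub_B by auto
 obtain thr :: "real => real" where thr: "Csm UNIV thr" "!!x. 0 <= thr x & thr x <= 1"
 "!!x. x ~: {l..r} ==> thr x = 0" "!!x. x : {x1 - 2 * d..x1 + 2 * d} ==> thr x = 1"
 using smooth_cutoff_exists[of l "x1 - 2 * d" "x1 + 2 * d" r] d by (auto simp: l_def r_def)
 define th :: "real => complex" where "th x = of_real (thr x)" for x
 have sth: "Csm UNIV th"
 unfolding th_def[abs_def] by (intro smooth_linear_compose[OF _ bounded_linear_of_real] thr) auto
 have th0: "th x = 0" if "x ~: {l..r}" for x using thr(3)[OF that] by (simp add: th_def)
 have th1: "th x = 1" if "x : {x1 - 2 * d<..<x1 + 2 * d}" for x using thr(4)[of x] that by (simp add: th_def)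
 have thle: "cmod (th x) <= 1" for x using thr(2)[of x] by (simp add: th_def)
 define V where "V = {x1 - 2 * d<..<x1 + 2 * d}"
 have V: "open V" "V <= IB" "!!y. y : V ==> th y = 1" using th1 lr lrb d by (auto simp: V_def l_def r_def)
 obtain c where c: "!!m. Csm IB (c m)" "!!m y. y : V ==> c m y = 0"
 and Dk: "!!x v y. 0 < v ==> y : IB ==> (Dz ^^ k) (%y. th y * kern 0 x v (pt y 0)) y =
 (-1) ^ k * fact k * th y * kern k x v (pt y 0) + (\<Sum>m<k. c m y * kern m x v (pt y 0))"
 using Dz_pow_cutoff_kern[OF smooth_subset[OF sth subset_UNIV] V, of k] by blast
 \<comment> \<open>A common lower bound for the distances from \<open>pt x v\<close> and its
   reflection to the lateral sides and, as long as v < et/2, to the top.\<close>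
 define rh where "rh = min d (et / 6)"
 have rh: "0 < rh" "rh <= d" "rh <= et / 6" using d et by (auto simp: rh_def)
 define v0 where "v0 = et / 2"
 define Ck where "Ck m = real (Suc m) * 2 / rh ^ Suc (Suc m)" for m
 have Ck: "Ck m \<ge> 0" for m using rh by (simp add: Ck_def)
 have kb: "cmod (kern m x v (pt y s)) <= Ck m * v" if "d <= \<bar>y - x\<bar>" "0 <= v" for m x v y s
 unfolding Ck_def
 by (rule kern_bound[OF rh(1)]) (use that rh(2) abs_Re_le_cmod[of "pt y s - pt x v"] abs_Re_le_cmod[of "pt y s - pt x (- v)"] in auto)
 have kt: "cmod (kern m x v (pt y et)) <= Ck m * v" if "x : {-b..b}" "y : {-b..b}" "0 <= v" "v < v0" for m x v y
 proof -
 have "rh <= cmod (pt y et - pt x v')" if v': "\<bar>v'\<bar> < v0" for v'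
 proof (cases "et / 6 <= \<bar>y - x\<bar>")
 case True
 thus ?thesis using abs_Re_le_cmod[of "pt y et - pt x v'"] rh(3) by auto
 next
 case False
 have "et / 6 <= \<bar>Im (pt y et - pt x v')\<bar>"
 proof -
 have "\<bar>ph y - ph x\<bar> <= et / 12" "\<bar>v'\<bar> <= et / 2"
 using lip[OF \<open>y : {-b..b}\<close> \<open>x : {-b..b}\<close>] False v' by (simp_all add: v0_def)
 hence "et / 6 <= ph y + et - (ph x + v')" using et unfolding abs_le_iff by linarith
 thus ?thesis unfolding minus_complex.sel Im_pt by (rule order_trans[OF _ abs_ge_self])
 qed
 thus ?thesis using abs_Im_le_cmod[of "pt y et - pt x v'"] rh(3) by linarith
 qed
 from this[of v] this[of "- v"] show ?thesis unfolding Ck_def using that by (intro kern_bound[OF rh(1)]) auto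
 qed
 obtain S where S: "S > 0" "!!w. w : Dc ==> cmod (F w) <= S" "\<forall>\<^sub>F n in sequentially. ALL w:Dc. cmod (h n w) <= S"
 using bounds by blast
 obtain Z where Z: "Z > 0" "!!y. y : {-b..b} ==> cmod (zt' y) <= Z"
 using compact_bd[OF cont_zt' compact_Icc] by blast
 have cc: "cts {l..r} (c m)" for m
 using smooth_con[OF c(1)] lrb con_subset by blast
 have "EX e. 0 <= e & (ALL y:{l..r}. cmod (c m y) <= e)" for m
 using compact_bd[OF cc compact_Icc] by (metis less_imp_le)
 then obtain E where E: "!!m. 0 <= E m" "!!m y. y : {l..r} ==> cmod (c m y) <= E m"
 by metis
 \<comment> \<open>What the Leibniz rule for the cut-off kernel leaves over. It vanishes on
   \<open>V\<close>, and elsewhere |y - x| >= d makes it O(v).\<close>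
 define br where "br x v y = fact k * kern k x v (pt y 0) - (-1) ^ k * (Dz ^^ k) (%y. th y * kern 0 x v (pt y 0)) y" for x v y
 define Eb where "Eb = fact k * 2 * Ck k + (\<Sum>m<k. E m * Ck m)"
 have Eb: "0 <= Eb" unfolding Eb_def by (intro add_nonneg_nonneg sum_nonneg mult_nonneg_nonneg Ck E) auto
 have br: "cmod (br x v y) <= Eb * v" if x: "x : {x1 - d..x1 + d}" and v: "0 < v" and y: "y : {l..r}" for x v y
 proof -
 let ?K = "%m. kern m x v (pt y 0)"
 have yI: "y : IB" using y lrb by auto
 have b1: "br x v y = fact k * ?K k - fact k * th y * ?K k - (-1) ^ k * (\<Sum>m<k. c m y * ?K m)"
 unfolding br_def Dk[OF v yI] by (simp add: algebra_simps flip: power_mult_distrib)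
 show ?thesis
 proof (cases "y : V")
 case True
 thus ?thesis unfolding b1 using c(2) V(3) Eb v by simp
 next
 case False
 hence "d <= \<bar>y - x\<bar>" using x by (auto simp: V_def)
 note K = kb[OF this less_imp_le[OF v], where s = 0]
 have "cmod (br x v y) <= cmod (fact k * ?K k) + cmod (fact k * th y * ?K k) + cmod ((-1) ^ k * (\<Sum>m<k. c m y * ?K m))"
 unfolding b1 by (meson norm_triangle_ineq4 order_trans add_right_mono)
 also have "cmod (fact k * ?K k) <= fact k * (Ck k * v)" using K[of k] by (simp add: norm_mult)
 also have "cmod (fact k * th y * ?K k) <= fact k * 1 * (Ck k * v)"
 unfolding norm_mult norm_fact using K[of k] thle[of y] by (intro mult_mono) auto
 also have "cmod ((-1) ^ k * (\<Sum>m<k. c m y * ?K m)) <= (\<Sum>m<k. E m * (Ck m * v))"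
 unfolding norm_mult norm_power by (simp, rule order_trans[OF norm_sum]) (use K E y in \<open>auto intro!: sum_mono mult_mono simp: norm_mult\<close>)
 finally show ?thesis by (simp add: Eb_def algebra_simps sum_distrib_left sum_distrib_right)
 qed
 qed
 define Q where "Q = 2 * et * S * Ck k + (r - l) * S * Ck k * Z"
 have Q0: "0 <= Q" using et S(1) Ck[of k] lr(1) Z(1) by (simp add: Q_def)
 define C where "C = 8 * Z / 3 + fact k * Q + (r - l) * S * Z * Eb + 1"
 have C0: "0 < C" using Z(1) Q0 lr(1) S(1) Eb by (simp add: C_def add_nonneg_pos)
 have gl: "set_integrable lborel {l..r} g" by (rule set_integrable_subset[OF g]) (use lr in auto)
 have "cmod (H (pt x v)) <= C * (LINT y:{l..r}|lborel. cmod (g y) * (v / ((x - y)\<^sup>2 + v\<^sup>2))) + C * v"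
 if x: "x : {x1 - d..x1 + d}" and v: "0 < v" "v < v0" for x v
 proof -
 have xb: "x : {-b..b}" "\<bar>x\<bar> < b" "l < x" "x < r" using x lr by auto
 have vs: "v < et" using v et by (simp add: v0_def)
 let ?w = "pt x v"
 have w: "?w : Do" using xb v vs by (intro pt_in_Do) auto
 have cK: "cts {l..r} (%y. kern m x v (pt y 0))" for m
 using smooth_con[OF smooth_kern[OF v(1)]] lrb con_subset by blast
 have cZ: "cts {l..r} zt'" using cont_zt' lrb con_subset by blast
 have cFp: "cts {l..r} (%y. F (pt y 0))"
 by (rule con_comp[OF cont_F con_subset[OF cont_pt1]]) (use lrb et pt_in_Dc in auto)
 have chp: "cts {l..r} (%y. h n (pt y 0))" for n
 by (rule con_comp[OF hol_con[OF entire] con_subset[OF cont_pt1]]) (use lrb in auto)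
 define bot where "bot f = HK {l..r} (%y. f (pt y 0) * kern k x v (pt y 0) * zt' y)" for f :: "complex => complex"
 have bot_lim: "(%n. bot (h n)) \<longlonglongrightarrow> bot F"
 proof -
 have "uniform_limit {l..r} (%n y. h n (pt y 0)) (%y. F (pt y 0)) sequentially"
 by (rule uniform_limit_compose'[OF ulim']) (use lrb et pt_in_Dc in auto)
 hence "uniform_limit {l..r} (%n y. h n (pt y 0) * (kern k x v (pt y 0) * zt' y)) (%y. F (pt y 0) * (kern k x v (pt y 0) * zt' y)) sequentially"
 by (intro uniform_lim_mult uniform_limit_const compact_imp_bounded compact_continuous_image con_mult cFp cK cZ compact_Icc)
 hence "uniform_limit (cbox l r) (%n y. h n (pt y 0) * kern k x v (pt y 0) * zt' y) (%y. F (pt y 0) * kern k x v (pt y 0) * zt' y) sequentially"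
 by (simp add: mult.assoc)
 then obtain I J where IJ: "!!n. ((%y. h n (pt y 0) * kern k x v (pt y 0) * zt' y) has_integral I n) (cbox l r)"
 "((%y. F (pt y 0) * kern k x v (pt y 0) * zt' y) has_integral J) (cbox l r)" "I \<longlonglongrightarrow> J"
 by (rule uniform_limit_integral_cbox) (auto intro!: con_mult chp cK cZ)
 have "bot (h n) = I n" for n using integral_unique[OF IJ(1)[of n]] by (simp add: bot_def)
 moreover have "bot F = J" using integral_unique[OF IJ(2)] by (simp add: bot_def)
 ultimately show ?thesis using IJ(3) by simp
 qed
 \<comment> \<open>Cauchy's formula for one entire approximant: up to the O(v) of the top and the
   sides, the bottom integral is the k-th derivative at \<open>pt x v\<close>. The limit in n then
   replaces \<open>h n\<close> by \<open>F\<close> and its derivative by \<open>H\<close>.\<close>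
 have approx: "cmod (fact k * bot (h n) - 2 * of_real pi * \<i> * (deriv ^^ k) (h n) ?w) <= fact k * (Q * v)"
 if hn: "ALL w:Dc. cmod (h n w) <= S" for n
 proof -
 let ?q = "%z. h n z * kern k x v z"
 define s1 s2 tp where "s1 = HK {0..et} (%s. \<i> * ?q (pt r s))" and "s2 = HK {0..et} (%s. \<i> * ?q (pt l s))"
 and "tp = HK {l..r} (%y. ?q (pt y et) * zt' y)"
 have "fact k * box_integral l r et ?q = 2 * of_real pi * \<i> * (deriv ^^ k) (h n) ?w"
 by (rule box_Cauchy_kern[OF lr(4,1,5) et entire v(1) vs xb(3,4)])
 hence e: "fact k * bot (h n) - 2 * of_real pi * \<i> * (deriv ^^ k) (h n) ?w = fact k * (tp + s2 - s1)"
 by (simp add: box_integral_def bot_def s1_def s2_def tp_def algebra_simps)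
 have side: "cmod (HK {0..et} (%s. \<i> * ?q (pt y s))) <= et * S * Ck k * v" if y: "y = l \<or> y = r" for y
 proof -
 have dy: "d <= \<bar>y - x\<bar>" "y : {-b..b}" using y x d lr by (auto simp: l_def r_def)
 have "cmod (HK (cbox 0 et) (%s. \<i> * ?q (pt y s))) <= S * (Ck k * v) * measure lborel (cbox 0 et)"
 proof (rule Henstock_Kurzweil_Integration.integrable_bound)
 show "0 <= S * (Ck k * v)" using S(1) Ck[of k] v by simp
 have "cts {0..et} (%s. 1 / (pt y s - c) ^ Suc k)" if "!!s. s : {0..et} ==> pt y s ~= c" for c
 using that by (intro continuous_intros cont_pt2) auto
 moreover have "pt y s ~= pt x v'" for s v' using dy d by (auto simp: complex_eq_iff)
 ultimately show "(%s. \<i> * ?q (pt y s)) integrable_on cbox 0 et"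
 unfolding kern_def box_real
 by (intro int_con con_mult con_const con_diff
 con_comp[OF hol_con[OF entire] cont_pt2]) auto
 fix s assume "s : cbox 0 et"
 hence "pt y s : Dc" using dy by (intro pt_in_Dc) auto
 thus "cmod (\<i> * ?q (pt y s)) <= S * (Ck k * v)"
 using hn kb[OF dy(1), of v k s] v S(1) by (auto simp: norm_mult intro!: mult_mono)
 qed
 thus ?thesis using et by (simp add: mult_ac)
 qed
 have top: "cmod tp <= (r - l) * S * Ck k * Z * v"
 proof -
 have "cmod (HK (cbox l r) (%y. ?q (pt y et) * zt' y)) <= S * (Ck k * v) * Z * measure lborel (cbox l r)"
 proof (rule Henstock_Kurzweil_Integration.integrable_bound)
 show "0 <= S * (Ck k * v) * Z" using S(1) Ck[of k] v Z(1) by simp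
 have "pt y et ~= pt x v'" if "\<bar>v'\<bar> < et" for y v' using that by (auto simp: pt_def complex_eq_iff)
 hence "cts {l..r} (%y. 1 / (pt y et - pt x v') ^ Suc k)" if "\<bar>v'\<bar> < et" for v'
 using that lrb by (intro continuous_intros con_subset[OF cont_pt1]) auto
 from this[of v] this[of "- v"] show "(%y. ?q (pt y et) * zt' y) integrable_on cbox l r"
 unfolding kern_def box_real using v vs lrb
 by (intro int_con con_mult con_diff cZ
 con_comp[OF hol_con[OF entire] con_subset[OF cont_pt1]]) auto
 fix y assume y: "y : cbox l r"
 hence "pt y et : Dc" and yb: "y : {-b..b}" using lrb et by (auto intro!: pt_in_Dc)
 thus "cmod (?q (pt y et) * zt' y) <= S * (Ck k * v) * Z"
 unfolding norm_mult using hn kt[OF xb(1) yb, of v k] v S(1) Z(2)[OF yb] Ck[of k] by (intro mult_mono) auto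
 qed
 thus ?thesis using lr(1) by (simp add: tp_def mult_ac)
 qed
 have "cmod (tp + s2 - s1) <= cmod tp + cmod s2 + cmod s1"
 by (meson norm_triangle_ineq norm_triangle_ineq4 order_trans add_right_mono)
 also have "... <= Q * v" using side[of l] side[of r] top by (simp add: s1_def s2_def Q_def algebra_simps)
 finally show ?thesis unfolding e by (simp add: norm_mult)
 qed
 have A: "cmod (fact k * bot F - 2 * of_real pi * \<i> * H ?w) <= fact k * (Q * v)"
 proof (rule Lim_norm_ubound)
 show "(%n. fact k * bot (h n) - 2 * of_real pi * \<i> * (deriv ^^ k) (h n) ?w) \<longlonglongrightarrow> fact k * bot F - 2 * of_real pi * \<i> * H ?w"
 by (intro tendsto_intros bot_lim h_lim_H w)
 show "\<forall>\<^sub>F n in sequentially. cmod (fact k * bot (h n) - 2 * of_real pi * \<i> * (deriv ^^ k) (h n) ?w) <= fact k * (Q * v)"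
 using S(3) by eventually_elim (rule approx)
 qed simp
 \<comment> \<open>The trace condition is tested with the cut-off kernel itself, which is smooth
   along the arc as long as v > 0.\<close>
 let ?u = "%y. th y * kern 0 x v (pt y 0)"
 have su: "Csm IB ?u" by (intro smooth_mult smooth_subset[OF sth] smooth_kern v) auto
 have su': "Csm UNIV ?u"
 by (rule smooth_UNIV_extend[OF _ _ lrb(2) su]) (use th0 in auto)
 have "Csm IB ((Dz ^^ k) ?u)" by (rule smooth_Dz_pow[OF su]) auto
 from con_subset[OF smooth_con[OF this] lrb(2)]
 have cD: "cts {l..r} ((Dz ^^ k) ?u)" .
 have cbr: "cts {l..r} (br x v)"
 unfolding br_def[abs_def]
 by (rule con_diff[OF con_mult[OF con_const cK] con_mult[OF con_const cD]])
 define Lg where "Lg = (LINT y:{l..r}|lborel. g y * (zt' y * ?u y))"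
 have "Lg = (-1) ^ k * HK {l..r} (%y. F (pt y 0) * (zt' y * (Dz ^^ k) ?u y))"
 unfolding Lg_def by (rule trace[OF su' _ lr(2,1,3)]) (use th0 in auto)
 also have "... = HK {l..r} (%y. (-1) ^ k * (F (pt y 0) * (zt' y * (Dz ^^ k) ?u y)))" by simp
 also have "... = HK {l..r} (%y. fact k * (F (pt y 0) * kern k x v (pt y 0) * zt' y) - F (pt y 0) * zt' y * br x v y)"
 by (rule arg_cong[where f = "HK {l..r}"]) (auto simp: br_def algebra_simps fun_eq_iff)
 also have "... = fact k * bot F - HK {l..r} (%y. F (pt y 0) * zt' y * br x v y)"
 unfolding bot_def by (subst integral_diff) (auto intro!: int_con con_mult con_const cFp cK cZ cbr)
 finally have L: "Lg = fact k * bot F - HK {l..r} (%y. F (pt y 0) * zt' y * br x v y)" .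
 have "cmod (HK (cbox l r) (%y. F (pt y 0) * zt' y * br x v y)) <= S * Z * (Eb * v) * measure lborel (cbox l r)"
 proof (rule Henstock_Kurzweil_Integration.integrable_bound)
 show "0 <= S * Z * (Eb * v)" using S(1) Z(1) Eb v by simp
 show "(%y. F (pt y 0) * zt' y * br x v y) integrable_on cbox l r"
 unfolding box_real by (intro int_con con_mult cFp cZ cbr)
 show "cmod (F (pt y 0) * zt' y * br x v y) <= S * Z * (Eb * v)" if "y : cbox l r" for y
 proof -
 have "y : {-b..b}" "pt y 0 : Dc" using that lrb et by (auto intro!: pt_in_Dc)
 thus ?thesis unfolding norm_mult using S(1) S(2) Z br[OF x v(1), of y] that by (intro mult_mono) auto
 qed
 qed
 hence Bd: "cmod (fact k * bot F - Lg) <= (r - l) * S * Z * Eb * v"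
 unfolding L using lr(1) by (simp add: mult_ac)
 have cu: "cts {l..r} (%y. zt' y * ?u y)"
 by (intro con_mult cZ cK con_subset[OF smooth_con[OF sth]]) auto
 have i1: "set_integrable lborel {l..r} (%y. g y * (zt' y * ?u y))" by (rule set_integrable_mult_continuous[OF gl cu])
 have cP: "cts {l..r} (%y. complex_of_real (v / ((x - y)\<^sup>2 + v\<^sup>2)))"
 proof -
 have "(x - y)\<^sup>2 + v\<^sup>2 ~= 0" for y using v(1) by (metis add_nonneg_pos less_irrefl zero_le_power2 zero_less_power)
 thus ?thesis by (intro continuous_intros) auto
 qed
 have i2: "set_integrable lborel {l..r} (%y. cmod (g y) * (v / ((x - y)\<^sup>2 + v\<^sup>2)))"
 proof -
 have "cmod (g y * complex_of_real (v / ((x - y)\<^sup>2 + v\<^sup>2))) = cmod (g y) * (v / ((x - y)\<^sup>2 + v\<^sup>2))" for y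
 using v(1) unfolding norm_mult norm_of_real by simp
 thus ?thesis using set_integrable_norm[OF set_integrable_mult_continuous[OF gl cP]] by simp
 qed
 have "cmod Lg <= (LINT y:{l..r}|lborel. cmod (g y * (zt' y * ?u y)))"
 unfolding Lg_def by (rule set_integral_norm_bound[OF i1])
 also have "... <= (LINT y:{l..r}|lborel. 8 * Z / 3 * (cmod (g y) * (v / ((x - y)\<^sup>2 + v\<^sup>2))))"
 proof (rule set_integral_mono)
 show "set_integrable lborel {l..r} (%y. cmod (g y * (zt' y * ?u y)))" by (rule set_integrable_norm[OF i1])
 show "set_integrable lborel {l..r} (%y. 8 * Z / 3 * (cmod (g y) * (v / ((x - y)\<^sup>2 + v\<^sup>2))))"
 by (intro set_integrable_mult_right i2)
 fix y assume "y : {l..r}"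
 hence y: "y : {-b..b}" using lrb by auto
 have "cmod (zt' y * ?u y) <= Z * (1 * (8 / 3 * (v / ((x - y)\<^sup>2 + v\<^sup>2))))"
 unfolding norm_mult using Z(2)[OF y] Z(1) thle[of y] kern_0_bound[OF xb(1) y v(1)] by (intro mult_mono mult_nonneg_nonneg) auto
 hence "cmod (g y) * cmod (zt' y * ?u y) <= cmod (g y) * (Z * (1 * (8 / 3 * (v / ((x - y)\<^sup>2 + v\<^sup>2)))))"
 by (intro mult_lm) auto
 thus "cmod (g y * (zt' y * ?u y)) <= 8 * Z / 3 * (cmod (g y) * (v / ((x - y)\<^sup>2 + v\<^sup>2)))"
 by (simp add: norm_mult mult_ac)
 qed
 also have "... = 8 * Z / 3 * (LINT y:{l..r}|lborel. cmod (g y) * (v / ((x - y)\<^sup>2 + v\<^sup>2)))" by (rule set_integral_mult_right)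
 finally have Lb: "cmod Lg <= 8 * Z / 3 * (LINT y:{l..r}|lborel. cmod (g y) * (v / ((x - y)\<^sup>2 + v\<^sup>2)))" .
 define P where "P = (LINT y:{l..r}|lborel. cmod (g y) * (v / ((x - y)\<^sup>2 + v\<^sup>2)))"
 have P0: "0 <= P" unfolding P_def set_lebesgue_integral_def using v(1) by (intro integral_nonneg_AE AE_I2) auto
 have "cmod (2 * of_real pi * \<i> * H ?w) <= cmod Lg + cmod (fact k * bot F - Lg) + cmod (fact k * bot F - 2 * of_real pi * \<i> * H ?w)"
 using norm_triangle_ineq4[of "Lg + (fact k * bot F - Lg)" "fact k * bot F - 2 * of_real pi * \<i> * H ?w"]
 norm_triangle_ineq[of Lg "fact k * bot F - Lg"] by simp
 hence "2 * pi * cmod (H ?w) <= 8 * Z / 3 * P + (r - l) * S * Z * Eb * v + fact k * (Q * v)"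
 using A Bd Lb by (simp add: norm_mult P_def)
 also have "... <= C * P + C * v"
 proof -
 have "8 * Z / 3 * P <= C * P" using P0 Q0 lr(1) S(1) Z(1) Eb by (intro mult_rm) (auto simp: C_def)
 moreover have "((r - l) * S * Z * Eb + fact k * Q) * v <= C * v" using v(1) Z(1) by (intro mult_rm) (auto simp: C_def)
 ultimately show ?thesis by (simp add: algebra_simps)
 qed
 finally have "2 * pi * cmod (H ?w) <= C * P + C * v" .
 moreover have "cmod (H ?w) <= 2 * pi * cmod (H ?w)"
 using mult_rm[of 1 "2 * pi" "cmod (H ?w)"] pi_gt3 by simp
 ultimately show ?thesis by (simp add: P_def)
 qed
 moreover have "0 < v0" "v0 < et" using et by (simp_all add: v0_def)
 ultimately show ?thesis using C0 unfolding l_def r_def by blast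
qed

end

section \<open>Integrals of \<open>H\<close> over the parallels to the arc\<close>

lemma poisson_has_derivative:
 assumes v: "0 < v"
 shows "((%x::real. arctan ((x - y) / v)) hrd v / ((x - y)\<^sup>2 + v\<^sup>2)) (at x)"
proof -
 have pos: "0 < (x - y)\<^sup>2 + v\<^sup>2" using v by (simp add: add_nonneg_pos)
 have "((%x. arctan ((x - y) / v)) hrd inverse (1 + ((x - y) / v)\<^sup>2) * (1 / v)) (at x)"
 using v by (auto intro!: derivative_eq_intros)
 moreover have "inverse (1 + ((x - y) / v)\<^sup>2) * (1 / v) = v / ((x - y)\<^sup>2 + v\<^sup>2)"
 using v pos by (simp add: power_divide field_simps power2_eq_square)
 ultimately show ?thesis by simp
qed

lemma poisson_nn_integral_le:
 assumes v: "0 < v" and "p <= q"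
 shows "(\<integral>\<^sup>+x\<in>{p..q}. enn (v / ((x - y)\<^sup>2 + v\<^sup>2)) \<partial>lborel) <= enn pi"
proof -
 have pos: "0 < (x - y)\<^sup>2 + v\<^sup>2" for x using v by (simp add: add_nonneg_pos)
 have "(NI (%x. enn (v / ((x - y)\<^sup>2 + v\<^sup>2)) * ind {p..q} x)) = enn (arctan ((q - y) / v) - arctan ((p - y) / v))"
 by (rule nn_integral_FTC_Icc) (use assms pos v in \<open>auto intro!: less_imp_le divide_pos_pos has_field_derivative_at_within poisson_has_derivative\<close>)
 also have "... <= enn pi"
 using arctan_bounded[of "(q - y) / v"] arctan_bounded[of "(p - y) / v"] by (intro ennreal_leI) linarith
 finally show ?thesis .
qed

context boundary_data
begin

text \<open>By \<open>H_representation\<close>, |H| is dominated by a Poisson integral of |g| up to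
  O(v); Fubini and the Poisson mass, at most pi, give the uniform bound. The smallness near
  \<open>A\<close> comes from the integrability of \<open>g\<close> and its vanishing on
  \<open>A\<close>.\<close>

lemma H_slices:
 assumes d: "0 < d" "j0 < x1 - 3 * d" "x1 + 3 * d < j1"
 shows "EX M v0. 0 < v0 & v0 < et & (ALL v. 0 < v --> v < v0 --> (\<integral>\<^sup>+x\<in>{x1 - d..x1 + d}. enn (cmod (H (pt x v))) \<partial>lborel) <= enn M) &
 (ALL A. compact A --> A ~= {} --> A <= {x1 - d..x1 + d} --> (ALL y:A. g y = 0) --> (\<forall>e>0. \<exists>dl>0. \<exists>v1>0. ALL v. 0 < v --> v < v1 -->
 (\<integral>\<^sup>+x\<in>{x : {x1 - d..x1 + d}. infdist x A <= dl}. enn (cmod (H (pt x v))) \<partial>lborel) <= enn e))"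
proof -
 obtain C v0 where v0: "0 < v0" "v0 < et" and C: "0 < C" and rep: "!!x v. x : {x1 - d..x1 + d} ==> 0 < v ==> v < v0 ==>
 cmod (H (pt x v)) <= C * (LINT y:{x1 - 3 * d..x1 + 3 * d}|lborel. cmod (g y) * (v / ((x - y)\<^sup>2 + v\<^sup>2))) + C * v"
 using H_representation[OF d] by blast
 define l r where "l = x1 - 3 * d" and "r = x1 + 3 * d"
 define gm where "gm y = ind {l..r} y * cmod (g y)" for y
 have gl: "set_integrable lborel {l..r} g" by (rule set_integrable_subset[OF g]) (use d in \<open>auto simp: l_def r_def\<close>)
 have gi: "integrable lborel gm"
 using set_integrable_norm[OF gl] by (simp add: set_integrable_def gm_def[abs_def])
 have [measurable]: "gm : borel_measurable lborel" using gi by (rule borel_measurable_integrable)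
 have gm0: "0 <= gm y" for y by (simp add: gm_def)
 have Ifin: "(NI (%y. enn (gm y))) = enn (integral\<^sup>L lborel gm)" by (rule nn_integral_eq_integral[OF gi]) (simp add: gm0)
 define P where "P x y v = v / ((x - y)\<^sup>2 + v\<^sup>2)" for x y v :: real
 have P0: "0 <= P x y v" if "0 < v" for x y v using that by (simp add: P_def add_nonneg_nonneg)
 have [measurable]: "(%z. P (fst z) (snd z) v) : borel_measurable (lborel \<Otimes>\<^sub>M lborel)" "(%y. P x y v) : borel_measurable lborel" "(%x. P x y v) : borel_measurable lborel" for x y v
 unfolding P_def by measurable
 have pt: "enn (cmod (H (pt x v))) <= enn C * (NI (%y. enn (gm y * P x y v))) + enn (C * v)"
 if x: "x : {x1 - d..x1 + d}" and v: "0 < v" "v < v0" for x v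
 proof -
 have Pb: "P x y v <= 1 / v" for y
 proof -
 have "v / ((x - y)\<^sup>2 + v\<^sup>2) <= v / v\<^sup>2" using v by (intro divide_left_mono mult_pos_pos) (auto simp: add_nonneg_pos)
 thus ?thesis using v by (simp add: P_def power2_eq_square)
 qed
 have ig: "integrable lborel (%y. gm y * P x y v)"
 proof (rule Bochner_Integration.integrable_bound[OF integrable_mult_left[of "1 / v" lborel gm]])
 show "AE y in lborel. norm (gm y * P x y v) <= norm (gm y * (1 / v))"
 proof (rule AE_I2)
 fix y
 have "0 <= gm y * P x y v" "gm y * P x y v <= gm y * (1 / v)"
 using mult_lm[OF Pb gm0] P0[OF v(1)] gm0 by auto
 thus "norm (gm y * P x y v) <= norm (gm y * (1 / v))"
 unfolding real_norm_def by (simp only: abs_of_nonneg order_trans[OF \<open>0 <= gm y * P x y v\<close>])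
 qed
 qed (use gi in auto)
 have "(LINT y:{x1 - 3 * d..x1 + 3 * d}|lborel. cmod (g y) * (v / ((x - y)\<^sup>2 + v\<^sup>2))) = integral\<^sup>L lborel (%y. gm y * P x y v)"
 unfolding set_lebesgue_integral_def gm_def P_def l_def r_def by (simp add: mult.assoc)
 with rep[OF x v] have "cmod (H (pt x v)) <= C * integral\<^sup>L lborel (%y. gm y * P x y v) + C * v" by simp
 hence "enn (cmod (H (pt x v))) <= enn (C * integral\<^sup>L lborel (%y. gm y * P x y v) + C * v)" by (rule ennreal_leI)
 also have "... = enn C * enn (integral\<^sup>L lborel (%y. gm y * P x y v)) + enn (C * v)"
 using C v by (simp add: ennreal_mult ennreal_plus integral_nonneg_AE gm0 P0)
 also have "enn (integral\<^sup>L lborel (%y. gm y * P x y v)) = (NI (%y. enn (gm y * P x y v)))"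
 by (rule nn_integral_eq_integral[OF ig, symmetric]) (use gm0 P0 v in auto)
 finally show ?thesis .
 qed
 have key: "(\<integral>\<^sup>+x\<in>A. enn (cmod (H (pt x v))) \<partial>lborel) <=
 enn C * (NI (%y. enn (gm y) * (\<integral>\<^sup>+x\<in>A. enn (P x y v) \<partial>lborel))) + enn (C * v * (2 * d))"
 if A: "A : sets lborel" and Asub: "A <= {x1 - d..x1 + d}" and v: "0 < v" "v < v0" for A v
 proof -
 note [measurable] = A
 have "(\<integral>\<^sup>+x\<in>A. enn (cmod (H (pt x v))) \<partial>lborel) <=
 (NI (%x. enn C * (NI (%y. enn (gm y * P x y v) * ind A x)) + enn (C * v) * ind A x))"
 proof (rule nn_integral_mono)
 fix x
 show "enn (cmod (H (pt x v))) * ind A x <= enn C * (NI (%y. enn (gm y * P x y v) * ind A x)) + enn (C * v) * ind A x"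
 using pt[of x v] Asub v by (cases "x : A") auto
 qed
 also have "... = enn C * (NI (%x. (NI (%y. enn (gm y * P x y v) * ind A x)))) + enn (C * v) * emeasure lborel A"
 by (subst nn_integral_add) (use A in \<open>auto simp: nn_integral_cmult nn_integral_indicator[OF A]\<close>)
 also have "(NI (%x. (NI (%y. enn (gm y * P x y v) * ind A x)))) =
 (NI (%y. (NI (%x. enn (gm y * P x y v) * ind A x))))"
 by (rule lborel_pair.Fubini'[symmetric]) (simp add: split_beta)
 also have "... = (NI (%y. enn (gm y) * (\<integral>\<^sup>+x\<in>A. enn (P x y v) \<partial>lborel)))"
 using gm0 P0[OF v(1)] by (intro nn_integral_cong) (simp add: ennreal_mult mult.assoc nn_integral_cmult)
 also have "enn (C * v) * emeasure lborel A <= enn (C * v) * enn (2 * d)"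
 proof (rule mult_lm)
 have "emeasure lborel A <= emeasure lborel {x1 - d..x1 + d}" by (rule emeasure_mono[OF Asub]) simp
 thus "emeasure lborel A <= enn (2 * d)" using d(1) by simp
 qed simp
 also have "enn (C * v) * enn (2 * d) = enn (C * v * (2 * d))" using C v d by (intro ennreal_mult[symmetric]) auto
 finally show ?thesis by (simp add: add_mono)
 qed
 have qpi: "(\<integral>\<^sup>+x\<in>A. enn (P x y v) \<partial>lborel) <= enn pi" if "A <= {x1 - d..x1 + d}" "0 < v" for A y v
 proof -
 have "(\<integral>\<^sup>+x\<in>A. enn (P x y v) \<partial>lborel) <= (\<integral>\<^sup>+x\<in>{x1 - d..x1 + d}. enn (P x y v) \<partial>lborel)"
 using that by (intro nn_integral_mono) (auto simp: indicator_def)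
 also have "... <= enn pi" unfolding P_def by (rule poisson_nn_integral_le) (use that d in auto)
 finally show ?thesis .
 qed
 define M where "M = C * (pi * integral\<^sup>L lborel gm) + C * v0 * (2 * d)"
 have I0: "0 <= integral\<^sup>L lborel gm" using gm0 by (simp add: integral_nonneg_AE)
 have S1: "(\<integral>\<^sup>+x\<in>{x1 - d..x1 + d}. enn (cmod (H (pt x v))) \<partial>lborel) <= enn M" if v: "0 < v" "v < v0" for v
 proof -
 have "(\<integral>\<^sup>+x\<in>{x1 - d..x1 + d}. enn (cmod (H (pt x v))) \<partial>lborel) <=
 enn C * (NI (%y. enn (gm y) * enn pi)) + enn (C * v * (2 * d))"
 by (rule order_trans[OF key]) (use v qpi[of "{x1 - d..x1 + d}" v] in \<open>auto intro!: add_mono mult_lm nn_integral_mono\<close>)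
 also have "(NI (%y. enn (gm y) * enn pi)) = enn (pi * integral\<^sup>L lborel gm)"
 by (subst nn_integral_multc, simp, unfold Ifin, subst ennreal_mult''[symmetric]) (auto simp: I0 mult.commute)
 also have "enn C * enn (pi * integral\<^sup>L lborel gm) + enn (C * v * (2 * d)) = enn (C * (pi * integral\<^sup>L lborel gm) + C * v * (2 * d))"
 using C I0 v d by (simp add: ennreal_mult ennreal_plus)
 also have "... <= enn M" using C v d unfolding M_def by (intro ennreal_leI add_left_mono mult_rm mult_lm) auto
 finally show ?thesis .
 qed
 \<comment> \<open>On a compact set only the mass of \<open>g\<close> on the set itself survives as
   v tends to 0: the part off it contributes a null sequence, by dominated convergence with the
   majorant pi |g|.\<close>
 have S2: "\<exists>v1>0. ALL v. 0 < v --> v < v1 --> (\<integral>\<^sup>+x\<in>A. enn (cmod (H (pt x v))) \<partial>lborel) <= enn C * (\<integral>\<^sup>+y\<in>A. enn (gm y) \<partial>lborel) * enn pi + enn e"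
 if A: "compact A" "A <= {x1 - d..x1 + d}" and e: "0 < e" for A e
 proof -
 have Am[measurable]: "A : sets lborel" using A(1) by (simp add: compact_imp_closed)
 let ?I = "\<integral>\<^sup>+y\<in>A. enn (gm y) \<partial>lborel"
 define gc where "gc y = ind (- A) y * gm y" for y
 have gc: "0 <= gc y" "gc y <= gm y" for y using gm0[of y] by (auto simp: gc_def indicator_def)
 have [measurable]: "gc : borel_measurable lborel" unfolding gc_def[abs_def] by measurable
 have "\<forall>\<^sub>F v in at_right 0. (\<integral>\<^sup>+x\<in>A. enn (cmod (H (pt x v))) \<partial>lborel) <= enn C * ?I * enn pi + enn e"
 proof (rule sequentially_imp_eventually_at_right[OF v0(1)])
 fix f :: "nat => real"
 assume f: "!!n. 0 < f n" "!!n. f n < v0" "decseq f" "f \<longlonglongrightarrow> 0"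
 let ?q = "%n y. \<integral>\<^sup>+x\<in>A. enn (P x y (f n)) \<partial>lborel"
 have lim: "(%n. enn (gc y) * ?q n y) \<longlonglongrightarrow> 0" for y
 proof (cases "y : A")
 case True
 thus ?thesis by (simp add: gc_def)
 next
 case False
 then obtain dl where dl: "0 < dl" "!!x. x : A ==> dl <= dist y x"
 using separate_point_closed[of A y] A(1) by (auto simp: compact_imp_closed)
 have "?q n y <= enn (f n / dl\<^sup>2 * (2 * d))" for n
 proof -
 have "?q n y <= (NI (%x. enn (f n / dl\<^sup>2) * ind {x1 - d..x1 + d} x))"
 proof (rule nn_integral_mono)
 fix x
 show "enn (P x y (f n)) * ind A x <= enn (f n / dl\<^sup>2) * ind {x1 - d..x1 + d} x"
 proof (cases "x : A")
 case True
 have "dl\<^sup>2 <= (x - y)\<^sup>2" using dl(1) dl(2)[OF True] by (intro abs_le_square_iff[THEN iffD1]) (simp add: dist_real_def)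
 hence "P x y (f n) <= f n / dl\<^sup>2" unfolding P_def using f(1)[of n] dl(1)
 by (intro divide_left_mono mult_pos_pos) (auto simp: add_nonneg_pos intro: add_increasing2)
 thus ?thesis using True A(2) by (auto intro!: ennreal_leI)
 qed simp
 qed
 also have "... = enn (f n / dl\<^sup>2) * enn (2 * d)" using d(1) by (simp add: nn_integral_cmult_indicator)
 also have "... = enn (f n / dl\<^sup>2 * (2 * d))" using f(1)[of n] d(1) by (intro ennreal_mult[symmetric]) auto
 finally show ?thesis .
 qed
 hence up: "enn (gc y) * ?q n y <= enn (gc y * (f n / dl\<^sup>2 * (2 * d)))" for n
 using gc(1)[of y] f(1)[of n] d(1) by (subst ennreal_mult) (auto intro!: mult_lm)
 have "(%n. enn (gc y * (f n / dl\<^sup>2 * (2 * d)))) \<longlonglongrightarrow> enn (gc y * (0 / dl\<^sup>2 * (2 * d)))"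
 by (intro tendsto_ennrealI tendsto_intros f) (use dl in simp)
 hence to0: "(%n. enn (gc y * (f n / dl\<^sup>2 * (2 * d)))) \<longlonglongrightarrow> 0" by simp
 show ?thesis
 by (rule tendsto_sandwich[OF _ _ tendsto_const to0]) (use up in \<open>simp_all only: eventually_True zero_le\<close>)
 qed
 have qm[measurable]: "(%y. ?q n y) : borel_measurable lborel" for n
 proof -
 have [measurable]: "(%z. enn (P (snd z) (fst z) (f n)) * ind A (snd z)) : borel_measurable (lborel \<Otimes>\<^sub>M lborel)"
 unfolding P_def by measurable
 show ?thesis
 using lborel.borel_measurable_nn_integral[of "%y x. enn (P x y (f n)) * ind A x" lborel] by (simp add: split_beta)
 qed
 have "(%n. \<integral>\<^sup>+y. enn (gc y) * ?q n y \<partial>lborel) \<longlonglongrightarrow> (\<integral>\<^sup>+(y::real). 0 \<partial>lborel)"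
 proof (rule nn_integral_dominated_convergence[where w = "%y. enn (gm y) * enn pi"])
 show "(%y. enn (gc y) * ?q n y) : borel_measurable lborel" for n by measurable
 show "AE y in lborel. enn (gc y) * ?q n y <= enn (gm y) * enn pi" for n
 using qpi[OF A(2) f(1)] gc by (intro AE_I2 mult_mono ennreal_leI) auto
 show "(NI (%y. enn (gm y) * enn pi)) < \<infinity>"
 by (simp add: nn_integral_multc Ifin ennreal_mult_less_top)
 show "AE y in lborel. (%n. enn (gc y) * ?q n y) \<longlonglongrightarrow> 0" using lim by auto
 qed auto
 hence "(%n. enn C * (NI (%y. enn (gc y) * ?q n y)) + enn (C * f n * (2 * d))) \<longlonglongrightarrow> enn C * 0 + enn (C * 0 * (2 * d))"
 by (intro tendsto_add ennreal_tendsto_cmult tendsto_ennrealI tendsto_intros f) auto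
 hence "(%n. enn C * (NI (%y. enn (gc y) * ?q n y)) + enn (C * f n * (2 * d))) \<longlonglongrightarrow> 0" by simp
 hence "\<forall>\<^sub>F n in sequentially. enn C * (NI (%y. enn (gc y) * ?q n y)) + enn (C * f n * (2 * d)) < enn e"
 using e by (intro order_tendstoD) auto
 thus "\<forall>\<^sub>F n in sequentially. (\<integral>\<^sup>+x\<in>A. enn (cmod (H (pt x (f n)))) \<partial>lborel) <= enn C * ?I * enn pi + enn e"
 proof eventually_elim
 case (elim n)
 have "(NI (%y. enn (gm y) * ?q n y)) <= (NI (%y. enn (gm y) * ind A y * enn pi + enn (gc y) * ?q n y))"
 using qpi[OF A(2) f(1)] by (intro nn_integral_mono) (auto simp: gc_def indicator_def intro!: mult_lm)
 also have "... = ?I * enn pi + (NI (%y. enn (gc y) * ?q n y))"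
 by (subst nn_integral_add) (auto simp: nn_integral_multc)
 finally have "enn C * (NI (%y. enn (gm y) * ?q n y)) <= enn C * (?I * enn pi + (NI (%y. enn (gc y) * ?q n y)))"
 by (rule mult_lm) simp
 hence "enn C * (NI (%y. enn (gm y) * ?q n y)) + enn (C * f n * (2 * d)) <=
 enn C * ?I * enn pi + (enn C * (NI (%y. enn (gc y) * ?q n y)) + enn (C * f n * (2 * d)))"
 by (simp add: distrib_left mult.assoc add.assoc add_right_mono)
 also have "... <= enn C * ?I * enn pi + enn e" using elim by (intro add_left_mono less_imp_le)
 finally show ?case using key[OF Am A(2) f(1)[of n] f(2)[of n]] by (rule order_trans[rotated])
 qed
 qed
 thus ?thesis unfolding eventually_at_right_field by auto
 qed
 have S3: "\<exists>dl>0. \<exists>v1>0. ALL v. 0 < v --> v < v1 -->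
 (\<integral>\<^sup>+x\<in>{x : {x1 - d..x1 + d}. infdist x A <= dl}. enn (cmod (H (pt x v))) \<partial>lborel) <= enn e"
 if A: "compact A" "A ~= {}" "A <= {x1 - d..x1 + d}" "ALL y:A. g y = 0" and e: "0 < e" for A e
 proof -
 \<comment> \<open>\<open>S2\<close> is applied to closed neighbourhoods of \<open>A\<close>; they
   shrink to \<open>A\<close>, where \<open>g\<close> vanishes, so the mass of \<open>g\<close> on
   them tends to 0.\<close>
 define N where "N dl = {x : {x1 - d..x1 + d}. infdist x A <= dl}" for dl
 have cN: "closed (N dl)" for dl
 proof -
 have "N dl = {x1 - d..x1 + d} \<inter> {x. infdist x A <= dl}" by (auto simp: N_def)
 thus ?thesis by (simp add: closed_Int closed_Collect_le continuous_on_infdist continuous_intros)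
 qed
 have N2: "N dl <= {x1 - d..x1 + d}" for dl by (auto simp: N_def)
 have N1: "compact (N dl)" for dl
 using bounded_subset[OF compact_imp_bounded[OF compact_Icc] N2] cN by (simp add: compact_eq_bounded_closed)
 have [measurable]: "N dl : sets borel" for dl using cN by auto
 have "(%n. \<integral>\<^sup>+y. enn (gm y) * ind (N (inverse (Suc n))) y \<partial>lborel) \<longlonglongrightarrow> (\<integral>\<^sup>+(y::real). 0 \<partial>lborel)"
 proof (rule nn_integral_dominated_convergence[where w = "%y. enn (gm y)"])
 show "(NI (%y. enn (gm y))) < \<infinity>" by (simp add: Ifin)
 show "AE y in lborel. enn (gm y) * ind (N (inverse (Suc n))) y <= enn (gm y)" for n
 by (intro AE_I2) (auto simp: indicator_def)
 have "(%n. enn (gm y) * ind (N (inverse (Suc n))) y) \<longlonglongrightarrow> 0" for y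
 proof (cases "y : A")
 case True
 thus ?thesis using A(4) by (simp add: gm_def)
 next
 case False
 hence "0 < infdist y A" using A(1,2) by (simp add: infdist_pos_not_in_closed compact_imp_closed)
 hence "\<forall>\<^sub>F n in sequentially. inverse (real (Suc n)) < infdist y A"
 by (rule order_tendstoD(2)[OF LIMSEQ_inverse_real_of_nat])
 hence "\<forall>\<^sub>F n in sequentially. enn (gm y) * ind (N (inverse (Suc n))) y = 0"
 by eventually_elim (auto simp: N_def)
 thus ?thesis by (rule tendsto_eventually)
 qed
 thus "AE y in lborel. (%n. enn (gm y) * ind (N (inverse (Suc n))) y) \<longlonglongrightarrow> 0" by auto
 qed auto
 from ennreal_tendsto_cmult[OF ennreal_less_top ennreal_tendsto_cmult[OF ennreal_less_top this], of pi C]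
 have "(%n. enn pi * (enn C * (NI (%y. enn (gm y) * ind (N (inverse (Suc n))) y)))) \<longlonglongrightarrow> 0"
 by simp
 hence "\<forall>\<^sub>F n in sequentially. enn pi * (enn C * (NI (%y. enn (gm y) * ind (N (inverse (Suc n))) y))) < enn (e / 2)"
 using e by (intro order_tendstoD) auto
 then obtain n where n: "enn C * (NI (%y. enn (gm y) * ind (N (inverse (Suc n))) y)) * enn pi < enn (e / 2)"
 using eventually_happens'[OF sequentially_bot] unfolding mult.commute[of "enn pi"] by blast
 obtain v1 where v1: "0 < v1" "!!v. 0 < v ==> v < v1 ==> (\<integral>\<^sup>+x\<in>N (inverse (Suc n)). enn (cmod (H (pt x v))) \<partial>lborel)
 <= enn C * (\<integral>\<^sup>+y\<in>N (inverse (Suc n)). enn (gm y) \<partial>lborel) * enn pi + enn (e / 2)"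
 using S2[OF N1 N2, of "e / 2"] half_gt_zero[OF e] by blast
 have "(\<integral>\<^sup>+x\<in>N (inverse (Suc n)). enn (cmod (H (pt x v))) \<partial>lborel) <= enn e" if "0 < v" "v < v1" for v
 proof -
 have "(\<integral>\<^sup>+x\<in>N (inverse (Suc n)). enn (cmod (H (pt x v))) \<partial>lborel) <= enn (e / 2) + enn (e / 2)"
 by (rule order_trans[OF v1(2)[OF that]]) (use n in \<open>intro add_right_mono less_imp_le\<close>)
 also have "... = enn e" using ennreal_plus[of "e / 2" "e / 2"] e by simp
 finally show ?thesis .
 qed
 moreover have "0 < inverse (real (Suc n))" by simp
 ultimately show ?thesis using v1(1) unfolding N_def by blast
 qed
 show ?thesis using v0 S1 S3 by blast
qed

end

lemma mean_value_between:
 fixes u :: "real => real"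
 assumes "!!x. x : {p..q} ==> (u hrd u1 x) (at x)" "x : {p..q}" "y : {p..q}"
 shows "EX z:{p..q}. \<bar>z - y\<bar> <= \<bar>x - y\<bar> & u x - u y = (x - y) * u1 z"
proof -
 consider "x < y" | "x = y" | "y < x" by linarith
 thus ?thesis
 proof cases
 case 1
 then obtain z where "x < z" "z < y" "u y - u x = (y - x) * u1 z"
 using MVT2[of x y u u1] assms by auto
 thus ?thesis using assms 1 by (intro bexI[of _ z]) (auto simp: algebra_simps)
 next
 case 3
 then obtain z where "y < z" "z < x" "u x - u y = (x - y) * u1 z"
 using MVT2[of y x u u1] assms by auto
 thus ?thesis using assms 3 by (intro bexI[of _ z]) (auto simp: algebra_simps)
 qed (use assms in auto)
qed

text \<open>Pigeonhole: \<open>n\<close> intervals of equal length cover \<open>{p..q}\<close>, so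
  they cannot all contain less than the mean share of \<open>A\<close>. This takes the place of
  Lebesgue's density theorem.\<close>

lemma exists_dense_interval:
 fixes A :: "real set"
 assumes A: "A : sets lborel" "A <= {p..q}" and pq: "p < q" and n: "0 < n"
 shows "EX y0:{p..q}. 2 * ((q - p) / (2 * real n)) * (measure lborel A / (q - p)) <= measure lborel (A \<inter> {y0 - (q - p) / (2 * real n)..y0 + (q - p) / (2 * real n)})"
proof (rule ccontr)
 assume neg: "~ ?thesis"
 define l where "l = (q - p) / (2 * real n)"
 have l: "0 < l" "2 * l * real n = q - p" using pq n by (auto simp: l_def)
 define c where "c i = p + (2 * real i + 1) * l" for i :: nat
 have small: "measure lborel (A \<inter> {c i - l..c i + l}) < 2 * l * (measure lborel A / (q - p))" if "i < n" for i
 proof -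
 have "(2 * real i + 1) * l <= (2 * real n) * l" using that l(1) by (intro mult_rm) auto
 moreover have "(2 * real n) * l = q - p" unfolding l(2)[symmetric] by simp
 moreover have "0 <= (2 * real i + 1) * l" using l(1) by simp
 ultimately have "c i : {p..q}" unfolding c_def atLeastAtMost_iff by linarith
 thus ?thesis using neg unfolding l_def by (meson not_le)
 qed
 have cov: "A <= (\<Union>i<n. A \<inter> {c i - l..c i + l})"
 proof
 fix x assume x: "x : A"
 hence px: "p <= x" "x <= q" using A(2) by auto
 show "x : (\<Union>i<n. A \<inter> {c i - l..c i + l})"
 proof (cases "x = q")
 case True
 have "c (n - 1) = p + 2 * l * real n - l" using n by (simp add: c_def of_nat_diff algebra_simps)
 hence "x : {c (n - 1) - l..c (n - 1) + l}" using True l by auto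
 thus ?thesis using x n by (intro UN_I[of "n - 1"]) auto
 next
 case False
 define i where "i = nat \<lfloor>(x - p) / (2 * l)\<rfloor>"
 have i: "real i <= (x - p) / (2 * l)" "(x - p) / (2 * l) < real i + 1"
 using px l(1) by (auto simp: i_def)
 hence ii: "real i * (2 * l) <= x - p" "x - p < (real i + 1) * (2 * l)"
 using l(1) by (auto simp: pos_le_divide_eq pos_divide_less_eq)
 moreover have "real n * (2 * l) = q - p" unfolding l(2)[symmetric] by simp
 ultimately have "real i * (2 * l) < real n * (2 * l)" using False px(2) by linarith
 hence "i < n" using l(1) by simp
 moreover have "x : {c i - l..c i + l}" using ii by (auto simp: c_def algebra_simps)
 ultimately show ?thesis using x by auto
 qed
 qed
 have fin: "A \<inter> {c i - l..c i + l} : fmeasurable lborel" for i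
 by (rule fmeasurableI2[of "{c i - l..c i + l}"]) (use A l(1) in \<open>auto intro!: fmeasurableI\<close>)
 have "measure lborel A <= measure lborel (\<Union>i<n. A \<inter> {c i - l..c i + l})"
 by (rule measure_mono_fmeasurable[OF cov A(1)]) (intro fmeasurable.finite_UN fin, simp)
 also have "... <= (\<Sum>i<n. measure lborel (A \<inter> {c i - l..c i + l}))"
 by (rule measure_UNION_le) (simp, rule fmeasurableD[OF fin])
 also have "... < (\<Sum>i<n. 2 * l * (measure lborel A / (q - p)))"
 by (rule sum_strict_mono) (use small n in auto)
 also have "... = (2 * l * real n) * (measure lborel A / (q - p))" by simp
 also have "... = measure lborel A" unfolding l(2) using pq by simp
 finally show False by simp
qed

section \<open>The Cauchy potential of a part of the arc\<close>

context graph_arc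
begin

lemma pt_dist_lower:
 assumes "x : {-b..b}" "y : {-b..b}"
 shows "(y - x)\<^sup>2 + (s - t)\<^sup>2 <= 4 * (cmod (pt y s - pt x t))\<^sup>2"
 and "(cmod (pt y s - pt x t))\<^sup>2 <= 2 * ((y - x)\<^sup>2 + (s - t)\<^sup>2)"
proof -
 define e v where "e = ph y - ph x" and "v = s - t"
 have "e\<^sup>2 <= ((y - x) / 2)\<^sup>2"
 unfolding e_def by (rule abs_le_square_iff[THEN iffD1]) (use lip[OF assms(2,1)] in simp)
 hence e: "e\<^sup>2 <= (y - x)\<^sup>2 / 4" by (simp add: power_divide)
 have c: "(cmod (pt y s - pt x t))\<^sup>2 = (y - x)\<^sup>2 + (e + v)\<^sup>2" by (simp add: cmod_power2 e_def v_def algebra_simps)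
 have "0 <= (v + 2 * e)\<^sup>2" "0 <= (e - v)\<^sup>2" by simp_all
 hence "v\<^sup>2 <= 2 * (e + v)\<^sup>2 + 2 * e\<^sup>2" "(e + v)\<^sup>2 <= 2 * e\<^sup>2 + 2 * v\<^sup>2"
 by (simp_all add: power2_eq_square algebra_simps)
 moreover have "a + V <= 4 * (a + c)" "a + c <= 2 * (a + V)"
 if "V <= 2 * c + 2 * E" "c <= 2 * E + 2 * V" "E <= a / 4" "0 <= a" "0 <= c" for a c V E :: real
 using that by argo+
 ultimately have "(y - x)\<^sup>2 + v\<^sup>2 <= 4 * ((y - x)\<^sup>2 + (e + v)\<^sup>2)" "(y - x)\<^sup>2 + (e + v)\<^sup>2 <= 2 * ((y - x)\<^sup>2 + v\<^sup>2)"
 using e zero_le_power2 by blast+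
 thus "(y - x)\<^sup>2 + (s - t)\<^sup>2 <= 4 * (cmod (pt y s - pt x t))\<^sup>2"
 "(cmod (pt y s - pt x t))\<^sup>2 <= 2 * ((y - x)\<^sup>2 + (s - t)\<^sup>2)" unfolding c v_def by simp_all
qed

definition ph1 :: "real => real" where "ph1 x = fder ph (at x) 1"

lemma ph_deriv:
 assumes "x : {-b..b}"
 shows "(ph hrd ph1 x) (at x)"
 unfolding ph1_def hrd_hvd
 using smooth_has_vector_derivative[OF smooth subsetD[OF sub_B assms], of UNIV] .

lemma taylor_remainder:
 "\<exists>K\<ge>0. ALL x:{-b..b}. ALL y:{-b..b}. \<bar>ph x - ph y - ph1 y * (x - y)\<bar> <= K * (x - y)\<^sup>2"
proof -
 have s1: "Csm {-B<..<B} ph1" unfolding ph1_def[abs_def] by (rule smooth_frechet_derivative[OF smooth])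
 define ph2 where "ph2 x = fder ph1 (at x) 1" for x
 have s2: "Csm {-B<..<B} ph2" unfolding ph2_def[abs_def] by (rule smooth_frechet_derivative[OF s1])
 have d2: "(ph1 hrd ph2 x) (at x)" if "x : {-b..b}" for x
 unfolding ph2_def hrd_hvd
 using smooth_has_vector_derivative[OF s1 subsetD[OF sub_B that], of UNIV] .
 obtain K where K: "K > 0" "!!x. x : {-b..b} ==> norm (ph2 x) <= K"
 using compact_bd[OF con_subset[OF smooth_con[OF s2] sub_B] compact_Icc] by blast
 have "\<bar>ph x - ph y - ph1 y * (x - y)\<bar> <= K * (x - y)\<^sup>2" if x: "x : {-b..b}" and y: "y : {-b..b}" for x y
 proof -
 obtain z where z: "z : {-b..b}" "\<bar>z - y\<bar> <= \<bar>x - y\<bar>" "ph x - ph y = (x - y) * ph1 z"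
 using mean_value_between[OF ph_deriv x y] by blast
 obtain w where w: "w : {-b..b}" "ph1 z - ph1 y = (z - y) * ph2 w"
 using mean_value_between[OF d2 z(1) y] by blast
 have "ph x - ph y - ph1 y * (x - y) = (x - y) * (ph1 z - ph1 y)" unfolding z(3) by (simp add: algebra_simps)
 also have "\<bar>...\<bar> = \<bar>x - y\<bar> * (\<bar>z - y\<bar> * \<bar>ph2 w\<bar>)" unfolding w(2) by (simp add: abs_mult)
 also have "... <= \<bar>x - y\<bar> * (\<bar>x - y\<bar> * K)"
 using z(2) K(2)[OF w(1)] by (intro mult_lm mult_mono) auto
 finally show ?thesis by (simp add: power2_eq_square mult_ac)
 qed
 thus ?thesis using K(1) by (intro exI[of _ K]) auto
qed

text \<open>The y-derivative of arg(pt y 0 - w), the speed at which the arc turns as seen from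
  \<open>w\<close>.\<close>

definition angle :: "real => complex => real" where "angle y w = Im (zt' y / (pt y 0 - w))"

text \<open>Along the arc the harmonic function \<open>w \<mapsto> \<integral> angle y w dy\<close> behaves like a Poisson integral up to
 bounded terms.\<close>
lemma angle_bounds:
 assumes K: "0 <= K" "!!x y. x : {-b..b} ==> y : {-b..b} ==> \<bar>ph x - ph y - ph1 y * (x - y)\<bar> <= K * (x - y)\<^sup>2"
 and x: "x : {-b..b}" and y: "y : {-b..b}" and v: "0 < v"
 shows "angle y (pt x v) <= 4 * (v / ((y - x)\<^sup>2 + v\<^sup>2)) + 4 * K"
 and "v / (2 * ((y - x)\<^sup>2 + v\<^sup>2)) - 4 * K <= angle y (pt x v)"
proof -
 define D where "D = (cmod (pt y 0 - pt x v))\<^sup>2"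
 define R where "R = ph x - ph y - ph1 y * (x - y)"
 have D: "(y - x)\<^sup>2 + v\<^sup>2 <= 4 * D" "D <= 2 * ((y - x)\<^sup>2 + v\<^sup>2)"
 unfolding D_def using pt_dist_lower[OF x y, of 0 v] by simp_all
 have P: "0 < (y - x)\<^sup>2 + v\<^sup>2" using v by (simp add: add_nonneg_pos)
 hence D0: "0 < D" using D(1) by linarith
 \<comment> \<open>The numerator is v plus the Taylor remainder of \<open>ph\<close> at
   \<open>y\<close>, taken at \<open>x\<close>. That remainder is at most K (x - y)^2 and hence at
   most 4 K D, so the curvature of the arc costs only the constant 4K.\<close>
 have "angle y (pt x v) = (ph1 y * (y - x) - (ph y - ph x - v)) / D"
 by (simp add: angle_def zt'_def ph1_def D_def Im_divide cmod_power2)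
 hence a: "angle y (pt x v) = v / D + R / D" by (simp add: R_def algebra_simps flip: add_divide_distrib)
 have "\<bar>R\<bar> <= K * (x - y)\<^sup>2" unfolding R_def by (rule K(2)[OF x y])
 also have "... <= K * (4 * D)" using D(1) v by (intro mult_lm K(1)) (simp add: power2_commute[of x y], smt (verit) zero_le_power2)
 finally have "\<bar>R / D\<bar> <= 4 * K" using D0 by (simp add: field_simps abs_divide)
 hence r: "R / D <= 4 * K" "- (4 * K) <= R / D" by linarith+
 have "v / D <= v / (((y - x)\<^sup>2 + v\<^sup>2) / 4)" using D P D0 v by (intro divide_left_mono mult_pos_pos) auto
 thus "angle y (pt x v) <= 4 * (v / ((y - x)\<^sup>2 + v\<^sup>2)) + 4 * K" unfolding a using r(1) by (simp add: field_simps)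
 have "v / (2 * ((y - x)\<^sup>2 + v\<^sup>2)) <= v / D" using D P D0 v by (intro divide_left_mono mult_pos_pos) auto
 thus "v / (2 * ((y - x)\<^sup>2 + v\<^sup>2)) - 4 * K <= angle y (pt x v)" unfolding a using r by linarith
qed

text \<open>A Cauchy integral over the arc with real density \<open>th\<close>. Its imaginary part
  is the integral of \<open>th y * angle y w\<close>, and exp(-i m potential) is a holomorphic
  weight of modulus exp(m Im potential).\<close>

definition potential :: "(real => real) => complex => complex" where
 "potential th w = HK {-b..b} (%y. of_real (th y) * (zt' y / (pt y 0 - w)))"

lemma above_ne: "0 < Im w - ph (Re w) ==> pt y 0 - w ~= 0"
 by (auto simp: complex_eq_iff)

text \<open>The rule for differentiation under the integral sign asks for a convex domain, hence the
  passage to balls.\<close>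

lemma potential_holomorphic:
 assumes S: "open S" "!!w. w : S ==> 0 < Im w - ph (Re w)" and th: "cts {-b..b} th"
 shows "potential th hol S"
proof -
 have hb: "potential th hol ball w e" if be: "ball w e <= S" for w e
 proof -
 have ne: "pt y 0 - z ~= 0" if "z : ball w e" for y z using above_ne[OF S(2)] that be by blast
 have "(%z. HK (cbox (-b) b) (%y. of_real (th y) * (zt' y / (pt y 0 - z)))) hol ball w e"
 proof (rule leibniz_rule_holomorphic[where fx = "%z y. of_real (th y) * (zt' y / (pt y 0 - z)\<^sup>2)"])
 fix z y assume z: "z : ball w e"
 have "((%z. of_real (th y) * (zt' y / (pt y 0 - z))) hfd of_real (th y) * (- (zt' y * (- 1)) / ((pt y 0 - z) * (pt y 0 - z)))) (at z within ball w e)"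
 using ne[OF z, of y] by (auto intro!: derivative_eq_intros)
 thus "((%z. of_real (th y) * (zt' y / (pt y 0 - z))) hfd of_real (th y) * (zt' y / (pt y 0 - z)\<^sup>2)) (at z within ball w e)"
 by (simp add: power2_eq_square)
 next
 fix z assume z: "z : ball w e"
 have "cts {-b..b} (%y. of_real (th y) * (zt' y / (pt y 0 - z)))"
 using ne[OF z] by (intro con_mult continuous_on_of_real th continuous_on_divide con_diff con_const cont_zt' cont_pt1 ballI)
 thus "(%y. of_real (th y) * (zt' y / (pt y 0 - z))) integrable_on cbox (- b) b"
 by (simp add: int_con)
 next
 show "cts (ball w e \<times> cbox (- b) b) (%(z, y). of_real (th y) * (zt' y / (pt y 0 - z)\<^sup>2))"
 unfolding split_beta
 by (intro con_mult continuous_on_of_real continuous_on_divide continuous_on_power con_diff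
 continuous_on_fst continuous_on_snd continuous_on_id
 con_comp[OF th continuous_on_snd[OF continuous_on_id]] con_comp[OF cont_zt' continuous_on_snd[OF continuous_on_id]]
 con_comp[OF cont_pt1 continuous_on_snd[OF continuous_on_id]])
 (use ne in auto)
 qed auto
 thus ?thesis by (simp add: potential_def[abs_def])
 qed
 have "potential th field_differentiable at w" if w: "w : S" for w
 proof -
 obtain e where "e > 0" "ball w e <= S" using S(1) w openE by blast
 thus ?thesis using holomorphic_on_imp_differentiable_at[OF hb open_ball, of w e w] by simp
 qed
 thus ?thesis by (simp add: holomorphic_on_def field_differentiable_at_within)
qed

context
 fixes th :: "real => real" and w :: complex and p q :: real
 assumes w: "0 < Im w - ph (Re w)" and th: "cts {-b..b} th" "!!y. 0 <= th y & th y <= 1" "!!y. y ~: {p..q} ==> th y = 0"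
 and pq: "p <= q" "{p..q} <= {-b..b}"
begin

lemma angle_cont: "cts {-b..b} (%y. th y * angle y w)"
proof -
 have "cts {-b..b} (%y. zt' y / (pt y 0 - w))"
 using above_ne[OF w] by (intro continuous_on_divide con_diff con_const cont_zt' cont_pt1 ballI)
 thus ?thesis unfolding angle_def by (intro con_mult continuous_on_Im th(1))
qed

lemma Im_potential: "Im (potential th w) = HK {p..q} (%y. th y * angle y w)"
proof -
 have "cts {-b..b} (%y. of_real (th y) * (zt' y / (pt y 0 - w)))"
 using above_ne[OF w] by (intro con_mult continuous_on_of_real th(1) continuous_on_divide con_diff con_const cont_zt' cont_pt1 ballI)
 hence "(%y. of_real (th y) * (zt' y / (pt y 0 - w))) integrable_on {-b..b}" by (rule int_con)
 hence "Im (potential th w) = HK {-b..b} (%y. Im (of_real (th y) * (zt' y / (pt y 0 - w))))"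
 unfolding potential_def by (rule integral_linear[OF _ bounded_linear_Im, unfolded o_def, symmetric])
 also have "... = HK {-b..b} (%y. th y * angle y w)"
 unfolding angle_def by (intro integral_cong) (simp del: times_divide_eq_right)
 also have "... = HK {-b..b} (%y. if y : {p..q} then th y * angle y w else 0)"
 by (rule integral_cong) (use th(3) in auto)
 also have "... = HK ({p..q} \<inter> {-b..b}) (%y. th y * angle y w)"
 by (rule Henstock_Kurzweil_Integration.integral_restrict_Int)
 also have "{p..q} \<inter> {-b..b} = {p..q}" by (rule Int_absorb2[OF pq(2)])
 finally show ?thesis .
qed

lemma angle_integrable: "(%y. th y * angle y w) integrable_on {p..q}"
 by (intro int_con con_subset[OF angle_cont pq(2)])

text \<open>The three bounds serve three places: this one the parts of the contour away from the
  support of \<open>th\<close>, \<open>Im_potential_le_pi\<close> the part close to it, and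
  \<open>Im_potential_ge\<close> the point inside the contour.\<close>

lemma Im_potential_le:
 assumes "0 <= bt" "!!y. y : {p..q} ==> th y ~= 0 ==> angle y w <= bt"
 shows "Im (potential th w) <= bt * (q - p)"
proof -
 have "Im (potential th w) <= HK {p..q} (%y. bt)"
 unfolding Im_potential
 proof (rule integral_le[OF angle_integrable integrable_const_ivl])
 fix y assume y: "y : {p..q}"
 show "th y * angle y w <= bt"
 proof (cases "th y = 0")
 case False
 hence "th y * angle y w <= th y * bt" using assms(2)[OF y] th(2)[of y] by (intro mult_lm) auto
 also have "... <= 1 * bt" using th(2)[of y] assms(1) by (intro mult_rm) auto
 finally show ?thesis by simp
 qed (use assms(1) in simp)
 qed
 also have "... = bt * (q - p)" using pq(1) by simp
 finally show ?thesis .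
qed

lemma Im_potential_le_pi:
 assumes K: "0 <= K" "!!x y. x : {-b..b} ==> y : {-b..b} ==> \<bar>ph x - ph y - ph1 y * (x - y)\<bar> <= K * (x - y)\<^sup>2"
 and x: "x : {-b..b}" and v: "0 < v" and wv: "w = pt x v"
 shows "Im (potential th w) <= 4 * pi + 4 * K * (q - p)"
proof -
 have d: "((%y. 4 * arctan ((y - x) / v) + 4 * K * y) hrd 4 * (v / ((y - x)\<^sup>2 + v\<^sup>2)) + 4 * K) (at y)" for y
 using DERIV_add[OF DERIV_cmult[OF poisson_has_derivative[OF v, of x y], of 4] DERIV_cmult[OF DERIV_ident, of "4 * K"]] by simp
 have i: "((%y. 4 * (v / ((y - x)\<^sup>2 + v\<^sup>2)) + 4 * K) has_integral
 (4 * arctan ((q - x) / v) + 4 * K * q - (4 * arctan ((p - x) / v) + 4 * K * p))) {p..q}"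
 by (rule FTC[OF pq(1)])
 (rule has_vector_derivative_at_within[OF d[unfolded hrd_hvd]])
 have "Im (potential th w) <= HK {p..q} (%y. 4 * (v / ((y - x)\<^sup>2 + v\<^sup>2)) + 4 * K)"
 unfolding Im_potential
 proof (rule integral_le[OF angle_integrable has_integral_integrable[OF i]])
 fix y assume y: "y : {p..q}"
 have a: "angle y w <= 4 * (v / ((y - x)\<^sup>2 + v\<^sup>2)) + 4 * K"
 unfolding wv by (rule angle_bounds[OF K x _ v]) (use y pq in auto)
 have nn: "0 <= 4 * (v / ((y - x)\<^sup>2 + v\<^sup>2)) + 4 * K" using v K by (simp add: add_nonneg_nonneg)
 have "th y * angle y w <= th y * (4 * (v / ((y - x)\<^sup>2 + v\<^sup>2)) + 4 * K)" using th(2)[of y] by (intro mult_lm a) auto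
 also have "... <= 1 * (4 * (v / ((y - x)\<^sup>2 + v\<^sup>2)) + 4 * K)" using th(2)[of y] nn by (intro mult_rm) auto
 finally show "th y * angle y w <= 4 * (v / ((y - x)\<^sup>2 + v\<^sup>2)) + 4 * K" by simp
 qed
 also have "... = 4 * arctan ((q - x) / v) - 4 * arctan ((p - x) / v) + 4 * K * (q - p)"
 unfolding integral_unique[OF i] by (simp add: algebra_simps)
 also have "... <= 4 * pi + 4 * K * (q - p)"
 using arctan_bounded[of "(q - x) / v"] arctan_bounded[of "(p - x) / v"] by linarith
 finally show ?thesis .
qed

lemma Im_potential_ge:
 assumes K: "0 <= K" "!!x y. x : {-b..b} ==> y : {-b..b} ==> \<bar>ph x - ph y - ph1 y * (x - y)\<bar> <= K * (x - y)\<^sup>2"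
 and x: "x : {-b..b}" and v: "0 < v" and wv: "w = pt x v"
 and A: "compact A" "A <= {p..q}" "!!y. y : A ==> th y = 1"
 and al: "!!y. y : A ==> al <= v / (2 * ((y - x)\<^sup>2 + v\<^sup>2))"
 shows "al * measure lborel A - 4 * K * (q - p) <= Im (potential th w)"
proof -
 have "((%x. 1) has_integral measure lborel A) A"
 by (rule has_integral_measure_lborel) (rule borel_closed[OF compact_imp_closed[OF A(1)]], rule emeasure_bounded_finite[OF compact_imp_bounded[OF A(1)]])
 hence "((%y. if y : A then 1 else 0) has_integral measure lborel A) {p..q}"
 by (simp add: has_integral_restrict[OF A(2)])
 from has_integral_diff[OF has_integral_mult_right[OF this, of al] has_integral_const_real[of "4 * K" p q]]
 have i: "((%y. al * (if y : A then 1 else 0) - 4 * K) has_integral al * measure lborel A - 4 * K * (q - p)) {p..q}"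
 using pq(1) by (simp add: mult.commute)
 have "HK {p..q} (%y. al * (if y : A then 1 else 0) - 4 * K) <= Im (potential th w)"
 unfolding Im_potential
 proof (rule integral_le[OF has_integral_integrable[OF i] angle_integrable])
 fix y assume y: "y : {p..q}"
 have a: "v / (2 * ((y - x)\<^sup>2 + v\<^sup>2)) - 4 * K <= angle y w"
 unfolding wv by (rule angle_bounds[OF K x _ v]) (use y pq in auto)
 show "al * (if y : A then 1 else 0) - 4 * K <= th y * angle y w"
 proof (cases "y : A")
 case True
 thus ?thesis unfolding if_P[OF True] A(3)[OF True] using a al[OF True] by linarith
 next
 case False
 have "0 <= v / (2 * ((y - x)\<^sup>2 + v\<^sup>2))"
 using v by (intro divide_nonneg_nonneg mult_nonneg_nonneg add_nonneg_nonneg zero_le_power2) auto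
 hence "- (4 * K) <= angle y w" using a by linarith
 hence "th y * (- (4 * K)) <= th y * angle y w" using th(2)[of y] by (intro mult_lm) auto
 moreover have "th y * K <= 1 * K" using th(2)[of y] K(1) by (intro mult_rm) auto
 moreover have "th y * (- (4 * K)) = - (4 * (th y * K))" by simp
 ultimately have "- (4 * K) <= th y * angle y w" by linarith
 thus ?thesis unfolding if_not_P[OF False] by simp
 qed
 qed
 thus ?thesis unfolding integral_unique[OF i] .
qed

end

end

section \<open>Uniqueness for integrable boundary values\<close>

context graph_arc
begin

text \<open>Moved up by v, the arc is again a graph arc, so the box formulas also serve for contours
  inside the open region.\<close>

lemma graph_arc_shift: "graph_arc (%x. ph x + v) b B"
 using bB lip by unfold_locales (auto intro!: smooth_add smooth smooth_const)

lemma shift_pt: "graph_arc.pt (%x. ph x + v) x s = pt x (v + s)"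
 by (simp add: graph_arc.pt_def[OF graph_arc_shift] pt_def)

lemma shift_zt': "x : {-b..b} ==> graph_arc.zt' (%x. ph x + v) x = zt' x"
proof -
 assume x: "x : {-b..b}"
 have "(ph hasd fder ph (at x)) (at x)"
 using smooth_has_derivative[OF smooth] sub_B x by blast
 from has_derivative_add[OF this has_derivative_const[of v]]
 have "fder (%x. ph x + v) (at x) = fder ph (at x)"
 using frechet_derivative_at by fastforce
 thus ?thesis by (simp add: graph_arc.zt'_def[OF graph_arc_shift] zt'_def)
qed

end

context boundary_data
begin

lemma simply_connected_Do: "simply_connected Do"
proof -
 let ?R = "{-b<..<b} \<times> {0<..<et}"
 have "homeomorphism ?R Do (%z. pt (fst z) (snd z)) (%w. (Re w, Im w - ph (Re w)))"
 proof (rule homeomorphismI)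
 show "cts ?R (%z. pt (fst z) (snd z))"
 by (rule con_subset[OF cont_pt[unfolded split_beta]]) auto
 show "cts Do (%w. (Re w, Im w - ph (Re w)))"
 by (intro continuous_intros con_comp[OF cont_ph]) (auto simp: Do_def)
 qed (auto simp: Do_def complex_eq_iff)
 hence "?R homeomorphic Do" by (auto simp: homeomorphic_def)
 moreover have "simply_connected ?R" by (intro convex_imp_simply_connected convex_Times convex_real_interval)
 ultimately show ?thesis by (rule homeomorphic_simply_connected)
qed

lemma connected_Do: "connected Do" by (rule simply_connected_imp_connected[OF simply_connected_Do])

lemma Do_primitive: "G hol Do ==> EX Q. ALL z:Do. (Q hfd G z) (at z)"
 using simply_connected_eq_global_primitive[OF open_Do] simply_connected_Do by blast

text \<open>\<open>G\<close> is holomorphic only in the open region, so the box stands on the arc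
  shifted by v. The difference quotient of \<open>G\<close> has a primitive there because
  \<open>Do\<close> is simply connected. \<open>mu\<close> is a lower bound for the distance from
  the point to the contour.\<close>

lemma Do_Cauchy_estimate:
 assumes G: "G hol Do"
 and y: "-b < y0" "y0 < x" "x < y1" "y1 < b"
 and s: "0 < v" "v < nx" "nx < c" "c < et"
 and mu: "0 < mu" "!!y s. y : {y0..y1} ==> s : {v..c} ==> y = y0 \<or> y = y1 \<or> s = v \<or> s = c ==> mu <= cmod (pt y s - pt x nx)"
 and Z: "!!y. y : {-b..b} ==> cmod (zt' y) <= Z" "1 <= Z"
 shows "2 * pi * mu * cmod (G (pt x nx)) <= Z * (HK {y0..y1} (%y. cmod (G (pt y v))) + HK {y0..y1} (%y. cmod (G (pt y c)))
 + HK {v..c} (%s. cmod (G (pt y0 s))) + HK {v..c} (%s. cmod (G (pt y1 s))))"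
proof -
 interpret U: graph_arc "%x. ph x + v" b B by (rule graph_arc_shift)
 note pe = shift_pt[of v] and ze = shift_zt'[of _ v]
 define w where "w = pt x nx"
 have w: "w : Do" unfolding w_def using y s by (intro pt_in_Do) auto
 have wU: "w = U.pt x (nx - v)" by (simp add: pe w_def)
 have yb: "-b <= y0" "y0 < y1" "y1 <= b" and cv: "0 < c - v" using y s by auto
 have wn: "w ~: U.box_frame y0 y1 (c - v)"
 unfolding wU by (rule U.pt_inside_notin_frame[OF yb cv]) (use y s in auto)
 have fD: "U.box_frame y0 y1 (c - v) <= Do"
 using y s by (auto simp: U.box_frame_def pe intro!: pt_in_Do)
 let ?q = "%z. if z = w then deriv G w else (G z - G w) / (z - w)"
 have qh: "?q hol Do" using pole_lemma_open[OF G open_Do] .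
 obtain Q where Q: "!!z. z : Do ==> (Q hfd ?q z) (at z)" using Do_primitive[OF qh] by blast
 have cG: "cts Do G" using G by (rule hol_con)
 have cq: "cts (U.box_frame y0 y1 (c - v)) ?q"
 using con_subset[OF hol_con[OF qh] fD] .
 have "U.box_integral y0 y1 (c - v) (%z. G z / (z - w)) = U.box_integral y0 y1 (c - v) (%z. ?q z + G w * (1 / (z - w)))"
 proof (rule U.box_integral_cong[OF yb cv])
 fix z assume "z : U.box_frame y0 y1 (c - v)"
 hence "z ~= w" using wn by auto
 thus "G z / (z - w) = ?q z + G w * (1 / (z - w))" by (simp flip: add_divide_distrib)
 qed
 also have "... = U.box_integral y0 y1 (c - v) ?q + U.box_integral y0 y1 (c - v) (%z. G w * (1 / (z - w)))"
 by (rule U.box_integral_add[OF yb cv cq]) (use wn in \<open>auto intro!: continuous_intros\<close>)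
 also have "U.box_integral y0 y1 (c - v) ?q = 0"
 using U.box_integral_primitive[OF yb cv, of Q ?q] Q fD by blast
 also have "U.box_integral y0 y1 (c - v) (%z. G w * (1 / (z - w))) = G w * (2 * of_real pi * \<i>)"
 unfolding U.box_integral_cmult[OF yb cv] unfolding wU by (subst U.box_winding_inside[OF yb cv]) (use y s in auto)
 finally have e: "U.box_integral y0 y1 (c - v) (%z. G z / (z - w)) = G w * (2 * of_real pi * \<i>)" by simp
 have h: "cmod (HK {y0..y1} (%y. G (U.pt y s) / (U.pt y s - w) * U.zt' y)) <= Z / mu * HK {y0..y1} (%y. cmod (G (pt y (v + s))))"
 if s': "s = 0 \<or> s = c - v" for s
 proof -
 have vs: "v + s : {v..c}" "v + s = v \<or> v + s = c" using s' s by auto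
 have c1: "cts {y0..y1} (%y. G (pt y (v + s)))"
 by (rule con_comp[OF cG con_subset[OF cont_pt1]]) (use y s vs in \<open>auto intro!: pt_in_Do\<close>)
 have ne: "pt y (v + s) - w ~= 0" if "y : {y0..y1}" for y using mu(2)[OF that vs(1)] vs(2) mu(1) unfolding w_def by fastforce
 have c2: "cts {y0..y1} (%y. G (pt y (v + s)) / (pt y (v + s) - w) * zt' y)"
 using ne y by (intro con_mult continuous_on_divide c1 con_diff con_const con_subset[OF cont_pt1] con_subset[OF cont_zt']) auto
 have "HK {y0..y1} (%y. G (U.pt y s) / (U.pt y s - w) * U.zt' y) = HK {y0..y1} (%y. G (pt y (v + s)) / (pt y (v + s) - w) * zt' y)"
 by (rule integral_cong) (use y in \<open>simp add: pe ze\<close>)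
 also have "cmod ... <= HK {y0..y1} (%y. Z / mu * cmod (G (pt y (v + s))))"
 proof (rule int_norm_bd)
 fix y' assume y': "y' : {y0..y1}"
 have "cmod (G (pt y' (v + s)) / (pt y' (v + s) - w) * zt' y') = cmod (G (pt y' (v + s))) * (cmod (zt' y') / cmod (pt y' (v + s) - w))"
 by (simp add: norm_mult norm_divide)
 also have "... <= cmod (G (pt y' (v + s))) * (Z / mu)"
 using y y' Z mu(2)[OF y' vs(1)] vs(2) mu(1) unfolding w_def by (intro mult_lm frac_le) auto
 finally show "cmod (G (pt y' (v + s)) / (pt y' (v + s) - w) * zt' y') <= Z / mu * cmod (G (pt y' (v + s)))" by (simp add: mult.commute)
 qed (intro int_con c2 con_mult con_const con_norm c1)+
 finally show ?thesis by simp
 qed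
 have vt: "cmod (HK {0..c - v} (%s. \<i> * (G (U.pt y' s) / (U.pt y' s - w)))) <= Z / mu * HK {v..c} (%s. cmod (G (pt y' s)))"
 if y': "y' = y0 \<or> y' = y1" for y'
 proof -
 have yy: "y' : {y0..y1}" using y' yb by auto
 have c1: "cts {0..c - v} (%s. G (pt y' (v + s)))"
 by (rule con_comp[OF cG con_comp[OF cont_pt2[of UNIV]]]) (use y s y' in \<open>auto intro!: pt_in_Do continuous_intros\<close>)
 have sv: "v + s : {v..c}" if "s : {0..c - v}" for s using that by auto
 have ne: "pt y' (v + s) - w ~= 0" if "s : {0..c - v}" for s using mu(2)[OF yy sv[OF that]] y' mu(1) unfolding w_def by fastforce
 have cp: "cts {0..c - v} (%s. pt y' (v + s))"
 by (rule con_comp[OF cont_pt2[of UNIV]]) (auto intro!: continuous_intros)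
 have c2: "cts {0..c - v} (%s. \<i> * (G (pt y' (v + s)) / (pt y' (v + s) - w)))"
 using ne by (intro con_mult continuous_on_divide c1 con_diff con_const cp) auto
 have "HK {0..c - v} (%s. \<i> * (G (U.pt y' s) / (U.pt y' s - w))) = HK {0..c - v} (%s. \<i> * (G (pt y' (v + s)) / (pt y' (v + s) - w)))"
 by (simp add: pe)
 also have "cmod ... <= HK {0..c - v} (%s. Z / mu * cmod (G (pt y' (v + s))))"
 proof (rule int_norm_bd)
 fix s assume s': "s : {0..c - v}"
 have "cmod (\<i> * (G (pt y' (v + s)) / (pt y' (v + s) - w))) = cmod (G (pt y' (v + s))) * (1 / cmod (pt y' (v + s) - w))"
 by (simp add: norm_mult norm_divide)
 also have "... <= cmod (G (pt y' (v + s))) * (Z / mu)"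
 using Z(2) mu(2)[OF yy sv[OF s']] y' mu(1) unfolding w_def by (intro mult_lm frac_le) auto
 finally show "cmod (\<i> * (G (pt y' (v + s)) / (pt y' (v + s) - w))) <= Z / mu * cmod (G (pt y' (v + s)))" by (simp add: mult.commute)
 qed (intro int_con c2 con_mult con_const con_norm c1)+
 also have "... = Z / mu * HK {0..c - v} (%s. cmod (G (pt y' (v + s))))" by simp
 also have "HK {0..c - v} (%s. cmod (G (pt y' (v + s)))) = HK {v..c} (%s. cmod (G (pt y' s)))"
 using integral_shift_real_ivl[of v v c "%s. cmod (G (pt y' s))"] by (simp add: add.commute)
 finally show ?thesis .
 qed
 have "2 * pi * cmod (G w) = cmod (U.box_integral y0 y1 (c - v) (%z. G z / (z - w)))"
 unfolding e by (simp add: norm_mult)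
 also have "... <= cmod (HK {y0..y1} (%y. G (U.pt y 0) / (U.pt y 0 - w) * U.zt' y)) + cmod (HK {0..c - v} (%s. \<i> * (G (U.pt y1 s) / (U.pt y1 s - w))))
 + cmod (HK {y0..y1} (%y. G (U.pt y (c - v)) / (U.pt y (c - v) - w) * U.zt' y)) + cmod (HK {0..c - v} (%s. \<i> * (G (U.pt y0 s) / (U.pt y0 s - w))))"
 unfolding U.box_integral_def by (intro order_trans[OF norm_triangle_ineq4] add_mono norm_triangle_ineq order_refl)
 also have "... <= Z / mu * HK {y0..y1} (%y. cmod (G (pt y (v + 0)))) + Z / mu * HK {v..c} (%s. cmod (G (pt y1 s)))
 + Z / mu * HK {y0..y1} (%y. cmod (G (pt y (v + (c - v))))) + Z / mu * HK {v..c} (%s. cmod (G (pt y0 s)))"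
 by (intro add_mono h vt) auto
 finally have "mu * (2 * pi * cmod (G w)) <= mu * (Z / mu * (HK {y0..y1} (%y. cmod (G (pt y v))) + HK {y0..y1} (%y. cmod (G (pt y c)))
 + HK {v..c} (%s. cmod (G (pt y0 s))) + HK {v..c} (%s. cmod (G (pt y1 s)))))"
 using mu(1) by (intro mult_lm) (simp_all add: algebra_simps)
 thus ?thesis using mu(1) by (simp add: w_def mult_ac)
qed

end

lemma nn_integral_continuous:
 fixes f :: "real => real"
 assumes "cts {p..q} f" "!!x. 0 <= f x"
 shows "(\<integral>\<^sup>+x\<in>{p..q}. enn (f x) \<partial>lborel) = enn (HK {p..q} f)"
 by (rule nn_integral_has_integral_lebesgue') (use assms int_con in blast)+

context boundary_data
begin

lemma slice_cont:
 assumes "G hol Do"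
 shows "{p..q} <= {-b<..<b} ==> 0 < s ==> s < et ==> cts {p..q} (%y. G (pt y s))"
 and "\<bar>y\<bar> < b ==> 0 < p ==> q < et ==> cts {p..q} (%s. G (pt y s))"
proof -
 note cG = hol_con[OF assms]
 assume a: "{p..q} <= {-b<..<b}" "0 < s" "s < et"
 have "{p..q} <= {-b..b}" using a(1) by force
 moreover have "pt y s : Do" if "y : {p..q}" for y using subsetD[OF a(1) that] a by (intro pt_in_Do) auto
 ultimately show "cts {p..q} (%y. G (pt y s))"
 by (intro con_comp[OF cG con_subset[OF cont_pt1]]) auto
next
 note cG = hol_con[OF assms]
 assume a: "\<bar>y\<bar> < b" "0 < p" "q < et"
 show "cts {p..q} (%s. G (pt y s))"
 by (rule con_comp[OF cG cont_pt2]) (use a in \<open>auto intro!: pt_in_Do\<close>)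
qed

text \<open>For every m, H exp(-i m potential) is estimated over a contour with bottom at height v.
  \<open>tu\<close> bounds the imaginary part of the potential on the contour except near
  \<open>A\<close>, and \<open>gap\<close> puts it above \<open>tu + ka\<close> at the point. Near
  \<open>A\<close> the weight is at most exp(m M0), which the smallness of \<open>H\<close>
  compensates. Thus |H| exp(m ka) is bounded independently of m, which excludes a nonzero
  value.\<close>

lemma uniqueness_core:
 assumes K: "0 <= K" "!!x y. x : {-b..b} ==> y : {-b..b} ==> \<bar>ph x - ph y - ph1 y * (x - y)\<bar> <= K * (x - y)\<^sup>2"
 and Z: "!!y. y : {-b..b} ==> cmod (zt' y) <= Z" "1 <= Z"
 and c: "0 < c" "c < et" and y: "-b < ya" "yb < b"
 and M: "!!v. 0 < v ==> v <= c ==> (\<integral>\<^sup>+y\<in>{ya..yb}. enn (cmod (H (pt y v))) \<partial>lborel) <= enn M" "0 <= M"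
 and S: "!!y. y = ya \<or> y = yb ==> (\<integral>\<^sup>+s\<in>{0<..c}. enn (cmod (H (pt y s))) \<partial>lborel) <= enn S" "0 <= S"
 and small: "!!e. 0 < e ==> \<exists>dl>0. \<exists>v1>0. ALL v. 0 < v --> v < v1 -->
 (\<integral>\<^sup>+y\<in>{y : {ya..yb}. infdist y A <= dl}. enn (cmod (H (pt y v))) \<partial>lborel) <= enn e"
 and A: "compact A" "A ~= {}" "A <= {y0 - l..y0 + l}" and l: "0 < l" "2 * l <= c"
 and r: "0 < r" "ya + r + 2 * l <= y0" "y0 + r + 2 * l <= yb" "l <= r"
 and B0: "B0 = 1 + 4 * K + 4 * c / r\<^sup>2 + 4 / c"
 and gap: "0 < ka" "4 * l * B0 + 16 * K * l + ka <= measure lborel A / (16 * l)"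
 and x: "\<bar>x - y0\<bar> < l / 2" "l / 2 < nx" "nx < l"
 shows "H (pt x nx) = 0"
proof (rule ccontr)
 assume "H (pt x nx) ~= 0"
 hence h: "0 < cmod (H (pt x nx))" by simp
 have K4: "0 <= B0" unfolding B0 using K(1) c r(1) by (intro add_nonneg_nonneg) auto
 \<comment> \<open>The support of the cut-off lies in an interval of length 4l, and
   \<open>B0\<close> bounds \<open>angle\<close> on the far parts of the contour: 1 + 4K on the
   bottom, 4K + 4/c on the top, 4K + 4c/r^2 on the sides.\<close>
 define tu where "tu = 4 * l * B0"
 have tu: "0 <= tu" using K4 l by (simp add: tu_def)
 define M0 where "M0 = 4 * pi + 4 * K * (4 * l)"
 define C where "C = Z * (1 + 2 * M + 2 * S)"
 have yy: "ya < x" "x < yb" "{y0 - 2 * l..y0 + 2 * l} <= {-b..b}" "y0 - 2 * l <= y0 + 2 * l"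
 "{ya..yb} <= {-b<..<b}" "{ya..yb} <= {-b..b}" "ya < yb"
 using x(1)[unfolded abs_less_iff] r l y by auto
 have nu: "0 < nx" "nx < c" using x l by auto
 have main: "2 * pi * (l / 8) * cmod (H (pt x nx)) * exp (real m * ka) <= C" for m :: nat
 proof -
 \<comment> \<open>The tolerance exp(-m M0) cancels the crude bound exp(m M0) of the weight near
   \<open>A\<close>.\<close>
 obtain dl0 v1 where dl0: "0 < dl0" "0 < v1" and sm: "!!v. 0 < v ==> v < v1 ==>
 (\<integral>\<^sup>+y\<in>{y : {ya..yb}. infdist y A <= dl0}. enn (cmod (H (pt y v))) \<partial>lborel) <= enn (exp (- real m * M0))"
 using small[of "exp (- real m * M0)"] by auto
 define dl where "dl = min (dl0 / 2) l"
 have dl: "0 < dl" "2 * dl <= dl0" "dl <= l" using dl0 l by (auto simp: dl_def)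
 define th where "th y = max 0 (1 - infdist y A / dl)" for y
 have th: "cts {-b..b} th" "!!y. 0 <= th y & th y <= 1"
 unfolding th_def using dl(1) by (auto intro!: continuous_intros simp: infdist_nonneg)
 have thA: "th y = 1" if "y : A" for y using that by (simp add: th_def)
 have thn: "infdist y A < dl" if "th y ~= 0" for y
 using that dl(1) by (auto simp: th_def max_def divide_simps split: if_splits)
 have ths: "th y = 0" if "y ~: {y0 - 2 * l..y0 + 2 * l}" for y
 proof (rule ccontr)
 assume "th y ~= 0"
 hence i: "infdist y A < l" using thn dl(3) by fastforce
 obtain a where "a : A" "infdist y A = dist y a" using infdist_attains_inf[of A y] A(1,2) compact_imp_closed by blast
 hence "\<bar>y - a\<bar> < l" "y0 - l <= a" "a <= y0 + l" using i A(3) by (auto simp: dist_real_def)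
 thus False using that by auto
 qed
 \<comment> \<open>The height is chosen after m: v1/2 gives the smallness near \<open>A\<close>,
   dl^2/4 gives 4v/dl^2 <= 1 away from \<open>A\<close>, and l/4 and c/2 keep the bottom well below
   the point and the top.\<close>
 define v where "v = Min {v1 / 2, dl\<^sup>2 / 4, l / 4, c / 2}"
 have "0 < dl\<^sup>2" by (rule zero_less_power[OF dl(1)])
 hence v0: "0 < v" unfolding v_def using dl0 l c by (simp del: zero_less_power2)
 have v: "v <= v1 / 2" "v <= dl\<^sup>2 / 4" "v <= l / 4" "v <= c / 2" by (auto simp: v_def)
 define G where "G w = H w * exp (- \<i> * of_nat m * potential th w)" for w
 have pot: "potential th hol Do"
 by (rule potential_holomorphic[OF open_Do _ th(1)]) (simp add: Do_def)
 have G: "G hol Do"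
 unfolding G_def[abs_def] by (intro holomorphic_intros holomorphic_H pot)
 have Gn: "cmod (G w) = cmod (H w) * exp (real m * Im (potential th w))" for w
 by (simp add: G_def norm_mult)
 have ab: "0 < Im (pt u s) - ph (Re (pt u s))" if "0 < s" for u s using that by simp
 note P = th ths yy(4,3)
 have ple: "Im (potential th (pt u s)) <= tu"
 if u: "u : {-b..b}" and s: "0 < s" and rh: "!!y. th y ~= 0 ==> y : {y0 - 2 * l..y0 + 2 * l} ==> rh <= (y - u)\<^sup>2 + s\<^sup>2" and rh0: "0 < rh"
 and bt: "4 * (s / rh) + 4 * K <= B0" for u s rh
 proof -
 have "Im (potential th (pt u s)) <= B0 * (y0 + 2 * l - (y0 - 2 * l))"
 proof (rule Im_potential_le[OF ab[OF s] P K4])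
 fix y assume y: "y : {y0 - 2 * l..y0 + 2 * l}" "th y ~= 0"
 have "angle y (pt u s) <= 4 * (s / ((y - u)\<^sup>2 + s\<^sup>2)) + 4 * K"
 by (rule angle_bounds(1)[OF K u _ s]) (use y yy in auto)
 also have "... <= 4 * (s / rh) + 4 * K" using s rh[OF y(2,1)] rh0 by (intro add_right_mono mult_lm frac_le) auto
 finally show "angle y (pt u s) <= B0" using bt by linarith
 qed
 also have "... = tu" by (simp add: tu_def algebra_simps)
 finally show ?thesis .
 qed
 have p1: "Im (potential th (pt u v)) <= tu" if u: "u : {ya..yb}" "dl0 < infdist u A" for u
 proof (rule ple[OF _ v0, where rh = "dl\<^sup>2"])
 fix y assume "th y ~= 0"
 hence "dl <= \<bar>y - u\<bar>" using thn[of y] infdist_triangle[of u A y] u(2) dl(2) by (simp add: dist_real_def abs_minus_commute)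
 hence "dl\<^sup>2 <= (y - u)\<^sup>2" using dl(1) by (intro abs_le_square_iff[THEN iffD1]) simp
 thus "dl\<^sup>2 <= (y - u)\<^sup>2 + v\<^sup>2" by (simp add: add_increasing2)
 next
 have "4 * (v / dl\<^sup>2) <= 1" using v(2) dl(1) by (simp add: field_simps)
 moreover have "0 <= 4 * c / r\<^sup>2" "0 <= 4 / c" using c by auto
 ultimately show "4 * (v / dl\<^sup>2) + 4 * K <= B0" unfolding B0 by linarith
 qed (use u yy dl in auto)
 have p2: "Im (potential th (pt u v)) <= M0" if u: "u : {ya..yb}" for u
 using Im_potential_le_pi[OF ab[OF v0] P K _ v0 refl, of u] u yy unfolding M0_def by auto
 have p3: "Im (potential th (pt u c)) <= tu" if u: "u : {ya..yb}" for u
 proof (rule ple[OF _ c(1), where rh = "c\<^sup>2"])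
 have "4 * (c / c\<^sup>2) = 4 / c" using c(1) by (simp add: power2_eq_square)
 moreover have "0 <= 4 * c / r\<^sup>2" using c by auto
 ultimately show "4 * (c / c\<^sup>2) + 4 * K <= B0" unfolding B0 by linarith
 qed (use u yy c in auto)
 have p4: "Im (potential th (pt u s)) <= tu" if u: "u = ya \<or> u = yb" and s: "s : {v..c}" for u s
 proof (rule ple[where rh = "r\<^sup>2"])
 fix y assume "y : {y0 - 2 * l..y0 + 2 * l}"
 hence "r <= \<bar>y - u\<bar>" using u r by auto
 hence "r\<^sup>2 <= (y - u)\<^sup>2" using r(1) by (intro abs_le_square_iff[THEN iffD1]) simp
 thus "r\<^sup>2 <= (y - u)\<^sup>2 + s\<^sup>2" by (simp add: add_increasing2)
 next
 have "4 * (s / r\<^sup>2) <= 4 * (c / r\<^sup>2)" using s by (intro mult_lm divide_right_mono) auto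
 moreover have "4 * (c / r\<^sup>2) = 4 * c / r\<^sup>2" "0 <= 4 / c" using c by auto
 ultimately show "4 * (s / r\<^sup>2) + 4 * K <= B0" unfolding B0 by linarith
 qed (use u s yy v0 r in auto)
 \<comment> \<open>Every y in \<open>A\<close> is within 3l/2 of x, and l/2 < nx < l. So 2 ((y -
   x)^2 + nx^2) <= 8 l^2, and the Poisson factor is at least (l/2) / (8 l^2) = 1 / (16 l).\<close>
 have p5: "tu + ka <= Im (potential th (pt x nx))"
 proof -
 have "1 / (16 * l) * measure lborel A - 4 * K * (y0 + 2 * l - (y0 - 2 * l)) <= Im (potential th (pt x nx))"
 proof (rule Im_potential_ge[OF ab[OF nu(1)] P K _ nu(1) refl A(1) _ thA])
 fix y assume "y : A"
 hence "y0 - l <= y" "y <= y0 + l" using A(3) by auto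
 hence "\<bar>y - x\<bar> <= 3 / 2 * l" using x(1) by linarith
 hence "\<bar>y - x\<bar> <= \<bar>3 / 2 * l\<bar>" using l(1) by simp
 hence "(y - x)\<^sup>2 <= (3 / 2 * l)\<^sup>2" by (rule abs_le_square_iff[THEN iffD1])
 hence "(y - x)\<^sup>2 <= 9 / 4 * l\<^sup>2" by (simp add: power_mult_distrib power_divide)
 moreover have "nx\<^sup>2 <= l\<^sup>2" using nu x by (intro power_mono) auto
 ultimately have "2 * ((y - x)\<^sup>2 + nx\<^sup>2) <= 8 * l\<^sup>2"  using zero_le_power2[of l] by argo
 moreover have "0 < 2 * ((y - x)\<^sup>2 + nx\<^sup>2)" using nu by (simp add: add_nonneg_pos)
 ultimately have "(l / 2) / (8 * l\<^sup>2) <= nx / (2 * ((y - x)\<^sup>2 + nx\<^sup>2))" using x l by (intro frac_le) auto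
 thus "1 / (16 * l) <= nx / (2 * ((y - x)\<^sup>2 + nx\<^sup>2))" using l by (simp add: power2_eq_square)
 qed (use yy y A l in auto)
 thus ?thesis using gap(2) by (simp add: tu_def algebra_simps)
 qed
 \<comment> \<open>Each point of the contour differs from the given one by at least l/4 in one of
   the two parameters; \<open>pt_dist_lower\<close> halves this.\<close>
 have mu: "l / 8 <= cmod (pt u s - pt x nx)" if u: "u : {ya..yb}" "s : {v..c}" "u = ya \<or> u = yb \<or> s = v \<or> s = c" for u s
 proof -
 have "\<bar>l / 4\<bar> <= \<bar>ya - x\<bar>" "\<bar>l / 4\<bar> <= \<bar>yb - x\<bar>" "\<bar>l / 4\<bar> <= \<bar>v - nx\<bar>" "\<bar>l / 4\<bar> <= \<bar>c - nx\<bar>"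
 using x l r v(3) by (simp_all only: abs_if split: if_splits) linarith+
 hence "\<bar>l / 4\<bar> <= \<bar>u - x\<bar> \<or> \<bar>l / 4\<bar> <= \<bar>s - nx\<bar>" using u(3) by blast
 hence "(l / 4)\<^sup>2 <= (u - x)\<^sup>2 \<or> (l / 4)\<^sup>2 <= (s - nx)\<^sup>2" by (auto simp only: abs_le_square_iff)
 hence "(l / 4)\<^sup>2 <= (u - x)\<^sup>2 + (s - nx)\<^sup>2" using zero_le_power2[of "u - x"] zero_le_power2[of "s - nx"] by linarith
 also have "... <= 4 * (cmod (pt u s - pt x nx))\<^sup>2" by (rule pt_dist_lower) (use u yy in auto)
 finally have "(l / 8)\<^sup>2 <= (cmod (pt u s - pt x nx))\<^sup>2" by (simp add: power_divide)
 thus ?thesis by (rule power2_le_imp_le) simp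
 qed
 have bottom: "HK {ya..yb} (%u. cmod (G (pt u v))) <= 1 + exp (real m * tu) * M"
 proof -
 define N where "N = {u : {ya..yb}. infdist u A <= dl0}"
 have [measurable]: "N : sets borel"
 proof -
 have "N = {ya..yb} \<inter> {u. infdist u A <= dl0}" by (auto simp: N_def)
 thus ?thesis by (simp add: closed_Collect_le continuous_on_infdist borel_closed)
 qed
 have cH: "cts {ya..yb} (%u. cmod (H (pt u v)))"
 by (intro con_norm slice_cont(1)[OF holomorphic_H]) (use yy v0 v c in auto)
 have Hm[measurable]: "(%u. enn (cmod (H (pt u v))) * ind {ya..yb} u) : borel_measurable lborel"
 proof -
 have "(%u. enn (cmod (H (pt u v))) * ind {ya..yb} u) = (%u. enn (ind {ya..yb} u *\<^sub>R cmod (H (pt u v))))"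
 by (auto simp: indicator_def fun_eq_iff)
 moreover have "(%u. ind {ya..yb} u *\<^sub>R cmod (H (pt u v))) : borel_measurable lborel"
 using bm_indicator[OF _ cH] by simp
 ultimately show ?thesis by simp
 qed
 have "enn (HK {ya..yb} (%u. cmod (G (pt u v)))) = (\<integral>\<^sup>+u\<in>{ya..yb}. enn (cmod (G (pt u v))) \<partial>lborel)"
 by (rule nn_integral_continuous[symmetric]) (use yy v0 v c in \<open>auto intro!: con_norm slice_cont(1)[OF G]\<close>)
 \<comment> \<open>The bound valid near \<open>A\<close> and the one valid elsewhere are added
   instead of splitting the interval; each point is covered by one of the two terms.\<close>
 also have "... <= (NI (%u. enn (exp (real m * M0)) * ((enn (cmod (H (pt u v))) * ind {ya..yb} u) * ind N u)
 + enn (exp (real m * tu)) * (enn (cmod (H (pt u v))) * ind {ya..yb} u)))"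
 proof (rule nn_integral_mono)
 fix u
 consider "u ~: {ya..yb}" | "u : N" "u : {ya..yb}" | "u : {ya..yb}" "dl0 < infdist u A" "u ~: N" by (force simp: N_def)
 thus "enn (cmod (G (pt u v))) * ind {ya..yb} u <= enn (exp (real m * M0)) * ((enn (cmod (H (pt u v))) * ind {ya..yb} u) * ind N u)
 + enn (exp (real m * tu)) * (enn (cmod (H (pt u v))) * ind {ya..yb} u)"
 proof cases
 case 2
 have "cmod (G (pt u v)) <= exp (real m * M0) * cmod (H (pt u v))"
 unfolding Gn using p2[OF 2(2)] by (subst mult.commute) (intro mult_rm, auto intro: mult_lm)
 hence "enn (cmod (G (pt u v))) <= enn (exp (real m * M0)) * enn (cmod (H (pt u v)))"
 by (simp add: ennreal_leI flip: ennreal_mult)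
 thus ?thesis using 2 by (simp add: add_increasing2)
 next
 case 3
 have "cmod (G (pt u v)) <= exp (real m * tu) * cmod (H (pt u v))"
 unfolding Gn using p1[OF 3(1,2)] by (subst mult.commute) (intro mult_rm, auto intro: mult_lm)
 hence "enn (cmod (G (pt u v))) <= enn (exp (real m * tu)) * enn (cmod (H (pt u v)))"
 by (simp add: ennreal_leI flip: ennreal_mult)
 thus ?thesis using 3 by simp
 qed simp
 qed
 also have "... = enn (exp (real m * M0)) * (NI (%u. (enn (cmod (H (pt u v))) * ind {ya..yb} u) * ind N u))
 + enn (exp (real m * tu)) * (\<integral>\<^sup>+u\<in>{ya..yb}. enn (cmod (H (pt u v))) \<partial>lborel)"
 by (subst nn_integral_add) (auto simp: nn_integral_cmult)
 also have "(NI (%u. (enn (cmod (H (pt u v))) * ind {ya..yb} u) * ind N u)) = (\<integral>\<^sup>+u\<in>N. enn (cmod (H (pt u v))) \<partial>lborel)"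
 by (rule nn_integral_cong) (auto simp: N_def indicator_def)
 also have "enn (exp (real m * M0)) * (\<integral>\<^sup>+u\<in>N. enn (cmod (H (pt u v))) \<partial>lborel)
 + enn (exp (real m * tu)) * (\<integral>\<^sup>+u\<in>{ya..yb}. enn (cmod (H (pt u v))) \<partial>lborel)
 <= enn (exp (real m * M0)) * enn (exp (- real m * M0)) + enn (exp (real m * tu)) * enn M"
 unfolding N_def using v v0 dl0 c by (intro add_mono mult_lm sm M(1)) auto
 also have "... = enn (1 + exp (real m * tu) * M)"
 using M(2) by (simp add: exp_minus ennreal_plus flip: ennreal_mult)
 finally show ?thesis using M(2) by (subst (asm) ennreal_le_iff) (auto intro!: add_nonneg_nonneg)
 qed
 have top: "HK {ya..yb} (%u. cmod (G (pt u c))) <= exp (real m * tu) * M"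
 proof -
 have cH: "cts {ya..yb} (%u. cmod (H (pt u c)))"
 by (intro con_norm slice_cont(1)[OF holomorphic_H]) (use yy c in auto)
 have "HK {ya..yb} (%u. cmod (G (pt u c))) <= HK {ya..yb} (%u. exp (real m * tu) * cmod (H (pt u c)))"
 proof (rule integral_le)
 fix u assume "u : {ya..yb}"
 thus "cmod (G (pt u c)) <= exp (real m * tu) * cmod (H (pt u c))"
 unfolding Gn using p3 by (subst mult.commute) (intro mult_rm, auto intro: mult_lm)
 qed (intro int_con con_mult con_const cH con_norm slice_cont(1)[OF G]; use yy c in auto)+
 also have "... = exp (real m * tu) * HK {ya..yb} (%u. cmod (H (pt u c)))" by simp
 also have "... <= exp (real m * tu) * M"
 using M(1)[OF c(1)] nn_integral_continuous[OF cH] M(2) by (intro mult_lm) (auto simp: ennreal_le_iff)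
 finally show ?thesis .
 qed
 have side: "HK {v..c} (%s. cmod (G (pt u s))) <= exp (real m * tu) * S" if u: "u = ya \<or> u = yb" for u
 proof -
 have ub: "\<bar>u\<bar> < b" using u y yy(7) by (auto simp: abs_less_iff)
 have cH: "cts {v..c} (%s. cmod (H (pt u s)))"
 by (intro con_norm slice_cont(2)[OF holomorphic_H]) (use ub v0 c in auto)
 have "HK {v..c} (%s. cmod (G (pt u s))) <= HK {v..c} (%s. exp (real m * tu) * cmod (H (pt u s)))"
 proof (rule integral_le)
 fix s assume "s : {v..c}"
 thus "cmod (G (pt u s)) <= exp (real m * tu) * cmod (H (pt u s))"
 unfolding Gn using p4[OF u] by (subst mult.commute) (intro mult_rm, auto intro: mult_lm)
 qed (intro int_con con_mult con_const cH con_norm slice_cont(2)[OF G]; use ub v0 c in auto)+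
 also have "... = exp (real m * tu) * HK {v..c} (%s. cmod (H (pt u s)))" by simp
 also have "... <= exp (real m * tu) * S"
 proof (rule mult_lm)
 have "enn (HK {v..c} (%s. cmod (H (pt u s)))) = (\<integral>\<^sup>+s\<in>{v..c}. enn (cmod (H (pt u s))) \<partial>lborel)"
 by (rule nn_integral_continuous[OF cH, symmetric]) simp
 also have "... <= (\<integral>\<^sup>+s\<in>{0<..c}. enn (cmod (H (pt u s))) \<partial>lborel)"
 using v0 by (intro nn_integral_mono) (auto simp: indicator_def)
 also have "... <= enn S" by (rule S(1)[OF u])
 finally show "HK {v..c} (%s. cmod (H (pt u s))) <= S" using S(2) by (simp add: ennreal_le_iff)
 qed simp
 finally show ?thesis .
 qed
 have "2 * pi * (l / 8) * cmod (G (pt x nx)) <= Z * (HK {ya..yb} (%y. cmod (G (pt y v))) + HK {ya..yb} (%y. cmod (G (pt y c)))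
 + HK {v..c} (%s. cmod (G (pt ya s))) + HK {v..c} (%s. cmod (G (pt yb s))))"
 by (rule Do_Cauchy_estimate[OF G y(1) yy(1,2) y(2) v0 _ nu(2) c(2) _ mu Z]) (use v x l in auto)
 also have "... <= Z * ((1 + exp (real m * tu) * M) + exp (real m * tu) * M + exp (real m * tu) * S + exp (real m * tu) * S)"
 using Z(2) by (intro mult_lm add_mono bottom top side) auto
 also have "... <= Z * (exp (real m * tu) * (1 + 2 * M + 2 * S))"
 using Z(2) tu by (intro mult_lm) (auto simp: algebra_simps)
 finally have 1: "2 * pi * (l / 8) * cmod (G (pt x nx)) <= exp (real m * tu) * C" by (simp add: C_def mult_ac)
 have "exp (real m * tu) * exp (real m * ka) <= exp (real m * Im (potential th (pt x nx)))"
 using p5 by (simp add: mult_lm flip: exp_add distrib_left)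
 hence "2 * pi * (l / 8) * (cmod (H (pt x nx)) * (exp (real m * tu) * exp (real m * ka))) <= 2 * pi * (l / 8) * cmod (G (pt x nx))"
 unfolding Gn using l by (intro mult_lm) auto
 from order_trans[OF this 1]
 have "exp (real m * tu) * (2 * pi * (l / 8) * cmod (H (pt x nx)) * exp (real m * ka)) <= exp (real m * tu) * C"
 by (simp only: mult_ac)
 thus ?thesis by (simp only: mult_le_cancel_left_pos[OF exp_gt_zero])
 qed
 define a where "a = 2 * pi * (l / 8) * cmod (H (pt x nx))"
 have a: "0 < a" using l h by (simp add: a_def)
 obtain m :: nat where m: "C / a < real m * ka" using reals_Archimedean3[OF gap(1)] by blast
 have "C < a * (real m * ka)" using m a by (simp add: field_simps)
 also have "... <= a * exp (real m * ka)"
 using a exp_ge_add_one_self[of "real m * ka"] by (intro mult_lm) linarith+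
 also have "... <= C" using main[of m] by (simp add: a_def)
 finally show False by simp
qed

text \<open>The vertical sides of the contour descend towards the arc as v tends to 0, so they are
  placed where \<open>H\<close> is integrable along them. Fubini and the slice bounds provide such a
  line in every interval.\<close>

lemma side_finite:
 assumes albt: "al < bt" "{al..bt} <= {-b<..<b}" and c: "0 < c" "c < et" and M: "!!s. 0 < s ==> s <= c ==> (\<integral>\<^sup>+y\<in>{al..bt}. enn (cmod (H (pt y s))) \<partial>lborel) <= enn M"
 shows "EX y:{al..bt}. (\<integral>\<^sup>+s\<in>{0<..c}. enn (cmod (H (pt y s))) \<partial>lborel) < \<infinity>"
proof (rule ccontr)
 assume neg: "~ ?thesis"
 define f where "f z = enn (cmod (H (pt (fst z) (snd z)))) * ind ({-b<..<b} \<times> {0<..<et}) z" for z :: "real \<times> real"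
 have f: "f z = enn (ind ({-b<..<b} \<times> {0<..<et}) z *\<^sub>R cmod (H (pt (fst z) (snd z))))" for z
 by (auto simp: f_def indicator_def)
 have "cts ({-b<..<b} \<times> {0<..<et}) (%z. cmod (H (pt (fst z) (snd z))))"
 by (intro con_norm con_comp[OF hol_con[OF holomorphic_H]]
 con_subset[OF cont_pt[unfolded split_beta]]) (auto intro!: pt_in_Do)
 hence "(%z. ind ({-b<..<b} \<times> {0<..<et}) z *\<^sub>R cmod (H (pt (fst z) (snd z)))) : borel_measurable borel"
 by (intro bm_indicator borel_open open_Times) auto
 hence [measurable]: "f : borel_measurable (lborel \<Otimes>\<^sub>M lborel)"
 unfolding f by (simp add: lborel_prod)
 have "(NI (%y. (NI (%s. f (y, s) * ind {0<..c} s * ind {al..bt} y))))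
 = (NI (%s. (NI (%y. f (y, s) * ind {0<..c} s * ind {al..bt} y))))"
 by (rule lborel_pair.Fubini') (simp add: split_beta)
 also have "... <= (NI (%s. enn M * ind {0<..c} s))"
 proof (rule nn_integral_mono)
 fix s
 show "(NI (%y. f (y, s) * ind {0<..c} s * ind {al..bt} y)) <= enn M * ind {0<..c} s"
 proof (cases "s : {0<..c}")
 case True
 have "(NI (%y. f (y, s) * ind {0<..c} s * ind {al..bt} y)) <= (\<integral>\<^sup>+y\<in>{al..bt}. enn (cmod (H (pt y s))) \<partial>lborel)"
 by (rule nn_integral_mono) (auto simp: f_def indicator_def)
 also have "... <= enn M" using M[of s] True by simp
 finally show ?thesis using True by simp
 qed simp
 qed
 also have "... = enn M * enn c" using c by (subst nn_integral_cmult_indicator) auto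
 also have "... < \<infinity>" by (simp add: ennreal_mult_less_top)
 finally have fin: "(NI (%y. (NI (%s. f (y, s) * ind {0<..c} s * ind {al..bt} y)))) < \<infinity>" .
 have "(NI (%y. (NI (%s. f (y, s) * ind {0<..c} s * ind {al..bt} y)))) = (NI (%y. \<infinity> * ind {al..bt} y))"
 proof (rule nn_integral_cong)
 fix y
 show "(NI (%s. f (y, s) * ind {0<..c} s * ind {al..bt} y)) = \<infinity> * ind {al..bt} y"
 proof (cases "y : {al..bt}")
 case True
 hence "~ (\<integral>\<^sup>+s\<in>{0<..c}. enn (cmod (H (pt y s))) \<partial>lborel) < \<infinity>" using neg by blast
 hence "(\<integral>\<^sup>+s\<in>{0<..c}. enn (cmod (H (pt y s))) \<partial>lborel) = \<infinity>" by (simp flip: less_top)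
 moreover have "(NI (%s. f (y, s) * ind {0<..c} s * ind {al..bt} y)) = (\<integral>\<^sup>+s\<in>{0<..c}. enn (cmod (H (pt y s))) \<partial>lborel)"
 using True subsetD[OF albt(2) True] c by (intro nn_integral_cong) (auto simp: f_def indicator_def)
 ultimately show ?thesis using True by simp
 qed simp
 qed
 also have "... = \<infinity> * enn (bt - al)" using albt(1) by (subst nn_integral_cmult_indicator) auto
 also have "... = \<infinity>" using albt(1) by (simp add: ennreal_top_mult)
 finally show False using fin by simp
qed

theorem boundary_uniqueness:
 assumes A0: "A0 : sets lborel" "A0 <= {j0<..<j1}" "0 < emeasure lborel A0" "!!y. y : A0 ==> g y = 0" and w: "w : Do"
 shows "H w = 0"
proof -
 have "emeasure lborel A0 <= emeasure lborel {j0<..<j1}" by (rule emeasure_mono[OF A0(2)]) simp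
 also have "... < \<infinity>" using J(2) by simp
 finally have fin: "emeasure lborel A0 < \<infinity>" .
 hence eA0: "emeasure lborel A0 = enn (measure lborel A0)" by (intro emeasure_eq_ennreal_measure) auto
 hence "0 < measure lborel A0" using A0(3) by simp
 then obtain T where T: "closed T" "T <= A0" "emeasure lebesgue (A0 - T) < enn (measure lborel A0)"
 using sets_lebesgue_inner_closed[of A0 "measure lborel A0"] A0(1) by blast
 have "T <= {j0..j1}" using T(2) A0(2) by force
 hence cT: "compact T" using T(1) bounded_subset[OF bounded_closed_interval] compact_eq_bounded_closed by blast
 have Tm: "T : sets lborel" using T(1) by simp
 have "emeasure lborel A0 <= emeasure lborel T + emeasure lborel (A0 - T)"
 using emeasure_subadditive[of T lborel "A0 - T"] T(2) A0(1) Tm by (simp add: Un_absorb1)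
 moreover have "emeasure lborel (A0 - T) < emeasure lborel A0"
 using T(3) A0(1) Tm by (simp add: eA0)
 ultimately have "emeasure lborel T ~= 0" by (metis add_0 leD)
 hence mT: "0 < measure lborel T"
 using emeasure_bounded_finite[OF compact_imp_bounded[OF cT]] emeasure_eq_ennreal_measure[of lborel T]
 by (metis ennreal_0 less_irrefl measure_nonneg not_less_iff_gr_or_eq order_less_le top.not_eq_extremum)
 hence "T ~= {}" by auto
 obtain p q where pq: "p : T" "q : T" "T <= {p..q}"
 using compact_attains_inf[OF cT \<open>T ~= {}\<close>] compact_attains_sup[OF cT \<open>T ~= {}\<close>] by (metis atLeastAtMost_iff subsetI)
 have pqj: "j0 < p" "q < j1" using pq(1,2) T(2) A0(2) by auto
 define d where "d = min (p - j0) (j1 - q) / 8"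
 have d: "0 < d" "j0 + 8 * d <= p" "q + 8 * d <= j1" using pqj by (auto simp: d_def min_def field_simps)
 define q' where "q' = q + d"
 have pq': "p < q'" "T <= {p..q'}" using pq d by (auto simp: q'_def)
 \<comment> \<open>The first localization, to an interval of radius below d/4, leaves room in
   \<open>{j0<..<j1}\<close> for the contour, whose sides are sought at distances between 3d/4 and d
   from \<open>x1\<close>.\<close>
 obtain n :: nat where n: "(q' - p) / (d / 2) < real n" using reals_Archimedean2 by blast
 have "0 < (q' - p) / (d / 2)" using pq'(1) d(1) by (intro divide_pos_pos) auto
 hence "0 < real n" using n by (rule less_trans)
 hence n0: "0 < n" by simp
 define h where "h = (q' - p) / (2 * real n)"
 have h: "0 < h" "h < d / 4" using n n0 d pq' by (auto simp: h_def field_simps)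
 obtain x1 where x1: "x1 : {p..q'}" "2 * h * (measure lborel T / (q' - p)) <= measure lborel (T \<inter> {x1 - h..x1 + h})"
 using exists_dense_interval[OF Tm pq'(2,1) n0] unfolding h_def by blast
 have x1j: "j0 < x1 - 3 * d" "x1 + 3 * d < j1" using x1(1) d by (auto simp: q'_def)
 define A where "A = T \<inter> {x1 - d / 4..x1 + d / 4}"
 have A: "compact A" "A <= {x1 - d / 4..x1 + d / 4}" "!!y. y : A ==> g y = 0" "A : sets lborel"
 using compact_Int_closed[OF cT] T(2) A0(4) Tm by (auto simp: A_def)
 have Af: "A : fmeasurable lborel"
 using emeasure_bounded_finite[OF compact_imp_bounded[OF A(1)]] A(4) by (intro fmeasurableI) auto
 have "T \<inter> {x1 - h..x1 + h} <= A" unfolding A_def using h by auto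
 hence "measure lborel (T \<inter> {x1 - h..x1 + h}) <= measure lborel A"
 by (rule measure_mono_fmeasurable[OF _ _ Af]) (use Tm in simp)
 moreover have "0 < 2 * h * (measure lborel T / (q' - p))" using h(1) mT pq'(1) by (intro mult_pos_pos divide_pos_pos) auto
 ultimately have mA: "0 < measure lborel A" using x1(2) by linarith
 obtain K where K: "0 <= K" "!!x y. x : {-b..b} ==> y : {-b..b} ==> \<bar>ph x - ph y - ph1 y * (x - y)\<bar> <= K * (x - y)\<^sup>2"
 using taylor_remainder by blast
 obtain Z0 where Z0: "Z0 > 0" "!!y. y : {-b..b} ==> cmod (zt' y) <= Z0"
 using compact_bd[OF cont_zt' compact_Icc] by blast
 obtain M0 v0 where v0: "0 < v0" "v0 < et"
 and M0: "ALL v. 0 < v --> v < v0 --> (\<integral>\<^sup>+x\<in>{x1 - d..x1 + d}. enn (cmod (H (pt x v))) \<partial>lborel) <= enn M0"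
 and small: "ALL A. compact A --> A ~= {} --> A <= {x1 - d..x1 + d} --> (ALL y:A. g y = 0) --> (\<forall>e>0. \<exists>dl>0. \<exists>v1>0. ALL v. 0 < v --> v < v1 -->
 (\<integral>\<^sup>+x\<in>{x : {x1 - d..x1 + d}. infdist x A <= dl}. enn (cmod (H (pt x v))) \<partial>lborel) <= enn e)"
 using H_slices[OF d(1) x1j] by (elim exE conjE)
 define c where "c = v0 / 2"
 have c: "0 < c" "c < et" "c < v0" using v0 by (auto simp: c_def)
 define M where "M = max M0 0"
 have M: "(\<integral>\<^sup>+x\<in>{al..bt}. enn (cmod (H (pt x v))) \<partial>lborel) <= enn M"
 if "0 < v" "v <= c" "{al..bt} <= {x1 - d..x1 + d}" for v al bt
 proof -
 have "(\<integral>\<^sup>+x\<in>{al..bt}. enn (cmod (H (pt x v))) \<partial>lborel) <= (\<integral>\<^sup>+x\<in>{x1 - d..x1 + d}. enn (cmod (H (pt x v))) \<partial>lborel)"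
 using that(3) by (intro nn_integral_mono mult_lm) (auto simp: indicator_def)
 also have "... <= enn M0" using M0 that c by auto
 also have "... <= enn M" by (rule ennreal_leI) (simp add: M_def)
 finally show ?thesis .
 qed
 have jb: "{x1 - d..x1 + d} <= {-b<..<b}" using x1j J d by auto
 obtain ya where ya: "ya : {x1 - d..x1 - 3 / 4 * d}" "(\<integral>\<^sup>+s\<in>{0<..c}. enn (cmod (H (pt ya s))) \<partial>lborel) < \<infinity>"
 using side_finite[of "x1 - d" "x1 - 3 / 4 * d" c M] M jb c d by (auto simp: subset_iff)
 obtain yb where yb: "yb : {x1 + 3 / 4 * d..x1 + d}" "(\<integral>\<^sup>+s\<in>{0<..c}. enn (cmod (H (pt yb s))) \<partial>lborel) < \<infinity>"
 using side_finite[of "x1 + 3 / 4 * d" "x1 + d" c M] M jb c d by (auto simp: subset_iff)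
 define S where "S = enn2real (\<integral>\<^sup>+s\<in>{0<..c}. enn (cmod (H (pt ya s))) \<partial>lborel) + enn2real (\<integral>\<^sup>+s\<in>{0<..c}. enn (cmod (H (pt yb s))) \<partial>lborel)"
 have S: "(\<integral>\<^sup>+s\<in>{0<..c}. enn (cmod (H (pt y s))) \<partial>lborel) <= enn S" if "y = ya \<or> y = yb" for y
 proof -
 have "(\<integral>\<^sup>+s\<in>{0<..c}. enn (cmod (H (pt y s))) \<partial>lborel) = enn (enn2real (\<integral>\<^sup>+s\<in>{0<..c}. enn (cmod (H (pt y s))) \<partial>lborel))"
 using ya(2) yb(2) that by (auto simp: ennreal_enn2real)
 also have "... <= enn S" using that by (intro ennreal_leI) (auto simp: S_def)
 finally show ?thesis .
 qed
 define r B0 th0 where "r = d / 4" and "B0 = 1 + 4 * K + 4 * c / r\<^sup>2 + 4 / c" and "th0 = measure lborel A / (d / 2)"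
 have B0: "1 <= B0" unfolding B0_def using K(1) c(1) d(1) by (simp add: r_def)
 have th0: "0 < th0" using mA d by (simp add: th0_def)
 \<comment> \<open>\<open>c\<close> and \<open>B0\<close> are fixed before the second localization.
   There the set keeps the mean density \<open>th0\<close> on an interval of half-length l, so the
   right side of \<open>gap\<close> is at least th0/8 for every l. The left side is a multiple of l
   plus th0/16, and \<open>l0\<close> makes that multiple at most th0/16.\<close>
 define l0 where "l0 = min (d / 8) (min (c / 2) (th0 / (16 * (4 * B0 + 16 * K))))"
 have "0 < th0 / (16 * (4 * B0 + 16 * K))" using th0 B0 K(1) by (intro divide_pos_pos) auto
 hence l0: "0 < l0" "l0 <= d / 8" "l0 <= c / 2" "l0 <= th0 / (16 * (4 * B0 + 16 * K))"
 using d(1) c(1) unfolding l0_def by linarith+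
 obtain n2 :: nat where n2: "(d / 4) / l0 < real n2" using reals_Archimedean2 by blast
 have "0 < (d / 4) / l0" using d(1) l0(1) by (intro divide_pos_pos) auto
 hence "0 < real n2" using n2 by (rule less_trans)
 hence n20: "0 < n2" by simp
 define l where "l = (x1 + d / 4 - (x1 - d / 4)) / (2 * real n2)"
 have leq: "l = (d / 4) / real n2" by (simp add: l_def)
 have l: "0 < l" unfolding leq using d(1) n20 by simp
 have ll0: "l <= l0"
 proof -
 have "d / 4 < real n2 * l0" using n2 l0(1) by (simp add: pos_divide_less_eq)
 thus ?thesis unfolding leq using n20 by (simp add: pos_divide_le_eq mult.commute)
 qed
 have "x1 - d / 4 < x1 + d / 4" using d by simp
 from exists_dense_interval[OF A(4,2) this n20, folded l_def]
 obtain y0 where y0: "y0 : {x1 - d / 4..x1 + d / 4}" "2 * l * (measure lborel A / (x1 + d / 4 - (x1 - d / 4))) <= measure lborel (A \<inter> {y0 - l..y0 + l})"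
 by blast
 have y0m: "2 * l * th0 <= measure lborel (A \<inter> {y0 - l..y0 + l})" using y0(2) by (simp add: th0_def)
 define A' where "A' = A \<inter> {y0 - l..y0 + l}"
 have A': "compact A'" "A' <= {y0 - l..y0 + l}" "A' <= {x1 - d..x1 + d}" "ALL y:A'. g y = 0"
 using compact_Int_closed[OF A(1)] A d by (auto simp: A'_def)
 have "0 < 2 * l * th0" using l(1) th0 by simp
 hence "0 < measure lborel A'" using y0m unfolding A'_def by linarith
 hence A'ne: "A' ~= {}" by auto
 have gap: "4 * l * B0 + 16 * K * l + th0 / 16 <= measure lborel A' / (16 * l)"
 proof -
 have "0 < 16 * (4 * B0 + 16 * K)" using B0 K(1) by simp
 from order_trans[OF ll0 l0(4), unfolded pos_le_divide_eq[OF this]]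
 have "l * (16 * (4 * B0 + 16 * K)) <= th0" .
 moreover have "l * (16 * (4 * B0 + 16 * K)) = 16 * (4 * l * B0 + 16 * K * l)" by (simp only: algebra_simps)
 ultimately have "16 * (4 * l * B0 + 16 * K * l) <= th0" by (simp only:)
 moreover have "X + th0 / 16 <= th0 / 8" if "16 * X <= th0" for X using that by argo
 ultimately have "4 * l * B0 + 16 * K * l + th0 / 16 <= th0 / 8" by blast
 also have "... = 2 * l * th0 / (16 * l)" using l by simp
 also have "... <= measure lborel A' / (16 * l)" using y0m l unfolding A'_def by (intro divide_right_mono) auto
 finally show ?thesis .
 qed
 have core: "H (pt x nx) = 0" if x: "\<bar>x - y0\<bar> < l / 2" "l / 2 < nx" "nx < l" for x nx
 proof -
 have sm: "\<exists>dl>0. \<exists>v1>0. ALL v. 0 < v --> v < v1 -->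
 (\<integral>\<^sup>+y\<in>{y : {ya..yb}. infdist y A' <= dl}. enn (cmod (H (pt y v))) \<partial>lborel) <= enn e" if e: "0 < e" for e
 proof -
 obtain dl v1 where dl: "0 < dl" "0 < v1" "!!v. 0 < v ==> v < v1 ==>
 (\<integral>\<^sup>+x\<in>{x : {x1 - d..x1 + d}. infdist x A' <= dl}. enn (cmod (H (pt x v))) \<partial>lborel) <= enn e"
 using small[THEN spec, THEN mp, OF A'(1), THEN mp, OF A'ne, THEN mp, OF A'(3), THEN mp, OF A'(4)] e by blast
 have "(\<integral>\<^sup>+y\<in>{y : {ya..yb}. infdist y A' <= dl}. enn (cmod (H (pt y v))) \<partial>lborel) <= enn e" if v: "0 < v" "v < v1" for v
 by (rule order_trans[OF nn_integral_mono dl(3)[OF v]], rule mult_lm) (use ya(1) yb(1) in \<open>auto simp: indicator_def\<close>)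
 thus ?thesis using dl(1,2) by blast
 qed
 have M1: "(\<integral>\<^sup>+y\<in>{ya..yb}. enn (cmod (H (pt y v))) \<partial>lborel) <= enn M" if "0 < v" "v <= c" for v
 by (rule M[OF that]) (use ya yb in auto)
 have Z1: "cmod (zt' y) <= Z0 + 1" if "y : {-b..b}" for y using Z0(2)[OF that] by simp
 have yb': "-b < ya" "yb < b" using ya(1) yb(1) d(1) x1j J by auto
 have r: "0 < r" "ya + r + 2 * l <= y0" "y0 + r + 2 * l <= yb" "l <= r"
 using ya(1) yb(1) y0(1) l ll0 l0 d(1) by (auto simp: r_def)
 have "0 <= M" "0 <= S" "1 <= Z0 + 1" "2 * l <= c" "0 < th0 / 16" using Z0(1) l0 ll0 th0 by (auto simp: S_def M_def)
 thus ?thesis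
 by (intro uniqueness_core[OF K Z1 _ c(1,2) yb' M1 _ S _ sm A'(1) A'ne A'(2) l _ r B0_def _ gap x])
 qed
 \<comment> \<open>The points reached by \<open>uniqueness_core\<close> form a nonempty open set;
   the rest of the connected region follows by analytic continuation.\<close>
 define V where "V = Do \<inter> {w. Re w : {y0 - l / 2<..<y0 + l / 2}} \<inter> (%w. Im w - ph (Re w)) -` {l / 2<..<l}"
 have oV: "open V"
 proof -
 have "cts Do (%w. Im w - ph (Re w))"
 by (intro continuous_intros con_comp[OF cont_ph]) (auto simp: Do_def)
 hence "open (Do \<inter> (%w. Im w - ph (Re w)) -` {l / 2<..<l})" by (rule open_preimage[OF _ open_Do]) simp
 moreover have "open {w. Re w : {y0 - l / 2<..<y0 + l / 2}}"
 using open_vimage[of "{y0 - l / 2<..<y0 + l / 2}" Re] by (simp add: vimage_def continuous_on_Re continuous_on_id)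
 moreover have "V = (Do \<inter> (%w. Im w - ph (Re w)) -` {l / 2<..<l}) \<inter> {w. Re w : {y0 - l / 2<..<y0 + l / 2}}" by (auto simp: V_def)
 ultimately show ?thesis by auto
 qed
 have "\<bar>y0\<bar> < b" using y0(1) x1j J d(1) by (auto simp: abs_less_iff)
 hence "pt y0 (3 / 4 * l) : V" using l ll0 l0 c by (auto simp: V_def intro!: pt_in_Do)
 hence "V ~= {}" by auto
 moreover have "H z = 0" if "z : V" for z
 proof -
 have "y0 - l / 2 < Re z" "Re z < y0 + l / 2" and i: "l / 2 < Im z - ph (Re z)" "Im z - ph (Re z) < l" using that by (auto simp: V_def)
 hence "\<bar>Re z - y0\<bar> < l / 2" by linarith
 note this i
 from core[OF this] show ?thesis using Do_pt[of z] that by (simp add: V_def)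
 qed
 ultimately show ?thesis
 using analytic_continuation_open[OF oV open_Do _ connected_Do _ holomorphic_H holomorphic_on_const[of 0] _ w] by (auto simp: V_def)
qed

end

section \<open>Normalized first integrals and adapted charts\<close>

lemma frechet_derivative_px_py:
 assumes "Csm B u" "z : B"
 shows "fder u (at z) v = fst v *\<^sub>R px u z + snd v *\<^sub>R py u z"
 by (rule frechet_derivative_plane[OF smooth_differentiable[OF assms]])

text \<open>The inverse function theorem yields a differentiable inverse, whose derivative is the
  matrix of Cramer's rule composed with the inverse itself; smoothness follows by bootstrapping. The
  determinant stands on the left of the derivative formula to keep it free of division.\<close>

lemma smooth_inverse_plane:
 fixes u v :: "plane => real"
 assumes B: "open B" "p : B" and uv: "Csm B u" "Csm B v"
 and J: "!!z. z : B ==> px u z * py v z - py u z * px v z ~= 0"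
 shows "EX U' V Ps. open U' & U' <= B & p : U' & open V & homeomorphism U' V (%z. (u z, v z)) Ps & Csm V Ps &
 (ALL w:V. ALL h. (px u (Ps w) * py v (Ps w) - py u (Ps w) * px v (Ps w)) *\<^sub>R fder Ps (at w) h =
 (py v (Ps w) * fst h - py u (Ps w) * snd h, px u (Ps w) * snd h - px v (Ps w) * fst h))"
proof -
 define F where "F z = (u z, v z)" for z
 define J where "J z = px u z * py v z - py u z * px v z" for z
 have Jnz: "J z ~= 0" if "z : B" for z using J[OF that] by (simp add: J_def)
 define D where "D z h = (fst h * px u z + snd h * py u z, fst h * px v z + snd h * py v z)" for z and h :: plane
 have blD: "bounded_linear (D z)" for z
 unfolding D_def[abs_def]
 by (intro bounded_linear_Pair bounded_linear_add bounded_linear_compose[OF bounded_linear_mult_left] bounded_linear_fst bounded_linear_snd)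
 have FD: "(F hasd D z) (at z)" if "z : B" for z
 proof -
 have "(F hasd (%h. (fder u (at z) h, fder v (at z) h))) (at z)"
 unfolding F_def[abs_def] by (intro has_derivative_Pair smooth_has_derivative[OF uv(1) that] smooth_has_derivative[OF uv(2) that])
 thus ?thesis
 by (simp add: frechet_derivative_px_py[OF uv(1) that] frechet_derivative_px_py[OF uv(2) that] D_def[abs_def])
 qed
 define E where "E h = ((fst h * py v p - snd h * py u p) / J p, (snd h * px u p - fst h * px v p) / J p)" for h :: plane
 have blE: "bounded_linear E"
 unfolding E_def[abs_def]
 by (intro bounded_linear_Pair bounded_linear_sub bounded_linear_compose[OF bounded_linear_divide] bounded_linear_compose[OF bounded_linear_mult_left] bounded_linear_fst bounded_linear_snd)
 have cp: "cts B (px u)" "cts B (py u)" "cts B (px v)" "cts B (py v)"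
 using uv by (auto intro!: smooth_con smooth_px smooth_py)
 have cD: "cts B (%z. Blinfun (D z))"
 proof (rule continuous_on_blinfun_componentwise)
 fix i :: plane
 have "cts B (%z. D z i)" unfolding D_def by (intro continuous_intros cp)
 thus "cts B (%z. blinfun_apply (Blinfun (D z)) i)" by (simp add: bounded_linear_Blinfun_apply[OF blD])
 qed
 have ED: "Blinfun E o\<^sub>L Blinfun (D p) = id_blinfun"
 proof (rule blinfun_eqI)
 fix h :: plane
 have a: "((fst h * px u p + snd h * py u p) * py v p - (fst h * px v p + snd h * py v p) * py u p) = fst h * J p"
 "((fst h * px v p + snd h * py v p) * px u p - (fst h * px u p + snd h * py u p) * px v p) = snd h * J p"
 by (simp_all add: J_def algebra_simps)
 have "E (D p h) = h" unfolding E_def D_def fst_conv snd_conv a using Jnz[OF B(2)] by simp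
 thus "blinfun_apply (Blinfun E o\<^sub>L Blinfun (D p)) h = blinfun_apply id_blinfun h"
 by (simp add: bounded_linear_Blinfun_apply[OF blD] bounded_linear_Blinfun_apply[OF blE])
 qed
 obtain U' V Ps Ps' where U': "open U'" "U' <= B" "p : U'" and V: "open V" and hom: "homeomorphism U' V F Ps"
 and Ps': "!!w. w : V ==> (Ps hasd Ps' w) (at w)"
 proof (rule inverse_function_theorem[OF B(1) _ cD B(2) ED, of F])
 show "(F hasd blinfun_apply (Blinfun (D z))) (at z)" if "z : B" for z
 using FD[OF that] by (simp only: bounded_linear_Blinfun_apply[OF blD])
 qed (rule that)
 have PsB: "Ps w : U'" "Ps w : B" "F (Ps w) = w" if "w : V" for w
 using hom that U'(2) unfolding homeomorphism_def by auto
 define E2 where "E2 h z = ((fst h * py v z - snd h * py u z) / J z, (snd h * px u z - fst h * px v z) / J z)" for h z :: plane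
 have fd: "fder Ps (at w) h = E2 h (Ps w)" if w: "w : V" for w h
 proof -
 have "((%w. F (Ps w)) hasd (%h. D (Ps w) (Ps' w h))) (at w)"
 by (rule hd_comp[OF Ps'[OF w] FD[OF PsB(2)[OF w]]])
 hence "((%w. w) hasd (%h. D (Ps w) (Ps' w h))) (at w)"
 by (rule hd_transform[OF _ V w]) (simp add: PsB(3))
 hence "(%h. D (Ps w) (Ps' w h)) = (%h. h)" by (rule has_derivative_unique[OF _ has_derivative_ident])
 hence e: "D (Ps w) (Ps' w h) = h" by metis
 define k where "k = Ps' w h"
 note Jw = Jnz[OF PsB(2)[OF w]]
 have "fst h = fst k * px u (Ps w) + snd k * py u (Ps w)" "snd h = fst k * px v (Ps w) + snd k * py v (Ps w)"
 using e unfolding D_def k_def[symmetric] by (metis fst_conv, metis snd_conv)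
 hence "fst h * py v (Ps w) - snd h * py u (Ps w) = fst k * J (Ps w)" "snd h * px u (Ps w) - fst h * px v (Ps w) = snd k * J (Ps w)"
 by (simp_all add: J_def algebra_simps)
 hence "E2 h (Ps w) = k" unfolding E2_def using Jw by simp
 thus ?thesis using frechet_derivative_at[OF Ps'[OF w]] by (simp add: k_def)
 qed
 have sE2: "Csm B (E2 h)" for h
 unfolding E2_def[abs_def] J_def[abs_def] using J
 by (intro smooth_Pair[OF B(1)] smooth_divide[OF B(1)] smooth_diff[OF B(1)] smooth_mult[OF B(1)] smooth_const smooth_px smooth_py uv) auto
 have "Ck_on k V Ps" for k
 proof (induction k)
 case 0
 thus ?case using hom by (simp add: homeomorphism_def)
 next
 case (Suc k)
 have "Ck_on k V (%w. fder Ps (at w) h)" for h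
 proof -
 have "Ck_on k V (%w. E2 h (Ps w))"
 by (rule Ck_on_compose[OF V B(1) _ _ Suc.IH]) (use sE2[of h] PsB(2) in \<open>auto simp: smooth_on_def\<close>)
 thus ?thesis using Ck_on_cong[OF V, of "%w. E2 h (Ps w)" "%w. fder Ps (at w) h" k] fd by auto
 qed
 thus ?case unfolding Ck_on.simps differentiable_def using Ps' by blast
 qed
 hence sm: "Csm V Ps" by (simp add: smooth_on_def)
 have d: "J (Ps w) *\<^sub>R fder Ps (at w) h = (py v (Ps w) * fst h - py u (Ps w) * snd h, px u (Ps w) * snd h - px v (Ps w) * fst h)" if "w : V" for w h
 unfolding fd[OF that] E2_def using Jnz[OF PsB(2)[OF that]] by (simp add: mult.commute)
 show ?thesis
 by (rule exI[of _ U'], rule exI[of _ V], rule exI[of _ Ps],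
 rule conjI[OF U'(1) conjI[OF U'(2) conjI[OF U'(3) conjI[OF V conjI[OF hom[unfolded F_def[abs_def]] conjI[OF sm ballI[OF allI[OF d[unfolded J_def]]]]]]]]])
qed

lemma smooth_Re_Im:
 assumes "open S" "Csm S u"
 shows "Csm S (%z. Re (u z))" "Csm S (%z. Im (u z))"
 by (intro smooth_linear_compose[OF assms(1) _ assms(2)] bounded_linear_Re bounded_linear_Im)+

lemma px_Re_Im:
 assumes "Csm S u" "z : S"
 shows "px (%z. Re (u z)) z = Re (px u z)" "py (%z. Re (u z)) z = Re (py u z)"
 "px (%z. Im (u z)) z = Im (px u z)" "py (%z. Im (u z)) z = Im (py u z)"
 using px_eqI[OF has_derivative_Re[OF smooth_has_derivative[OF assms]]] py_eqI[OF has_derivative_Re[OF smooth_has_derivative[OF assms]]]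
 px_eqI[OF has_derivative_Im[OF smooth_has_derivative[OF assms]]] py_eqI[OF has_derivative_Im[OF smooth_has_derivative[OF assms]]]
 by (simp_all add: px_def[of u] py_def[of u])

lemma px_py_of_real:
 assumes "Csm S u" "z : S"
 shows "px (%z. complex_of_real (u z)) z = of_real (px u z)" "py (%z. complex_of_real (u z)) z = of_real (py u z)"
 using px_eqI[OF has_derivative_of_real[OF smooth_has_derivative[OF assms]]] py_eqI[OF has_derivative_of_real[OF smooth_has_derivative[OF assms]]]
 by (simp_all add: px_def[of u] py_def[of u])

text \<open>The part of the boundary geometry near one point that is used: a first integral \<open>Z\<close> and the
 defining function \<open>rh\<close> on a neighbourhood \<open>B\<close>.\<close>
definition first_integral_near :: "plane set => (plane => plane) => (plane => plane) => (plane => real) => plane => (plane => complex) => bool" where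
 "first_integral_near B X Y rh p Z \<longleftrightarrow> open B & p : B & Csm B X & Csm B Y & Csm B rh & Csm B Z &
 (ALL z:B. vf_apply X Y Z z = 0 & (px Z z ~= 0 \<or> py Z z ~= 0) & vf_apply X Y (%z. of_real (rh z)) z ~= 0) &
 Z p = 0 & (\<exists>r::real. r ~= 0 & px Z p * of_real (py rh p) - py Z p * of_real (px rh p) = of_real r)"

text \<open>Dividing by \<open>ka\<close>, the determinant of dZ0 and d rh at \<open>p\<close>,
  makes this determinant real, so that d(Im Z) and d rh are parallel at \<open>p\<close>. It is
  nonzero because a form d rh proportional to dZ0 would give L rh = 0 along with L Z0 = 0.\<close>

lemma first_integral_near_exists:
 assumes U: "open U" "p : U" and L: "Csm U X" "Csm U Y" "locally_integrable U X Y"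
 and rh: "open V" "p : V" "Csm V rh" "vf_apply X Y (%z. complex_of_real (rh z)) p ~= 0"
 and W: "open W" "p : W"
 shows "EX B Z. B <= W & B <= U & first_integral_near B X Y rh p Z"
proof -
 obtain B0 Z0 where B0: "open B0" "p : B0" "B0 <= U" and Z0: "Csm B0 Z0"
 and LZ0: "!!w. w : B0 ==> vf_apply X Y Z0 w = 0 & fder Z0 (at w) ~= (%_. 0)"
 using L(3) U(2) unfolding locally_integrable_def by metis
 let ?rh = "%z. complex_of_real (rh z)"
 define B1 where "B1 = B0 \<inter> V \<inter> W"
 have B1: "open B1" "p : B1" "B1 <= B0" "B1 <= V" "B1 <= W" "B1 <= U" using B0 rh W by (auto simp: B1_def)
 have srh: "Csm B1 rh" by (rule smooth_subset[OF rh(3) B1(4)])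
 have sc: "Csm B1 ?rh" by (rule smooth_linear_compose[OF B1(1) bounded_linear_of_real srh])
 have sXY: "Csm B1 X" "Csm B1 Y" using L B1(6) smooth_subset by blast+
 have sZ0: "Csm B1 Z0" by (rule smooth_subset[OF Z0 B1(3)])
 have Lrh: "vf_apply X Y ?rh z = vf_x X Y z * px ?rh z + vf_y X Y z * py ?rh z" if "z : B1" for z
 by (rule vf_apply_eq[OF smooth_differentiable[OF sc that]])
 have "cts B1 (%z. vf_x X Y z * px ?rh z + vf_y X Y z * py ?rh z)"
 by (intro continuous_intros smooth_con smooth_vf[OF B1(1) sXY] smooth_px[OF sc] smooth_py[OF sc])
 hence "open (B1 \<inter> (%z. vf_x X Y z * px ?rh z + vf_y X Y z * py ?rh z) -` (- {0}))"
 by (rule open_preimage[OF _ B1(1) open_Compl]) simp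
 moreover define B where "B = B1 \<inter> (%z. vf_x X Y z * px ?rh z + vf_y X Y z * py ?rh z) -` (- {0})"
 ultimately have B: "open B" "B <= B1" by auto
 have pB: "p : B" using rh(4) Lrh[OF B1(2)] B1(2) by (simp add: B_def)
 define ka where "ka = px Z0 p * of_real (py rh p) - py Z0 p * of_real (px rh p)"
 have dZ0: "px Z0 z ~= 0 \<or> py Z0 z ~= 0" if "z : B1" for z
 proof (rule ccontr)
 assume "~ ?thesis"
 hence "fder Z0 (at z) = (%_. 0)" using frechet_derivative_px_py[OF sZ0 that] by (simp add: fun_eq_iff)
 thus False using LZ0[of z] that B1(3) by blast
 qed
 have LZ: "vf_x X Y z * px Z0 z + vf_y X Y z * py Z0 z = 0" if "z : B1" for z
 using LZ0[of z] that B1(3) vf_apply_eq[OF smooth_differentiable[OF sZ0 that], of X Y] by auto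
 have ka: "ka ~= 0"
 proof
 assume k: "ka = 0"
 define r1 r2 where "r1 = complex_of_real (px rh p)" and "r2 = complex_of_real (py rh p)"
 have k': "px Z0 p * r2 = py Z0 p * r1" using k by (simp add: ka_def r1_def r2_def)
 have n: "vf_x X Y p * r1 + vf_y X Y p * r2 ~= 0"
 using rh(4) Lrh[OF B1(2)] px_py_of_real[OF srh B1(2)] by (simp add: r1_def r2_def)
 have z: "vf_x X Y p * px Z0 p + vf_y X Y p * py Z0 p = 0" by (rule LZ[OF B1(2)])
 have "px Z0 p * (vf_x X Y p * r1 + vf_y X Y p * r2) = r1 * (vf_x X Y p * px Z0 p + vf_y X Y p * py Z0 p)"
 using k' by (simp add: algebra_simps)
 moreover have "py Z0 p * (vf_x X Y p * r1 + vf_y X Y p * r2) = r2 * (vf_x X Y p * px Z0 p + vf_y X Y p * py Z0 p)"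
 using k' by (simp add: algebra_simps)
 ultimately have "px Z0 p = 0" "py Z0 p = 0" using z n by auto
 thus False using dZ0[OF B1(2)] by simp
 qed
 define Z where "Z z = inverse ka * (Z0 z - Z0 p)" for z
 have sZ: "Csm B Z"
 unfolding Z_def[abs_def] by (intro smooth_mult[OF B(1)] smooth_diff[OF B(1)] smooth_const smooth_subset[OF sZ0 B(2)])
 have Zd: "(Z hasd (%h. inverse ka * fder Z0 (at z) h)) (at z)" if "z : B" for z
 proof -
 have "(Z0 hasd fder Z0 (at z)) (at z)" using smooth_has_derivative[OF sZ0] that B(2) by blast
 from has_derivative_mult_right[OF has_derivative_diff[OF this has_derivative_const], of "inverse ka" "Z0 p"]
 show ?thesis unfolding Z_def[abs_def] by simp
 qed
 have pZ: "px Z z = inverse ka * px Z0 z" "py Z z = inverse ka * py Z0 z" if "z : B" for z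
 using px_eqI[OF Zd[OF that]] py_eqI[OF Zd[OF that]] by (simp_all add: px_def[of Z0] py_def[of Z0])
 have "vf_apply X Y Z z = 0" if "z : B" for z
 proof -
 have "vf_apply X Y Z z = inverse ka * (vf_x X Y z * px Z0 z + vf_y X Y z * py Z0 z)"
 unfolding vf_apply_eq[OF smooth_differentiable[OF sZ that]] pZ[OF that] by (simp add: algebra_simps)
 thus ?thesis using LZ[of z] that B(2) by auto
 qed
 note n1 = this
 have n2: "px Z z ~= 0 \<or> py Z z ~= 0" if "z : B" for z using pZ[OF that] dZ0[of z] that B(2) ka by auto
 have n3: "vf_apply X Y ?rh z ~= 0" if "z : B" for z using that Lrh[of z] B(2) by (auto simp: B_def)
 have n4: "px Z p * of_real (py rh p) - py Z p * of_real (px rh p) = of_real 1"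
 proof -
 have "px Z p * of_real (py rh p) - py Z p * of_real (px rh p) = inverse ka * ka"
 unfolding pZ[OF pB] ka_def by (simp add: right_diff_distrib)
 thus ?thesis using ka by simp
 qed
 have n5: "Z p = 0" by (simp add: Z_def)
 have "\<exists>r::real. r ~= 0 & px Z p * of_real (py rh p) - py Z p * of_real (px rh p) = of_real r"
 using n4 by (intro exI[of _ 1]) simp
 hence "first_integral_near B X Y rh p Z"
 unfolding first_integral_near_def using n1 n2 n3 n5 B(1) pB sZ smooth_subset[OF sXY(1) B(2)] smooth_subset[OF sXY(2) B(2)] smooth_subset[OF srh B(2)]
 by (intro conjI ballI) simp_all
 thus ?thesis
 by (intro exI[of _ B] exI[of _ Z] conjI order_trans[OF B(2) B1(5)] order_trans[OF B(2) B1(6)])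
qed

text \<open>The coordinates are (Re Z, rh). By the normalization of \<open>Z\<close> the
  x-derivative of Im Z vanishes at \<open>p\<close>, so it stays below 1/2 nearby.\<close>

lemma chart_exists:
 assumes fi: "first_integral_near B X Y rh p Z" and BU: "B <= U" and Om: "open Om" "defining_function Om rh" "p : frontier Om"
 shows "EX A Ps. 0 < A & adapted_chart Om rh U X Y (-A) A A Ps & open (Ps ` ({-A<..<A} \<times> {-A<..<A})) & Ps ` ({-A<..<A} \<times> {-A<..<A}) <= B & Ps (0, 0) = p &
 Csm ({-A<..<A} \<times> {-A<..<A}) (%z. Z (Ps z)) &
 (ALL z:{-A<..<A} \<times> {-A<..<A}. Re (Z (Ps z)) = fst z & \<bar>px (%z. Im (Z (Ps z))) z\<bar> <= 1 / 2)"
proof -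
 have B: "open B" "p : B" and sm: "Csm B X" "Csm B Y" "Csm B rh" "Csm B Z"
 and LZ: "!!z. z : B ==> vf_apply X Y (%z. of_real (rh z)) z ~= 0" and Zp: "Z p = 0"
 using fi by (auto simp: first_integral_near_def)
 obtain r :: real where r: "r ~= 0" "px Z p * of_real (py rh p) - py Z p * of_real (px rh p) = of_real r"
 using fi by (auto simp: first_integral_near_def)
 have rhp: "rh p = 0" and rhpos: "!!z. z : Om ==> 0 < rh z" and rhf: "!!z. z : frontier Om ==> rh z = 0"
 using Om(2,3) by (auto simp: defining_function_def)
 define u where "u z = Re (Z z)" for z
 note su = smooth_Re_Im(1)[OF B(1) sm(4), folded u_def] and si = smooth_Re_Im(2)[OF B(1) sm(4)]
 define J where "J z = px u z * py rh z - py u z * px rh z" for z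
 have "cts B J"
 unfolding J_def[abs_def] by (intro continuous_intros smooth_con smooth_px smooth_py su sm)
 hence "open (B \<inter> J -` (- {0}))" by (rule open_preimage[OF _ B(1) open_Compl]) simp
 moreover define B2 where "B2 = B \<inter> J -` (- {0})"
 ultimately have B2: "open B2" "B2 <= B" "!!z. z : B2 ==> J z ~= 0" by auto
 have pu: "px u p = Re (px Z p)" "py u p = Re (py Z p)" using px_Re_Im[OF sm(4) B(2)] by (simp_all add: u_def[abs_def])
 have "J p = r" using arg_cong[OF r(2), of Re] by (simp add: J_def pu)
 hence pB2: "p : B2" using r B(2) by (simp add: B2_def)
 obtain U' V Ps where U': "open U'" "U' <= B2" "p : U'" and V: "open V" and hom: "homeomorphism U' V (%z. (u z, rh z)) Ps" and sPs: "Csm V Ps"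
 and dPs: "!!w h. w : V ==> J (Ps w) *\<^sub>R fder Ps (at w) h =
 (py rh (Ps w) * fst h - py u (Ps w) * snd h, px u (Ps w) * snd h - px rh (Ps w) * fst h)"
 using smooth_inverse_plane[OF B2(1) pB2 smooth_subset[OF su B2(2)] smooth_subset[OF sm(3) B2(2)] B2(3)[unfolded J_def], folded J_def] by blast
 have Ps: "Ps w : U'" "Ps w : B" "J (Ps w) ~= 0" "u (Ps w) = fst w" "rh (Ps w) = snd w" if "w : V" for w
 proof -
 have a: "Ps w : U'" "(u (Ps w), rh (Ps w)) = w"
 using homeomorphism_image2[OF hom] homeomorphism_apply2[OF hom that] that by blast+
 show "Ps w : U'" by (rule a(1))
 show "Ps w : B" using a(1) U'(2) B2(2) by blast
 show "J (Ps w) ~= 0" by (rule B2(3)[OF subsetD[OF U'(2) a(1)]])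
 show "u (Ps w) = fst w" "rh (Ps w) = snd w" using a(2) by (metis fst_conv, metis snd_conv)
 qed
 have pV: "(0, 0) : V" "Ps (0, 0) = p"
 proof -
 have e: "(u p, rh p) = (0, 0)" using Zp rhp by (simp add: u_def)
 show "(0, 0) : V" using imageI[OF U'(3), of "%z. (u z, rh z)"] unfolding homeomorphism_image1[OF hom] e .
 show "Ps (0, 0) = p" using homeomorphism_apply1[OF hom U'(3)] unfolding e .
 qed
 define ph where "ph w = Im (Z (Ps w))" for w
 have sV: "Csm V (%w. Z (Ps w))"
 by (rule smooth_compose[OF V B(1) _ sm(4) sPs]) (use Ps(2) in auto)
 have sph: "Csm V ph" unfolding ph_def[abs_def] by (rule smooth_Re_Im(2)[OF V sV])
 have d1: "fder Ps (at w) (1, 0) = (py rh (Ps w) / J (Ps w), - px rh (Ps w) / J (Ps w))"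
 "fder Ps (at w) (0, 1) = (- py u (Ps w) / J (Ps w), px u (Ps w) / J (Ps w))" if w: "w : V" for w
 using dPs[OF w, of "(1, 0)"] dPs[OF w, of "(0, 1)"] Ps(3)[OF w]
 by (cases "fder Ps (at w) (1, 0)", simp add: field_simps, cases "fder Ps (at w) (0, 1)", simp add: field_simps)
 have "px ph (0, 0) = 0"
 proof -
 have "(ph hasd (%h. fder (%z. Im (Z z)) (at (Ps (0, 0))) (fder Ps (at (0, 0)) h))) (at (0, 0))"
 unfolding ph_def[abs_def]
 by (rule hd_comp[OF smooth_has_derivative[OF sPs pV(1)] smooth_has_derivative[OF si]]) (simp add: pV B(2))
 from px_eqI[OF this] have "px ph (0, 0) = py rh p / J p * Im (px Z p) - px rh p / J p * Im (py Z p)"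
 unfolding d1[OF pV(1)] pV(2) frechet_derivative_px_py[OF si B(2)] px_Re_Im(3,4)[OF sm(4) B(2)] by simp
 also have "... = Im (px Z p * of_real (py rh p) - py Z p * of_real (px rh p)) / J p" by (simp add: diff_divide_distrib mult.commute)
 finally show ?thesis unfolding r(2) by simp
 qed
 moreover have "cts V (px ph)" by (rule smooth_con[OF smooth_px[OF sph]])
 ultimately have "open (V \<inter> px ph -` {-1/2<..<1/2})" "(0, 0) : V \<inter> px ph -` {-1/2<..<1/2}"
 using open_preimage[OF _ V, of "px ph" "{-1/2<..<1/2}"] pV(1) by auto
 then obtain e where e: "e > 0" "ball (0, 0) e <= V \<inter> px ph -` {-1/2<..<1/2}" by (meson openE)
 define A where "A = e / 2"
 have A: "0 < A" using e by (simp add: A_def)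
 define Q where "Q = {-A<..<A} \<times> {-A<..<A}"
 have "Q <= ball (0, 0) e"
 proof
 fix z assume "z : Q"
 hence "\<bar>fst z\<bar> < A" "\<bar>snd z\<bar> < A" by (auto simp: Q_def)
 moreover have "dist (0, 0) z <= \<bar>fst z\<bar> + \<bar>snd z\<bar>"
 using sqrt_sum_squares_le_sum_abs[of "fst z" "snd z"] by (simp add: dist_prod_def dist_real_def split_beta)
 ultimately show "z : ball (0, 0) e" by (simp add: A_def)
 qed
 hence QV: "Q <= V \<inter> px ph -` {-1/2<..<1/2}" using e(2) by (rule order_trans)
 have Q2: "\<bar>px ph z\<bar> <= 1 / 2" if "z : Q" for z
 proof -
 have "-1/2 < px ph z & px ph z < 1/2" using subsetD[OF QV that] by simp
 thus ?thesis by linarith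
 qed
 have Q1: "Q <= V" using QV by blast
 have oQ: "open Q" "(0, 0) : Q" using A by (auto simp: Q_def open_Times)
 have oI: "open (Ps ` Q)"
 proof -
 have "Ps ` Q = U' \<inter> (%z. (u z, rh z)) -` Q"
 proof (intro equalityI subsetI)
 fix z assume "z : Ps ` Q"
 then obtain w where w: "w : Q" "z = Ps w" by (metis imageE)
 have "(u z, rh z) = w" unfolding w(2) Ps(4)[OF subsetD[OF Q1 w(1)]] Ps(5)[OF subsetD[OF Q1 w(1)]] by (rule prod.collapse)
 hence "(u z, rh z) : Q" using w(1) by (rule ssubst)
 thus "z : U' \<inter> (%z. (u z, rh z)) -` Q" using Ps(1)[OF subsetD[OF Q1 w(1)]] w(2) by blast
 next
 fix z assume "z : U' \<inter> (%z. (u z, rh z)) -` Q"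
 thus "z : Ps ` Q" using homeomorphism_apply1[OF hom, of z] by (intro image_eqI[of _ _ "(u z, rh z)"]) auto
 qed
 thus ?thesis using open_preimage[OF homeomorphism_cont1[OF hom] U'(1) oQ(1)] by simp
 qed
 have inj: "inj_on Ps Q" by (rule inj_onI) (metis homeomorphism_apply2[OF hom subsetD[OF Q1]])
 \<comment> \<open>Positivity of \<open>rh\<close> is given only inside \<open>Om\<close>. For the
   converse, the upper half of the box is connected, avoids the frontier, where \<open>rh\<close> is
   0, and meets \<open>Om\<close> because \<open>p\<close> is a frontier point.\<close>
 have OmQ: "Ps w : Om \<longleftrightarrow> 0 < snd w" if w: "w : Q" for w
 proof
 assume "Ps w : Om"
 thus "0 < snd w" using rhpos[of "Ps w"] Ps(5)[OF subsetD[OF Q1 w]] by simp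
 next
 assume s: "0 < snd w"
 define Qp where "Qp = {-A<..<A} \<times> {0<..<A}"
 have Qp: "Qp <= Q" "!!z. z : Qp ==> 0 < snd z" by (auto simp: Qp_def Q_def)
 have "connected (Ps ` Qp)"
 proof (rule connected_continuous_image)
 show "cts Qp Ps" using smooth_con[OF sPs] Q1 Qp(1) con_subset by (metis subset_trans)
 show "connected Qp" unfolding Qp_def by (intro convex_connected convex_Times convex_real_interval)
 qed
 moreover have "Ps ` Qp \<inter> frontier Om = {}"
 proof (rule ccontr)
 assume "Ps ` Qp \<inter> frontier Om ~= {}"
 then obtain z where z: "z : Qp" "Ps z : frontier Om" by blast
 thus False using rhf[OF z(2)] Ps(5)[of z] Qp(2)[OF z(1)] subsetD[OF Qp(1) z(1)] Q1 by (metis less_irrefl subsetD)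
 qed
 moreover have "Ps ` Qp \<inter> Om ~= {}"
 proof -
 have "p : Ps ` Q" using oQ(2) pV(2) by force
 moreover have "p : closure Om" using Om(3) by (simp add: frontier_def)
 ultimately obtain z where z: "z : Q" "Ps z : Om" using oI open_Int_closure_eq_empty[OF oI, of Om] by blast
 hence "0 < snd z" using rhpos[of "Ps z"] Ps(5)[OF subsetD[OF Q1 z(1)]] by simp
 hence "z : Qp" using z(1) by (auto simp: Q_def Qp_def)
 thus ?thesis using z by blast
 qed
 ultimately have "Ps ` Qp <= Om" using connected_Int_frontier[of "Ps ` Qp" Om] by blast
 moreover have "w : Qp" using w s by (auto simp: Q_def Qp_def)
 ultimately show "Ps w : Om" by blast
 qed
 have bij: "bij (fder Ps (at w))" if w: "w : Q" for w
 proof -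
 have wV: "w : V" using w Q1 by blast
 have l: "linear (fder Ps (at w))"
 using bounded_linear.linear[OF has_derivative_bounded_linear[OF smooth_has_derivative[OF sPs wV]]] .
 have "inj (fder Ps (at w))"
 proof (subst linear_injective_0[OF l], intro allI impI)
 fix h assume "fder Ps (at w) h = 0"
 hence "(py rh (Ps w) * fst h - py u (Ps w) * snd h, px u (Ps w) * snd h - px rh (Ps w) * fst h) = 0" using dPs[OF wV, of h] by simp
 hence z: "py rh (Ps w) * fst h - py u (Ps w) * snd h = 0" "px u (Ps w) * snd h - px rh (Ps w) * fst h = 0"
 by (simp_all add: zero_prod_def)
 have "J (Ps w) * fst h = px u (Ps w) * (py rh (Ps w) * fst h - py u (Ps w) * snd h) + py u (Ps w) * (px u (Ps w) * snd h - px rh (Ps w) * fst h)"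
 "J (Ps w) * snd h = px rh (Ps w) * (py rh (Ps w) * fst h - py u (Ps w) * snd h) + py rh (Ps w) * (px u (Ps w) * snd h - px rh (Ps w) * fst h)"
 by (simp_all add: J_def algebra_simps)
 hence "fst h = 0" "snd h = 0" unfolding z using Ps(3)[OF wV] by auto
 thus "h = 0" by (simp add: prod_eq_iff)
 qed
 thus ?thesis using linear_inj_imp_surj[OF l] by (simp add: bij_def)
 qed
 have vec: "EX m al. m ~= 0 & (ALL e:Basis. Complex (X (Ps w) \<bullet> e) (Y (Ps w) \<bullet> e) =
 m * (of_real (fder Ps (at w) (0, 1) \<bullet> e) + al * of_real (fder Ps (at w) (1, 0) \<bullet> e)))" if w: "w : Q" for w
 proof -
 have wV: "w : V" using w Q1 by blast
 define a b where "a = vf_x X Y (Ps w)" and "b = vf_y X Y (Ps w)"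
 define u1 u2 r1 r2 j where "u1 = complex_of_real (px u (Ps w))" and "u2 = complex_of_real (py u (Ps w))"
 and "r1 = complex_of_real (px rh (Ps w))" and "r2 = complex_of_real (py rh (Ps w))" and "j = complex_of_real (J (Ps w))"
 have "j ~= 0" using Ps(3)[OF wV] by (simp only: j_def of_real_eq_0_iff not_False_eq_True)
 moreover have "j = u1 * r2 - u2 * r1" by (simp add: j_def u1_def u2_def r1_def r2_def J_def)
 ultimately have j: "j ~= 0" "j = u1 * r2 - u2 * r1" .
 \<comment> \<open>In these coordinates L = (L rh) d/dt + (L Re Z) d/dx; \<open>m\<close> and
   \<open>l\<close> are the two coefficients, and the factor of d/dx after dividing by
   \<open>m\<close> is l/m.\<close>
 define m l where "m = a * r1 + b * r2" and "l = a * u1 + b * u2"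
 have sr: "Csm B (%z. complex_of_real (rh z))" by (rule smooth_linear_compose[OF B(1) bounded_linear_of_real sm(3)])
 have m: "m ~= 0"
 using LZ[OF Ps(2)[OF wV]] vf_apply_eq[OF smooth_differentiable[OF sr Ps(2)[OF wV]], of X Y] px_py_of_real[OF sm(3) Ps(2)[OF wV]]
 by (simp add: m_def a_def b_def r1_def r2_def)
 have ja: "- (m * u2) + l * r2 = j * a" and jb: "m * u1 - l * r1 = j * b"
 unfolding j(2) m_def l_def by (simp_all add: algebra_simps)
 have m1: "m * (x + l / m * y) = m * x + l * y" for x y
 by (simp only: distrib_left mult.assoc[symmetric] times_divide_eq_right nonzero_mult_div_cancel_left[OF m])
 have "m * (- u2 / j + l / m * (r2 / j)) = (- (m * u2) + l * r2) / j"
 unfolding m1 by (simp only: times_divide_eq_right mult_minus_right add_divide_distrib)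
 hence e1: "a = m * (- u2 / j + l / m * (r2 / j))" unfolding ja nonzero_mult_div_cancel_left[OF j(1)] by (rule sym)
 have "m * (u1 / j + l / m * (- r1 / j)) = (m * u1 - l * r1) / j"
 unfolding m1 by (simp only: times_divide_eq_right mult_minus_right diff_conv_add_uminus add_divide_distrib)
 hence e2: "b = m * (u1 / j + l / m * (- r1 / j))" unfolding jb nonzero_mult_div_cancel_left[OF j(1)] by (rule sym)
 show ?thesis
 proof (intro exI conjI ballI)
 fix e :: plane assume "e : Basis"
 then consider "e = (1, 0)" | "e = (0, 1)" by (auto simp: Basis_prod_def)
 thus "Complex (X (Ps w) \<bullet> e) (Y (Ps w) \<bullet> e) =
 m * (of_real (fder Ps (at w) (0, 1) \<bullet> e) + l / m * of_real (fder Ps (at w) (1, 0) \<bullet> e))"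
 proof cases
 case 1
 thus ?thesis using e1 unfolding d1[OF wV] by (simp add: a_def vf_x_def inner_prod_def u2_def r2_def j_def)
 next
 case 2
 thus ?thesis using e2 unfolding d1[OF wV] by (simp add: b_def vf_y_def inner_prod_def u1_def r1_def j_def)
 qed
 qed (rule m)
 qed
 have ad: "adapted_chart Om rh U X Y (-A) A A Ps"
 unfolding adapted_chart_def Q_def[symmetric]
 proof (intro conjI ballI)
 show "Csm Q Ps" using smooth_subset[OF sPs Q1] .
 fix x t assume "x : {-A<..<A}" "t : {-A<..<A}"
 hence w: "(x, t) : Q" by (simp add: Q_def)
 hence wV: "(x, t) : V" using Q1 by blast
 show "bij (fder Ps (at (x, t)))" "Ps (x, t) : U" "rh (Ps (x, t)) = t" "(Ps (x, t) : Om) = (0 < t)"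
 using bij[OF w] Ps(2,5)[OF wV] OmQ[OF w] BU by auto
 show "EX m al. m ~= 0 & (ALL e:Basis. Complex (X (Ps (x, t)) \<bullet> e) (Y (Ps (x, t)) \<bullet> e) =
 m * (of_real (fder Ps (at (x, t)) (0, 1) \<bullet> e) + al * of_real (fder Ps (at (x, t)) (1, 0) \<bullet> e)))" by (rule vec[OF w])
 qed (use A inj in auto)
 have sub: "Ps ` Q <= B" using Ps(2) Q1 by blast
 have re: "Re (Z (Ps z)) = fst z & \<bar>px (%z. Im (Z (Ps z))) z\<bar> <= 1 / 2" if "z : Q" for z
 using Ps(4)[OF subsetD[OF Q1 that]] Q2[OF that] by (simp add: u_def ph_def[abs_def])
 have "0 < A & adapted_chart Om rh U X Y (-A) A A Ps & open (Ps ` Q) & Ps ` Q <= B & Ps (0, 0) = p & Csm Q (%z. Z (Ps z)) &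
 (ALL z:Q. Re (Z (Ps z)) = fst z & \<bar>px (%z. Im (Z (Ps z))) z\<bar> <= 1 / 2)"
 by (rule conjI[OF A conjI[OF ad conjI[OF oI conjI[OF sub conjI[OF pV(2) conjI[OF smooth_subset[OF sV Q1] ballI[OF re]]]]]]])
 thus ?thesis unfolding Q_def by (rule exI[of _ A, OF exI[of _ Ps]])
qed

lemma prim_cong:
 assumes S: "open S" and p: "prim S Z g G" and "!!z. z : S ==> G z = G' z"
 shows "prim S Z g G'"
 unfolding prim_def
proof (intro conjI ballI)
 show "cts S g" using p by (simp add: prim_def)
 fix z assume z: "z : S"
 have "(G hasd (%v. g z * fder Z (at z) v)) (at z)" using p z by (simp add: prim_def)
 thus "(G' hasd (%v. g z * fder Z (at z) v)) (at z)"
 by (rule hd_transform[OF _ S z]) (rule assms(3))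
qed

text \<open>\<open>closed_on\<close> speaks of rectangles and is not visibly invariant under a
  change of coordinates. Local primitives are, by the chain rule, and they give closedness of the
  pulled-back form.\<close>

lemma prim_pullback:
 assumes S: "open S" "Csm S Ps" "inj_on Ps S" and img: "open (Ps ` S)" "Csm (Ps ` S) Z"
 and f: "cts (Ps ` S) f" "closed_on (Ps ` S) (%z. f z * px Z z) (%z. f z * py Z z)"
 and box: "S = {a<..<b} \<times> {c<..<d}"
 shows "EX G. prim S (%w. Z (Ps w)) (%w. f (Ps w)) G"
proof -
 let ?Z = "%w. Z (Ps w)" and ?f = "%w. f (Ps w)"
 have sZ: "Csm S ?Z" by (rule smooth_compose[OF S(1) img(1) subset_refl img(2) S(2)])
 have cPs: "cts S Ps" by (rule smooth_con[OF S(2)])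
 have cf: "cts S ?f" by (rule con_comp[OF f(1) cPs]) simp
 have "closed_on S (%z. ?f z * px ?Z z) (%z. ?f z * py ?Z z)"
 proof (rule closed_on_local)
 show "cts S (%z. ?f z * px ?Z z)" "cts S (%z. ?f z * py ?Z z)"
 by (intro continuous_intros cf smooth_con[OF smooth_px[OF sZ]] smooth_con[OF smooth_py[OF sZ]])+
 fix w assume w: "w : S"
 hence "Ps w : Ps ` S" by (rule imageI)
 then obtain A B where AB: "open A" "open B" "Ps w : A \<times> B" "A \<times> B <= Ps ` S"
 by (rule open_prod_elim[OF img(1)])
 obtain e1 e2 where e: "0 < e1" "ball (fst (Ps w)) e1 <= A" "0 < e2" "ball (snd (Ps w)) e2 <= B"
 using AB openE by (metis mem_Times_iff)
 define R where "R = {fst (Ps w) - e1<..<fst (Ps w) + e1} \<times> {snd (Ps w) - e2<..<snd (Ps w) + e2}"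
 have R: "R <= Ps ` S" "open R" "Ps w : R"
 using e AB(4) by (auto simp: R_def ball_eq_greaterThanLessThan open_Times mem_Times_iff)
 have "closed_on R (%z. f z * px Z z) (%z. f z * py Z z)"
 using f(2) R(1) con_subset unfolding closed_on_def by (metis (no_types, lifting) subset_trans)
 then obtain G0 where "exact_on R (%z. f z * px Z z) (%z. f z * py Z z) G0" using closed_on_box_imp_exact unfolding R_def by blast
 hence G0: "prim R Z f G0"
 using prim_eq_exact_on[OF smooth_subset[OF img(2) R(1)] con_subset[OF f(1) R(1)]] by simp
 define T where "T = S \<inter> Ps -` R"
 have T: "open T" "w : T" "T <= S" using open_preimage[OF cPs S(1) R(2)] w R(3) by (auto simp: T_def)
 have "prim T ?Z ?f (%w. G0 (Ps w))"
 unfolding prim_def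
 proof (intro conjI ballI)
 show "cts T ?f" using cf T(3) by (rule con_subset)
 fix v assume v: "v : T"
 hence vS: "v : S" "Ps v : R" by (auto simp: T_def)
 note dPs = smooth_has_derivative[OF S(2) vS(1)]
 have dZ: "(Z hasd fder Z (at (Ps v))) (at (Ps v))" by (rule smooth_has_derivative[OF img(2)]) (use vS in simp)
 have e: "fder ?Z (at v) = (%h. fder Z (at (Ps v)) (fder Ps (at v) h))"
 by (rule frechet_derivative_at[OF hd_comp[OF dPs dZ], symmetric])
 have dG: "(G0 hasd (%h. f (Ps v) * fder Z (at (Ps v)) h)) (at (Ps v))" using G0 vS(2) by (simp add: prim_def)
 show "((%w. G0 (Ps w)) hasd (%h. f (Ps v) * fder ?Z (at v) h)) (at v)"
 unfolding e by (rule hd_comp[OF dPs dG])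
 qed
 hence "exact_on T (%z. ?f z * px ?Z z) (%z. ?f z * py ?Z z) (%w. G0 (Ps w))"
 using prim_eq_exact_on[OF smooth_subset[OF sZ T(3)] con_subset[OF cf T(3)]] by simp
 thus "EX T. open T & w : T & closed_on T (%z. ?f z * px ?Z z) (%z. ?f z * py ?Z z)"
 by (intro exI[of _ T] conjI T(1,2) exact_imp_closed_on)
 qed
 with sZ cf show ?thesis unfolding box by (rule prim_exists)
qed

section \<open>Growth of iterated primitives\<close>

locale upper_chart =
 fixes A a :: real and Z :: "plane => complex"
 assumes a: "0 < a" "a < A" and smooth: "Csm ({-A<..<A} \<times> {-A<..<A}) Z"
begin

abbreviation "Qp \<equiv> {-A<..<A} \<times> {0<..<A}"

lemma smooth_Qp: "Csm Qp Z" by (rule smooth_subset[OF smooth]) auto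

lemma open_Qp: "open Qp" by (simp add: open_Times)

lemma next_prim: "prim Qp Z g G ==> EX G'. prim Qp Z G G'"
 using prim_exists[OF smooth_Qp prim_imp_continuous_on prim_imp_closed_on[OF open_Qp smooth_Qp]] by blast

lemma partial_bound: "\<exists>C>0. ALL z:{-a..a} \<times> {0..a}. cmod (px Z z) <= C & cmod (py Z z) <= C"
proof -
 have sub: "{-a..a} \<times> {0..a} <= {-A<..<A} \<times> {-A<..<A}" using a by auto
 have c: "compact ({-a..a} \<times> {0..a})" by (intro compact_Times compact_Icc)
 obtain C1 where C1: "C1 > 0" "!!z. z : {-a..a} \<times> {0..a} ==> cmod (px Z z) <= C1"
 using compact_bd[OF con_subset[OF smooth_con[OF smooth_px[OF smooth]] sub] c] by blast
 obtain C2 where C2: "C2 > 0" "!!z. z : {-a..a} \<times> {0..a} ==> cmod (py Z z) <= C2"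
 using compact_bd[OF con_subset[OF smooth_con[OF smooth_py[OF smooth]] sub] c] by blast
 have "cmod (px Z z) <= max C1 C2 & cmod (py Z z) <= max C1 C2" if "z : {-a..a} \<times> {0..a}" for z
 using C1(2)[OF that] C2(2)[OF that] by (simp add: le_max_iff_disj)
 thus ?thesis using C1(1) by (intro exI[of _ "max C1 C2"]) auto
qed

lemma prim_partials:
 assumes "prim Qp Z g G" "(x, t) : Qp"
 shows "((%x. G (x, t)) hvd g (x, t) * px Z (x, t)) (at x within B)"
 and "((%t. G (x, t)) hvd g (x, t) * py Z (x, t)) (at t within B)"
proof -
 have "(G hasd (%v. g (x, t) * fder Z (at (x, t)) v)) (at (x, t))" using assms by (simp add: prim_def)
 note d = has_derivative_plane_partials[OF this, folded px_def py_def]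
 show "((%x. G (x, t)) hvd g (x, t) * px Z (x, t)) (at x within B)" by (rule d(1))
 show "((%t. G (x, t)) hvd g (x, t) * py Z (x, t)) (at t within B)" by (rule d(2))
qed

lemma prim_cont: "prim Qp Z g G ==> cts Qp g & cts Qp G"
 using prim_imp_continuous_on by (auto simp: prim_def)

lemma bounded_on_top:
 assumes "prim Qp Z g G"
 shows "\<exists>M>0. ALL x:{-a..a}. cmod (G (x, a)) <= M"
proof -
 have "cts {-a..a} (%x. G (x, a))"
 by (rule con_slice(1)[OF conjunct2[OF prim_cont[OF assms]]]) (use a in auto)
 from compact_bd[OF this compact_Icc]
 obtain M where "M > 0" "!!x. x : {-a..a} ==> cmod (G (x, a)) <= M" by metis
 thus ?thesis by (intro exI[of _ M] conjI ballI)
qed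

text \<open>Vertical integration from t up to height \<open>a\<close>, where \<open>G\<close> is
  bounded. One formula serves both signs of 1 - e: for e > 1 one power of t is gained, for e < 1 the
  result is bounded.\<close>

lemma prim_powr_bound:
 assumes p: "prim Qp Z g G" and g: "!!x t. x : {-a..a} ==> t : {0<..a} ==> cmod (g (x, t)) <= K * t powr (- e)" and e: "e ~= 1" and K: "0 <= K"
 shows "EX M C. 0 <= M & 0 <= C & (ALL x:{-a..a}. ALL t:{0<..a}. cmod (G (x, t)) <= M + K * C / (1 - e) * (a powr (1 - e) - t powr (1 - e)))"
proof -
 obtain C where C: "C > 0" "!!z. z : {-a..a} \<times> {0..a} ==> cmod (py Z z) <= C" using partial_bound by blast
 obtain M where M: "M > 0" "!!x. x : {-a..a} ==> cmod (G (x, a)) <= M" using bounded_on_top[OF p] by blast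
 have "cmod (G (x, t)) <= M + K * C / (1 - e) * (a powr (1 - e) - t powr (1 - e))" if x: "x : {-a..a}" and t: "t : {0<..a}" for x t
 proof (cases "t = a")
 case True
 thus ?thesis using M(2)[OF x] by simp
 next
 case False
 hence ta: "t < a" using t by simp
 have Q: "(x, s) : Qp" if "s : {t..a}" for s using x t a that by auto
 have "cmod (G (x, a) - G (x, t)) <= K * C / (1 - e) * a powr (1 - e) - K * C / (1 - e) * t powr (1 - e)"
 proof (rule differentiable_bound_general[OF ta, where f' = "%s. g (x, s) * py Z (x, s)" and \<phi>' = "%s. K * C * s powr (- e)"])
 show "cts {t..a} (%s. G (x, s))"
 by (rule con_slice(2)[OF conjunct2[OF prim_cont[OF p]]]) (rule Q)
 show "cts {t..a} (%s. K * C / (1 - e) * s powr (1 - e))" using t by (intro continuous_intros) auto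
 fix s assume s: "t < s" "s < a"
 hence sQ: "(x, s) : Qp" by (intro Q) simp
 show "((%s. G (x, s)) hvd g (x, s) * py Z (x, s)) (at s)" by (rule prim_partials(2)[OF p sQ])
 have s0: "0 < s" using s t by simp
 have "((%s. K * C / (1 - e) * s powr (1 - e)) hrd K * C / (1 - e) * ((1 - e) * s powr (1 - e - 1))) (at s)"
 by (rule DERIV_cmult[OF has_real_derivative_powr[OF s0]])
 moreover have "K * C / (1 - e) * ((1 - e) * s powr (1 - e - 1)) = K * C * s powr (- e)" using e by simp
 ultimately show "((%s. K * C / (1 - e) * s powr (1 - e)) hvd K * C * s powr (- e)) (at s)"
 by (simp only: hrd_hvd)
 have "s : {0<..a}" using s s0 by simp
 note 1 = g[OF x this]
 have 2: "cmod (py Z (x, s)) <= C" by (rule C(2)) (use x s s0 in simp)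
 have "cmod (g (x, s) * py Z (x, s)) <= (K * s powr (- e)) * C"
 unfolding norm_mult by (rule mult_mono[OF 1 2 mult_nonneg_nonneg[OF K powr_ge_zero] norm_ge_zero])
 thus "cmod (g (x, s) * py Z (x, s)) <= K * C * s powr (- e)" by (simp only: mult_ac)
 qed
 hence "cmod (G (x, a) - G (x, t)) <= K * C / (1 - e) * (a powr (1 - e) - t powr (1 - e))" by (simp only: right_diff_distrib)
 thus ?thesis using M(2)[OF x] norm_triangle_ineq3[of "G (x, a)" "G (x, t)"] by linarith
 qed
 thus ?thesis by (intro exI[of _ M] exI[of _ C] conjI ballI less_imp_le[OF M(1)] less_imp_le[OF C(1)])
qed

lemma le_powr_neg: "0 < t ==> t <= a ==> 0 <= e ==> 1 <= a powr e * t powr (- e)"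
 using powr_mono2[of e t a] by (simp add: powr_minus field_simps)

lemma prim_bound_high:
 assumes p: "prim Qp Z g G" and g: "!!x t. x : {-a..a} ==> t : {0<..a} ==> cmod (g (x, t)) <= K * t powr (- e)" and e: "1 < e" and K: "0 <= K"
 shows "\<exists>K'\<ge>0. ALL x:{-a..a}. ALL t:{0<..a}. cmod (G (x, t)) <= K' * t powr (- (e - 1))"
proof -
 have "e ~= 1" using e by simp
 from prim_powr_bound[OF p g this K] obtain M C where MC: "0 <= M" "0 <= C"
 and G: "!!x t. x : {-a..a} ==> t : {0<..a} ==> cmod (G (x, t)) <= M + K * C / (1 - e) * (a powr (1 - e) - t powr (1 - e))" by blast
 define D where "D = K * C / (e - 1)"
 have D: "0 <= D" using K MC e by (simp add: D_def)
 have bd: "cmod (G (x, t)) <= (M * a powr (e - 1) + D) * t powr (- (e - 1))" if x: "x : {-a..a}" and t: "t : {0<..a}" for x t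
 proof -
 have "K * C / (1 - e) = - D" unfolding D_def by (metis minus_diff_eq minus_divide_right)
 hence "K * C / (1 - e) * (a powr (1 - e) - t powr (1 - e)) = D * t powr (1 - e) - D * a powr (1 - e)" by (simp add: right_diff_distrib)
 also have "... <= D * t powr (- (e - 1))" using D by simp
 finally have 1: "cmod (G (x, t)) <= M + D * t powr (- (e - 1))" using G[OF x t] by linarith
 have "M * 1 <= M * (a powr (e - 1) * t powr (- (e - 1)))" using le_powr_neg[of t "e - 1"] t e MC by (intro mult_lm) auto
 hence "M <= M * a powr (e - 1) * t powr (- (e - 1))" by (simp only: mult_1_right mult.assoc)
 thus ?thesis using 1 unfolding distrib_right by linarith
 qed
 have nn: "0 <= M * a powr (e - 1) + D" using MC D by simp
 show ?thesis by (rule exI[of _ "M * a powr (e - 1) + D"], rule conjI[OF nn], intro ballI bd)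
qed

lemma prim_bound_low:
 assumes p: "prim Qp Z g G" and g: "!!x t. x : {-a..a} ==> t : {0<..a} ==> cmod (g (x, t)) <= K * t powr (- e)" and e: "e < 1" and K: "0 <= K"
 shows "\<exists>K'\<ge>0. ALL x:{-a..a}. ALL t:{0<..a}. cmod (G (x, t)) <= K'"
proof -
 have "e ~= 1" using e by simp
 from prim_powr_bound[OF p g this K] obtain M C where MC: "0 <= M" "0 <= C"
 and G: "!!x t. x : {-a..a} ==> t : {0<..a} ==> cmod (G (x, t)) <= M + K * C / (1 - e) * (a powr (1 - e) - t powr (1 - e))" by blast
 have D: "0 <= K * C / (1 - e)" using K MC e by simp
 have bd: "cmod (G (x, t)) <= M + K * C / (1 - e) * a powr (1 - e)" if x: "x : {-a..a}" and t: "t : {0<..a}" for x t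
 proof -
 have "K * C / (1 - e) * (a powr (1 - e) - t powr (1 - e)) <= K * C / (1 - e) * a powr (1 - e)" by (rule mult_lm[OF _ D]) simp
 thus ?thesis using G[OF x t] by linarith
 qed
 have nn: "0 <= M + K * C / (1 - e) * a powr (1 - e)" using MC(1) D by (intro add_nonneg_nonneg mult_nonneg_nonneg powr_ge_zero)
 show ?thesis by (rule exI[of _ "M + K * C / (1 - e) * a powr (1 - e)"], rule conjI[OF nn], intro ballI bd)
qed

text \<open>One primitive turns an L^1 bound into a pointwise one: on a horizontal line
  \<open>G\<close> oscillates by at most C times the L^1 norm of \<open>g\<close>, and averaging
  over x yields a vertical line on which the increment up to height \<open>a\<close> is of the same
  size.\<close>

lemma prim_L1_bound:
 assumes p: "prim Qp Z g G" and g: "!!t. t : {0<..a} ==> HK {-a..a} (%x. cmod (g (x, t))) <= K * t powr (- e)" and e: "0 <= e" and K: "0 < K"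
 shows "\<exists>K'\<ge>0. ALL x:{-a..a}. ALL t:{0<..a}. cmod (G (x, t)) <= K' * t powr (- e)"
proof -
 obtain C where C: "C > 0" "!!z. z : {-a..a} \<times> {0..a} ==> cmod (px Z z) <= C & cmod (py Z z) <= C" using partial_bound by blast
 obtain M where M: "M > 0" "!!x. x : {-a..a} ==> cmod (G (x, a)) <= M" using bounded_on_top[OF p] by blast
 note cg = conjunct1[OF prim_cont[OF p]] and cG = conjunct2[OF prim_cont[OF p]]
 have gx: "cts {-a..a} (%x. cmod (g (x, t)))" if "t : {0<..a}" for t
 by (rule con_slice(1)[OF con_norm[OF cg]]) (use that a in auto)
 have cgZ: "cts Qp (%z. g z * px Z z)" "cts Qp (%z. g z * py Z z)"
 by (intro con_mult cg smooth_con smooth_px smooth_py smooth_Qp)+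
 have hor: "cmod (G (x, t) - G (y, t)) <= C * (K * t powr (- e))" if xy: "-a <= y" "y <= x" "x <= a" and t: "t : {0<..a}" for x y t
 proof -
 have Q: "(u, t) : Qp" if "u : {y..x}" for u using xy t a that by auto
 have "((%u. g (u, t) * px Z (u, t)) has_integral (G (x, t) - G (y, t))) {y..x}"
 by (rule FTC[OF xy(2)]) (rule prim_partials(1)[OF p Q])
 hence "cmod (G (x, t) - G (y, t)) = cmod (HK {y..x} (%u. g (u, t) * px Z (u, t)))" by (simp add: integral_unique)
 also have "... <= HK {y..x} (%u. C * cmod (g (u, t)))"
 proof (rule int_norm_bd)
 show "(%u. g (u, t) * px Z (u, t)) integrable_on {y..x}"
 by (rule int_con, rule con_slice(1)[OF cgZ(1)]) (rule Q)
 show "(%u. C * cmod (g (u, t))) integrable_on {y..x}"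
 by (intro int_con con_mult con_const con_subset[OF gx[OF t]]) (use xy in auto)
 show "cmod (g (u, t) * px Z (u, t)) <= C * cmod (g (u, t))" if "u : {y..x}" for u
 unfolding norm_mult mult.commute[of C] using C(2)[of "(u, t)"] that xy t by (intro mult_lm) auto
 qed
 also have "... <= HK {-a..a} (%u. C * cmod (g (u, t)))"
 proof (rule integral_subset_le)
 show "(%u. C * cmod (g (u, t))) integrable_on {y..x}" "(%u. C * cmod (g (u, t))) integrable_on {-a..a}"
 by (intro int_con con_mult con_const con_subset[OF gx[OF t]]; use xy in auto)+
 qed (use xy C in auto)
 also have "... <= C * (K * t powr (- e))" using g[OF t] C(1) by simp
 finally show ?thesis .
 qed
 have ver: "EX x:{-a..a}. cmod (G (x, a) - G (x, t)) <= C * (K * t powr (- e))" if t: "t : {0<..a}" for t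
 proof (rule ccontr)
 assume "~ ?thesis"
 hence big: "C * (K * t powr (- e)) <= cmod (G (x, a) - G (x, t))" if "x : {-a..a}" for x using that by force
 have Q: "(x, s) : Qp" if "x : {-a..a}" "s : {t..a}" for x s using t a that by auto
 have QR: "{-a..a} \<times> {t..a} <= Qp" using Q by blast
 define c where "c = C * (K * t powr (- e))"
 have c: "0 < c" using C K t by (simp add: c_def)
 have cI: "cts {-a..a} (%x. HK {t..a} (%s. C * cmod (g (x, s))))"
 using int_param[of "{-a..a}" t a "%x s. C * cmod (g (x, s))"]
 con_subset[OF con_mult[OF con_const[of Qp C] con_norm[OF cg]] QR] by (simp add: case_prod_eta split_beta)
 have "2 * a * c = HK {-a..a} (%x. c)" using a(1) by simp
 also have "... <= HK {-a..a} (%x. HK {t..a} (%s. C * cmod (g (x, s))))"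
 proof (rule integral_le)
 fix x assume x: "x : {-a..a}"
 have "((%s. g (x, s) * py Z (x, s)) has_integral (G (x, a) - G (x, t))) {t..a}"
 by (rule FTC) (use t in simp, rule prim_partials(2)[OF p Q[OF x]])
 hence "cmod (G (x, a) - G (x, t)) = cmod (HK {t..a} (%s. g (x, s) * py Z (x, s)))" by (simp add: integral_unique)
 also have "... <= HK {t..a} (%s. C * cmod (g (x, s)))"
 proof (rule int_norm_bd)
 show "(%s. g (x, s) * py Z (x, s)) integrable_on {t..a}"
 by (rule int_con, rule con_slice(2)[OF cgZ(2)]) (rule Q[OF x])
 show "(%s. C * cmod (g (x, s))) integrable_on {t..a}"
 by (intro int_con con_mult con_const, rule con_slice(2)[OF con_norm[OF cg]]) (rule Q[OF x])
 show "cmod (g (x, s) * py Z (x, s)) <= C * cmod (g (x, s))" if "s : {t..a}" for s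
 unfolding norm_mult mult.commute[of C] using C(2)[of "(x, s)"] that x t by (intro mult_lm) auto
 qed
 finally show "c <= HK {t..a} (%s. C * cmod (g (x, s)))" using big[OF x] unfolding c_def by linarith
 qed (intro int_con cI con_const)+
 also have "... = HK {t..a} (%s. HK {-a..a} (%x. C * cmod (g (x, s))))"
 proof -
 have "cts (cbox (- a, t) (a, a)) (%(x, y). C * cmod (g (x, y)))"
 using con_subset[OF con_mult[OF con_const[of Qp C] con_norm[OF cg]] QR] by (simp add: cbox_Pair_eq split_beta)
 from integral_swap_continuous[OF this] show ?thesis by (simp only: cbox_interval)
 qed
 also have "... <= HK {t..a} (%s. c)"
 proof (rule integral_le)
 have "cts {t..a} (%s. HK (cbox (-a) a) (%x. C * cmod (g (x, s))))"
 proof (rule int_param)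
 show "cts ({t..a} \<times> cbox (- a) a) (%(s, x). C * cmod (g (x, s)))"
 unfolding split_beta
 by (intro con_mult con_const con_norm con_comp[OF cg] continuous_on_Pair continuous_on_fst continuous_on_snd continuous_on_id)
 (use QR in auto)
 qed
 thus "(%s. HK {-a..a} (%x. C * cmod (g (x, s)))) integrable_on {t..a}" by (simp add: int_con)
 fix s assume s: "s : {t..a}"
 hence st: "s : {0<..a}" using t by simp
 have "HK {-a..a} (%x. C * cmod (g (x, s))) = C * HK {-a..a} (%x. cmod (g (x, s)))" by simp
 also have "... <= C * (K * s powr (- e))" using g[OF st] C(1) by (intro mult_lm) auto
 also have "... <= c" unfolding c_def using C(1) K s t e by (intro mult_lm powr_mono2') auto
 finally show "HK {-a..a} (%x. C * cmod (g (x, s))) <= c" .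
 qed (rule integrable_const_ivl)
 also have "... = (a - t) * c" using t by simp
 also have "... < 2 * a * c" using t a(1) c by (intro mult_strict_right_mono) auto
 finally show False by simp
 qed
 define L where "L = M * a powr e + 2 * (C * K)"
 have bd: "cmod (G (x, t)) <= L * t powr (- e)" if x: "x : {-a..a}" and t: "t : {0<..a}" for x t
 proof -
 obtain y where y: "y : {-a..a}" "cmod (G (y, a) - G (y, t)) <= C * (K * t powr (- e))" using ver[OF t] by blast
 have "cmod (G (x, t) - G (y, t)) <= C * (K * t powr (- e))"
 proof (cases "y <= x")
 case True
 thus ?thesis using hor[of y x t] x y(1) t by simp
 next
 case False
 thus ?thesis using hor[of x y t] x y(1) t by (simp add: norm_minus_commute)
 qed
 moreover have "cmod (G (x, t)) <= cmod (G (y, a)) + cmod (G (y, a) - G (y, t)) + cmod (G (x, t) - G (y, t))"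
 using norm_triangle_ineq[of "G (x, t) - G (y, t)" "G (y, t)"] norm_triangle_ineq4[of "G (y, a)" "G (y, a) - G (y, t)"] by simp
 ultimately have 1: "cmod (G (x, t)) <= M + 2 * (C * (K * t powr (- e)))" using M(2)[OF y(1)] y(2) by linarith
 have "M * 1 <= M * (a powr e * t powr (- e))" using le_powr_neg[of t e] t e M(1) by (intro mult_lm) auto
 hence "M <= M * a powr e * t powr (- e)" by (simp only: mult_1_right mult.assoc)
 moreover have "L * t powr (- e) = M * a powr e * t powr (- e) + 2 * (C * (K * t powr (- e)))" by (simp add: L_def distrib_right mult.assoc)
 ultimately show ?thesis using 1 by linarith
 qed
 have nn: "0 <= L" using M C K by (simp add: L_def)
 show ?thesis by (rule exI[of _ "L"], rule conjI[OF nn], intro ballI bd)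
qed

text \<open>With \<open>g\<close> bounded, \<open>G\<close> is Lipschitz on a convex box and extends
  to its closure by uniform continuity.\<close>

lemma prim_extends:
 assumes p: "prim Qp Z g G" and g: "!!x t. x : {-a..a} ==> t : {0<..a} ==> cmod (g (x, t)) <= K" and K: "0 <= K"
 shows "EX G'. prim Qp Z g G' & cts ({-a..a} \<times> {0..a}) G'"
proof -
 define X where "X = {-a..a} \<times> {0<..a}"
 have X1: "convex X" unfolding X_def by (intro convex_Times convex_real_interval)
 have X2: "X <= Qp" unfolding X_def by (rule Sigma_mono) (use a in auto)
 have cl: "closure X = {-a..a} \<times> {0..a}" using a by (simp add: X_def closure_Times)
 obtain C where C: "C > 0" "!!z. z : {-a..a} \<times> {0..a} ==> cmod (px Z z) <= C & cmod (py Z z) <= C" using partial_bound by blast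
 have lip: "cmod (G z - G w) <= K * (2 * C) * norm (z - w)" if zw: "z : X" "w : X" for z w
 proof (rule differentiable_bound[OF X1 _ _ zw(1) zw(2)])
 fix v assume v: "v : X"
 hence vQ: "v : Qp" using X2 by blast
 show "(G hasd (%h. g v * fder Z (at v) h)) (at v within X)"
 by (rule hd_within[OF bspec[OF conjunct2[OF p[unfolded prim_def]] vQ]])
 show "onorm (%h. g v * fder Z (at v) h) <= K * (2 * C)"
 proof (rule onorm_le)
 fix h :: plane
 have "v : {-a..a} \<times> {0..a}" using v by (auto simp: X_def)
 note Cv = conjunct1[OF C(2)[OF this]] conjunct2[OF C(2)[OF this]]
 have "cmod (fder Z (at v) h) <= \<bar>fst h\<bar> * cmod (px Z v) + \<bar>snd h\<bar> * cmod (py Z v)"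
 unfolding frechet_derivative_px_py[OF smooth_Qp vQ] by (rule order_trans[OF norm_triangle_ineq]) simp
 also have "... <= norm h * C + norm h * C"
 using Cv norm_fst_le[of "fst h" "snd h"] norm_snd_le[of "snd h" "fst h"] C(1) by (intro add_mono mult_mono) auto
 finally have 1: "cmod (fder Z (at v) h) <= 2 * C * norm h" by (simp add: mult_ac)
 have "cmod (g v) <= K" using g[of "fst v" "snd v"] v by (simp add: X_def mem_Times_iff)
 hence "cmod (g v) * cmod (fder Z (at v) h) <= K * (2 * C * norm h)" using 1 K by (intro mult_mono) auto
 thus "cmod (g v * fder Z (at v) h) <= K * (2 * C) * norm h" by (simp only: norm_mult mult.assoc)
 qed
 qed
 have "uniformly_continuous_on X G"
 by (rule lipschitz_on_uniformly_continuous[of "K * (2 * C)"], rule lipschitz_onI) (use lip K C(1) in \<open>auto simp: dist_norm\<close>)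
 then obtain E where E: "uniformly_continuous_on (closure X) E" "!!z. z : X ==> G z = E z"
 using uniformly_continuous_on_extension_on_closure by metis
 define G' where "G' z = (if z : Qp then G z else E z)" for z
 have "prim Qp Z g G'" by (rule prim_cong[OF open_Qp p]) (simp add: G'_def)
 moreover have "cts ({-a..a} \<times> {0..a}) G'"
 proof (rule continuous_on_eq[OF uniformly_continuous_imp_continuous[OF E(1), unfolded cl]])
 fix z assume z: "z : {-a..a} \<times> {0..a}"
 show "E z = G' z"
 proof (cases "z : Qp")
 case True
 hence "z : X" using z by (auto simp: X_def)
 thus ?thesis using E(2) True by (simp add: G'_def)
 qed (simp add: G'_def)
 qed
 ultimately show ?thesis by blast
qed

text \<open>Exponents of the form n + 1/2 never meet 1, where a logarithm would appear. The first
  primitive makes the bound pointwise, n more lower the exponent to 1/2, the next one is bounded,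
  and the last one extends continuously.\<close>

lemma iterated_prim_extends:
 assumes p: "prim Qp Z g G" and g: "!!t. t : {0<..a} ==> HK {-a..a} (%x. cmod (g (x, t))) <= K * t powr (- (real n + 1 / 2))" and K: "0 < K"
 shows "EX k G. (prim Qp Z ^^ Suc k) g G & cts ({-a..a} \<times> {0..a}) G"
proof -
 have step: "EX k G. (prim Qp Z ^^ Suc k) g G & (\<exists>K\<ge>0. ALL x:{-a..a}. ALL t:{0<..a}. cmod (G (x, t)) <= K * t powr (- (real (n - j) + 1 / 2)))" if "j <= n" for j
 using that
 proof (induction j)
 case 0
 have "0 <= real n + 1 / 2" by simp
 from prim_L1_bound[OF p g this K]
 have "\<exists>K\<ge>0. ALL x:{-a..a}. ALL t:{0<..a}. cmod (G (x, t)) <= K * t powr (- (real (n - 0) + 1 / 2))" by (simp only: minus_nat.diff_0)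
 thus ?case
 by - (rule exI[of _ "0::nat"], rule exI[of _ G], rule conjI[OF relpowp_Suc_I[where P = "prim Qp Z", OF relpowp_0_I p]])
 next
 case (Suc j)
 from Suc.IH[OF Suc_leD[OF Suc.prems]] obtain k G K1 where G: "(prim Qp Z ^^ Suc k) g G" and K1: "K1 \<ge> 0"
 "!!x t. x : {-a..a} ==> t : {0<..a} ==> cmod (G (x, t)) <= K1 * t powr (- (real (n - j) + 1 / 2))" by blast
 obtain G0 where G0: "prim Qp Z G0 G" by (rule relpowp_Suc_E[where P = "prim Qp Z", OF G])
 obtain G1 where G1: "prim Qp Z G G1" using next_prim[OF G0] by blast
 have e: "1 < real (n - j) + 1 / 2" "real (n - j) + 1 / 2 - 1 = real (n - Suc j) + 1 / 2" using Suc.prems by (auto simp: of_nat_diff)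
 from prim_bound_high[OF G1 K1(2) e(1) K1(1)]
 have "\<exists>K\<ge>0. ALL x:{-a..a}. ALL t:{0<..a}. cmod (G1 (x, t)) <= K * t powr (- (real (n - Suc j) + 1 / 2))" unfolding e(2) .
 moreover have "(prim Qp Z ^^ Suc (Suc k)) g G1" by (rule relpowp_Suc_I[where P = "prim Qp Z", OF G G1])
 ultimately show ?case by blast
 qed
 obtain k G K1 where G: "(prim Qp Z ^^ Suc k) g G" and K1: "K1 \<ge> 0"
 "!!x t. x : {-a..a} ==> t : {0<..a} ==> cmod (G (x, t)) <= K1 * t powr (- (1 / 2))"
 using step[OF order_refl, unfolded diff_self_eq_0 of_nat_0 add_0] by blast
 obtain G0 where G0: "prim Qp Z G0 G" by (rule relpowp_Suc_E[where P = "prim Qp Z", OF G])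
 obtain G1 where G1: "prim Qp Z G G1" using next_prim[OF G0] by blast
 obtain K2 where K2: "K2 \<ge> 0" "!!x t. x : {-a..a} ==> t : {0<..a} ==> cmod (G1 (x, t)) <= K2"
 using prim_bound_low[OF G1 K1(2) _ K1(1)] by force
 obtain G2 where G2: "prim Qp Z G1 G2" using next_prim[OF G1] by blast
 obtain G3 where G3: "prim Qp Z G1 G3" "cts ({-a..a} \<times> {0..a}) G3" using prim_extends[OF G2 K2(2,1)] by blast
 have "(prim Qp Z ^^ Suc (Suc (Suc k))) g G3" by (rule relpowp_Suc_I[where P = "prim Qp Z", OF relpowp_Suc_I[where P = "prim Qp Z", OF G G1] G3(1)])
 with G3(2) show ?thesis by blast
qed

end

section \<open>Arc length and the growth condition in the chart\<close>

lemma regular_arcD: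
 assumes "regular_arc gmm"
 shows "cts {0..1} gmm" "inj_on gmm {0..1}"
 and "!!s. s : {0..1} ==> (gmm hvd vector_derivative gmm (at s)) (at s)"
 and "cts {0..1} (%s. vector_derivative gmm (at s))"
 and "!!s. s : {0..1} ==> vector_derivative gmm (at s) ~= 0"
proof -
 obtain S where S: "open S" "{0..1} <= S" "Csm S gmm" using assms by (auto simp: regular_arc_def)
 have d: "vector_derivative gmm (at s) = fder gmm (at s) 1" "(gmm hvd vector_derivative gmm (at s)) (at s)" if "s : {0..1}" for s
 proof -
 have "(gmm hvd fder gmm (at s) 1) (at s)" by (rule smooth_has_vector_derivative[OF S(3)]) (use that S in auto)
 from vector_derivative_at[OF this] this show "vector_derivative gmm (at s) = fder gmm (at s) 1" "(gmm hvd vector_derivative gmm (at s)) (at s)"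
 by simp_all
 qed
 show "cts {0..1} gmm" "inj_on gmm {0..1}" using assms by (auto simp: regular_arc_def arc_def path_def)
 show "!!s. s : {0..1} ==> (gmm hvd vector_derivative gmm (at s)) (at s)" by (rule d(2))
 show "cts {0..1} (%s. vector_derivative gmm (at s))"
 by (rule continuous_on_eq[OF con_subset[OF smooth_con[OF smooth_frechet_derivative[OF S(3), of 1]] S(2)]])
 (simp add: d(1))
 show "!!s. s : {0..1} ==> vector_derivative gmm (at s) ~= 0" using assms by (auto simp: regular_arc_def)
qed

lemma sets_arc_length [simp, measurable_cong]: "sets (arc_length gmm) = sets borel"
 by (simp add: arc_length_def)

lemma nn_integral_arc_length:
 assumes gmm: "regular_arc gmm" and h: "h : borel_measurable borel"
 shows "(\<integral>\<^sup>+z. h z \<partial>arc_length gmm) = (NI (%s. enn (norm (vector_derivative gmm (at s))) * h (gmm s) * ind {0..1} s))"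
proof -
 let ?M = "restrict_space lborel {0..1::real}" and ?w = "%s. enn (norm (vector_derivative gmm (at s)))"
 have sM: "sets ?M = sets (restrict_space borel {0..1})" by (rule sets_restrict_space_cong) simp
 have g: "gmm : borel_measurable ?M"
 using bm_restrict[OF regular_arcD(1)[OF gmm]] by (simp cong: measurable_cong_sets add: measurable_cong_sets[OF sM refl])
 have "(%s. norm (vector_derivative gmm (at s))) : borel_measurable ?M"
 using bm_restrict[OF con_norm[OF regular_arcD(4)[OF gmm]]] by (simp add: measurable_cong_sets[OF sM refl])
 hence w: "?w : borel_measurable ?M" by simp
 have hg: "(%s. h (gmm s)) : borel_measurable ?M" by (rule measurable_compose[OF g h])
 have "(\<integral>\<^sup>+z. h z \<partial>arc_length gmm) = (\<integral>\<^sup>+s. h (gmm s) \<partial>density ?M ?w)"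
 unfolding arc_length_def by (rule nn_integral_distr) (use g h in \<open>simp_all add: measurable_density_eq1\<close>)
 also have "... = (\<integral>\<^sup>+s. ?w s * h (gmm s) \<partial>?M)" by (rule nn_integral_density[OF w hg])
 also have "... = (NI (%s. ?w s * h (gmm s) * ind {0..1} s))" by (rule nn_integral_restrict_space) simp
 finally show ?thesis .
qed

text \<open>A horizontal segment of the chart is a regular arc in the level set of
  \<open>rh\<close>, and a system consisting of this arc alone bounds \<open>curve_integral\<close>
  from below.\<close>

lemma chart_growth:
 assumes ch: "adapted_chart Om rh U X Y (-A) A A Ps" and f: "cts Om f" and gr: "tempered_growth Om rh f N"
 shows "EX t0 K n. 0 < t0 & 0 < K & (ALL t:{0<..t0}. HK {-A/2..A/2} (%x. cmod (f (Ps (x, t)))) <= K * t powr (- (real n + 1 / 2)))"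
proof -
 let ?Q = "{-A<..<A} \<times> {-A<..<A}"
 have A: "0 < A" and sPs: "Csm ?Q Ps" and inj: "inj_on Ps ?Q" using ch by (auto simp: adapted_chart_def)
 have bij: "bij (fder Ps (at (x, t)))" and rh: "rh (Ps (x, t)) = t" and Om: "Ps (x, t) : Om \<longleftrightarrow> t > 0" if "x : {-A<..<A}" "t : {-A<..<A}" for x t
 using ch that unfolding adapted_chart_def by blast+
 have oQ: "open ?Q" by (simp add: open_Times)
 have px0: "px Ps z ~= 0" if z: "z : ?Q" for z
 proof
 assume "px Ps z = 0"
 hence e: "fder Ps (at z) (1, 0) = 0" by (simp add: px_def)
 have l: "linear (fder Ps (at z))"
 using bounded_linear.linear[OF has_derivative_bounded_linear[OF smooth_has_derivative[OF sPs z]]] .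
 have "inj (fder Ps (at z))" using bij[of "fst z" "snd z"] z by (simp add: bij_def mem_Times_iff)
 hence "(1::real, 0::real) = 0" using e linear_0[OF l] by (metis injD)
 thus False by (simp add: zero_prod_def)
 qed
 let ?K = "{-A/2..A/2} \<times> {0..A/2}"
 have KQ: "?K <= ?Q" using A by auto
 have cpx: "cts ?K (%z. norm (px Ps z))"
 by (intro con_norm con_subset[OF smooth_con[OF smooth_px[OF sPs]] KQ])
 obtain z0 where z0: "z0 : ?K" "!!z. z : ?K ==> norm (px Ps z0) <= norm (px Ps z)"
 proof -
 have "compact ?K" "?K ~= {}" using A by (auto intro!: compact_Times)
 from continuous_attains_inf[OF this cpx] show ?thesis using that by blast
 qed
 \<comment> \<open>The least length of \<open>px Ps\<close> on the half-size box; it converts dx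
   into arc length.\<close>
 define m where "m = norm (px Ps z0)"
 have m: "0 < m" using px0[of z0] z0(1) KQ by (auto simp: m_def)
 obtain K0 where K0: "\<forall>\<^sub>F t in at_right 0. curve_integral {z\<in>Om. rh z = t} (%z. enn (cmod (f z))) <= enn (K0 * t powi (- N))"
 using gr by (auto simp: tempered_growth_def)
 then obtain b0 where b0: "0 < b0" "!!t. 0 < t ==> t < b0 ==> curve_integral {z\<in>Om. rh z = t} (%z. enn (cmod (f z))) <= enn (K0 * t powi (- N))"
 unfolding eventually_at_right_field by blast
 define t0 where "t0 = min (b0 / 2) (min (A / 2) 1)"
 have t0: "0 < t0" "t0 < b0" "t0 <= A / 2" "t0 <= 1" using b0(1) A by (auto simp: t0_def)
 define n where "n = nat \<bar>N\<bar>"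
 define K where "K = (\<bar>K0\<bar> + 1) / m"
 have K: "0 < K" using m by (simp add: K_def)
 have "HK {-A/2..A/2} (%x. cmod (f (Ps (x, t)))) <= K * t powr (- (real n + 1 / 2))" if t: "t : {0<..t0}" for t
 proof -
 have tA: "t : {-A<..<A}" "t : {0..A/2}" "0 < t" "t < b0" "t <= 1" using t t0 A by auto
 define gmm where "gmm s = Ps (- A / 2 + A * s, t)" for s
 \<comment> \<open>For s in \<open>S\<close> the point -A/2 + A s stays within 3A/4 of 0, so the arc
   is smooth beyond its end points, as \<open>regular_arc\<close> demands.\<close>
 define S where "S = {- 1/4<..<5/4::real}"
 have aff: "(- A / 2 + A * s) : {-A<..<A}" if "s : S" for s
 proof -
 have "-1/4 < s" "s < 5/4" using that by (auto simp: S_def)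
 from mult_strict_left_mono[OF this(1) A] mult_strict_left_mono[OF this(2) A]
 show ?thesis using A unfolding greaterThanLessThan_iff by (intro conjI) linarith+
 qed
 have aff2: "(- A / 2 + A * s) : {-A/2..A/2}" if "s : {0..1}" for s
 proof -
 have "0 <= s" "s <= 1" using that by auto
 from mult_lm[OF this(1) less_imp_le[OF A]] mult_lm[OF this(2) less_imp_le[OF A]]
 show ?thesis unfolding atLeastAtMost_iff by (intro conjI) linarith+
 qed
 have S01: "{0..1} <= S" by (auto simp: S_def)
 have oS: "open S" by (simp add: S_def)
 have qS: "(- A / 2 + A * s, t) : ?Q" if "s : S" for s using aff[OF that] tA(1) by simp
 have sgmm: "Csm S gmm"
 unfolding gmm_def[abs_def]
 proof (rule smooth_compose[OF oS oQ _ sPs])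
 show "(%s. (- A / 2 + A * s, t)) ` S <= ?Q" by (rule image_subsetI) (rule qS)
 show "Csm S (%s. (- A / 2 + A * s, t))"
 by (intro smooth_Pair[OF oS] smooth_add[OF oS] smooth_const smooth_bounded_linear[OF oS] bounded_linear_mult_right)
 qed
 have dgmm: "vector_derivative gmm (at s) = A *\<^sub>R px Ps (- A / 2 + A * s, t)" if s: "s : S" for s
 proof -
 have "((%x. Ps (x, t)) hvd px Ps (- A / 2 + A * s, t)) (at (- A / 2 + A * s))"
 by (rule smooth_partials(1)[OF sPs]) (rule qS[OF s])
 moreover have "((%s. - A / 2 + A * s) hvd A) (at s)"
 unfolding hrd_hvd[symmetric] by (auto intro!: derivative_eq_intros)
 ultimately have "(((%x. Ps (x, t)) \<circ> (%s. - A / 2 + A * s)) hvd A *\<^sub>R px Ps (- A / 2 + A * s, t)) (at s)"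
 using vector_diff_chain_at by blast
 thus ?thesis unfolding gmm_def[abs_def] o_def by (rule vector_derivative_at)
 qed
 have reg: "regular_arc gmm"
 unfolding regular_arc_def
 proof (intro conjI ballI exI[of _ S])
 show "arc gmm"
 unfolding arc_def path_def
 proof (intro conjI inj_onI)
 show "cts {0..1} gmm" using smooth_con[OF sgmm] S01 con_subset by blast
 fix s s' assume ss: "s : {0..1}" "s' : {0..1}" "gmm s = gmm s'"
 have "(- A / 2 + A * s, t) = (- A / 2 + A * s', t)"
 by (rule inj_onD[OF inj ss(3)[unfolded gmm_def] qS[OF subsetD[OF S01 ss(1)]] qS[OF subsetD[OF S01 ss(2)]]])
 thus "s = s'" using A by simp
 qed
 show "open S" "{0..1} <= S" "Csm S gmm" by (rule oS S01 sgmm)+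
 show "vector_derivative gmm (at s) ~= 0" if "s : {0..1}" for s
 using dgmm[OF subsetD[OF S01 that]] px0[OF qS[OF subsetD[OF S01 that]]] A by simp
 qed
 have im: "path_image gmm <= {z\<in>Om. rh z = t}"
 proof
 fix z assume "z : path_image gmm"
 then obtain s where s: "s : S" "z = Ps (- A / 2 + A * s, t)" using S01 by (auto simp: path_image_def gmm_def)
 show "z : {z\<in>Om. rh z = t}" using rh[OF aff[OF s(1)] tA(1)] Om[OF aff[OF s(1)] tA(1)] tA(3) s(2) by simp
 qed
 define h where "h z = enn (cmod (f z)) * ind (path_image gmm) z" for z
 have cl: "closed (path_image gmm)" using reg by (simp add: regular_arc_def closed_arc_image)
 have hm: "h : borel_measurable borel"
 proof -
 have "cts (path_image gmm) (%z. cmod (f z))" using f im by (intro con_norm) (auto elim: con_subset)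
 hence "(%z. ind (path_image gmm) z *\<^sub>R cmod (f z)) : borel_measurable borel"
 using cl by (intro bm_indicator) auto
 hence "(%z. enn (ind (path_image gmm) z *\<^sub>R cmod (f z))) : borel_measurable borel" by simp
 moreover have "h = (%z. enn (ind (path_image gmm) z *\<^sub>R cmod (f z)))" by (auto simp: h_def indicator_def fun_eq_iff)
 ultimately show ?thesis by simp
 qed
 define F where "F x = cmod (f (Ps (x, t)))" for x
 have cF: "cts {-A/2..A/2} F"
 unfolding F_def
 proof (intro con_norm con_comp[OF f])
 show "cts {-A/2..A/2} (%x. Ps (x, t))"
 by (rule con_slice(1)[OF smooth_con[OF sPs]]) (use A tA(1) in auto)
 show "(%x. Ps (x, t)) ` {-A/2..A/2} <= Om"
 proof (rule image_subsetI)
 fix x assume "x : {-A/2..A/2}"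
 hence "x : {-A<..<A}" using A by auto
 thus "Ps (x, t) : Om" using Om[OF _ tA(1)] tA(3) by blast
 qed
 qed
 have "enn m * enn (HK {-A/2..A/2} F) = enn m * (NI (%x. enn (F x) * ind {-A/2..A/2} x))"
 by (subst nn_integral_continuous[OF cF]) (simp_all add: F_def)
 also have "(NI (%x. enn (F x) * ind {-A/2..A/2} x)) = enn \<bar>A\<bar> * (NI (%s. enn (F (- A / 2 + A * s)) * ind {-A/2..A/2} (- A / 2 + A * s)))"
 proof (rule nn_integral_real_affine)
 have "(%x. ind {-A/2..A/2} x *\<^sub>R F x) : borel_measurable borel" by (rule bm_indicator[OF _ cF]) simp
 hence "(%x. enn (ind {-A/2..A/2} x *\<^sub>R F x)) : borel_measurable borel" by simp
 moreover have "(%x. enn (F x) * ind {-A/2..A/2} x) = (%x. enn (ind {-A/2..A/2} x *\<^sub>R F x))" by (auto simp: indicator_def fun_eq_iff)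
 ultimately show "(%x. enn (F x) * ind {-A/2..A/2} x) : borel_measurable borel" by simp
 qed (use A in simp)
 also have "enn m * (enn \<bar>A\<bar> * (NI (%s. enn (F (- A / 2 + A * s)) * ind {-A/2..A/2} (- A / 2 + A * s))))
 <= enn m * (enn \<bar>A\<bar> * (NI (%s. h (gmm s) * ind {0..1} s)))"
 proof (intro mult_lm nn_integral_mono)
 fix s
 show "enn (F (- A / 2 + A * s)) * ind {-A/2..A/2} (- A / 2 + A * s) <= h (gmm s) * ind {0..1} s"
 proof (cases "s : {0..1}")
 case True
 hence "gmm s : path_image gmm" by (simp add: path_image_def)
 thus ?thesis using True aff2[OF True] by (simp add: h_def F_def gmm_def)
 next
 case False
 hence "s < 0 \<or> 1 < s" by auto
 hence "A * s < A * 0 \<or> A * 1 < A * s" using mult_strict_left_mono[OF _ A] by blast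
 hence "- A / 2 + A * s ~: {-A/2..A/2}" unfolding atLeastAtMost_iff by linarith
 thus ?thesis by simp
 qed
 qed simp_all
 also have "... = (NI (%s. enn (m * A) * (h (gmm s) * ind {0..1} s)))"
 proof -
 have "(%s. h (gmm s)) : borel_measurable (restrict_space borel {0..1})"
 by (rule measurable_compose[OF bm_restrict[OF regular_arcD(1)[OF reg]] hm])
 hence "(%s. h (gmm s) * ind {0..1} s) : borel_measurable lborel" by (subst (asm) borel_measurable_restrict_space_iff_ennreal) simp_all
 thus ?thesis using m A by (subst nn_integral_cmult) (simp_all add: ennreal_mult mult.assoc)
 qed
 also have "... <= (NI (%s. enn (norm (vector_derivative gmm (at s))) * h (gmm s) * ind {0..1} s))"
 proof (rule nn_integral_mono)
 fix s
 show "enn (m * A) * (h (gmm s) * ind {0..1} s) <= enn (norm (vector_derivative gmm (at s))) * h (gmm s) * ind {0..1} s"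
 proof (cases "s : {0..1}")
 case True
 have "m <= norm (px Ps (- A / 2 + A * s, t))" unfolding m_def by (rule z0(2)) (use aff2[OF True] tA(2) in simp)
 hence "A * m <= norm (vector_derivative gmm (at s))" using dgmm[OF subsetD[OF S01 True]] A by simp
 hence "enn (m * A) <= enn (norm (vector_derivative gmm (at s)))" by (intro ennreal_leI) (simp only: mult.commute)
 from mult_rm[OF this, of "h (gmm s)"] show ?thesis using True by simp
 qed simp
 qed
 also have "... = (\<integral>\<^sup>+z\<in>path_image gmm. enn (cmod (f z)) \<partial>arc_length gmm)"
 using nn_integral_arc_length[OF reg hm] by (simp add: h_def)
 also have "... <= curve_integral {z\<in>Om. rh z = t} (%z. enn (cmod (f z)))"
 unfolding curve_integral_def
 by (rule SUP_upper2[of "{gmm}"]) (use reg im in \<open>simp_all add: disjoint_family_on_def\<close>)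
 also have "... <= enn (K0 * t powi (- N))" by (rule b0(2)[OF tA(3,4)])
 also have "... <= enn ((\<bar>K0\<bar> + 1) * t powr (- (real n + 1 / 2)))"
 proof (rule ennreal_leI, rule mult_mono)
 \<comment> \<open>As t <= 1, the exponent may be enlarged from N to n + 1/2 with n = |N|, the form
   required by \<open>iterated_prim_extends\<close>.\<close>
 have "t powi (- N) = t powr (real_of_int (- N))" using tA by (subst powr_real_of_int') (use tA in simp_all)
 also have "... <= t powr (- (real n + 1 / 2))"
 proof (rule powr_mono')
 have "real_of_int N <= real n" by (simp add: n_def)
 thus "- (real n + 1 / 2) <= real_of_int (- N)" by simp
 qed (use tA in auto)
 finally show "t powi (- N) <= t powr (- (real n + 1 / 2))" .
 qed (use tA in auto)
 finally have "enn m * enn (HK {-A/2..A/2} F) <= enn ((\<bar>K0\<bar> + 1) * t powr (- (real n + 1 / 2)))"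
 using m by (simp add: ennreal_mult')
 hence "enn (m * HK {-A/2..A/2} F) <= enn ((\<bar>K0\<bar> + 1) * t powr (- (real n + 1 / 2)))"
 by (simp only: ennreal_mult'[OF less_imp_le[OF m]])
 hence "m * HK {-A/2..A/2} F <= (\<bar>K0\<bar> + 1) * t powr (- (real n + 1 / 2))"
 by (subst (asm) ennreal_le_iff) (rule mult_nonneg_nonneg, simp_all)
 thus ?thesis using m by (simp add: F_def[abs_def] K_def pos_le_divide_eq mult.commute)
 qed
 thus ?thesis using t0 K by (intro exI[of _ t0] exI[of _ K] exI[of _ n]) auto
qed

section \<open>The trace as an iterated derivative of continuous boundary values\<close>

lemma integral_zero_outside:
 fixes F :: "real => complex"
 assumes "{p..q} <= {l..r}" "!!x. x : {l..r} ==> x ~: {p..q} ==> F x = 0"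
 shows "HK {l..r} F = HK {p..q} F"
proof -
 have "HK {l..r} F = HK {l..r} (%x. if x : {p..q} then F x else 0)"
 by (rule integral_cong) (use assms(2) in auto)
 also have "... = HK ({p..q} \<inter> {l..r}) F" by (rule Henstock_Kurzweil_Integration.integral_restrict_Int)
 also have "{p..q} \<inter> {l..r} = {p..q}" by (rule Int_absorb2[OF assms(1)])
 finally show ?thesis .
qed

locale chart_trace = upper_chart +
 assumes nz: "!!z. z : {-A<..<A} \<times> {-A<..<A} ==> px Z z ~= 0"
begin

abbreviation "Q \<equiv> {-A<..<A} \<times> {-A<..<A}"

text \<open>The derivative with respect to \<open>Z\<close> at fixed height; on the line t = 0 it
  becomes \<open>Dz\<close> of the boundary arc.\<close>

definition DU :: "(plane => complex) => plane => complex" where "DU V z = px V z / px Z z"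

lemma open_Q: "open Q" by (simp add: open_Times)

lemma smooth_DU: "Csm Q V ==> Csm Q (DU V)"
 unfolding DU_def[abs_def] by (intro smooth_divide open_Q smooth_px smooth nz)

lemma smooth_DU_pow: "Csm Q V ==> Csm Q ((DU ^^ k) V)"
 by (induction k) (simp_all add: smooth_DU)

lemma DU_zero:
 assumes "!!z. z : Q ==> fst z ~: {l..r} ==> V z = 0" "z : Q" "fst z ~: {l..r}"
 shows "DU V z = 0"
proof -
 define S where "S = Q \<inter> fst -` (- {l..r})"
 have S: "open S" "z : S" using open_Q assms(2,3) by (auto simp: S_def intro!: open_Int open_vimage_fst)
 have "px V z = px (%_. 0) z" by (rule px_cong_open[OF S]) (use assms(1) in \<open>simp add: S_def\<close>)
 also have "... = 0" by (rule px_eqI[of _ "%_. 0"]) simp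
 finally show ?thesis by (simp add: DU_def)
qed

lemma DU_pow_zero:
 assumes "!!z. z : Q ==> fst z ~: {l..r} ==> V z = 0"
 shows "z : Q ==> fst z ~: {l..r} ==> (DU ^^ k) V z = 0"
proof (induction k arbitrary: z)
 case 0
 thus ?case using assms by simp
next
 case (Suc k)
 show ?case unfolding funpow.simps o_def by (rule DU_zero[OF Suc.IH Suc.prems])
qed

context
 fixes l r l1 r1 :: real
 assumes lr: "-a <= l" "l < l1" "l1 <= r1" "r1 < r" "r <= a"
begin

lemma in_Q: "x : {l..r} ==> t : {-A<..<A} ==> (x, t) : Q" using lr a by auto

lemma in_Qp: "x : {l..r} ==> t : {0<..<A} ==> (x, t) : Qp" using lr a by auto

lemma prim_by_parts:
 assumes p: "prim Qp Z H G" and W: "Csm Q W" "!!z. z : Q ==> fst z ~: {l1..r1} ==> W z = 0" and t: "t : {0<..<A}"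
 shows "HK {l..r} (%x. H (x, t) * (px Z (x, t) * W (x, t))) = - HK {l..r} (%x. G (x, t) * (px Z (x, t) * DU W (x, t)))"
proof -
 have tA: "t : {-A<..<A}" using t a by auto
 have cH: "cts {l..r} (%x. H (x, t))" and cG: "cts {l..r} (%x. G (x, t))"
 by (rule con_slice(1)[OF conjunct1[OF prim_cont[OF p]] in_Qp[OF _ t]], assumption,
 rule con_slice(1)[OF conjunct2[OF prim_cont[OF p]] in_Qp[OF _ t]], assumption)
 have cZ: "cts {l..r} (%x. px Z (x, t))" and cW: "cts {l..r} (%x. W (x, t))" and cD: "cts {l..r} (%x. DU W (x, t))"
 by (rule con_slice(1)[OF smooth_con], rule smooth_px[OF smooth] W(1) smooth_DU[OF W(1)], rule in_Q[OF _ tA], assumption)+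
 have "((%x. G (x, t) * (px Z (x, t) * DU W (x, t)) + H (x, t) * (px Z (x, t) * W (x, t))) has_integral (G (r, t) * W (r, t) - G (l, t) * W (l, t))) {l..r}"
 proof (rule FTC)
 show "l <= r" using lr by simp
 fix x assume x: "x : {l..r}"
 have "((%x. G (x, t) * W (x, t)) hvd G (x, t) * px W (x, t) + (H (x, t) * px Z (x, t)) * W (x, t)) (at x within {l..r})"
 by (rule has_vector_derivative_mult[OF prim_partials(1)[OF p in_Qp[OF x t]] smooth_partials(1)[OF W(1) in_Q[OF x tA]]])
 moreover have "px W (x, t) = px Z (x, t) * DU W (x, t)" using nz[OF in_Q[OF x tA]] by (simp add: DU_def)
 ultimately show "((%x. G (x, t) * W (x, t)) hvd G (x, t) * (px Z (x, t) * DU W (x, t)) + H (x, t) * (px Z (x, t) * W (x, t))) (at x within {l..r})"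
 by (simp only: mult.assoc)
 qed
 moreover have "W (r, t) = 0" "W (l, t) = 0" using W(2)[OF in_Q[OF _ tA]] lr by auto
 ultimately have "HK {l..r} (%x. G (x, t) * (px Z (x, t) * DU W (x, t)) + H (x, t) * (px Z (x, t) * W (x, t))) = 0"
 by (simp add: integral_unique)
 moreover have "HK {l..r} (%x. G (x, t) * (px Z (x, t) * DU W (x, t)) + H (x, t) * (px Z (x, t) * W (x, t)))
 = HK {l..r} (%x. G (x, t) * (px Z (x, t) * DU W (x, t))) + HK {l..r} (%x. H (x, t) * (px Z (x, t) * W (x, t)))"
 by (rule integral_add) (intro int_con con_mult cG cH cZ cW cD)+
 ultimately show ?thesis by (simp add: add_eq_0_iff)
qed

lemma iterated_by_parts:
 assumes V: "Csm Q V" "!!z. z : Q ==> fst z ~: {l1..r1} ==> V z = 0" and t: "t : {0<..<A}"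
 shows "(prim Qp Z ^^ k) f0 G ==> HK {l..r} (%x. f0 (x, t) * (px Z (x, t) * V (x, t))) =
 (-1) ^ k * HK {l..r} (%x. G (x, t) * (px Z (x, t) * (DU ^^ k) V (x, t)))"
proof (induction k arbitrary: G)
 case 0
 hence "f0 = G" by simp
 thus ?case by simp
next
 case (Suc k)
 obtain H where H: "(prim Qp Z ^^ k) f0 H" "prim Qp Z H G" by (rule relpowp_Suc_E[where P = "prim Qp Z", OF Suc.prems])
 have "HK {l..r} (%x. H (x, t) * (px Z (x, t) * (DU ^^ k) V (x, t))) = - HK {l..r} (%x. G (x, t) * (px Z (x, t) * DU ((DU ^^ k) V) (x, t)))"
 by (rule prim_by_parts[OF H(2) smooth_DU_pow[OF V(1)] _ t]) (rule DU_pow_zero[OF V(2)])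
 thus ?case unfolding Suc.IH[OF H(1)] by simp
qed

text \<open>After k integrations by parts the integral contains only the k-th primitive, which is
  continuous up to t = 0, so the limit exists and may be taken inside.\<close>

lemma trace_limit:
 assumes V: "Csm Q V" "!!z. z : Q ==> fst z ~: {l1..r1} ==> V z = 0"
 and G: "(prim Qp Z ^^ k) f0 G" "cts ({-a..a} \<times> {0..a}) G"
 shows "((%t. HK {l..r} (%x. f0 (x, t) * (px Z (x, t) * V (x, t)))) \<longlongrightarrow>
 (-1) ^ k * HK {l..r} (%x. G (x, 0) * (px Z (x, 0) * (DU ^^ k) V (x, 0)))) (at_right 0)"
proof -
 let ?I = "%t. HK {l..r} (%x. G (x, t) * (px Z (x, t) * (DU ^^ k) V (x, t)))"
 define g where "g z = G z * (px Z z * (DU ^^ k) V z)" for z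
 have sub: "{-a..a} \<times> {0..a} <= Q" using a by auto
 have cg: "cts ({-a..a} \<times> {0..a}) g"
 unfolding g_def[abs_def]
 by (intro con_mult G(2) con_subset[OF smooth_con sub] smooth_px[OF smooth] smooth_DU_pow[OF V(1)])
 have "cts ({0..a} \<times> cbox l r) (%(t, x). g (x, t))"
 unfolding split_beta
 by (intro con_comp[OF cg] continuous_on_Pair continuous_on_fst continuous_on_snd continuous_on_id) (use lr in auto)
 from int_param[OF this]
 have "cts {0..a} (%t. HK {l..r} (%x. g (x, t)))" by (simp only: cbox_interval)
 hence "((%t. HK {l..r} (%x. g (x, t))) \<longlongrightarrow> HK {l..r} (%x. g (x, 0))) (at 0 within {0..a})"
 unfolding continuous_on_def using a by simp
 hence "(?I \<longlongrightarrow> ?I 0) (at_right 0)" unfolding g_def at_within_Icc_at_right[OF a(1)] .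
 hence lim: "((%t. (-1) ^ k * ?I t) \<longlongrightarrow> (-1) ^ k * ?I 0) (at_right 0)" by (rule tendsto_mult_left)
 have "0 < A" using a by simp
 hence ev: "\<forall>\<^sub>F t in at_right 0. t : {0<..<A}" unfolding eventually_at_right_field by (intro exI[of _ A]) simp
 show ?thesis
 by (rule tendsto_cong[THEN iffD2, OF eventually_mono[OF ev] lim]) (rule iterated_by_parts[OF V _ G(1)])
qed

end

lemma slice_Dz:
 assumes ga: "graph_arc ph b B" and BA: "B <= A" and zt: "!!x. x : {-B<..<B} ==> graph_arc.zt' ph x = px Z (x, 0)"
 and V: "Csm Q V" "!!x. x : {-B<..<B} ==> V (x, 0) = v x"
 shows "x : {-B<..<B} ==> (DU ^^ k) V (x, 0) = (graph_arc.Dz ph ^^ k) v x"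
proof (induction k arbitrary: x)
 case 0
 thus ?case using V(2) by simp
next
 case (Suc k)
 interpret graph_arc ph b B by (rule ga)
 have xQ: "(x, 0) : Q" using Suc.prems BA by auto
 have "Dz ((Dz ^^ k) v) x = Dz (%x. (DU ^^ k) V (x, 0)) x"
 by (rule Dz_cong[of "{-B<..<B}"]) (use Suc in auto)
 also have "... = px ((DU ^^ k) V) (x, 0) / zt' x" by (rule Dz_eqI[OF smooth_partials(1)[OF smooth_DU_pow[OF V(1)] xQ]])
 also have "... = DU ((DU ^^ k) V) (x, 0)" using zt[OF Suc.prems] by (simp add: DU_def)
 finally show ?case by simp
qed

lemma chart_trace_identity:
 assumes ga: "graph_arc ph b B" and BA: "B <= A" and zt: "!!x. x : {-B<..<B} ==> graph_arc.zt' ph x = px Z (x, 0)"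
 and ch: "adapted_chart Om rh U X Y (-A) A A Ps" and tr: "trace_eq_on Om rh U X Y f J bf"
 and G: "(prim Qp Z ^^ k) (%z. f (Ps z)) G" "cts ({-a..a} \<times> {0..a}) G" and f: "cts Qp (%z. f (Ps z))"
 and u: "Csm UNIV u" "!!x. x ~: {l1..r1} ==> u x = 0"
 and l1: "-a < l1" "-B < l1" "l1 < r1" "r1 < a" "r1 < B" and J: "!!x. x : {l1..r1} ==> Ps (x, 0) : J"
 shows "(LINT x:{l1..r1}|lborel. bf (Ps (x, 0)) * (graph_arc.zt' ph x * u x)) =
 (-1) ^ k * HK {l1..r1} (%x. G (x, 0) * (graph_arc.zt' ph x * (graph_arc.Dz ph ^^ k) u x))"
proof -
 interpret g: graph_arc ph b B by (rule ga)
 define ps where "ps x = g.zt' x * u x" for x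
 have ps0: "ps x = 0" if "x ~: {l1..r1}" for x using u(2)[OF that] by (simp add: ps_def)
 have "Csm {-B<..<B} ps"
 unfolding ps_def[abs_def] by (intro smooth_mult g.smooth_zt' smooth_subset[OF u(1)]) auto
 hence sps: "Csm UNIV ps"
 by (intro smooth_UNIV_extend[of "{-B<..<B}" "{l1..r1}"]) (use l1 ps0 in auto)
 have test: "test_function {x\<in>{-A<..<A}. Ps (x, 0) : J} ps"
 proof -
 have "{x. ps x ~= 0} <= {l1..r1}" using ps0 by blast
 hence c: "closure {x. ps x ~= 0} <= {l1..r1}" by (rule closure_minimal) simp
 have "bounded (closure {x. ps x ~= 0})" by (rule bounded_subset[OF _ c]) simp
 hence "compact (closure {x. ps x ~= 0})" by (simp add: compact_eq_bounded_closed)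
 moreover have "{l1..r1} <= {x\<in>{-A<..<A}. Ps (x, 0) : J}" using J l1 BA by auto
 ultimately show ?thesis using sps c by (auto simp: test_function_def)
 qed
 have t1: "trace_in_chart f Ps ps = (LINT x|lborel. bf (Ps (x, 0)) * ps x)"
 using tr ch test unfolding trace_eq_on_def by blast
 \<comment> \<open>Division by \<open>px Z\<close> makes the density \<open>px Z * V\<close> equal
   to \<open>ps\<close> at every height, while at t = 0, where \<open>px Z\<close> is
   \<open>zt'\<close>, the function \<open>V\<close> equals \<open>u\<close>.\<close>
 define V where "V z = ps (fst z) / px Z z" for z
 have sV: "Csm Q V"
 unfolding V_def[abs_def]
 proof (intro smooth_divide open_Q smooth_px smooth nz)
 show "Csm Q (%z. ps (fst z))"
 by (rule smooth_compose[OF open_Q open_UNIV _ sps smooth_bounded_linear[OF open_Q bounded_linear_fst]]) simp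
 qed
 have V0: "V z = 0" if "fst z ~: {l1..r1}" for z using ps0[OF that] by (simp add: V_def)
 have Vu: "V (x, 0) = u x" if "x : {-B<..<B}" for x using zt[OF that] g.zt'_nz[of x] by (simp add: V_def ps_def)
 define l r where "l = (l1 - a) / 2" and "r = (r1 + a) / 2"
 have lr: "-a <= l" "l < l1" "l1 <= r1" "r1 < r" "r <= a" using l1 by (auto simp: l_def r_def)
 have ev: "(LINT x|lborel. f (Ps (x, t)) * ps x) = HK {l..r} (%x. f (Ps (x, t)) * (px Z (x, t) * V (x, t)))" if t: "t : {0<..<A}" for t
 proof -
 have tA: "t : {-A<..<A}" using t a by auto
 have c: "cts {l..r} (%x. f (Ps (x, t)) * ps x)"
 by (intro con_mult con_slice(1)[OF f] con_subset[OF smooth_con[OF sps]])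
 (use in_Qp[OF lr] t in auto)
 have "(LINT x|lborel. f (Ps (x, t)) * ps x) = (LINT x:{l..r}|lborel. f (Ps (x, t)) * ps x)"
 unfolding set_lebesgue_integral_def
 proof (rule Bochner_Integration.integral_cong[OF refl])
 fix x
 show "f (Ps (x, t)) * ps x = indicat_real {l..r} x *\<^sub>R (f (Ps (x, t)) * ps x)"
 proof (cases "x : {l1..r1}")
 case True
 hence "x : {l..r}" using lr by auto
 thus ?thesis by simp
 qed (simp add: ps0)
 qed
 also have "... = HK {l..r} (%x. f (Ps (x, t)) * ps x)"
 by (rule set_borel_integral_eq_integral(2)[OF borel_integrable_atLeastAtMost'[OF c]])
 also have "... = HK {l..r} (%x. f (Ps (x, t)) * (px Z (x, t) * V (x, t)))"
 proof (rule integral_cong)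
 fix x assume "x : {l..r}"
 thus "f (Ps (x, t)) * ps x = f (Ps (x, t)) * (px Z (x, t) * V (x, t))"
 using nz[OF in_Q[OF lr _ tA]] by (simp add: V_def)
 qed
 finally show ?thesis .
 qed
 have "0 < A" using a by simp
 hence evA: "\<forall>\<^sub>F t in at_right 0. t : {0<..<A}" unfolding eventually_at_right_field by (intro exI[of _ A]) simp
 define R where "R = (-1) ^ k * HK {l..r} (%x. G (x, 0) * (px Z (x, 0) * (DU ^^ k) V (x, 0)))"
 have "((%t. LINT x|lborel. f (Ps (x, t)) * ps x) \<longlongrightarrow> R) (at_right 0)"
 unfolding R_def
 by (rule tendsto_cong[THEN iffD2, OF eventually_mono[OF evA] trace_limit[OF lr sV V0 G]]) (rule ev)
 \<comment> \<open>\<open>trace_in_chart\<close> is a \<open>Lim\<close>, which says something only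
   if the limit exists; this is why convergence to \<open>R\<close> is shown first.\<close>
 hence t2: "trace_in_chart f Ps ps = R"
 unfolding trace_in_chart_def by (intro tendsto_Lim) (rule trivial_limit_at_right_real)
 have "HK {l..r} (%x. G (x, 0) * (px Z (x, 0) * (DU ^^ k) V (x, 0))) = HK {l1..r1} (%x. G (x, 0) * (px Z (x, 0) * (DU ^^ k) V (x, 0)))"
 proof (rule integral_zero_outside)
 show "{l1..r1} <= {l..r}" using lr by auto
 fix x assume x: "x : {l..r}" "x ~: {l1..r1}"
 have "(DU ^^ k) V (x, 0) = 0" by (rule DU_pow_zero[of l1 r1 V, OF V0]) (use x lr a in auto)
 thus "G (x, 0) * (px Z (x, 0) * (DU ^^ k) V (x, 0)) = 0" by simp
 qed
 also have "... = HK {l1..r1} (%x. G (x, 0) * (g.zt' x * (g.Dz ^^ k) u x))"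
 proof (rule integral_cong)
 fix x assume "x : {l1..r1}"
 hence xB: "x : {-B<..<B}" using l1 by auto
 show "G (x, 0) * (px Z (x, 0) * (DU ^^ k) V (x, 0)) = G (x, 0) * (g.zt' x * (g.Dz ^^ k) u x)"
 by (simp only: slice_Dz[OF ga BA zt sV Vu xB] zt[OF xB])
 qed
 finally have R: "R = (-1) ^ k * HK {l1..r1} (%x. G (x, 0) * (g.zt' x * (g.Dz ^^ k) u x))" by (simp add: R_def)
 have "(LINT x:{l1..r1}|lborel. bf (Ps (x, 0)) * ps x) = (LINT x|lborel. bf (Ps (x, 0)) * ps x)"
 unfolding set_lebesgue_integral_def
 by (rule Bochner_Integration.integral_cong[OF refl]) (use ps0 in \<open>auto simp: indicator_def\<close>)
 thus ?thesis using t1 t2 R by (simp add: ps_def)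
qed

end

section \<open>Points of type (II)\<close>

text \<open>The kernel of a nonzero complex linear form on C^2 is a complex line. If it contains the
  real vector v, then a + ib, lying in it, is a complex multiple of v, so that a and b are real
  multiples of v.\<close>

lemma kernel_direction:
 fixes v a b :: plane and P R :: complex
 assumes v: "v ~= 0" "of_real (fst v) * P + of_real (snd v) * R = 0" and PR: "P ~= 0 \<or> R ~= 0"
 and L: "of_real (fst a) * P + of_real (snd a) * R + \<i> * (of_real (fst b) * P + of_real (snd b) * R) = 0"
 shows "of_real (fst a) * P + of_real (snd a) * R = 0" "EX al bt. (al ~= 0 \<or> bt ~= 0) & al *\<^sub>R a + bt *\<^sub>R b = 0"
proof -
 define da db where "da = snd a * fst v - fst a * snd v" and "db = snd b * fst v - fst b * snd v"
 have dR: "of_real (fst v) * (of_real (fst c) * P + of_real (snd c) * R) = of_real (snd c * fst v - fst c * snd v) * R"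
 and dP: "of_real (snd v) * (of_real (fst c) * P + of_real (snd c) * R) = - of_real (snd c * fst v - fst c * snd v) * P" for c :: plane
 using v(2) by (simp_all add: algebra_simps) algebra+
 define Va Vb where "Va = of_real (fst a) * P + of_real (snd a) * R" and "Vb = of_real (fst b) * P + of_real (snd b) * R"
 have V: "Va + \<i> * Vb = 0" using L by (simp add: Va_def Vb_def)
 have "Complex da db * R = of_real (fst v) * Va + \<i> * (of_real (fst v) * Vb)"
 unfolding Va_def Vb_def dR by (simp add: da_def db_def Complex_eq algebra_simps)
 also have "... = of_real (fst v) * (Va + \<i> * Vb)" by (simp add: algebra_simps)
 finally have 1: "Complex da db * R = 0" using V by simp
 have "- Complex da db * P = of_real (snd v) * Va + \<i> * (of_real (snd v) * Vb)"
 unfolding Va_def Vb_def dP by (simp add: da_def db_def Complex_eq algebra_simps)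
 also have "... = of_real (snd v) * (Va + \<i> * Vb)" by (simp add: algebra_simps)
 finally have 2: "Complex da db * P = 0" using V by simp
 have "Complex da db = 0" using 1 2 PR by auto
 hence d: "da = 0" "db = 0" by (simp_all add: complex_eq_iff)
 have v': "fst v ~= 0 \<or> snd v ~= 0" using v(1) by (auto simp: prod_eq_iff)
 show "of_real (fst a) * P + of_real (snd a) * R = 0"
 using dR[of a] dP[of a] v' unfolding da_def[symmetric] d(1) by auto
 obtain x y where a: "a = x *\<^sub>R v" and b: "b = y *\<^sub>R v"
 proof (cases "fst v = 0")
 case True
 thus ?thesis using d v' by (intro that[of "snd a / snd v" "snd b / snd v"]) (auto simp: da_def db_def prod_eq_iff)
 next
 case False
 thus ?thesis using d by (intro that[of "fst a / fst v" "fst b / fst v"]) (auto simp: da_def db_def prod_eq_iff field_simps)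
 qed
 show "EX al bt. (al ~= 0 \<or> bt ~= 0) & al *\<^sub>R a + bt *\<^sub>R b = 0"
 proof (cases "x = 0")
 case True
 thus ?thesis using a by (intro exI[of _ 1] exI[of _ 0]) simp
 next
 case False
 thus ?thesis unfolding a b by (intro exI[of _ y] exI[of _ "- x"]) simp
 qed
qed

text \<open>Where \<open>X rh > 0\<close>, flowing backwards from a point close to the boundary leaves \<open>Om\<close> in a short time, so that
 a positive half orbit cannot return to \<open>p\<close>.\<close>
lemma no_return:
 fixes c :: "real => plane" and X :: "plane => plane" and rh :: "plane => real"
 assumes B: "open B" "p : B" "Csm B rh" "Csm B X" and Xp: "0 < fder rh (at p) (X p)" and rhp: "rh p = 0"
 and c: "!!s. s : {0<..<ep} ==> (c hvd X (c s)) (at s)" "!!s. s : {0<..<ep} ==> 0 < rh (c s)"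
 and dl: "0 < dl"
 shows "\<exists>r>0. ALL s:{0<..<ep}. norm (c s - p) < r --> s < dl"
proof -
 define e where "e z = fder rh (at z) (X z)" for z
 have ce: "cts B e"
 proof (rule continuous_on_eq)
 show "cts B (%z. fst (X z) *\<^sub>R px rh z + snd (X z) *\<^sub>R py rh z)"
 by (intro continuous_intros smooth_con B smooth_px smooth_py)
 show "fst (X z) *\<^sub>R px rh z + snd (X z) *\<^sub>R py rh z = e z" if "z : B" for z
 unfolding e_def by (rule frechet_derivative_px_py[OF B(3) that, symmetric])
 qed
 define d0 where "d0 = e p / 2"
 have d0: "0 < d0" "d0 < e p" using Xp by (simp_all add: d0_def e_def)
 have "open {z\<in>B. d0 < e z}" using open_preimage[OF ce B(1) open_greaterThan[of d0]] by (simp add: vimage_def Int_def)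
 then obtain R where R: "0 < R" "cball p R <= {z\<in>B. d0 < e z}"
 using open_contains_cball[THEN iffD1] B(2) d0(2) by blast
 have "cball p R <= B" using R(2) by blast
 from compact_bd[OF con_subset[OF smooth_con[OF B(4)] this] compact_cball]
 obtain M where M: "0 < M" "!!z. z : cball p R ==> norm (X z) <= M" by metis
 define ka where "ka = min (d0 * dl) (d0 * R / (4 * M)) / 2"
 have ka: "0 < ka" "2 * ka / d0 <= dl" "M * (2 * ka / d0) < R / 2"
 proof -
 show "0 < ka" using d0 R M dl by (simp add: ka_def)
 have "2 * ka <= d0 * dl" by (simp add: ka_def)
 thus "2 * ka / d0 <= dl" using d0 by (simp add: pos_divide_le_eq mult.commute)
 have "2 * ka <= d0 * R / (4 * M)" by (simp add: ka_def)
 hence "2 * ka / d0 <= R / (4 * M)" using d0 by (simp add: pos_divide_le_eq mult.commute)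
 hence "M * (2 * ka / d0) <= M * (R / (4 * M))" by (rule mult_lm) (use M in simp)
 also have "... < R / 2" using M R by simp
 finally show "M * (2 * ka / d0) < R / 2" .
 qed
 have "isCont rh p" using smooth_con[OF B(3)] B(1,2) by (simp add: continuous_on_eq_continuous_at)
 then obtain r1 where r1: "0 < r1" "!!z. dist z p < r1 ==> dist (rh z) (rh p) < ka"
 using ka(1) unfolding continuous_at_eps_delta by blast
 show ?thesis
 proof (rule exI[of _ "min r1 (R / 2)"], intro conjI ballI impI)
 show "0 < min r1 (R / 2)" using r1 R by simp
 fix s assume s: "s : {0<..<ep}" and near: "norm (c s - p) < min r1 (R / 2)"
 have rhs: "0 < rh (c s)" "rh (c s) < ka" using c(2)[OF s] r1(2)[of "c s"] near rhp by (auto simp: dist_norm)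
 show "s < dl"
 proof (rule ccontr)
 assume "~ s < dl"
 \<comment> \<open>Flowing backwards for the time h, the curve stays in \<open>cball p R\<close>,
   where \<open>rh\<close> changes along the flow at a rate above \<open>d0\<close>. So
   \<open>rh\<close> would be at most \<open>- rh (c s)\<close> at time s - h, although it is
   positive there.\<close>
 define h where "h = 2 * rh (c s) / d0"
 have "h < 2 * ka / d0" unfolding h_def using rhs d0 by (intro divide_strict_right_mono) auto
 hence h: "0 < h" "h < dl" "M * h < R / 2"
 using rhs d0 ka(2) mult_strict_left_mono[of h "2 * ka / d0" M] M(1) ka(3) by (auto simp: h_def)
 have sub: "{s - h..s} <= {0<..<ep}" using h s \<open>~ s < dl\<close> by auto
 have cc: "cts {s - h..s} c"
 by (intro con_at_on ballI has_vector_derivative_continuous[OF c(1)]) (use sub in blast)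
 have inb: "c sg : cball p R" if sg: "sg : {s - h..s}" for sg
 proof (rule ccontr)
 assume out: "c sg ~: cball p R"
 \<comment> \<open>Its largest element is the last time at which the curve is at distance at least R
   from \<open>p\<close>; after that time the speed bound \<open>M\<close> applies.\<close>
 define K where "K = {x\<in>{s - h..s}. R <= norm (c x - p)}"
 have "closed K" unfolding K_def
 by (intro continuous_on_closed_Collect_le continuous_intros cc)
 moreover have "bounded K" by (rule bounded_subset[of "{s - h..s}"]) (auto simp: K_def)
 ultimately have "compact K" by (simp add: compact_eq_bounded_closed)
 moreover have "sg : K" using sg out by (auto simp: K_def dist_norm norm_minus_commute)
 ultimately obtain s0 where s0: "s0 : K" "!!x. x : K ==> x <= s0" using compact_attains_sup[of K] by blast
 have s0s: "s0 < s" using s0(1) near R by (cases "s0 = s") (auto simp: K_def)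
 have "EX x:{s0<..<s}. norm (c s - c s0) <= norm ((s - s0) *\<^sub>R X (c x))"
 using mvt_general[of s0 s c "%x y. y *\<^sub>R X (c x)"] s0s con_subset[OF cc, of "{s0..s}"] s0(1) c(1) sub
 by (auto simp: K_def hvd_def subset_iff)
 then obtain x where x: "x : {s0<..<s}" "norm (c s - c s0) <= norm ((s - s0) *\<^sub>R X (c x))" by blast
 have "x ~: K" using s0(2)[of x] x(1) by auto
 hence "c x : cball p R" using x(1) s0(1) by (auto simp: K_def dist_norm norm_minus_commute)
 hence "norm ((s - s0) *\<^sub>R X (c x)) <= h * M"
 unfolding norm_scaleR using s0(1) s0s by (intro mult_mono M(2)) (auto simp: K_def)
 hence "norm (c s - c s0) < R / 2" using x(2) h(3) by (simp add: mult.commute)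
 moreover have "norm (c s0 - p) <= norm (c s - p) + norm (c s - c s0)"
 using norm_triangle_ineq4[of "c s - p" "c s - c s0"] by simp
 ultimately show False using s0(1) near by (simp add: K_def)
 qed
 have d: "((%x. rh (c x)) hrd e (c x)) (at x)" if x: "x : {s - h..s}" for x
 proof -
 have "c x : B" using inb[OF x] R(2) by blast
 from smooth_has_derivative[OF B(3) this]
 have "(rh hasd fder rh (at (c x))) (at (c x) within c ` UNIV)" by (rule hd_within)
 from vector_derivative_diff_chain_within[OF c(1)[OF subsetD[OF sub x]] this]
 show ?thesis by (simp add: o_def hrd_hvd e_def)
 qed
 obtain z where z: "s - h < z" "z < s" "rh (c s) - rh (c (s - h)) = (s - (s - h)) * e (c z)"
 using MVT2[of "s - h" s "%x. rh (c x)" "%x. e (c x)"] h d by auto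
 have "d0 < e (c z)" using inb[of z] z R(2) by auto
 hence "h * d0 <= h * e (c z)" using h by simp
 moreover have "h * d0 = 2 * rh (c s)" using d0 by (simp add: h_def)
 ultimately have "rh (c (s - h)) <= - rh (c s)" using z(3) by simp
 moreover have "0 < rh (c (s - h))" by (rule c(2)[OF subsetD[OF sub]]) (use h in simp)
 ultimately show False using rhs by simp
 qed
 qed
qed

definition normal_chart where
 "normal_chart Om U X Y rh B p Z A Ps \<longleftrightarrow> 0 < A & adapted_chart Om rh U X Y (-A) A A Ps & open (Ps ` ({-A<..<A} \<times> {-A<..<A})) & Ps ` ({-A<..<A} \<times> {-A<..<A}) <= B & Ps (0, 0) = p &
 Csm ({-A<..<A} \<times> {-A<..<A}) (%z. Z (Ps z)) &
 (ALL z:{-A<..<A} \<times> {-A<..<A}. Re (Z (Ps z)) = fst z & \<bar>px (%z. Im (Z (Ps z))) z\<bar> <= 1 / 2)"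

lemma normal_chartD:
 assumes "normal_chart Om U X Y rh B p Z A Ps"
 shows "0 < A" "adapted_chart Om rh U X Y (-A) A A Ps" "open (Ps ` ({-A<..<A} \<times> {-A<..<A}))" "Ps ` ({-A<..<A} \<times> {-A<..<A}) <= B" "Ps (0, 0) = p"
 "Csm ({-A<..<A} \<times> {-A<..<A}) (%z. Z (Ps z))" "Csm ({-A<..<A} \<times> {-A<..<A}) Ps" "inj_on Ps ({-A<..<A} \<times> {-A<..<A})"
 and "!!x t. x : {-A<..<A} ==> t : {-A<..<A} ==> Re (Z (Ps (x, t))) = x"
 and "!!x t. x : {-A<..<A} ==> t : {-A<..<A} ==> \<bar>px (%z. Im (Z (Ps z))) (x, t)\<bar> <= 1 / 2"
 and "!!x t. x : {-A<..<A} ==> t : {-A<..<A} ==> rh (Ps (x, t)) = t"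
 and "!!x t. x : {-A<..<A} ==> t : {-A<..<A} ==> Ps (x, t) : Om \<longleftrightarrow> 0 < t"
 and "!!x t. x : {-A<..<A} ==> t : {-A<..<A} ==> bij (fder Ps (at (x, t)))"
 using assms unfolding normal_chart_def adapted_chart_def by auto

lemma normal_chart_inverse:
 assumes nc: "normal_chart Om U X Y rh B p Z A Ps" and w: "w : Ps ` ({-A<..<A} \<times> {-A<..<A})"
 shows "w = Ps (Re (Z w), rh w)" "Re (Z w) : {-A<..<A}" "rh w : {-A<..<A}"
proof -
 obtain x t where xt: "x : {-A<..<A}" "t : {-A<..<A}" "w = Ps (x, t)" using w by auto
 show "w = Ps (Re (Z w), rh w)" "Re (Z w) : {-A<..<A}" "rh w : {-A<..<A}"
 using normal_chartD(9,11)[OF nc xt(1,2)] xt by simp_all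
qed

lemma normal_chart_box_open:
 assumes nc: "normal_chart Om U X Y rh B p Z A Ps" and B: "Csm B rh" "open B" "Csm B Z" and c: "c <= A" "T <= A"
 shows "open (Ps ` ({-c<..<c} \<times> {-T<..<T}))"
proof -
 let ?V = "Ps ` ({-A<..<A} \<times> {-A<..<A})"
 note D = normal_chartD[OF nc]
 have cr: "cts ?V (%w. Re (Z w))" "cts ?V rh"
 using con_subset[OF smooth_con D(4)] B smooth_Re_Im(1)[OF B(2,3)] by blast+
 have "Ps ` ({-c<..<c} \<times> {-T<..<T}) = (?V \<inter> (%w. Re (Z w)) -` {-c<..<c}) \<inter> (?V \<inter> rh -` {-T<..<T})"
 proof (intro equalityI subsetI)
 fix w assume "w : Ps ` ({-c<..<c} \<times> {-T<..<T})"
 then obtain x t where xt: "x : {-c<..<c}" "t : {-T<..<T}" "w = Ps (x, t)" by blast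
 hence "x : {-A<..<A}" "t : {-A<..<A}" using c by auto
 thus "w : (?V \<inter> (%w. Re (Z w)) -` {-c<..<c}) \<inter> (?V \<inter> rh -` {-T<..<T})"
 using D(9,11)[of x t] xt by simp
 next
 fix w assume w: "w : (?V \<inter> (%w. Re (Z w)) -` {-c<..<c}) \<inter> (?V \<inter> rh -` {-T<..<T})"
 hence "w = Ps (Re (Z w), rh w)" by (intro normal_chart_inverse(1)[OF nc]) blast
 thus "w : Ps ` ({-c<..<c} \<times> {-T<..<T})" by (rule image_eqI) (use w in auto)
 qed
 moreover have "open ..."
 by (intro open_Int open_preimage[OF cr(1) D(3)] open_preimage[OF cr(2) D(3)] open_greaterThanLessThan)
 ultimately show ?thesis by simp
qed

text \<open>If Im Z vanished on the axis x = 0 for small t, then so would \<open>Z\<close>, and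
  \<open>kernel_direction\<close> would make X and Y dependent along the axis and Re(XZ) zero there.
  Then |Re(XZ)| <= C|x|, and the orbit of \<open>p\<close>, on which x' = Re(XZ), would stay on the
  axis, contrary to the elliptic points on it.\<close>

lemma type_II_not_flat:
 assumes fin: "first_integral_near B X Y rh p Z" and nc: "normal_chart Om U X Y rh B p Z A Ps"
 and Om: "defining_function Om rh" and Xp: "0 < fder rh (at p) (X p)" and II: "type_II Om U X Y p"
 and tu: "0 < tu" "tu <= A"
 shows "EX t:{0<..<tu}. Im (Z (Ps (0, t))) ~= 0"
proof (rule ccontr)
 assume "~ ?thesis"
 hence flat: "Im (Z (Ps (0, t))) = 0" if "t : {0<..<tu}" for t using that by blast
 let ?Q = "{-A<..<A} \<times> {-A<..<A}"
 note D = normal_chartD[OF nc]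
 have oQ: "open ?Q" by (simp add: open_Times)
 have B: "open B" "p : B" "Csm B X" "Csm B Y" "Csm B rh" "Csm B Z"
 and LZ: "!!z. z : B ==> vf_apply X Y Z z = 0" "!!z. z : B ==> px Z z ~= 0 \<or> py Z z ~= 0" "Z p = 0"
 using fin unfolding first_integral_near_def by blast+
 define DX where "DX z = of_real (fst (X z)) * px Z z + of_real (snd (X z)) * py Z z" for z
 have ax: "DX (Ps (0, t)) = 0 & ~ elliptic_at X Y (Ps (0, t))" if t: "t : {0<..<tu}" for t
 proof -
 have 0: "(0::real) : {-A<..<A}" and tA: "t : {-A<..<A}" using t tu D(1) by auto
 have q: "(0, t) : ?Q" using 0 tA by simp
 let ?q = "Ps (0, t)"
 have qB: "?q : B" using D(4) q by blast
 define v where "v = py Ps (0, t)"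
 have "fder Ps (at (0, t)) (0, 1) ~= fder Ps (at (0, t)) (0, 0)"
 unfolding inj_eq[OF bij_is_inj[OF D(13)[OF 0 tA]]] by simp
 moreover have "fder Ps (at (0, t)) (0, 0) = 0" using frechet_derivative_px_py[OF D(7) q, of "(0, 0)"] by simp
 ultimately have v0: "v ~= 0" by (simp add: v_def py_def)
 have "((%t. Z (Ps (0, t))) hvd fder Z (at ?q) v) (at t)"
 using vector_derivative_diff_chain_within[OF smooth_partials(2)[OF D(7) q, of UNIV], of Z "fder Z (at ?q)"]
 hd_within[OF smooth_has_derivative[OF B(6) qB]] by (simp add: o_def v_def)
 moreover have "((%t. Z (Ps (0, t))) hvd 0) (at t)"
 proof (rule has_vector_derivative_transform_within_open[of "%_. 0" _ _ "{0<..<tu}"])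
 fix t' assume t': "t' : {0<..<tu}"
 hence "t' : {-A<..<A}" using tu by auto
 from D(9)[OF 0 this] flat[OF t'] show "0 = Z (Ps (0, t'))" by (simp add: complex_eq_iff)
 qed (use t in auto)
 ultimately have "fder Z (at ?q) v = 0" by (rule vector_derivative_unique_at)
 hence k: "of_real (fst v) * px Z ?q + of_real (snd v) * py Z ?q = 0"
 unfolding frechet_derivative_px_py[OF B(6) qB] by (simp add: scaleR_conv_of_real)
 have l: "of_real (fst (X ?q)) * px Z ?q + of_real (snd (X ?q)) * py Z ?q + \<i> * (of_real (fst (Y ?q)) * px Z ?q + of_real (snd (Y ?q)) * py Z ?q) = 0"
 using LZ(1)[OF qB] unfolding vf_apply_def frechet_derivative_px_py[OF B(6) qB] by (simp add: scaleR_conv_of_real)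
 from kernel_direction[OF v0 k LZ(2)[OF qB] l] show ?thesis by (auto simp: DX_def elliptic_at_def)
 qed
 define bt where "bt z = Re (DX (Ps z))" for z
 have "Csm B (%z. fst (X z))" "Csm B (%z. snd (X z))"
 by (intro smooth_linear_compose[OF B(1) _ B(3)] bounded_linear_fst bounded_linear_snd)+
 hence "Csm B DX" unfolding DX_def[abs_def]
 by (intro smooth_add smooth_mult smooth_px smooth_py B smooth_linear_compose[OF B(1) bounded_linear_of_real])
 hence "Csm B (%z. Re (DX z))" by (rule smooth_Re_Im(1)[OF B(1)])
 hence sbt: "Csm ?Q bt" unfolding bt_def[abs_def] by (rule smooth_compose[OF oQ B(1) D(4) _ D(7)])
 have K: "{-A/2..A/2} \<times> {-A/2..A/2} <= ?Q" using D(1) by auto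
 obtain C where C: "0 < C" "!!z. z : {-A/2..A/2} \<times> {-A/2..A/2} ==> norm (px bt z) <= C"
 using compact_bd[OF con_subset[OF smooth_con[OF smooth_px[OF sbt]] K]] by (metis compact_Times compact_Icc)
 have bt: "\<bar>bt (x, t)\<bar> <= C * \<bar>x\<bar>" if "x : {-A/2..A/2}" "t : {0<..A/2}" "t < tu" for x t
 proof -
 have sub: "(x, t) : {-A/2..A/2} \<times> {-A/2..A/2}" if "x : {-A/2..A/2}" for x using that \<open>t : {0<..A/2}\<close> by auto
 have "EX z:{-A/2..A/2}. \<bar>z - 0\<bar> <= \<bar>x - 0\<bar> & bt (x, t) - bt (0, t) = (x - 0) * px bt (z, t)"
 proof (rule mean_value_between[of _ _ "%x. bt (x, t)" "%z. px bt (z, t)"])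
 show "((%x. bt (x, t)) hrd px bt (z, t)) (at z)" if "z : {-A/2..A/2}" for z
 unfolding hrd_hvd by (rule smooth_partials(1)[OF sbt subsetD[OF K sub[OF that]]])
 qed (use that D(1) in auto)
 then obtain z where z: "z : {-A/2..A/2}" "bt (x, t) - bt (0, t) = x * px bt (z, t)" by auto
 have "\<bar>bt (x, t) - bt (0, t)\<bar> = \<bar>px bt (z, t)\<bar> * \<bar>x\<bar>" unfolding z(2) abs_mult by (rule mult.commute)
 also have "... <= C * \<bar>x\<bar>" by (rule mult_rm) (use C(2)[OF sub[OF z(1)]] in simp_all)
 finally have "\<bar>bt (x, t) - bt (0, t)\<bar> <= C * \<bar>x\<bar>" .
 moreover have "bt (0, t) = 0" using ax[of t] that by (simp add: bt_def)
 ultimately show ?thesis by simp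
 qed
 obtain ep c Q where ep: "0 < ep" and c0: "c 0 = p" and c: "!!s. s : {-ep<..<ep} ==> (c hvd X (c s)) (at s)"
 and cOm: "c ` {0<..<ep} <= Om" and Q: "!!k::nat. Q k : c ` {0<..<ep}" "!!k. elliptic_at X Y (Q k)" "Q \<longlonglongrightarrow> p"
 using II unfolding type_II_def by blast
 define xi th where "xi s = Re (Z (c s))" and "th s = rh (c s)" for s
 have rhp: "rh p = 0" using D(11)[of 0 0] D(1,5) by simp
 have "isCont c 0" by (rule has_vector_derivative_continuous[OF c]) (use ep in simp)
 hence ic: "(c \<longlongrightarrow> p) (nhds 0)" unfolding isCont_def tendsto_at_iff_tendsto_nhds[of c 0] unfolding c0 .
 have "isCont rh p" "isCont (%z. Re (Z z)) p"
 using smooth_con[OF B(5)] smooth_con[OF smooth_Re_Im(1)[OF B(1,6)]] B(1,2) by (simp_all only: continuous_on_eq_continuous_at)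
 hence l: "(th \<longlongrightarrow> rh p) (nhds 0)" "(xi \<longlongrightarrow> Re (Z p)) (nhds 0)"
 unfolding th_def[abs_def] xi_def[abs_def] using isCont_tendsto_compose ic by fastforce+
 have pQ: "p : Ps ` ?Q" using D(1,5) by (auto intro!: image_eqI[of _ _ "(0, 0)"])
 have "\<forall>\<^sub>F s in nhds 0. c s : Ps ` ?Q & th s < min tu (A / 2) & - (A / 2) < xi s & xi s < A / 2"
 by (intro eventually_conj topological_tendstoD[OF ic D(3) pQ] order_tendstoD[OF l(1)] order_tendstoD[OF l(2)])
 (use rhp LZ(3) D(1) tu in auto)
 then obtain d where d: "0 < d" "!!s. \<bar>s\<bar> < d ==> c s : Ps ` ?Q & th s < min tu (A / 2) & - (A / 2) < xi s & xi s < A / 2"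
 unfolding eventually_nhds_metric dist_real_def by auto
 \<comment> \<open>dl C <= 1/2 makes the estimate at the maximum of |xi| a contraction, which forces
   the maximum to be 0.\<close>
 define dl where "dl = min (min d ep) (1 / C) / 2"
 have dl: "0 < dl" "dl < d" "dl < ep" "dl * C <= 1 / 2"
 proof -
 show "0 < dl" "dl < d" "dl < ep" using d ep C by (auto simp: dl_def min_def)
 have "dl <= 1 / C / 2" by (simp add: dl_def)
 hence "dl * C <= 1 / C / 2 * C" by (rule mult_rm) (use C in simp)
 thus "dl * C <= 1 / 2" using C by simp
 qed
 have th0: "0 < th s" if "s : {0<..<ep}" for s
 proof -
 have "c s : Om" using cOm that by blast
 thus ?thesis using Om unfolding th_def defining_function_def by blast
 qed
 have cB: "c s : B" and cPs: "c s = Ps (xi s, th s)" if "s : {0..dl}" for s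
 using d(2)[of s] dl that D(4) normal_chart_inverse(1)[OF nc, of "c s"] by (auto simp: xi_def th_def)
 have dxi: "(xi hrd bt (xi s, th s)) (at s)" if s: "s : {0..dl}" for s
 proof -
 have "((%z. Re (Z z)) hasd (%v. Re (fder Z (at (c s)) v))) (at (c s) within c ` UNIV)"
 by (rule hd_within[OF has_derivative_Re[OF smooth_has_derivative[OF B(6) cB[OF s]]]])
 from vector_derivative_diff_chain_within[OF c this] s dl
 have "(xi hrd Re (fder Z (at (c s)) (X (c s)))) (at s)"
 by (simp add: o_def hrd_hvd xi_def[abs_def])
 also have "Re (fder Z (at (c s)) (X (c s))) = bt (xi s, th s)"
 unfolding bt_def cPs[OF s, symmetric] frechet_derivative_px_py[OF B(6) cB[OF s]] DX_def by (simp add: scaleR_conv_of_real)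
 finally show ?thesis .
 qed
 have "cts {0..dl} (%s. \<bar>xi s\<bar>)"
 by (intro continuous_on_rabs con_at_on ballI DERIV_isCont[OF dxi])
 from continuous_attains_sup[OF compact_Icc _ this] dl(1)
 obtain sm where sm: "sm : {0..dl}" "!!s. s : {0..dl} ==> \<bar>xi s\<bar> <= \<bar>xi sm\<bar>" by auto
 have xi0: "xi 0 = 0" using c0 LZ(3) by (simp add: xi_def)
 have "xi sm = 0"
 proof (cases "sm = 0")
 case False
 hence "0 < sm" using sm(1) by simp
 from MVT2[OF this, of xi "%s. bt (xi s, th s)"] dxi sm(1)
 obtain z where z: "0 < z" "z < sm" "xi sm - xi 0 = (sm - 0) * bt (xi z, th z)" by auto
 have "\<bar>bt (xi z, th z)\<bar> <= C * \<bar>xi z\<bar>"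
 by (rule bt) (use d(2)[of z] th0[of z] z sm(1) dl in auto)
 also have "... <= C * \<bar>xi sm\<bar>" by (rule mult_lm[OF sm(2)]) (use z sm(1) C in auto)
 finally have "sm * \<bar>bt (xi z, th z)\<bar> <= dl * (C * \<bar>xi sm\<bar>)" by (rule mult_mono[rotated]) (use sm(1) dl in auto)
 also have "... <= 1 / 2 * \<bar>xi sm\<bar>" unfolding mult.assoc[symmetric] by (rule mult_rm[OF dl(4)]) simp
 finally show ?thesis using z xi0 by (simp add: abs_mult)
 qed (use xi0 in simp)
 hence xiz: "xi s = 0" if "s : {0..dl}" for s using sm(2)[OF that] by simp
 have ne: "~ elliptic_at X Y (c s)" if s: "s : {0<..dl}" for s
 using ax[of "th s"] cPs[of s] xiz[of s] th0[of s] d(2)[of s] s dl by auto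
 \<comment> \<open>The points \<open>Q k\<close> approach \<open>p\<close>, but their parameters on
   the orbit might stay away from 0; this excludes it.\<close>
 have "\<exists>r>0. ALL s:{0<..<ep}. norm (c s - p) < r --> s < dl"
 proof (rule no_return[OF B(1,2,5,3) Xp rhp _ _ dl(1)])
 show "(c hvd X (c s)) (at s)" if "s : {0<..<ep}" for s by (rule c) (use that in auto)
 show "0 < rh (c s)" if "s : {0<..<ep}" for s using th0[OF that] by (simp add: th_def)
 qed
 then obtain r where r: "0 < r" "!!s. s : {0<..<ep} ==> norm (c s - p) < r ==> s < dl" by blast
 obtain k where "dist (Q k) p < r" using metric_LIMSEQ_D[OF Q(3) r(1)] by blast
 moreover obtain s where "s : {0<..<ep}" "Q k = c s" using Q(1) by blast
 ultimately show False using r(2)[of s] ne[of s] Q(2)[of k] by (auto simp: dist_norm)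
qed

lemma first_integral_near_uminus:
 assumes "first_integral_near B X Y rh p Z"
 shows "first_integral_near B X Y rh p (%z. - Z z)"
proof -
 have B: "open B" "p : B" "Csm B X" "Csm B Y" "Csm B rh" "Csm B Z"
 and LZ: "!!z. z : B ==> vf_apply X Y Z z = 0" "!!z. z : B ==> px Z z ~= 0 \<or> py Z z ~= 0" "Z p = 0"
 and Lrh: "!!z. z : B ==> vf_apply X Y (%z. of_real (rh z)) z ~= 0"
 using assms unfolding first_integral_near_def by blast+
 obtain r :: real where r: "r ~= 0" "px Z p * of_real (py rh p) - py Z p * of_real (px rh p) = of_real r"
 using assms unfolding first_integral_near_def by blast+
 have d: "fder (%z. - Z z) (at z) = (%v. - fder Z (at z) v)" if "z : B" for z
 by (rule frechet_derivative_at[OF has_derivative_minus[OF smooth_has_derivative[OF B(6) that]], symmetric])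
 have p: "px (%z. - Z z) z = - px Z z" "py (%z. - Z z) z = - py Z z" if "z : B" for z
 using d[OF that] by (simp_all add: px_def py_def)
 have "vf_apply X Y (%z. - Z z) z = - vf_apply X Y Z z" if "z : B" for z using d[OF that] by (simp add: vf_apply_def)
 moreover have "px (%z. - Z z) p * of_real (py rh p) - py (%z. - Z z) p * of_real (px rh p) = of_real (- r)"
 using p[OF B(2)] r(2) by (simp add: algebra_simps)
 moreover have "Csm B (%z. - Z z)" by (rule smooth_linear_compose[OF B(1) bounded_linear_minus[OF bounded_linear_ident] B(6)])
 ultimately show ?thesis
 unfolding first_integral_near_def using B LZ Lrh p r(1) by (auto intro!: exI[of _ "- r"])
qed

text \<open>Im Z(0,t) is nonzero for arbitrarily small t; if it is not positive for arbitrarily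
  small t, then -Im Z(0,t) is. The chart obtained for -Z may differ from the one for Z, but near
  \<open>p\<close> the axes agree, since a point is determined by Re Z and
  \<open>rh\<close>.\<close>

lemma rising_chart_exists:
 assumes fin: "first_integral_near B X Y rh p Z" and BU: "B <= U" and Om: "open Om" "defining_function Om rh" "p : frontier Om"
 and Xp: "0 < fder rh (at p) (X p)" and II: "type_II Om U X Y p"
 shows "EX Z A Ps. first_integral_near B X Y rh p Z & normal_chart Om U X Y rh B p Z A Ps & (\<forall>tu>0. EX t:{0<..<tu}. 0 < Im (Z (Ps (0, t))))"
proof -
 obtain A Ps where nc: "normal_chart Om U X Y rh B p Z A Ps"
 using chart_exists[OF fin BU Om] unfolding normal_chart_def by blast
 note D = normal_chartD[OF nc]
 show ?thesis
 proof (cases "\<forall>tu>0. EX t:{0<..<tu}. 0 < Im (Z (Ps (0, t)))")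
 case True
 thus ?thesis using fin nc by blast
 next
 case False
 then obtain tu0 where tu0: "0 < tu0" "!!t. t : {0<..<tu0} ==> ~ 0 < Im (Z (Ps (0, t)))" by blast
 let ?Z = "%z. - Z z"
 have fin': "first_integral_near B X Y rh p ?Z" by (rule first_integral_near_uminus[OF fin])
 obtain A' Ps' where nc': "normal_chart Om U X Y rh B p ?Z A' Ps'"
 using chart_exists[OF fin' BU Om] unfolding normal_chart_def by blast
 note D' = normal_chartD[OF nc']
 have "((%t. Ps' (0, t)) \<longlongrightarrow> Ps' (0, 0)) (nhds 0)"
 using has_vector_derivative_continuous[OF smooth_partials(2)[OF D'(7), of 0 0 UNIV]] D'(1)
 unfolding continuous_within tendsto_at_iff_tendsto_nhds[of "%t. Ps' (0, t)" 0] by simp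
 moreover have "Ps' (0, 0) : Ps ` ({-A<..<A} \<times> {-A<..<A})" using D(1,5) D'(5) by (auto intro!: image_eqI[of _ _ "(0, 0)"])
 ultimately have "\<forall>\<^sub>F t in nhds 0. Ps' (0, t) : Ps ` ({-A<..<A} \<times> {-A<..<A})" by (intro topological_tendstoD[OF _ D(3)])
 then obtain d where d: "0 < d" "!!t. \<bar>t\<bar> < d ==> Ps' (0, t) : Ps ` ({-A<..<A} \<times> {-A<..<A})"
 unfolding eventually_nhds_metric dist_real_def by auto
 have "EX t:{0<..<tu}. 0 < Im (- Z (Ps' (0, t)))" if tu: "0 < tu" for tu
 proof -
 define m where "m = min (min tu tu0) (min (min d A) A')"
 have m: "0 < m" "m <= tu" "m <= tu0" "m <= d" "m <= A" "m <= A'" using tu tu0(1) d(1) D(1) D'(1) by (auto simp: m_def)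
 obtain t where t: "t : {0<..<m}" "Im (Z (Ps (0, t))) ~= 0" using type_II_not_flat[OF fin nc Om(2) Xp II m(1,5)] by blast
 have "Ps' (0, t) = Ps (Re (Z (Ps' (0, t))), rh (Ps' (0, t)))" by (rule normal_chart_inverse(1)[OF nc d(2)]) (use t m in auto)
 moreover have "Re (- Z (Ps' (0, t))) = 0" by (rule D'(9)) (use t m in auto)
 moreover have "rh (Ps' (0, t)) = t" by (rule D'(11)) (use t m in auto)
 ultimately have "Ps' (0, t) = Ps (0, t)" by simp
 thus ?thesis using t tu0(2)[of t] m by (intro bexI[of _ t]) auto
 qed
 thus ?thesis using fin' nc' by blast
 qed
qed

section \<open>From the vanishing derivative back to the solution\<close>

text \<open>\<open>P\<close> is a polynomial of degree below k. It is recorded as an entire function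
  with vanishing k-th derivative because that is what is differentiated in
  \<open>iterated_prim_zero\<close>.\<close>

lemma vanishing_iterated_deriv:
 "open S ==> connected S ==> F hol S ==> (!!w. w : S ==> (deriv ^^ k) F w = 0) ==>
 EX P. P hol UNIV & (ALL w. (deriv ^^ k) P w = 0) & (ALL w:S. F w = P w)"
proof (induction k arbitrary: F)
 case 0
 thus ?case by (intro exI[of _ "%_. 0"]) simp
next
 case (Suc k)
 have "EX P. P hol UNIV & (ALL w. (deriv ^^ k) P w = 0) & (ALL w:S. deriv F w = P w)"
 by (rule Suc.IH[OF Suc.prems(1,2) holomorphic_deriv[OF Suc.prems(3,1)]])
 (use Suc.prems(4) in \<open>simp add: funpow_swap1\<close>)
 then obtain P where P: "P hol UNIV" "!!w. (deriv ^^ k) P w = 0" "!!w. w : S ==> deriv F w = P w" by blast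
 obtain Q where Q: "!!x. (Q hfd P x) (at x)"
 using holomorphic_convex_primitive'[OF convex_UNIV open_UNIV P(1)] by auto
 have dF: "((%w. F w - Q w) hfd 0) (at w)" if "w : S" for w
 using DERIV_diff[OF holomorphic_derivI[OF Suc.prems(3,1) that] Q[of w]] P(3)[OF that] by simp
 have "cts S (%w. F w - Q w)" by (intro con_at_on ballI DERIV_isCont[OF dF])
 then obtain c where c: "!!w. w : S ==> F w - Q w = c"
 using DERIV_zero_connected_constant[OF Suc.prems(2,1) finite.emptyI, of "%w. F w - Q w"] dF by auto
 let ?P = "%w. Q w + c"
 have dP: "(?P hfd P w) (at w)" for w using DERIV_add[OF Q[of w] DERIV_const[of c]] by simp
 have "deriv ?P = P" by (rule ext) (rule DERIV_imp_deriv[OF dP])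
 hence "(deriv ^^ Suc k) ?P w = 0" for w using P(2) by (simp add: funpow_swap1)
 moreover have "?P hol UNIV" using dP by (auto simp: holomorphic_on_open intro!: exI)
 moreover have "F w = ?P w" if "w : S" for w using c[OF that] by (simp add: algebra_simps)
 ultimately show ?case by blast
qed

text \<open>From dG = H dZ and G = P(Z) follows H = P'(Z); going down the chain of k primitives one
  arrives at g = P^(k)(Z) = 0.\<close>

lemma iterated_prim_zero:
 assumes S: "open S" "S <= D" and Z: "Csm D Z" "!!z. z : S ==> px Z z ~= 0"
 shows "(prim D Z ^^ k) g G ==> P hol UNIV ==> (!!w. (deriv ^^ k) P w = 0) ==> (!!z. z : S ==> G z = P (Z z)) ==> z : S ==> g z = 0"
proof (induction k arbitrary: G P)
 case 0
 thus ?case by simp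
next
 case (Suc k)
 obtain H where H: "(prim D Z ^^ k) g H" "prim D Z H G" by (rule relpowp_Suc_E[where P = "prim D Z", OF Suc.prems(1)])
 have "H z = deriv P (Z z)" if z: "z : S" for z
 proof -
 have zD: "z : D" using z S by blast
 have "(G hasd (%v. H z * fder Z (at z) v)) (at z)" using H(2) zD by (simp add: prim_def)
 from px_eqI[OF this] have 1: "px G z = H z * px Z z" by (simp add: px_def)
 have "(P hasd (%v. deriv P (Z z) * v)) (at (Z z))"
 using holomorphic_derivI[OF Suc.prems(2) open_UNIV UNIV_I] by (simp add: has_field_derivative_def)
 from hd_comp[OF smooth_has_derivative[OF Z(1) zD] this]
 have "px (%z. P (Z z)) z = deriv P (Z z) * px Z z" by (subst px_eqI) (auto simp: px_def)
 hence "px G z = deriv P (Z z) * px Z z" using px_cong_open[OF S(1) z Suc.prems(4)] by simp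
 thus ?thesis using 1 Z(2)[OF z] by simp
 qed
 moreover have "(deriv ^^ k) (deriv P) w = 0" for w using Suc.prems(3)[of w] by (simp add: funpow_swap1)
 ultimately show ?case using Suc.IH[OF H(1) holomorphic_deriv[OF Suc.prems(2) open_UNIV]] Suc.prems(5) by blast
qed

locale straight_chart =
 fixes A :: real and Z :: "plane => complex"
 assumes A: "0 < A" and smooth: "Csm ({-A<..<A} \<times> {-A<..<A}) Z"
 and re: "!!x t. x : {-A<..<A} ==> t : {-A<..<A} ==> Re (Z (x, t)) = x"
 and slope: "!!x t. x : {-A<..<A} ==> t : {-A<..<A} ==> \<bar>px (%z. Im (Z z)) (x, t)\<bar> <= 1 / 2"
begin

abbreviation "Q \<equiv> {-A<..<A} \<times> {-A<..<A}"

lemma open_Q: "open Q" by (simp add: open_Times)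

lemma smooth_Im: "Csm Q (%z. Im (Z z))" by (rule smooth_Re_Im(2)[OF open_Q smooth])

lemma Re_px: "z : Q ==> Re (px Z z) = 1"
proof -
 assume z: "z : Q"
 have "px (%z. Re (Z z)) z = px fst z" by (rule px_cong_open[OF open_Q z]) (use re in auto)
 also have "... = 1" by (subst px_eqI[OF has_derivative_fst[OF has_derivative_ident]]) simp
 finally show ?thesis using px_Re_Im(1)[OF smooth z] by simp
qed

lemma px_nz: "z : Q ==> px Z z ~= 0" using Re_px by fastforce

lemma lip:
 assumes "x : {-A<..<A}" "y : {-A<..<A}" "t : {-A<..<A}"
 shows "\<bar>Im (Z (x, t)) - Im (Z (y, t))\<bar> <= \<bar>x - y\<bar> / 2"
proof -
 have sub: "{min x y..max x y} <= {-A<..<A}" using assms by auto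
 have "EX z:{min x y..max x y}. \<bar>z - y\<bar> <= \<bar>x - y\<bar> & Im (Z (x, t)) - Im (Z (y, t)) = (x - y) * px (%z. Im (Z z)) (z, t)"
 proof (rule mean_value_between[of _ _ "%x. Im (Z (x, t))" "%z. px (%z. Im (Z z)) (z, t)"])
 show "((%x. Im (Z (x, t))) hrd px (%z. Im (Z z)) (z, t)) (at z)" if "z : {min x y..max x y}" for z
 unfolding hrd_hvd
 by (rule smooth_partials(1)[OF smooth_Im]) (use subsetD[OF sub that] assms(3) in simp)
 qed auto
 then obtain z where z: "z : {min x y..max x y}" "Im (Z (x, t)) - Im (Z (y, t)) = (x - y) * px (%z. Im (Z z)) (z, t)" by blast
 have "\<bar>x - y\<bar> * \<bar>px (%z. Im (Z z)) (z, t)\<bar> <= \<bar>x - y\<bar> * (1 / 2)"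
 by (rule mult_lm[OF slope[OF subsetD[OF sub z(1)] assms(3)]]) simp
 thus ?thesis unfolding z(2) abs_mult by simp
qed

lemma tube_exists:
 assumes "0 < a0"
 shows "EX a T. a <= a0 & T <= a0 & a < A & T < A & tube a T Z"
proof -
 let ?K = "{-A/2..A/2} \<times> {-A/2..A/2}"
 have K: "?K <= Q" using A by auto
 obtain C where C: "0 < C" "!!z. z : ?K ==> norm (py (%z. Im (Z z)) z) <= C"
 using compact_bd[OF con_subset[OF smooth_con[OF smooth_py[OF smooth_Im]] K]] by (metis compact_Times compact_Icc)
 define a where "a = min a0 (A / 4)"
 \<comment> \<open>\<open>C\<close> bounds the t-derivative of Im Z, so the height a/(16C) keeps the
   vertical variation below a/16.\<close>
 define T where "T = min (min a0 (A / 4)) (a / (16 * C))"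
 have a: "0 < a" "a <= a0" "a <= A / 4" using assms A by (auto simp: a_def)
 have T: "0 < T" "T <= a0" "T <= A / 4" using assms A a C by (auto simp: T_def)
 have "T <= a / (16 * C)" by (simp add: T_def)
 hence TC: "C * T <= a / 16" using C by (simp add: field_simps)
 have "tube a T Z"
 proof
 show "Csm ({-2*a<..<2*a} \<times> {-2*T<..<2*T}) Z" by (rule smooth_subset[OF smooth]) (use a T in auto)
 show "Re (Z (x, t)) = x" if "x : {-2*a<..<2*a}" "t : {-2*T<..<2*T}" for x t by (rule re) (use that a T in auto)
 show "\<bar>Im (Z (x, t)) - Im (Z (y, t))\<bar> <= \<bar>x - y\<bar> / 2" if "x : {-a..a}" "y : {-a..a}" "t : {0..T}" for x y t
 by (rule lip) (use that a T in auto)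
 fix x t assume x: "x : {-a..a}" and t: "t : {0..T}"
 have inK: "(x, s) : ?K" if "s : {0..T}" for s using x that a T by auto
 have "EX z:{0..T}. \<bar>z - 0\<bar> <= \<bar>t - 0\<bar> & Im (Z (x, t)) - Im (Z (x, 0)) = (t - 0) * py (%z. Im (Z z)) (x, z)"
 proof (rule mean_value_between[of _ _ "%t. Im (Z (x, t))" "%z. py (%z. Im (Z z)) (x, z)"])
 show "((%t. Im (Z (x, t))) hrd py (%z. Im (Z z)) (x, z)) (at z)" if "z : {0..T}" for z
 unfolding hrd_hvd
 by (rule smooth_partials(2)[OF smooth_Im subsetD[OF K inK[OF that]]])
 qed (use t T in auto)
 then obtain z where z: "z : {0..T}" "Im (Z (x, t)) - Im (Z (x, 0)) = t * py (%z. Im (Z z)) (x, z)" by auto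
 have "\<bar>Im (Z (x, t)) - Im (Z (x, 0))\<bar> = t * \<bar>py (%z. Im (Z z)) (x, z)\<bar>" unfolding z(2) abs_mult using t by simp
 also have "... <= T * C" by (rule mult_mono) (use t T C(2)[OF inK[OF z(1)]] in auto)
 finally show "\<bar>Im (Z (x, t)) - Im (Z (x, 0))\<bar> <= a / 16" using TC by (simp add: mult.commute)
 qed (use a T in auto)
 thus ?thesis using a T A by (intro exI[of _ a] exI[of _ T]) auto
qed

lemma graph_arc_slice:
 assumes "0 < b" "b < B" "B <= A"
 shows "graph_arc (%x. Im (Z (x, 0))) b B" "x : {-B<..<B} ==> graph_arc.zt' (%x. Im (Z (x, 0))) x = px Z (x, 0)"
proof -
 show ga: "graph_arc (%x. Im (Z (x, 0))) b B"
 proof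
 have i: "Csm {-B<..<B} (%x. (x, 0::real))"
 by (intro smooth_Pair smooth_const smooth_bounded_linear bounded_linear_ident) simp_all
 show "Csm {-B<..<B} (%x. Im (Z (x, 0)))"
 by (rule smooth_compose[OF _ open_Q _ smooth_Im i]) (use assms A in auto)
 show "\<bar>Im (Z (x, 0)) - Im (Z (y, 0))\<bar> <= \<bar>x - y\<bar> / 2" if "x : {-b..b}" "y : {-b..b}" for x y
 by (rule lip) (use that assms A in auto)
 qed (use assms in auto)
 have pI: "px (%z. Im (Z z)) (x, 0) = Im (px Z (x, 0))" if "(x, 0) : Q" for x by (rule px_Re_Im(3)[OF smooth that])
 interpret graph_arc "%x. Im (Z (x, 0))" b B by (rule ga)
 assume x: "x : {-B<..<B}"
 hence xQ: "(x, 0) : Q" using assms A by auto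
 have "((%x. Im (Z (x, 0))) hasd (%h. h *\<^sub>R px (%z. Im (Z z)) (x, 0))) (at x)"
 using smooth_partials(1)[OF smooth_Im xQ] by (simp add: hvd_def)
 from fun_cong[OF frechet_derivative_at[OF this], of 1]
 have "fder (%x. Im (Z (x, 0))) (at x) 1 = Im (px Z (x, 0))" using pI[OF xQ] by simp
 thus "zt' x = px Z (x, 0)" using Re_px[OF xQ] by (simp add: zt'_def complex_eq_iff)
qed

text \<open>Where the curve \<open>Z(0, \<cdot>)\<close> rises above its starting point, the image of \<open>Z\<close> covers one side of the curve \<open>Z(\<cdot>, 0)\<close>,
 and the approximations converge there.\<close>
lemma pushforward_limit:
 assumes T: "0 < T" "T < A" and al: "0 < al" "al < A"
 and h: "uniform_limit ({-al..al} \<times> {0..T}) (%n z. h n (Z z)) G sequentially"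
 and t1: "t1 : {0<..T}" "Im (Z (0, 0)) < Im (Z (0, t1))"
 shows "EX b et F. 0 < b & b <= al & 0 < et & (ALL x:{-b..b}. F (Z (x, 0)) = G (x, 0)) &
 uniform_limit {Complex x (Im (Z (x, 0)) + s) |x s. x : {-b..b} & s : {0..et}} h F sequentially"
proof -
 define et where "et = (Im (Z (0, t1)) - Im (Z (0, 0))) / 2"
 have et: "0 < et" using t1 by (simp add: et_def)
 let ?d = "%x. Im (Z (x, t1)) - Im (Z (x, 0))"
 have tA: "t1 : {-A<..<A}" "(0::real) : {-A<..<A}" using t1 T A by auto
 have cd: "cts {-A<..<A} ?d"
 by (intro con_diff con_slice(1)[OF smooth_con[OF smooth_Im]]) (use tA in auto)
 have "isCont ?d 0" by (rule bspec[OF continuous_on_eq_continuous_at[THEN iffD1, OF open_greaterThanLessThan cd] tA(2)])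
 hence "(?d \<longlongrightarrow> ?d 0) (nhds 0)" unfolding isCont_def tendsto_at_iff_tendsto_nhds[of ?d 0] .
 moreover have "et < ?d 0" using et by (simp add: et_def)
 ultimately have "\<forall>\<^sub>F x in nhds 0. et < ?d x" by (rule order_tendstoD(1))
 then obtain d where d: "0 < d" "!!x. \<bar>x\<bar> < d ==> et < ?d x" unfolding eventually_nhds_metric dist_real_def by auto
 define b where "b = min al (d / 2)"
 have b: "0 < b" "b <= al" "b < d" using al d by (auto simp: b_def)
 let ?R = "{-b..b} \<times> {0..T}" and ?D = "{Complex x (Im (Z (x, 0)) + s) |x s. x : {-b..b} & s : {0..et}}"
 \<comment> \<open>Intermediate values on the vertical segment up to \<open>t1\<close>, on which Im
   Z rises by more than \<open>et\<close>.\<close>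
 have cover: "EX z:?R. Z z = w" if w: "w : ?D" for w
 proof -
 obtain x s where xs: "x : {-b..b}" "s : {0..et}" "w = Complex x (Im (Z (x, 0)) + s)" using w by blast
 have xA: "x : {-A<..<A}" using xs(1) b al by auto
 have c: "cts {0..t1} (%t. Im (Z (x, t)))"
 by (rule con_slice(2)[OF smooth_con[OF smooth_Im]]) (use xA t1 T in auto)
 have "et < ?d x" by (rule d(2)) (use xs(1) b in auto)
 hence "Im (Z (x, 0)) + s <= Im (Z (x, t1))" "Im (Z (x, 0)) <= Im (Z (x, 0)) + s" using xs(2) by simp_all
 hence "\<exists>t\<ge>0. t <= t1 & Im (Z (x, t)) = Im (Z (x, 0)) + s"
 by (intro IVT'[OF _ _ _ c]) (use t1 in auto)
 then obtain t where t: "0 <= t" "t <= t1" "Im (Z (x, t)) = Im (Z (x, 0)) + s" by blast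
 have "Re (Z (x, t)) = x" by (rule re[OF xA]) (use t t1 T in auto)
 hence "Z (x, t) = w" using t(3) xs(3) by (simp add: complex_eq_iff)
 thus ?thesis using t t1 xs(1) by (intro bexI[of _ "(x, t)"]) auto
 qed
 \<comment> \<open>\<open>Z\<close> need not be injective on the box. Any preimage of w will do: the
   limit of \<open>h n w\<close> depends on w alone, hence so does the value of \<open>G\<close> at
   a preimage.\<close>
 define tu where "tu w = (SOME z. z : ?R & Z z = w)" for w
 have tu: "tu w : ?R & Z (tu w) = w" if w: "EX z:?R. Z z = w" for w
 unfolding tu_def by (rule someI_ex) (use w in blast)
 have sub: "?R <= {-al..al} \<times> {0..T}" using b by auto
 define F where "F w = G (tu w)" for w
 have F0: "F (Z z) = G z" if z: "z : ?R" for z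
 proof -
 have t: "tu (Z z) : ?R & Z (tu (Z z)) = Z z" by (rule tu[OF bexI[OF refl z]])
 have "(%n. h n (Z (tu (Z z)))) \<longlonglongrightarrow> G (tu (Z z))" by (rule tendsto_uniform_limitI[OF h subsetD[OF sub conjunct1[OF t]]])
 moreover have "(%n. h n (Z z)) \<longlonglongrightarrow> G z" by (rule tendsto_uniform_limitI[OF h subsetD[OF sub z]])
 ultimately show ?thesis unfolding F_def conjunct2[OF t] by (rule LIMSEQ_unique)
 qed
 have "uniform_limit ?D h F sequentially"
 unfolding uniform_limit_iff
 proof (intro allI impI)
 fix e :: real assume "0 < e"
 from uniform_limitD[OF h this]
 show "\<forall>\<^sub>F n in sequentially. ALL w:?D. dist (h n w) (F w) < e"
 proof (rule eventually_mono)
 fix n assume n: "ALL z:{-al..al} \<times> {0..T}. dist (h n (Z z)) (G z) < e"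
 show "ALL w:?D. dist (h n w) (F w) < e"
 proof
 fix w assume "w : ?D"
 from tu[OF cover[OF this]] have t: "tu w : ?R" "Z (tu w) = w" by blast+
 from bspec[OF n subsetD[OF sub t(1)]] show "dist (h n w) (F w) < e" unfolding F_def t(2) .
 qed
 qed
 qed
 moreover have "ALL x:{-b..b}. F (Z (x, 0)) = G (x, 0)" using F0 T by auto
 ultimately show ?thesis using b et by blast
qed

lemma local_uniqueness:
 assumes ar: "0 < a" "a < A" and G: "prim ({-A<..<A} \<times> {0<..<A}) Z g G" "cts ({-a..a} \<times> {0..a}) G"
 and P: "P hol UNIV" and b: "0 < b" "b <= a" "!!x. x : {-b<..<b} ==> G (x, 0) = P (Z (x, 0))"
 shows "EX c T. 0 < c & c < A & 0 < T & T < A & (ALL z:{-c<..<c} \<times> {0<..<T}. G z = P (Z z))"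
proof -
 obtain c T where cT: "c <= b / 2" "T <= b / 2" "c < A" "T < A" "tube c T Z" using tube_exists[of "b / 2"] b(1) by auto
 interpret tube c T Z by (rule cT(5))
 define g1 G1 where "g1 z = g z - deriv P (Z z)" and "G1 z = G z - P (Z z)" for z
 have s1: "tupper <= {-A<..<A} \<times> {0<..<A}" using cT(1-4) b(1,2) ar by auto
 have s2: "tclosed <= {-a..a} \<times> {0..a}" using cT(1-4) b(1,2) by auto
 have s3: "tclosed <= Q" using cT(1-4) by auto
 have cZ: "cts Q Z" by (rule smooth_con[OF straight_chart.smooth[OF straight_chart_axioms]])
 have cP: "cts UNIV P" "cts UNIV (deriv P)"
 by (intro hol_con P holomorphic_deriv open_UNIV)+
 have prim1: "prim tupper Z g1 G1"
 unfolding prim_def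
 proof
 have "cts tupper g" using G(1) s1 unfolding prim_def by (meson con_subset)
 moreover have "tupper <= Q" using s1 by auto
 hence "cts tupper (%z. deriv P (Z z))"
 by (intro con_comp[OF cP(2) con_subset[OF cZ]]) simp_all
 ultimately show "cts tupper g1"
 unfolding g1_def[abs_def] by (rule con_diff)
 show "ALL z:tupper. (G1 hasd (%v. g1 z * fder Z (at z) v)) (at z)"
 proof
 fix z assume "z : tupper"
 hence z: "z : {-A<..<A} \<times> {0<..<A}" "z : Q" using s1 by auto
 have 1: "(G hasd (%v. g z * fder Z (at z) v)) (at z)" using G(1) z(1) unfolding prim_def by blast
 have "(P hasd (%v. deriv P (Z z) * v)) (at (Z z))"
 using holomorphic_derivI[OF P open_UNIV UNIV_I] by (simp add: has_field_derivative_def)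
 from has_derivative_diff[OF 1 hd_comp[OF smooth_has_derivative[OF straight_chart.smooth[OF straight_chart_axioms] z(2)] this]]
 show "(G1 hasd (%v. g1 z * fder Z (at z) v)) (at z)"
 unfolding G1_def[abs_def] g1_def by (simp add: left_diff_distrib)
 qed
 qed
 have "cts tclosed (%z. P (Z z))" by (rule con_comp[OF cP(1) con_subset[OF cZ s3]]) (rule subset_UNIV)
 hence cG1: "cts tclosed G1"
 unfolding G1_def[abs_def] by (rule con_diff[OF con_subset[OF G(2) s2]])
 have G1z: "G1 (x, 0) = 0" if x: "x : {-c..c}" for x
 proof -
 have "x : {-b<..<b}" using x cT(1) b(1) by simp
 from b(3)[OF this] show ?thesis by (simp add: G1_def)
 qed
 obtain h where h: "uniform_limit ({-c/4..c/4} \<times> {0..T}) (%n z. h n (Z z)) G1 sequentially" and h0: "!!n w. h n w = 0"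
 proof (rule gauss_approximation[OF cG1 prim1])
 fix h :: "nat => complex => complex"
 assume u: "uniform_limit ({-c/4..c/4} \<times> {0..T}) (%n z. h n (Z z)) G1 sequentially"
 and z: "(!!x. x : {-c..c} ==> G1 (x, 0) = 0) ==> (!!n w. h n w = 0)"
 have "h n w = 0" for n w by (rule z[OF G1z])
 thus thesis by (rule that[OF u])
 qed
 have "G z = P (Z z)" if z: "z : {-c/4<..<c/4} \<times> {0<..<T}" for z
 proof -
 have "z : {-c/4..c/4} \<times> {0..T}" using z by auto
 from tendsto_uniform_limitI[OF h this] have "(%n. 0) \<longlonglongrightarrow> G1 z" by (simp add: h0)
 hence "G1 z = 0" by (simp add: LIMSEQ_const_iff)
 thus ?thesis by (simp add: G1_def)
 qed
 thus ?thesis using a T cT tube.a[OF cT(5)] by (intro exI[of _ "c / 4"] exI[of _ T]) auto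
qed

end

lemma normal_chart_straight:
 assumes "normal_chart Om U X Y rh B p Z A Ps"
 shows "straight_chart A (%z. Z (Ps z))"
 using normal_chartD(1,6,9,10)[OF assms] by unfold_locales

section \<open>Transfer of the zero set from the arc to the chart\<close>

text \<open>A continuous derivative without zeros has constant sign; the decreasing case reduces to
  the increasing one by the reflection of y.\<close>

lemma nn_integral_change_nonvanishing:
 fixes x x' :: "real => real" and f :: "real => ennreal"
 assumes s: "s1 < s2" and d: "!!s. s : {s1..s2} ==> (x hrd x' s) (at s)" and c: "cts {s1..s2} x'"
 and nz: "!!s. s : {s1..s2} ==> x' s ~= 0" and f: "f : borel_measurable borel"
 shows "(NI (%y. f y * ind {min (x s1) (x s2)..max (x s1) (x s2)} y)) = (NI (%s. f (x s) * enn \<bar>x' s\<bar> * ind {s1..s2} s))"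
proof -
 have pos: "(NI (%y. f y * ind {min (x s1) (x s2)..max (x s1) (x s2)} y)) = (NI (%s. f (x s) * enn \<bar>x' s\<bar> * ind {s1..s2} s))"
 if d: "!!s. s : {s1..s2} ==> (x hrd x' s) (at s)" and c: "cts {s1..s2} x'"
 and p: "!!s. s : {s1..s2} ==> 0 < x' s" and f: "f : borel_measurable borel" for x x' :: "real => real" and f :: "real => ennreal"
 proof -
 obtain z where z: "s1 < z" "z < s2" "x s2 - x s1 = (s2 - s1) * x' z" using MVT2[OF s, of x x'] d by auto
 have "0 < (s2 - s1) * x' z" by (rule mult_pos_pos) (use s z p in auto)
 hence lt: "x s1 < x s2" using z by simp
 have "(NI (%y. f y * ind {x s1..x s2} y)) = (NI (%s. f (x s) * enn (x' s) * ind {s1..s2} s))"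
 by (rule nn_integral_substitution_aux[OF f _ d c _ s]) (use p in \<open>auto intro: less_imp_le\<close>)
 also have "... = (NI (%s. f (x s) * enn \<bar>x' s\<bar> * ind {s1..s2} s))"
 proof (rule nn_integral_cong)
 fix s show "f (x s) * enn (x' s) * ind {s1..s2} s = f (x s) * enn \<bar>x' s\<bar> * ind {s1..s2} s"
 using p[of s] by (cases "s : {s1..s2}") simp_all
 qed
 finally show ?thesis using lt by (simp add: min_def max_def)
 qed
 have "connected (x' ` {s1..s2})" by (rule connected_continuous_image[OF c connected_Icc])
 hence "(ALL s:{s1..s2}. 0 < x' s) \<or> (ALL s:{s1..s2}. x' s < 0)"
 proof (rule contrapos_pp)
 assume "~ ?thesis"
 then obtain u v where uv: "u : {s1..s2}" "v : {s1..s2}" "x' u <= 0" "0 <= x' v" by force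
 show "~ connected (x' ` {s1..s2})"
 proof
 assume "connected (x' ` {s1..s2})"
 from connectedD_interval[OF this imageI[OF uv(1)] imageI[OF uv(2)] uv(3,4)] show False using nz by force
 qed
 qed
 thus ?thesis
 proof
 assume "ALL s:{s1..s2}. 0 < x' s"
 thus ?thesis by (intro pos[OF d c _ f]) auto
 next
 assume n: "ALL s:{s1..s2}. x' s < 0"
 have f': "(%y. f (- y)) : borel_measurable borel" using f by measurable
 have "(NI (%y. f (- y) * ind {min (- x s1) (- x s2)..max (- x s1) (- x s2)} y)) = (NI (%s. f (- (- x s)) * enn \<bar>- x' s\<bar> * ind {s1..s2} s))"
 by (rule pos[where x = "%s. - x s" and x' = "%s. - x' s", OF DERIV_minus[OF d] continuous_on_minus[OF c] _ f']) (use n in auto)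
 moreover have "(NI (%y. f y * ind {min (x s1) (x s2)..max (x s1) (x s2)} y))
 = (NI (%y. f (- y) * ind {min (- x s1) (- x s2)..max (- x s1) (- x s2)} y))"
 proof -
 have m: "(%y. f y * ind {min (x s1) (x s2)..max (x s1) (x s2)} y) : borel_measurable borel" using f by measurable
 have "ind {min (x s1) (x s2)..max (x s1) (x s2)} (- y) = (ind {min (- x s1) (- x s2)..max (- x s1) (- x s2)} y :: ennreal)" for y
 by (auto simp: indicator_def min_def max_def)
 thus ?thesis using nn_integral_real_affine[OF m, of "-1" 0] by simp
 qed
 ultimately show ?thesis by simp
 qed
qed

text \<open>The parameters of arc points in the chart form an open set, a countable union of compact
  intervals; one of these meets the zero set in positive measure. On it the coordinate x is a change
  of variables with nonvanishing derivative, which carries both integrability and positive measure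
  over.\<close>

lemma boundary_interval:
 fixes bf :: "plane => complex"
 assumes reg: "regular_arc gmm" and nc: "normal_chart Om U X Y rh B p Z A Ps"
 and B: "open B" "Csm B Z" "Csm B rh" and rh0: "!!s. s : {0..1} ==> rh (gmm s) = 0"
 and bf: "integrable (arc_length gmm) bf" and dens: "density_point (arc_length gmm) {q\<in>path_image gmm. bf q = 0} p"
 and b: "0 < b" "b < A"
 shows "EX j0 j1 A0. -b < j0 & j0 < j1 & j1 < b & (ALL y:{j0..j1}. Ps (y, 0) : path_image gmm - {pathstart gmm, pathfinish gmm}) &
 set_integrable lborel {j0<..<j1} (%y. bf (Ps (y, 0))) &
 A0 : sets lborel & A0 <= {j0<..<j1} & 0 < emeasure lborel A0 & (ALL y:A0. bf (Ps (y, 0)) = 0)"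
proof -
 note D = normal_chartD[OF nc]
 note G = regular_arcD[OF reg]
 let ?n = "%s. norm (vector_derivative gmm (at s))"
 define V where "V = Ps ` ({-b<..<b} \<times> {-A<..<A})"
 have oV: "open V" unfolding V_def by (rule normal_chart_box_open[OF nc B(3,1,2)]) (use b in auto)
 have VQ: "V <= Ps ` ({-A<..<A} \<times> {-A<..<A})" unfolding V_def using b by (intro image_mono) auto
 have pV: "p : V" unfolding V_def using D(1,5) b by (auto intro!: image_eqI[of _ _ "(0, 0)"])
 have bfm: "bf : borel_measurable borel"
 using borel_measurable_integrable[OF bf] by (simp add: measurable_cong_sets[OF sets_arc_length refl])
 define VE where "VE = V \<inter> {q\<in>path_image gmm. bf q = 0}"
 have VE: "VE : sets borel"
 proof -
 have "VE = V \<inter> path_image gmm \<inter> (bf -` {0} \<inter> space borel)" by (auto simp: VE_def)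
 moreover have "closed (path_image gmm)" using reg by (simp add: regular_arc_def closed_arc_image)
 ultimately show ?thesis using oV measurable_sets[OF bfm, of "{0}"] by auto
 qed
 define T0 where "T0 = {s\<in>{0..1}. gmm s : VE}"
 have T0m: "T0 : sets lborel"
 proof -
 have "(%s. ind VE (gmm s) :: ennreal) : borel_measurable (restrict_space borel {0..1})"
 by (rule measurable_compose[OF bm_restrict[OF G(1)]]) (use VE in measurable)
 hence "(%s. ind VE (gmm s) * ind {0..1} s :: ennreal) : borel_measurable borel"
 by (subst (asm) borel_measurable_restrict_space_iff_ennreal) simp_all
 from measurable_sets[OF this, of "{1}"]
 have "(%s. ind VE (gmm s) * ind {0..1} s :: ennreal) -` {1} : sets borel" by simp
 also have "(%s. ind VE (gmm s) * ind {0..1} s :: ennreal) -` {1} = T0" by (auto simp: T0_def indicator_def of_bool_def split: if_splits)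
 finally show ?thesis by simp
 qed
 have T0p: "T0 ~: null_sets lborel"
 proof
 assume "T0 : null_sets lborel"
 from AE_not_in[OF this]
 have "AE s in lborel. enn (?n s) * ind VE (gmm s) * ind {0..1} s = 0"
 by eventually_elim (auto simp: T0_def indicator_def)
 hence "(NI (%s. enn (?n s) * ind VE (gmm s) * ind {0..1} s)) = (\<integral>\<^sup>+s. 0 \<partial>(lborel :: real measure))"
 by (rule nn_integral_cong_AE)
 hence "(\<integral>\<^sup>+z. ind VE z \<partial>arc_length gmm) = 0"
 using nn_integral_arc_length[OF reg, of "ind VE"] VE by simp
 hence "emeasure (arc_length gmm) VE = 0" using VE by simp
 moreover have "0 < emeasure (arc_length gmm) VE" using dens oV pV by (simp add: density_point_def VE_def)
 ultimately show False by simp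
 qed
 \<comment> \<open>The end points of the arc are left out because the trace is known only on the
   open arc; the two parameters form a null set.\<close>
 define I0 where "I0 = {0<..<1} \<inter> gmm -` V"
 have "open I0" unfolding I0_def
 by (rule open_preimage[OF con_subset[OF G(1)] _ oV]) auto
 from open_countable_Union_open_cbox[OF this]
 obtain \<D> where \<D>: "countable \<D>" "\<D> <= Pow I0" "!!X. X : \<D> ==> EX a b. X = cbox a b" "\<Union>\<D> = I0" by metis
 have "EX X:\<D>. T0 \<inter> X ~: null_sets lborel"
 proof (rule ccontr)
 assume "~ ?thesis"
 hence "(\<Union>X\<in>\<D>. T0 \<inter> X) : null_sets lborel" by (intro null_sets_UN'[OF \<D>(1)]) blast
 moreover have "{0, 1::real} : null_sets lborel" by (rule finite_imp_null_set_lborel) simp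
 ultimately have "(\<Union>X\<in>\<D>. T0 \<inter> X) \<union> {0, 1} : null_sets lborel" by (rule null_sets.Un)
 moreover have "T0 <= (\<Union>X\<in>\<D>. T0 \<inter> X) \<union> {0, 1}"
 proof
 fix s assume s: "s : T0"
 show "s : (\<Union>X\<in>\<D>. T0 \<inter> X) \<union> {0, 1}"
 proof (cases "s = 0 \<or> s = 1")
 case False
 hence "s : I0" using s by (auto simp: T0_def I0_def VE_def)
 thus ?thesis using s \<D>(4) by blast
 qed auto
 qed
 ultimately show False using null_sets_subset[OF _ T0m] T0p by blast
 qed
 then obtain X s1 s2 where X: "X : \<D>" "T0 \<inter> X ~: null_sets lborel" "X = cbox s1 s2" using \<D>(3) by metis
 define T1 where "T1 = T0 \<inter> {s1..s2}"
 have T1: "T1 ~: null_sets lborel" using X by (simp add: T1_def)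
 have I: "{s1..s2} <= I0" using X \<D>(2) by auto
 hence I01: "{s1..s2} <= {0<..<1}" by (auto simp: I0_def)
 have I': "s : I0" if "s : {s1..s2}" for s using I that by blast
 have s12: "s1 < s2"
 proof (rule ccontr)
 assume "~ s1 < s2"
 hence "finite T1" by (auto simp: T1_def intro: finite_subset[of _ "{s1}"])
 thus False using T1 finite_imp_null_set_lborel by blast
 qed
 define x where "x s = Re (Z (gmm s))" for s
 have gPs: "gmm s = Ps (x s, 0)" and xb: "x s : {-b<..<b}" and gB: "gmm s : B" if s: "s : I0" for s
 proof -
 have gV: "gmm s : V" using s by (simp add: I0_def)
 show "gmm s = Ps (x s, 0)" using normal_chart_inverse(1)[OF nc subsetD[OF VQ gV]] rh0[of s] s by (simp add: x_def I0_def)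
 show "gmm s : B" using gV VQ D(4) by blast
 obtain y t where yt: "y : {-b<..<b}" "t : {-A<..<A}" "gmm s = Ps (y, t)" using gV unfolding V_def by blast
 hence "y : {-A<..<A}" using b by auto
 thus "x s : {-b<..<b}" using D(9)[OF _ yt(2)] yt by (simp add: x_def)
 qed
 define x' where "x' s = fst (vector_derivative gmm (at s)) * Re (px Z (gmm s)) + snd (vector_derivative gmm (at s)) * Re (py Z (gmm s))" for s
 have dx: "(x hrd x' s) (at s)" if s: "s : I0" for s
 proof -
 have "((%z. Re (Z z)) hasd (%v. Re (fder Z (at (gmm s)) v))) (at (gmm s) within gmm ` UNIV)"
 by (rule hd_within[OF has_derivative_Re[OF smooth_has_derivative[OF B(2) gB[OF s]]]])
 moreover have "(gmm hvd vector_derivative gmm (at s)) (at s)" by (rule G(3)) (use s in \<open>simp add: I0_def\<close>)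
 ultimately have "(((%z. Re (Z z)) \<circ> gmm) hvd Re (fder Z (at (gmm s)) (vector_derivative gmm (at s)))) (at s)"
 by (rule vector_derivative_diff_chain_within[rotated])
 thus ?thesis
 by (simp add: o_def hrd_hvd x_def[abs_def] x'_def frechet_derivative_px_py[OF B(2) gB[OF s]])
 qed
 \<comment> \<open>On \<open>I0\<close> the arc is s |-> Ps (x s, 0), so x' = 0 would make its
   velocity vanish.\<close>
 have nz: "x' s ~= 0" if s: "s : I0" for s
 proof
 assume 0: "x' s = 0"
 have "(x s, 0) : {-A<..<A} \<times> {-A<..<A}" using xb[OF s] b by auto
 from smooth_partials(1)[OF D(7) this, of UNIV]
 have "((%y. Ps (y, 0)) hvd px Ps (x s, 0)) (at (x s))" .
 from vector_diff_chain_at[OF dx[OF s, unfolded hrd_hvd] this]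
 have "((%s. Ps (x s, 0)) hvd 0) (at s)" by (simp add: o_def 0)
 hence "(gmm hvd 0) (at s)"
 by (rule has_vector_derivative_transform_within_open[OF _ \<open>open I0\<close> s]) (rule gPs[symmetric])
 hence "vector_derivative gmm (at s) = 0" by (rule vector_derivative_at)
 thus False using G(5)[of s] s by (simp add: I0_def)
 qed
 have cx': "cts {s1..s2} x'"
 proof -
 have sub: "gmm ` {s1..s2} <= B" using gB I by blast
 have cg: "cts {s1..s2} gmm" "cts {s1..s2} (%s. vector_derivative gmm (at s))"
 using I01 by (auto intro!: con_subset[OF G(1)] con_subset[OF G(4)])
 show ?thesis unfolding x'_def[abs_def]
 by (intro continuous_intros cg con_comp[OF smooth_con[OF smooth_px[OF B(2)]] cg(1) sub]
 con_comp[OF smooth_con[OF smooth_py[OF B(2)]] cg(1) sub])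
 qed
 have cx: "cts {s1..s2} x" by (intro con_at_on ballI DERIV_isCont[OF dx]) (use I in blast)
 have dx1: "(x hrd x' s) (at s)" and nz1: "x' s ~= 0" if "s : {s1..s2}" for s
 using dx[of s] nz[of s] I that by blast+
 note change = nn_integral_change_nonvanishing[OF s12 dx1 cx' nz1]
 define j0 j1 where "j0 = min (x s1) (x s2)" and "j1 = max (x s1) (x s2)"
 have inj: "x s = x s' ==> s = s'" if "s : {s1..s2}" "s' : {s1..s2}" for s s'
 proof -
 assume "x s = x s'"
 hence "gmm s = gmm s'" using gPs[OF I'[OF that(1)]] gPs[OF I'[OF that(2)]] by simp
 thus "s = s'" by (rule inj_onD[OF G(2)]) (use that I01 in auto)
 qed
 have "x s1 ~= x s2" using inj[of s1 s2] s12 by auto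
 hence j: "j0 < j1" by (auto simp: j0_def j1_def min_def max_def)
 have xb12: "x s1 : {-b<..<b}" "x s2 : {-b<..<b}" by (rule xb[OF I'], use s12 in simp)+
 hence jb: "-b < j0" "j1 < b" by (auto simp: j0_def j1_def)
 have im: "Ps (y, 0) : path_image gmm - {pathstart gmm, pathfinish gmm}" if y: "y : {j0..j1}" for y
 proof -
 have c: "connected (x ` {s1..s2})" by (rule connected_continuous_image[OF cx connected_Icc])
 have m: "x s1 : x ` {s1..s2}" "x s2 : x ` {s1..s2}" using s12 by auto
 have "y : x ` {s1..s2}"
 proof (cases "x s1 <= x s2")
 case True
 show ?thesis by (rule connectedD_interval[OF c m(1,2)]) (use True y in \<open>auto simp: j0_def j1_def\<close>)
 next
 case False
 show ?thesis by (rule connectedD_interval[OF c m(2,1)]) (use False y in \<open>auto simp: j0_def j1_def\<close>)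
 qed
 then obtain s where s: "s : {s1..s2}" "y = x s" by blast
 have s01: "s : {0<..<1}" using s I01 by blast
 have "Ps (y, 0) = gmm s" using gPs[of s] s I by auto
 moreover have "gmm s ~= gmm 0" "gmm s ~= gmm 1" using inj_onD[OF G(2), of s 0] inj_onD[OF G(2), of s 1] s01 by auto
 ultimately show ?thesis using s01 by (auto simp: path_image_def pathstart_def pathfinish_def)
 qed
 \<comment> \<open>Cut off because \<open>Ps\<close> is controlled only inside the chart, while
   Borel measurability is wanted on the whole line.\<close>
 define gg where "gg y = ind {-b..b} y *\<^sub>R bf (Ps (y, 0))" for y
 have ggm: "gg : borel_measurable borel"
 proof -
 have "cts {-b..b} (%y. Ps (y, 0))"
 by (rule con_slice(1)[OF smooth_con[OF D(7)]]) (use b in auto)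
 from measurable_compose[OF bm_restrict[OF this] bfm]
 show ?thesis unfolding gg_def[abs_def] by (subst (asm) borel_measurable_restrict_space_iff) simp_all
 qed
 have ggx: "gg (x s) = bf (gmm s)" if "s : {s1..s2}" for s
 using xb[of s] gPs[of s] that I by (auto simp: gg_def indicator_def)
 have "cts {s1..s2} (%s. \<bar>x' s\<bar> / ?n s)"
 using I01 G(5) by (intro continuous_intros cx' con_norm con_subset[OF G(4)]) auto
 from compact_bd[OF this compact_Icc]
 obtain C where C: "0 < C" "!!s. s : {s1..s2} ==> norm (\<bar>x' s\<bar> / ?n s) <= C" by metis
 have x'C: "\<bar>x' s\<bar> <= C * ?n s" if s: "s : {s1..s2}" for s
 proof -
 have "0 < ?n s" using G(5)[of s] s I01 by auto
 thus ?thesis using C(2)[OF s] by (simp add: pos_divide_le_eq)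
 qed
 have "(NI (%y. enn (cmod (gg y)) * ind {j0..j1} y)) = (NI (%s. enn (cmod (gg (x s))) * enn \<bar>x' s\<bar> * ind {s1..s2} s))"
 unfolding j0_def j1_def by (rule change) (use ggm in measurable)
 also have "... <= (NI (%s. enn (?n s) * (enn C * enn (cmod (bf (gmm s)))) * ind {0..1} s))"
 proof (rule nn_integral_mono)
 fix s
 show "enn (cmod (gg (x s))) * enn \<bar>x' s\<bar> * ind {s1..s2} s <= enn (?n s) * (enn C * enn (cmod (bf (gmm s)))) * ind {0..1} s"
 proof (cases "s : {s1..s2}")
 case True
 have s01: "s : {0..1}" using True I01 by auto
 have "enn (cmod (gg (x s))) * enn \<bar>x' s\<bar> = enn (cmod (bf (gmm s)) * \<bar>x' s\<bar>)" by (simp add: ggx[OF True] ennreal_mult)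
 also have "... <= enn (cmod (bf (gmm s)) * (C * ?n s))" by (intro ennreal_leI mult_lm x'C[OF True]) simp
 also have "... = enn (?n s) * (enn C * enn (cmod (bf (gmm s))))" using C(1) by (simp add: ennreal_mult mult_ac)
 finally show ?thesis using True s01 by simp
 qed simp
 qed
 also have "... = (\<integral>\<^sup>+z. enn C * enn (cmod (bf z)) \<partial>arc_length gmm)"
 by (rule nn_integral_arc_length[OF reg, symmetric]) (use bfm in measurable)
 also have "... = enn C * (\<integral>\<^sup>+z. enn (cmod (bf z)) \<partial>arc_length gmm)"
 by (rule nn_integral_cmult) (use borel_measurable_integrable[OF bf] in measurable)
 also have "... < \<infinity>" using bf unfolding integrable_iff_bounded by (simp add: ennreal_mult_less_top)
 finally have fin: "(NI (%y. enn (cmod (gg y)) * ind {j0..j1} y)) < \<infinity>" .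
 have "integrable lborel (%y. ind {j0..j1} y *\<^sub>R gg y)"
 proof (rule integrableI_bounded)
 show "(%y. ind {j0..j1} y *\<^sub>R gg y) : borel_measurable lborel" using ggm by measurable
 have "(NI (%y. enn (norm (ind {j0..j1} y *\<^sub>R gg y)))) = (NI (%y. enn (cmod (gg y)) * ind {j0..j1} y))"
 by (rule nn_integral_cong) (simp add: indicator_def)
 thus "(NI (%y. enn (norm (ind {j0..j1} y *\<^sub>R gg y)))) < \<infinity>" using fin by simp
 qed
 hence "set_integrable lborel {j0..j1} gg" by (simp add: set_integrable_def)
 hence "set_integrable lborel {j0<..<j1} gg" by (rule set_integrable_subset) auto
 moreover have "set_integrable lborel {j0<..<j1} gg = set_integrable lborel {j0<..<j1} (%y. bf (Ps (y, 0)))"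
 unfolding set_integrable_def using jb by (intro Bochner_Integration.integrable_cong) (auto simp: gg_def indicator_def)
 ultimately have int: "set_integrable lborel {j0<..<j1} (%y. bf (Ps (y, 0)))" by simp
 define N where "N = {-b..b} \<inter> gg -` {0}"
 have Nm: "N : sets borel" using measurable_sets[OF ggm, of "{0}"] by (simp add: N_def)
 define A0 where "A0 = N \<inter> {j0<..<j1}"
 have A0m: "A0 : sets lborel" using Nm by (simp add: A0_def)
 have "0 < emeasure lborel A0"
 proof (rule ccontr)
 assume "~ 0 < emeasure lborel A0"
 hence "A0 : null_sets lborel" using A0m by (simp add: null_sets_def)
 moreover have "{j0, j1} : null_sets lborel" by (rule finite_imp_null_set_lborel) simp
 ultimately have n1: "A0 \<union> {j0, j1} : null_sets lborel" by (rule null_sets.Un)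
 have "AE y in lborel. ind N y * ind {j0..j1} y = (0 :: ennreal)"
 using AE_not_in[OF n1] by eventually_elim (auto simp: A0_def indicator_def)
 hence "(NI (%y. ind N y * ind {j0..j1} y)) = (\<integral>\<^sup>+y. 0 \<partial>(lborel :: real measure))"
 by (rule nn_integral_cong_AE)
 hence z: "(NI (%s. ind N (x s) * enn \<bar>x' s\<bar> * ind {s1..s2} s)) = 0"
 using change[of "ind N"] Nm unfolding j0_def j1_def by simp
 have m: "(%s. ind N (x s) * enn \<bar>x' s\<bar> * ind {s1..s2} s) : borel_measurable lborel"
 proof -
 have "(%s. ind N (x s) :: ennreal) : borel_measurable (restrict_space borel {s1..s2})"
 by (rule measurable_compose[OF bm_restrict[OF cx]]) (use Nm in measurable)
 moreover have "(%s. enn \<bar>x' s\<bar>) : borel_measurable (restrict_space borel {s1..s2})"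
 by (rule measurable_compose[OF bm_restrict[OF continuous_on_rabs[OF cx']]]) measurable
 ultimately have "(%s. ind N (x s) * enn \<bar>x' s\<bar>) : borel_measurable (restrict_space borel {s1..s2})" by measurable
 thus ?thesis by (subst (asm) borel_measurable_restrict_space_iff_ennreal) simp_all
 qed
 have "AE s in lborel. ind N (x s) * enn \<bar>x' s\<bar> * ind {s1..s2} s = 0"
 using z nn_integral_0_iff_AE[OF m] by simp
 hence "AE s in lborel. s ~: T1"
 proof eventually_elim
 fix s assume h: "ind N (x s) * enn \<bar>x' s\<bar> * ind {s1..s2} s = 0"
 show "s ~: T1"
 proof
 assume "s : T1"
 hence s: "s : {s1..s2}" "bf (gmm s) = 0" by (auto simp: T1_def T0_def VE_def)
 have "x s : N" using ggx[OF s(1)] s(2) xb[of s] I s(1) by (auto simp: N_def)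
 thus False using h s(1) nz1[OF s(1)] by (simp add: ennreal_eq_0_iff)
 qed
 qed
 moreover have "T1 : sets lborel" using T0m by (simp add: T1_def)
 ultimately have "T1 : null_sets lborel" by (simp add: AE_iff_null_sets)
 thus False using T1 by simp
 qed
 moreover have "bf (Ps (y, 0)) = 0" if "y : A0" for y using that by (auto simp: A0_def N_def gg_def indicator_def)
 ultimately show ?thesis
 using j jb im int A0m by (intro exI[of _ j0] exI[of _ j1] exI[of _ A0]) (simp add: A0_def)
qed

section \<open>Assembly in a chart around the density point\<close>

theorem theorem6p1:
  fixes \<Omega> S U W :: "plane set" and \<gamma> :: "real \<Rightarrow> plane" and X Y :: "plane \<Rightarrow> plane"
    and \<rho> :: "plane \<Rightarrow> real" and f bf :: "plane \<Rightarrow> complex" and N :: int and p :: plane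
  assumes domain: "smooth_domain \<Omega>"
    and arc: "regular_arc \<gamma>" "S = path_image \<gamma>" "S \<subseteq> frontier \<Omega>"
    and U: "open U" "S \<subseteq> U"
    and L: "smooth_on U X" "smooth_on U Y" "locally_integrable U X Y"
    and rho: "defining_function \<Omega> \<rho>"
    and L_transversal: "\<forall>q\<in>S. vf_apply X Y (\<lambda>z. complex_of_real (\<rho> z)) q \<noteq> 0"
    and X_inward: "\<forall>q\<in>S. frechet_derivative \<rho> (at q) (X q) > 0"
    and f: "continuous_on \<Omega> f"
    and growth: "tempered_growth \<Omega> \<rho> f N"
    and W: "open W" "S \<subseteq> W" "W \<subseteq> U"
    and Lf: "weak_solution (W \<inter> \<Omega>) X Y f"
    and trace: "trace_eq_on \<Omega> \<rho> U X Y f (S - {pathstart \<gamma>, pathfinish \<gamma>}) bf"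
    and trace_L1: "integrable (arc_length \<gamma>) bf"
    and p: "p \<in> S" "type_II \<Omega> U X Y p"
    and density: "density_point (arc_length \<gamma>) {q\<in>S. bf q = 0} p"
  shows "\<exists>r>0. \<forall>z \<in> ball p r \<inter> \<Omega>. f z = 0"
proof -
 have o\<Omega>: "open \<Omega>" using domain by (simp add: smooth_domain_def)
 have pf: "p : frontier \<Omega>" using p(1) arc(3) by blast
 obtain V where V: "open V" "closure \<Omega> <= V" "Csm V \<rho>" using rho unfolding defining_function_def by blast
 have pV: "p : V" using pf V(2) by (auto simp: frontier_def)
 have \<rho>0: "\<rho> (\<gamma> s) = 0" if "s : {0..1}" for s
 proof -
 have "\<gamma> s : frontier \<Omega>" using arc(2,3) that by (auto simp: path_image_def)
 thus ?thesis using rho unfolding defining_function_def by blast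
 qed
 obtain B Z0 where B: "B <= W" "B <= U" "first_integral_near B X Y \<rho> p Z0"
 using first_integral_near_exists[OF U(1) subsetD[OF U(2) p(1)] L V(1) pV V(3) bspec[OF L_transversal p(1)] W(1) subsetD[OF W(2) p(1)]] by blast
 obtain Z A Ps where fin: "first_integral_near B X Y \<rho> p Z" and nc: "normal_chart \<Omega> U X Y \<rho> B p Z A Ps"
 and rise: "!!tu. 0 < tu ==> EX t:{0<..<tu}. 0 < Im (Z (Ps (0, t)))"
 using rising_chart_exists[OF B(3,2) o\<Omega> rho pf bspec[OF X_inward p(1)] p(2)] by blast
 have sB: "open B" "p : B" "Csm B X" "Csm B Y" "Csm B \<rho>" "Csm B Z"
 and LZ: "!!z. z : B ==> vf_apply X Y Z z = 0" "!!z. z : B ==> px Z z ~= 0 \<or> py Z z ~= 0" "Z p = 0"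
 and L\<rho>: "!!z. z : B ==> vf_apply X Y (%z. of_real (\<rho> z)) z ~= 0"
 using fin unfolding first_integral_near_def by blast+
 note D = normal_chartD[OF nc]
 define Zc where "Zc z = Z (Ps z)" for z
 interpret sc: straight_chart A Zc using normal_chart_straight[OF nc] unfolding Zc_def[abs_def] .
 obtain t0 K n where gr: "0 < t0" "0 < K" "!!t. t : {0<..t0} ==> HK {-A/2..A/2} (%x. cmod (f (Ps (x, t)))) <= K * t powr (- (real n + 1 / 2))"
 using chart_growth[OF D(2) f growth] by blast
 \<comment> \<open>Within A/2 in width and t0 in height, the range of the growth estimate.\<close>
 define a where "a = min (A / 2) t0"
 have a: "0 < a" "a < A" "a <= A / 2" "a <= t0" using D(1) gr(1) by (auto simp: a_def)
 interpret ct: chart_trace A a Zc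
 using a sc.smooth sc.px_nz by unfold_locales
 let ?Qp = "{-A<..<A} \<times> {0<..<A}"
 have QpQ: "?Qp <= {-A<..<A} \<times> {-A<..<A}" using D(1) by auto
 have img: "Ps ` ?Qp = Ps ` ({-A<..<A} \<times> {-A<..<A}) \<inter> \<Omega>"
 proof (intro equalityI subsetI)
 fix w assume "w : Ps ` ?Qp"
 then obtain x t where xt: "x : {-A<..<A}" "t : {0<..<A}" "w = Ps (x, t)" by blast
 hence "t : {-A<..<A}" using D(1) by auto
 thus "w : Ps ` ({-A<..<A} \<times> {-A<..<A}) \<inter> \<Omega>" using D(12)[OF xt(1)] xt by auto
 next
 fix w assume "w : Ps ` ({-A<..<A} \<times> {-A<..<A}) \<inter> \<Omega>"
 then obtain x t where xt: "x : {-A<..<A}" "t : {-A<..<A}" "w = Ps (x, t)" "w : \<Omega>" by blast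
 hence "0 < t" using D(12)[OF xt(1,2)] by simp
 thus "w : Ps ` ?Qp" using xt by auto
 qed
 have oimg: "open (Ps ` ?Qp)" unfolding img by (rule open_Int[OF D(3) o\<Omega>])
 have imgB: "Ps ` ?Qp <= B" unfolding img using D(4) by blast
 have imgD: "Ps ` ?Qp <= W \<inter> \<Omega>" using imgB B(1) unfolding img by blast
 have cf: "cts (Ps ` ?Qp) f" by (rule con_subset[OF f]) (use imgD in blast)
 have cl: "closed_on (Ps ` ?Qp) (%z. f z * px Z z) (%z. f z * py Z z)"
 proof (rule weak_solution_closed_on[OF oimg _ _ _ _ _ _ _ cf Lf imgD])
 show "Csm (Ps ` ?Qp) (%z. complex_of_real (\<rho> z))"
 by (rule smooth_subset[OF smooth_linear_compose[OF sB(1) bounded_linear_of_real sB(5)] imgB])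
 show "vf_apply X Y Z z = 0" "px Z z ~= 0 \<or> py Z z ~= 0" "vf_apply X Y (%z. complex_of_real (\<rho> z)) z ~= 0" if "z : Ps ` ?Qp" for z
 using LZ(1,2) L\<rho> imgB that by blast+
 qed (use sB imgB in \<open>blast intro: smooth_subset\<close>)+
 have cfPs: "cts ?Qp (%z. f (Ps z))"
 by (rule con_comp[OF cf con_subset[OF smooth_con[OF D(7)] QpQ]]) simp
 obtain G0 where G0: "prim ?Qp Zc (%z. f (Ps z)) G0"
 using prim_pullback[OF _ smooth_subset[OF D(7) QpQ] inj_on_subset[OF D(8) QpQ] oimg smooth_subset[OF sB(6) imgB] cf cl refl]
 unfolding Zc_def[abs_def] by (auto simp: open_Times)
 have "EX k G. (prim ?Qp Zc ^^ Suc k) (%z. f (Ps z)) G & cts ({-a..a} \<times> {0..a}) G"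
 proof (rule ct.iterated_prim_extends[OF G0 _ gr(2)])
 fix t assume t: "t : {0<..a}"
 have c: "cts {-A/2..A/2} (%x. cmod (f (Ps (x, t))))"
 by (intro con_norm con_slice(1)[OF cfPs]) (use t a D(1) in auto)
 have "HK {-a..a} (%x. cmod (f (Ps (x, t)))) <= HK {-A/2..A/2} (%x. cmod (f (Ps (x, t))))"
 by (rule integral_subset_le)
 (use a int_con[OF c] int_con[OF con_subset[OF c]] in auto)
 also have "... <= K * t powr (- (real n + 1 / 2))" by (rule gr(3)) (use t a in auto)
 finally show "HK {-a..a} (%x. cmod (f (Ps (x, t)))) <= K * t powr (- (real n + 1 / 2))" .
 qed
 then obtain k G where G: "(prim ?Qp Zc ^^ Suc k) (%z. f (Ps z)) G" "cts ({-a..a} \<times> {0..a}) G" by blast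
 obtain g1 where g1: "prim ?Qp Zc g1 G" by (rule relpowp_Suc_E[where P = "prim ?Qp Zc", OF G(1)])
 \<comment> \<open>Half of \<open>a\<close>, because the tube refers to boxes of twice its size, on
   which the primitives must still be defined.\<close>
 obtain c T where cT: "c <= a / 2" "T <= a / 2" "c < A" "T < A" "tube c T Zc" using sc.tube_exists[of "a / 2"] a(1) by auto
 interpret tb: tube c T Zc by (rule cT(5))
 note c0 = tb.a and T0 = tb.T
 have cG: "cts ({-c..c} \<times> {0..T}) G" by (rule con_subset[OF G(2)]) (use cT c0 T0 in auto)
 have pG: "prim ({-2*c<..<2*c} \<times> {0<..<2*T}) Zc g1 G"
 proof -
 have s: "{-2*c<..<2*c} \<times> {0<..<2*T} <= ?Qp" using cT a by auto
 have "cts ({-2*c<..<2*c} \<times> {0<..<2*T}) g1"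
 using g1 s con_subset unfolding prim_def by blast
 thus ?thesis using g1 s unfolding prim_def by blast
 qed
 obtain h where h: "!!n. h n hol UNIV" "uniform_limit ({-c/4..c/4} \<times> {0..T}) (%n z. h n (Zc z)) G sequentially"
 proof (rule tb.gauss_approximation[OF cG pG])
 fix h :: "nat => complex => complex"
 assume e: "!!n. h n hol UNIV" and u: "uniform_limit ({-c/4..c/4} \<times> {0..T}) (%n z. h n (Zc z)) G sequentially"
 show thesis by (rule that[OF e u])
 qed
 obtain t1 where t1: "t1 : {0<..<T}" "0 < Im (Zc (0, t1))" using rise[OF T0] unfolding Zc_def by blast
 have Zc0: "Zc (0, 0) = 0" using D(5) LZ(3) by (simp add: Zc_def)
 have h': "uniform_limit ({-(c/4)..c/4} \<times> {0..T}) (%n z. h n (Zc z)) G sequentially" using h(2) by simp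
 have "EX b et F. 0 < b & b <= c/4 & 0 < et & (ALL x:{-b..b}. F (Zc (x, 0)) = G (x, 0)) &
 uniform_limit {Complex x (Im (Zc (x, 0)) + s) |x s. x : {-b..b} & s : {0..et}} h F sequentially"
 by (rule sc.pushforward_limit[OF T0 cT(4) _ _ h', of t1]) (use c0 cT t1 Zc0 in auto)
 then obtain b et F where b: "0 < b" "b <= c / 4" and et: "0 < et" and F0: "!!x. x : {-b..b} ==> F (Zc (x, 0)) = G (x, 0)"
 and ul: "uniform_limit {Complex x (Im (Zc (x, 0)) + s) |x s. x : {-b..b} & s : {0..et}} h F sequentially" by blast
 have ba: "b < a" "b < A" using b cT c0 a by auto
 obtain j0 j1 A0 where j: "-b < j0" "j0 < j1" "j1 < b" and jS: "!!y. y : {j0..j1} ==> Ps (y, 0) : S - {pathstart \<gamma>, pathfinish \<gamma>}"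
 and gint: "set_integrable lborel {j0<..<j1} (%y. bf (Ps (y, 0)))"
 and A0: "A0 : sets lborel" "A0 <= {j0<..<j1}" "0 < emeasure lborel A0" "!!y. y : A0 ==> bf (Ps (y, 0)) = 0"
 using boundary_interval[OF arc(1) nc sB(1,6,5) \<rho>0 trace_L1 density[unfolded arc(2)] b(1) ba(2)] unfolding arc(2) by blast
 define ph where "ph x = Im (Zc (x, 0))" for x
 have ga: "graph_arc ph b A" and zt: "!!x. x : {-A<..<A} ==> graph_arc.zt' ph x = px Zc (x, 0)"
 using sc.graph_arc_slice[OF b(1) ba(2) order_refl] unfolding ph_def[abs_def] by blast+
 interpret ga: graph_arc ph b A by (rule ga)
 have pt0: "ga.pt x 0 = Zc (x, 0)" if "x : {-b..b}" for x
 using sc.re[of x 0] that ba D(1) by (auto simp: ga.pt_def ph_def complex_eq_iff)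
 \<comment> \<open>The order is \<open>Suc k\<close> because that many primitives lead from f to the
   continuous \<open>G\<close>, whose values at t = 0 are those of \<open>F\<close> on the
   arc.\<close>
 interpret bd: boundary_data ph b A F h et "Suc k" "%y. bf (Ps (y, 0))" j0 j1
 proof (unfold_locales)
 show "0 < et" "-b < j0" "j0 < j1" "j1 < b" by (rule et j)+
 show "h n hol UNIV" for n by (rule h(1))
 show "uniform_limit {ga.pt x s |x s. x : {-b..b} & s : {0..et}} h F sequentially" using ul by (simp add: ga.pt_def ph_def)
 show "set_integrable lborel {j0<..<j1} (%y. bf (Ps (y, 0)))" by (rule gint)
 fix u :: "real => complex" and l r :: real assume u: "Csm UNIV u" "!!x. x ~: {l..r} ==> u x = 0" and lr: "j0 < l" "l < r" "r < j1"
 have "(LINT x:{l..r}|lborel. bf (Ps (x, 0)) * (ga.zt' x * u x)) = (-1) ^ Suc k * HK {l..r} (%x. G (x, 0) * (ga.zt' x * (ga.Dz ^^ Suc k) u x))"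
 by (rule ct.chart_trace_identity[OF ga order_refl zt D(2) trace G cfPs u]) (use lr j ba jS in auto)
 also have "HK {l..r} (%x. G (x, 0) * (ga.zt' x * (ga.Dz ^^ Suc k) u x)) = HK {l..r} (%x. F (ga.pt x 0) * (ga.zt' x * (ga.Dz ^^ Suc k) u x))"
 proof (rule integral_cong)
 fix x assume "x : {l..r}"
 hence "x : {-b..b}" using lr j by auto
 thus "G (x, 0) * (ga.zt' x * (ga.Dz ^^ Suc k) u x) = F (ga.pt x 0) * (ga.zt' x * (ga.Dz ^^ Suc k) u x)"
 using F0[of x] pt0[of x] by simp
 qed
 finally show "(LINT x:{l..r}|lborel. bf (Ps (x, 0)) * (ga.zt' x * u x)) = (-1) ^ Suc k * HK {l..r} (%x. F (ga.pt x 0) * (ga.zt' x * (ga.Dz ^^ Suc k) u x))" .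
 qed
 have "(deriv ^^ Suc k) F w = 0" if "w : bd.Do" for w
 using bd.boundary_uniqueness[OF A0 that] unfolding bd.H_def by simp
 from vanishing_iterated_deriv[OF bd.open_Do bd.connected_Do bd.holomorphic_F this]
 obtain P where P: "P hol UNIV" "!!w. (deriv ^^ Suc k) P w = 0" "!!w. w : bd.Do ==> F w = P w" by metis
 \<comment> \<open>\<open>F\<close> and \<open>P\<close> are known to agree only above the arc;
   continuity up to height 0 gives equality on the arc, where \<open>F\<close> is
   \<open>G\<close>.\<close>
 have G0P: "G (x, 0) = P (Zc (x, 0))" if x: "x : {-b<..<b}" for x
 proof -
 have xb: "x : {-b..b}" using x by auto
 let ?d = "%s. F (ga.pt x s) - P (ga.pt x s)"
 have cpt: "cts {0..et} (%s. ga.pt x s)" unfolding ga.pt_def Complex_eq by (intro continuous_intros)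
 have "cts {0..et} ?d"
 by (intro con_diff con_comp[OF bd.cont_F cpt] con_comp[OF hol_con[OF P(1)] cpt])
 (use bd.pt_in_Dc[of x] xb in auto)
 hence "cts (closure {0<..<et}) ?d" using et by simp
 moreover have "?d s = 0" if "s : {0<..<et}" for s using P(3)[OF bd.pt_in_Do[of x s]] x that by auto
 moreover have "0 : closure {0<..<et}" using et by simp
 ultimately have "?d 0 = 0" by (rule continuous_constant_on_closure)
 thus ?thesis using F0[OF xb] pt0[OF xb] by simp
 qed
 obtain c' T' where c': "0 < c'" "c' < A" "0 < T'" "T' < A" "!!z. z : {-c'<..<c'} \<times> {0<..<T'} ==> G z = P (Zc z)"
 using sc.local_uniqueness[OF a(1,2) g1 G(2) P(1) b(1) less_imp_le[OF ba(1)] G0P] by blast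
 have f0: "f (Ps z) = 0" if z: "z : {-c'<..<c'} \<times> {0<..<T'}" for z
 proof (rule iterated_prim_zero[OF _ _ _ _ G(1) P(1,2) c'(5) z])
 show "open ({-c'<..<c'} \<times> {0<..<T'})" by (simp add: open_Times)
 show sub: "{-c'<..<c'} \<times> {0<..<T'} <= ?Qp" using c' by auto
 show "Csm ?Qp Zc" by (rule smooth_subset[OF sc.smooth QpQ])
 show "px Zc z ~= 0" if "z : {-c'<..<c'} \<times> {0<..<T'}" for z using sc.px_nz that sub QpQ by blast
 qed
 let ?V = "Ps ` ({-c'<..<c'} \<times> {-T'<..<T'})"
 have "open ?V" by (rule normal_chart_box_open[OF nc sB(5,1,6)]) (use c' in auto)
 moreover have "p : ?V" using D(5) c' by (auto intro!: image_eqI[of _ _ "(0, 0)"])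
 ultimately obtain r where r: "0 < r" "ball p r <= ?V" unfolding open_contains_ball by blast
 have "f z = 0" if z: "z : ball p r \<inter> \<Omega>" for z
 proof -
 obtain x t where xt: "x : {-c'<..<c'}" "t : {-T'<..<T'}" "z = Ps (x, t)" using z r(2) by blast
 have "0 < t" using D(12)[of x t] xt c' z by auto
 thus ?thesis using f0[of "(x, t)"] xt by auto
 qed
 thus ?thesis using r(1) by blast
qed

end
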